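(* Let $(X,\mathcal{S})$ be a finite set system with $|X| = n$, bounded primal shatter dimension $d$, and size-sensitive shattering constants $d_1 = 1$ and $d_2 = d - 1$. Suppose further that each element of $X$ belongs to at most $t$ sets of $\mathcal{S}$. Then $$ \mathrm{disc}(\mathcal{S}) = O\left(t^{1/2 - 1/(2d)} \sqrt{\log\log t}\,\log n\right),$$ and a coloring $\chi: X\to\{-1,+1\}$ achieving this bound can be computed in expected polynomial time.
   Context: For $Y \subseteq X$, $\mathcal{S}|_Y = \{S \cap Y : S \in \mathcal{S}\}$. Primal shatter dimension $d$: $\max_{Y\subseteq X,|Y|=m}|\mathcal{S}|_Y| \le C m^d$ for all $m \le n$, for a constant $C$. Size-sensitive shattering constants $d_1$, $d_2=d-d_1$: for every $Y\subseteq X$ with $|Y|=m$ and every $1\le k\le m$, the number of sets of size at most $k$ in $\mathcal{S}|_Y$ is at most $C m^{d_1}k^{d-d_1}$. The discrepancy is $\mathrm{disc}(\mathcal{S}) = \min_{\chi: X\to\{-1,+1\}} \max_{S\in\mathcal{S}} |\sum_{x\in S}\chi(x)|$. Constants in $O(\cdot)$ depend only on $d$ and $C$. *)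

theory Defs
  imports
    "HOL-Probability.Probability"
    "HOL-Computational_Algebra.Polynomial"
    "HOL-Library.Log_Nat"
begin


definition restrict_sys :: "'a set set \<Rightarrow> 'a set \<Rightarrow> 'a set set" where
  "restrict_sys \<S> Y = (\<lambda>S. S \<inter> Y) ` \<S>"

definition shatter_function :: "'a set \<Rightarrow> 'a set set \<Rightarrow> nat \<Rightarrow> nat" where
  "shatter_function X \<S> m = Max {card (restrict_sys \<S> Y) |Y. Y \<subseteq> X \<and> card Y = m}"

text \<open>The value \<open>m = 0\<close> is left out: \<open>restrict_sys \<S> {} = {{}}\<close> for every nonempty \<open>\<S>\<close>, while
  \<open>0 powr d = 0\<close>, so the condition would only admit the empty system.\<close>

definition primal_shatter_dim :: "'a set \<Rightarrow> 'a set set \<Rightarrow> real \<Rightarrow> real \<Rightarrow> bool" where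
  "primal_shatter_dim X \<S> d C \<longleftrightarrow>
     (\<forall>m\<in>{1..card X}. real (shatter_function X \<S> m) \<le> C * real m powr d)"

definition size_sensitive_shattering ::
  "'a set \<Rightarrow> 'a set set \<Rightarrow> real \<Rightarrow> real \<Rightarrow> real \<Rightarrow> bool" where
  "size_sensitive_shattering X \<S> d1 d2 C \<longleftrightarrow>
     (\<forall>Y. Y \<subseteq> X \<longrightarrow> (\<forall>k\<in>{1..card Y}.
        real (card {R \<in> restrict_sys \<S> Y. card R \<le> k})
          \<le> C * real (card Y) powr d1 * real k powr d2))"

definition colorings :: "'a set \<Rightarrow> ('a \<Rightarrow> int) set" where
  "colorings X = X \<rightarrow>\<^sub>E {-1, 1}"

text \<open>Inserting \<open>0\<close> only matters for the empty system, as all other values are nonnegative.\<close>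

definition coloring_disc :: "'a set set \<Rightarrow> ('a \<Rightarrow> int) \<Rightarrow> int" where
  "coloring_disc \<S> f = Max (insert 0 ((\<lambda>S. \<bar>\<Sum>x\<in>S. f x\<bar>) ` \<S>))"

definition disc :: "'a set \<Rightarrow> 'a set set \<Rightarrow> int" where
  "disc X \<S> = Min (coloring_disc \<S> ` colorings X)"



text \<open>
  The machine model is a structured random access machine with multiplication, division and fair
  coin flips under the logarithmic cost criterion. Every subexpression is charged the bit length
  of its value; since addresses and operands are themselves subexpressions, the running time
  bounds the total length of all numbers handled, which makes the model polynomially equivalent
  to probabilistic Turing machines.
\<close>

type_synonym memory = "nat \<Rightarrow> nat"

datatype aexp =
    Lit nat
  | Cell aexp
  | Add aexp aexp
  | Sub aexp aexp
  | Mul aexp aexp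
  | Quot aexp aexp

primrec aval :: "aexp \<Rightarrow> memory \<Rightarrow> nat" where
  "aval (Lit c) s = c"
| "aval (Cell a) s = s (aval a s)"
| "aval (Add a b) s = aval a s + aval b s"
| "aval (Sub a b) s = aval a s - aval b s"
| "aval (Mul a b) s = aval a s * aval b s"
| "aval (Quot a b) s = aval a s div aval b s"

text \<open>\<open>floorlog 2 v\<close> is the number of binary digits of \<open>v\<close>.\<close>

definition len :: "nat \<Rightarrow> nat" where
  "len v = Suc (floorlog 2 v)"

primrec acost :: "aexp \<Rightarrow> memory \<Rightarrow> nat" where
  "acost (Lit c) s = len c"
| "acost (Cell a) s = acost a s + len (aval (Cell a) s)"
| "acost (Add a b) s = acost a s + acost b s + len (aval (Add a b) s)"
| "acost (Sub a b) s = acost a s + acost b s + len (aval (Sub a b) s)"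
| "acost (Mul a b) s = acost a s + acost b s + len (aval (Mul a b) s)"
| "acost (Quot a b) s = acost a s + acost b s + len (aval (Quot a b) s)"

datatype com =
    Skip
  | Assign aexp aexp
  | Flip aexp
  | Seq com com
  | If aexp com com
  | While aexp com

text \<open>\<open>exec c s \<omega> T s' \<omega>'\<close>: started in memory \<open>s\<close> with coin stream \<open>\<omega>\<close>, the program \<open>c\<close> halts
  after time \<open>T\<close> in memory \<open>s'\<close>, and \<open>\<omega>'\<close> is the unread rest of the coin stream. The first
  argument of \<open>Assign\<close> and \<open>Flip\<close> is the address written to.\<close>

inductive exec ::
  "com \<Rightarrow> memory \<Rightarrow> bool stream \<Rightarrow> nat \<Rightarrow> memory \<Rightarrow> bool stream \<Rightarrow> bool" where
  Skip: "exec Skip s \<omega> 1 s \<omega>"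
| Assign: "exec (Assign a e) s \<omega> (1 + acost a s + acost e s) (s(aval a s := aval e s)) \<omega>"
| Flip: "exec (Flip a) s \<omega> (1 + acost a s) (s(aval a s := of_bool (shd \<omega>))) (stl \<omega>)"
| Seq: "\<lbrakk>exec c1 s \<omega> T1 s1 \<omega>1; exec c2 s1 \<omega>1 T2 s2 \<omega>2\<rbrakk>
    \<Longrightarrow> exec (Seq c1 c2) s \<omega> (T1 + T2) s2 \<omega>2"
| IfTrue: "\<lbrakk>aval e s \<noteq> 0; exec c1 s \<omega> T s' \<omega>'\<rbrakk>
    \<Longrightarrow> exec (If e c1 c2) s \<omega> (1 + acost e s + T) s' \<omega>'"
| IfFalse: "\<lbrakk>aval e s = 0; exec c2 s \<omega> T s' \<omega>'\<rbrakk>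
    \<Longrightarrow> exec (If e c1 c2) s \<omega> (1 + acost e s + T) s' \<omega>'"
| WhileFalse: "aval e s = 0 \<Longrightarrow> exec (While e c) s \<omega> (1 + acost e s) s \<omega>"
| WhileTrue: "\<lbrakk>aval e s \<noteq> 0; exec c s \<omega> T1 s1 \<omega>1; exec (While e c) s1 \<omega>1 T2 s2 \<omega>2\<rbrakk>
    \<Longrightarrow> exec (While e c) s \<omega> (1 + acost e s + T1 + T2) s2 \<omega>2"

definition coin_space :: "bool stream measure" where
  "coin_space = stream_space (measure_pmf (bernoulli_pmf (1/2)))"

text \<open>The infimum ranges over at most one value, and it is \<open>\<infinity>\<close> if the program does not halt
  on \<open>\<omega>\<close>. In particular a finite expected time entails halting with probability one.\<close>

definition run_time :: "com \<Rightarrow> memory \<Rightarrow> bool stream \<Rightarrow> ennreal" where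
  "run_time c s \<omega> = (INF T\<in>{T. \<exists>s' \<omega>'. exec c s \<omega> T s' \<omega>'}. of_nat T)"

definition expected_time :: "com \<Rightarrow> memory \<Rightarrow> ennreal" where
  "expected_time c s = (\<integral>\<^sup>+ \<omega>. run_time c s \<omega> \<partial>coin_space)"

lemma exec_deterministic:
  assumes "exec c s \<omega> T s' \<omega>'" and "exec c s \<omega> U r' \<rho>'"
  shows "T = U \<and> s' = r' \<and> \<omega>' = \<rho>'"
  using assms
proof (induction arbitrary: U r' \<rho>' rule: exec.induct)
  case (WhileTrue e s c \<omega> T1 s1 \<omega>1 T2 s2 \<omega>2)
  from WhileTrue.prems WhileTrue.hyps(1) obtain V1 r1 \<rho>1 V2
    where V: "exec c s \<omega> V1 r1 \<rho>1" "exec (While e c) r1 \<rho>1 V2 r' \<rho>'" "U = 1 + acost e s + V1 + V2"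
    by (cases rule: exec.cases) auto
  with WhileTrue.IH(1)[OF V(1)] WhileTrue.IH(2) show ?case by blast
next
  case (Seq c1 s \<omega> T1 s1 \<omega>1 c2 T2 s2 \<omega>2)
  from Seq.prems obtain V1 r1 \<rho>1 V2
    where V: "exec c1 s \<omega> V1 r1 \<rho>1" "exec c2 r1 \<rho>1 V2 r' \<rho>'" "U = V1 + V2"
    by (cases rule: exec.cases) auto
  with Seq.IH(1)[OF V(1)] Seq.IH(2) show ?case by blast
next
  case (IfTrue e s c1 \<omega> T s' \<omega>' c2)
  from IfTrue.prems IfTrue.hyps(1) obtain V
    where V: "exec c1 s \<omega> V r' \<rho>'" "U = 1 + acost e s + V"
    by (cases rule: exec.cases) auto
  with IfTrue.IH show ?case by blast
next
  case (IfFalse e s c2 \<omega> T s' \<omega>' c1)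
  from IfFalse.prems IfFalse.hyps(1) obtain V
    where V: "exec c2 s \<omega> V r' \<rho>'" "U = 1 + acost e s + V"
    by (cases rule: exec.cases) auto
  with IfFalse.IH show ?case by blast
next
  case Skip
  then show ?case by (cases rule: exec.cases) auto
next
  case Assign
  then show ?case by (cases rule: exec.cases) auto
next
  case Flip
  then show ?case by (cases rule: exec.cases) auto
next
  case WhileFalse
  from WhileFalse.prems WhileFalse.hyps show ?case by (cases rule: exec.cases) auto
qed

lemma exec_finite_prefix:
  assumes "exec c s \<omega> T s' \<omega>'"
  shows "\<exists>k. \<omega>' = sdrop k \<omega> \<and>
    (\<forall>\<rho>. stake k \<rho> = stake k \<omega> \<longrightarrow> exec c s \<rho> T s' (sdrop k \<rho>))"
  using assms
proof (induction rule: exec.induct)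
  case (Skip s \<omega>)
  show ?case using exec.Skip by (intro exI[of _ 0]) auto
next
  case (Assign a e s \<omega>)
  show ?case using exec.Assign[of a e s] by (intro exI[of _ 0]) (auto simp del: fun_upd_apply)
next
  case (Flip a s \<omega>)
  show ?case
  proof (rule exI[of _ 1], intro conjI allI impI)
    show "stl \<omega> = sdrop 1 \<omega>" by simp
    fix \<rho> assume "stake 1 \<rho> = stake 1 \<omega>"
    then have "shd \<rho> = shd \<omega>" by simp
    with exec.Flip[of a s \<rho>]
    show "exec (Flip a) s \<rho> (1 + acost a s) (s(aval a s := of_bool (shd \<omega>))) (sdrop 1 \<rho>)"
      by (simp del: fun_upd_apply)
  qed
next
  case (Seq c1 s \<omega> T1 s1 \<omega>1 c2 T2 s2 \<omega>2)
  from Seq.IH obtain k l where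
    k: "\<omega>1 = sdrop k \<omega>" "\<And>\<rho>. stake k \<rho> = stake k \<omega> \<Longrightarrow> exec c1 s \<rho> T1 s1 (sdrop k \<rho>)" and
    l: "\<omega>2 = sdrop l \<omega>1" "\<And>\<rho>. stake l \<rho> = stake l \<omega>1 \<Longrightarrow> exec c2 s1 \<rho> T2 s2 (sdrop l \<rho>)"
    by blast
  show ?case
  proof (intro exI[of _ "k + l"] conjI allI impI)
    show "\<omega>2 = sdrop (k + l) \<omega>" by (simp add: k(1) l(1))
    fix \<rho> assume "stake (k + l) \<rho> = stake (k + l) \<omega>"
    then have "stake k \<rho> = stake k \<omega>" "stake l (sdrop k \<rho>) = stake l \<omega>1"
      using k(1) by (simp_all add: stake_add[symmetric] del: stake_add)
    show "exec (Seq c1 c2) s \<rho> (T1 + T2) s2 (sdrop (k + l) \<rho>)"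
      unfolding sdrop_add[symmetric] by (rule exec.Seq[OF k(2) l(2)]) fact+
  qed
next
  case (WhileTrue e s c \<omega> T1 s1 \<omega>1 T2 s2 \<omega>2)
  from WhileTrue.IH obtain k l where
    k: "\<omega>1 = sdrop k \<omega>" "\<And>\<rho>. stake k \<rho> = stake k \<omega> \<Longrightarrow> exec c s \<rho> T1 s1 (sdrop k \<rho>)" and
    l: "\<omega>2 = sdrop l \<omega>1"
       "\<And>\<rho>. stake l \<rho> = stake l \<omega>1 \<Longrightarrow> exec (While e c) s1 \<rho> T2 s2 (sdrop l \<rho>)"
    by blast
  show ?case
  proof (intro exI[of _ "k + l"] conjI allI impI)
    show "\<omega>2 = sdrop (k + l) \<omega>" by (simp add: k(1) l(1))
    fix \<rho> assume "stake (k + l) \<rho> = stake (k + l) \<omega>"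
    then have "stake k \<rho> = stake k \<omega>" "stake l (sdrop k \<rho>) = stake l \<omega>1"
      using k(1) by (simp_all add: stake_add[symmetric] del: stake_add)
    show "exec (While e c) s \<rho> (1 + acost e s + T1 + T2) s2 (sdrop (k + l) \<rho>)"
      unfolding sdrop_add[symmetric] by (rule exec.WhileTrue[OF WhileTrue.hyps(1) k(2) l(2)]) fact+
  qed
next
  case (IfTrue e s c1 \<omega> T s' \<omega>' c2)
  from IfTrue.IH obtain k where k: "\<omega>' = sdrop k \<omega>"
    "\<And>\<rho>. stake k \<rho> = stake k \<omega> \<Longrightarrow> exec c1 s \<rho> T s' (sdrop k \<rho>)"
    by blast
  show ?case
    by (rule exI[of _ k]) (simp add: k(1) exec.IfTrue[OF IfTrue.hyps(1) k(2)] del: One_nat_def plus_1_eq_Suc)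
next
  case (IfFalse e s c2 \<omega> T s' \<omega>' c1)
  from IfFalse.IH obtain k where k: "\<omega>' = sdrop k \<omega>"
    "\<And>\<rho>. stake k \<rho> = stake k \<omega> \<Longrightarrow> exec c2 s \<rho> T s' (sdrop k \<rho>)"
    by blast
  show ?case
    by (rule exI[of _ k]) (simp add: k(1) exec.IfFalse[OF IfFalse.hyps(1) k(2)] del: One_nat_def plus_1_eq_Suc)
next
  case (WhileFalse e s c \<omega>)
  then show ?case by (intro exI[of _ 0]) (simp add: exec.WhileFalse del: One_nat_def plus_1_eq_Suc)
qed

lemma measurable_run_time: "run_time c s \<in> borel_measurable coin_space"
proof -
  have sp: "space coin_space = UNIV"
    by (simp add: coin_space_def space_stream_space)
  have cyl: "{\<omega>. stake k \<omega> = u} \<in> sets coin_space" for k and u :: "bool list"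
  proof -
    have "sets coin_space = sets (stream_space (count_space UNIV))"
      unfolding coin_space_def by (intro sets_stream_space_cong) simp
    moreover have "stake k -` {u} \<inter> space (stream_space (count_space UNIV)) \<in>
        sets (stream_space (count_space (UNIV :: bool set)))"
      by (intro measurable_sets[OF measurable_stake]) simp
    ultimately show ?thesis by (simp add: vimage_def space_stream_space)
  qed
  have halt: "{\<omega>. \<exists>s' \<omega>'. exec c s \<omega> T s' \<omega>'} \<in> sets coin_space" for T
  proof -
    let ?H = "\<lambda>\<omega>. \<exists>s' \<omega>'. exec c s \<omega> T s' \<omega>'"
    let ?U = "{u. \<forall>\<rho>. stake (length u) \<rho> = u \<longrightarrow> ?H \<rho>}"
    have "{\<omega>. ?H \<omega>} = (\<Union>u\<in>?U. {\<omega>. stake (length u) \<omega> = u})"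
    proof (intro equalityI subsetI)
      fix \<omega> assume "\<omega> \<in> {\<omega>. ?H \<omega>}"
      then obtain s' \<omega>' where "exec c s \<omega> T s' \<omega>'" by blast
      from exec_finite_prefix[OF this]
      obtain k where "\<forall>\<rho>. stake k \<rho> = stake k \<omega> \<longrightarrow> ?H \<rho>" by blast
      then show "\<omega> \<in> (\<Union>u\<in>?U. {\<omega>. stake (length u) \<omega> = u})"
        by (intro UN_I[of "stake k \<omega>"]) auto
    qed auto
    moreover have "countable ?U" by simp
    ultimately show ?thesis using cyl by (auto intro!: sets.countable_UN'')
  qed
  have "run_time c s = (\<lambda>\<omega>. INF T. if \<exists>s' \<omega>'. exec c s \<omega> T s' \<omega>' then of_nat T else top)"
  proof (intro ext antisym)
    fix \<omega>
    show "run_time c s \<omega> \<le> (INF T. if \<exists>s' \<omega>'. exec c s \<omega> T s' \<omega>' then of_nat T else top)"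
      unfolding run_time_def
    proof (rule INF_greatest)
      fix T
      show "(INF T\<in>{T. \<exists>s' \<omega>'. exec c s \<omega> T s' \<omega>'}. of_nat T)
          \<le> (if \<exists>s' \<omega>'. exec c s \<omega> T s' \<omega>' then of_nat T else (top :: ennreal))"
        by (cases "\<exists>s' \<omega>'. exec c s \<omega> T s' \<omega>'")
          (simp_all only: if_True if_False top_greatest mem_Collect_eq INF_lower)
    qed
    show "(INF T. if \<exists>s' \<omega>'. exec c s \<omega> T s' \<omega>' then of_nat T else top) \<le> run_time c s \<omega>"
      unfolding run_time_def
    proof (rule INF_greatest)
      fix T assume "T \<in> {T. \<exists>s' \<omega>'. exec c s \<omega> T s' \<omega>'}"
      then show "(INF T. if \<exists>s' \<omega>'. exec c s \<omega> T s' \<omega>' then of_nat T else top)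
          \<le> (of_nat T :: ennreal)"
        by (intro INF_lower2[of T]) (simp_all only: mem_Collect_eq if_True UNIV_I order_refl)
    qed
  qed
  also have "\<dots> \<in> borel_measurable coin_space"
    using halt by (intro borel_measurable_INF measurable_If) (auto simp: sp)
  finally show ?thesis .
qed

text \<open>A set system given by an enumeration \<open>xs\<close> of its ground set and an enumeration \<open>Ss\<close> of its
  sets is presented to the program as the two numbers \<open>length xs\<close>, \<open>length Ss\<close> followed by the
  rows of the 0/1 incidence matrix; all remaining cells are \<open>0\<close>.\<close>

definition input_memory :: "'a list \<Rightarrow> 'a set list \<Rightarrow> memory" where
  "input_memory xs Ss =
     (let w = [length xs, length Ss] @ concat (map (\<lambda>S. map (\<lambda>x. of_bool (x \<in> S)) xs) Ss)
      in (\<lambda>a. if a < length w then w ! a else 0))"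

text \<open>The output is read off cells \<open>0, \<dots>, length xs - 1\<close>.\<close>

definition stores_coloring :: "'a list \<Rightarrow> memory \<Rightarrow> ('a \<Rightarrow> int) \<Rightarrow> bool" where
  "stores_coloring xs s f \<longleftrightarrow>
     (\<forall>j<length xs. f (xs ! j) = (if s j = 0 then -1 else 1))"

end

theory Submission
  imports Defs "HOL-Real_Asymp.Real_Asymp"
begin

text \<open>
  The coloring is the end point of a deterministic walk on the integer points of a cube
  \<open>[-D, D]\<^sup>n\<close>, guided by a potential: with \<open>b\<close> inversely proportional to the number of coordinates
  that are still away from the boundary, it is the sum over all sets \<open>S\<close> of
  \<open>(\<rho>\<^sup>u + \<rho>\<^sup>-\<^sup>u) \<rho>\<^sup>-\<^sup>v\<close>, where \<open>\<rho>\<close> is slightly above \<open>1\<close>, \<open>u\<close> is a multiple of the signed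
  sum of \<open>x\<close> over \<open>S\<close>, and \<open>v = b |x|\<^sup>2\<close>.

  On any \<open>m\<close> elements, Haussler's packing argument, run with the size-sensitive bound on the sets of
  size \<open>O(t)\<close>, yields a net of at most \<open>m/4\<close> sets such that every \<open>S\<close> differs from a member of the net
  in at most \<open>q\<^sup>2 = O(t powr (1 - 1/d))\<close> elements; the few larger sets are put into the net themselves.
  Directions orthogonal to the net see only these differences, so a trace argument gives a direction in
  which the second-order increase of the first factor is paid for by the decrease of the second one.
  Power iteration finds such a direction exactly enough, and one of its two signs does not increase
  the potential. At the end the potential bounds every signed sum by \<open>O(q (ln |\<S>| + ln n))\<close>, and
  \<open>ln |\<S>| = O(ln n)\<close>. So \<open>t powr (1/2 - 1/(2 * d)) * ln n\<close> already suffices, and the factor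
  \<open>sqrt (ln (ln t))\<close>, bounded below for \<open>t \<ge> 3\<close>, is not needed.

  The program knows none of \<open>d\<close>, \<open>C\<close>, \<open>t\<close>: it runs the walk for every \<open>q \<le> n\<close> and keeps the best
  coloring. It flips no coins, so its expected running time is its running time.
\<close>

section \<open>Packing of shallow sets\<close>

text \<open>Measured in units of \<open>radius n\<close>, with m live coordinates, the two exponents
  of a set are about +-(signed sum)/q - 4096 |x|^2/(m + 1). A move V orthogonal to the net raises
  the first part, at second order and on weighted average, by O(|V|^2/m): vectors of squared length
  at most q^2 are divided by q, and at least half of the trace survives the projection. The second
  part gains 4096 |V|^2/(m + 1). So the damping has to be of order 1/m and must grow while
  coordinates freeze. The loss caused by this growth is proportional to the slack n - |x|^2, which
  is about m at most because frozen coordinates sit near +-1. Summation by parts turns the total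
  loss into a harmonic sum, the one source of ln n besides the logarithm of the number of sets. The
  obstacle is exactness: direction, rounding and exponentials are computed in natural numbers of
  polynomial length. The constants therefore leave room for three errors (distance to the net, power
  iteration, rounding), each at most one twelfth of the damping.\<close>

definition shatters :: "'a set set \<Rightarrow> 'a set \<Rightarrow> bool" where
  "shatters G U \<longleftrightarrow> (\<forall>V\<subseteq>U. \<exists>T\<in>G. T \<inter> U = V)"

text \<open>The cube on \<open>B\<close> has an edge from \<open>T\<close> to
  \<open>insert x T\<close>. For 0/1 weights this counts the edges of the one-inclusion graph;
  weights are needed because many members of a family may share a trace.\<close>

definition edge_weight :: "'a set \<Rightarrow> ('a set \<Rightarrow> nat) \<Rightarrow> nat" where
  "edge_weight B w = (\<Sum>x\<in>B. \<Sum>T\<in>Pow (B - {x}). min (w T) (w (insert x T)))"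

lemma sum_Pow_insert:
  assumes "finite B" "b \<notin> B"
  shows "(\<Sum>T\<in>Pow (insert b B). f T) = (\<Sum>T\<in>Pow B. f T + (f (insert b T) :: nat))"
proof -
  have inj: "inj_on (insert b) (Pow B)"
    using assms(2) by (auto simp: inj_on_def)
  have "(\<Sum>T\<in>Pow (insert b B). f T) = (\<Sum>T\<in>Pow B. f T) + (\<Sum>T\<in>insert b ` Pow B. f T)"
    unfolding Pow_insert using assms by (intro sum.union_disjoint) auto
  then show ?thesis
    by (simp add: sum.reindex[OF inj] sum.distrib)
qed

text \<open>Splitting the cube along a coordinate \<open>b\<close>, the pointwise maximum and minimum of \<open>w\<close> on the two
  halves carry all the weight and all edges not in direction \<open>b\<close>; the edges in direction \<open>b\<close> weigh
  exactly as much as the minimum, whose support has smaller dimension.\<close>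

lemma edge_weight_le:
  assumes "finite B"
    and "\<And>U. U \<subseteq> B \<Longrightarrow> shatters {T \<in> Pow B. 0 < w T} U \<Longrightarrow> card U \<le> v"
  shows "edge_weight B w \<le> v * (\<Sum>T\<in>Pow B. w T)"
  using assms
proof (induction B arbitrary: w v rule: finite_induct)
  case empty
  then show ?case by (simp add: edge_weight_def)
next
  case (insert b B)
  define w0 where "w0 T = max (w T) (w (insert b T))" for T
  define w1 where "w1 T = min (w T) (w (insert b T))" for T
  \<comment> \<open>An edge in direction \<open>x\<close> occurs on both sides of \<open>b\<close>.
    For its two copies the claim is min(p, s) + min(p', s') \<le> min(max(p, p'), max(s, s')) +
    min(min(p, p'), min(s, s')).\<close>
  have cross: "(\<Sum>T\<in>Pow (insert b B - {x}). min (w T) (w (insert x T)))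
      \<le> (\<Sum>T\<in>Pow (B - {x}). min (w0 T) (w0 (insert x T)))
        + (\<Sum>T\<in>Pow (B - {x}). min (w1 T) (w1 (insert x T)))" if "x \<in> B" for x
  proof -
    have "insert b B - {x} = insert b (B - {x})" using that insert.hyps by auto
    then have "(\<Sum>T\<in>Pow (insert b B - {x}). min (w T) (w (insert x T)))
      = (\<Sum>T\<in>Pow (B - {x}). min (w T) (w (insert x T))
          + min (w (insert b T)) (w (insert x (insert b T))))"
      using insert.hyps by (simp add: sum_Pow_insert)
    also have "\<dots> \<le> (\<Sum>T\<in>Pow (B - {x}). min (w0 T) (w0 (insert x T)) + min (w1 T) (w1 (insert x T)))"
      by (intro sum_mono) (auto simp: w0_def w1_def insert_commute)
    finally show ?thesis by (simp add: sum.distrib)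
  qed
  have "edge_weight (insert b B) w
      = (\<Sum>T\<in>Pow B. w1 T) + (\<Sum>x\<in>B. \<Sum>T\<in>Pow (insert b B - {x}). min (w T) (w (insert x T)))"
    using insert.hyps by (simp add: edge_weight_def w1_def)
  also have "\<dots> \<le> (\<Sum>T\<in>Pow B. w1 T) + (edge_weight B w0 + edge_weight B w1)"
    using sum_mono[OF cross, of B] by (simp add: edge_weight_def sum.distrib)
  finally have split: "edge_weight (insert b B) w
      \<le> (\<Sum>T\<in>Pow B. w1 T) + edge_weight B w0 + edge_weight B w1" by simp
  \<comment> \<open>Adding \<open>b\<close> does not change traces on subsets of \<open>B\<close>,
    so the support of \<open>w0\<close> shatters nothing that the support of \<open>w\<close> does
    not.\<close>
  have e0: "edge_weight B w0 \<le> v * (\<Sum>T\<in>Pow B. w0 T)"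
  proof (rule insert.IH)
    fix U assume U: "U \<subseteq> B" "shatters {T \<in> Pow B. 0 < w0 T} U"
    have "shatters {T \<in> Pow (insert b B). 0 < w T} U"
      unfolding shatters_def
    proof (intro allI impI)
      fix V assume "V \<subseteq> U"
      then obtain T where T: "T \<in> Pow B" "0 < w0 T" "T \<inter> U = V"
        using U(2) by (auto simp: shatters_def)
      then have "0 < w T \<or> 0 < w (insert b T)" by (auto simp: w0_def)
      moreover have "insert b T \<inter> U = V" using T U(1) insert.hyps by auto
      ultimately show "\<exists>T\<in>{T \<in> Pow (insert b B). 0 < w T}. T \<inter> U = V"
        using T by blast
    qed
    with insert.prems U(1) show "card U \<le> v" by blast
  qed
  have e1: "(\<Sum>T\<in>Pow B. w1 T) + edge_weight B w1 \<le> v * (\<Sum>T\<in>Pow B. w1 T)"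
  proof (cases "\<exists>T\<in>Pow B. 0 < w1 T")
    case False
    then have z: "w1 T = 0" if "T \<subseteq> B" for T using that by auto
    have "edge_weight B w1 = 0" unfolding edge_weight_def
      by (intro sum.neutral ballI) (subst z, auto)
    moreover from z have "(\<Sum>T\<in>Pow B. w1 T) = 0" by simp
    ultimately have "edge_weight B w1 = 0" "(\<Sum>T\<in>Pow B. w1 T) = 0" by auto
    then show ?thesis by simp
  next
    case True
    \<comment> \<open>Where \<open>w1 T\<close> is positive, both \<open>T\<close> and
      \<open>insert b T\<close> carry weight; hence \<open>b\<close> can be added to any set
      shattered by the support of \<open>w1\<close>.\<close>
    have dim: "Suc (card U) \<le> v" if U: "U \<subseteq> B" "shatters {T \<in> Pow B. 0 < w1 T} U" for U
    proof -
      have "shatters {T \<in> Pow (insert b B). 0 < w T} (insert b U)"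
        unfolding shatters_def
      proof (intro allI impI)
        fix V assume V: "V \<subseteq> insert b U"
        then have "V - {b} \<subseteq> U" by auto
        from U(2)[unfolded shatters_def, rule_format, OF this]
        obtain T where T: "T \<in> Pow B" "0 < w1 T" "T \<inter> U = V - {b}" by blast
        have "(if b \<in> V then insert b T else T) \<inter> insert b U = V"
          using T V U insert.hyps by auto
        moreover have "(if b \<in> V then insert b T else T) \<in> {T \<in> Pow (insert b B). 0 < w T}"
          using T by (auto simp: w1_def)
        ultimately show "\<exists>T\<in>{T \<in> Pow (insert b B). 0 < w T}. T \<inter> insert b U = V" by blast
      qed
      with insert.prems[of "insert b U"] U(1) have "card (insert b U) \<le> v" by auto
      moreover have "finite U" "b \<notin> U" using U(1) insert.hyps finite_subset by auto
      ultimately show ?thesis by simp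
    qed
    \<comment> \<open>Positive weight somewhere makes the empty set shattered and so forces
      \<open>v\<close> to have a predecessor. The case without weight is separate because
      \<open>v\<close> may then be 0.\<close>
    from True have "shatters {T \<in> Pow B. 0 < w1 T} {}" by (auto simp: shatters_def)
    with dim[of "{}"] obtain v' where v': "v = Suc v'" by (cases v) auto
    have "edge_weight B w1 \<le> v' * (\<Sum>T\<in>Pow B. w1 T)"
      using dim v' by (intro insert.IH) auto
    with v' show ?thesis by simp
  qed
  have "(\<Sum>T\<in>Pow (insert b B). w T) = (\<Sum>T\<in>Pow B. w0 T + w1 T)"
    unfolding sum_Pow_insert[OF insert.hyps] by (intro sum.cong refl) (simp add: w0_def w1_def)
  then have "(\<Sum>T\<in>Pow (insert b B). w T) = (\<Sum>T\<in>Pow B. w0 T) + (\<Sum>T\<in>Pow B. w1 T)"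
    by (simp only: sum.distrib)
  with split e0 e1 show ?case
    by (simp add: distrib_left)
qed

section \<open>Separated families and their traces\<close>

definition trace_weight :: "'a set set \<Rightarrow> 'a set \<Rightarrow> 'a set \<Rightarrow> nat" where
  "trace_weight P A T = card {S \<in> P. S \<inter> A = T}"

lemma sum_trace_weight:
  assumes "finite P" "finite A"
  shows "(\<Sum>T\<in>Pow A. trace_weight P A T) = card P"
  using sum.group[of P "Pow A" "\<lambda>S. S \<inter> A" "\<lambda>_. 1 :: nat"] assms
  unfolding trace_weight_def by auto

text \<open>For \<open>x\<close> outside \<open>A\<close>, membership of \<open>x\<close> splits
  each class of equal traces on \<open>A\<close> in two, and the smaller part is counted. This is
  also the weight of all edges in direction \<open>x\<close> of the cube on
  \<open>insert x A\<close>.\<close>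

definition split_weight :: "'a set set \<Rightarrow> 'a set \<Rightarrow> 'a \<Rightarrow> nat" where
  "split_weight P A x =
     (\<Sum>T\<in>Pow A. min (trace_weight P (insert x A) T) (trace_weight P (insert x A) (insert x T)))"

text \<open>The summands are the edge weights of the cube on \<open>B\<close>, one direction at a
  time, with the number of members of \<open>P\<close> per trace as weight. Whatever the traces
  shatter is shattered by \<open>P\<close>.\<close>

lemma sum_split_weight_le:
  assumes "finite P" "finite B" "\<And>U. U \<subseteq> B \<Longrightarrow> shatters P U \<Longrightarrow> card U \<le> v"
  shows "(\<Sum>x\<in>B. split_weight P (B - {x}) x) \<le> v * card P"
proof -
  have "(\<Sum>x\<in>B. split_weight P (B - {x}) x) = edge_weight B (trace_weight P B)"
    unfolding edge_weight_def split_weight_def by (intro sum.cong) (auto simp: insert_absorb)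
  also have "\<dots> \<le> v * (\<Sum>T\<in>Pow B. trace_weight P B T)"
  proof (rule edge_weight_le[OF assms(2)])
    fix U assume U: "U \<subseteq> B" "shatters {T \<in> Pow B. 0 < trace_weight P B T} U"
    have "shatters P U"
      unfolding shatters_def
    proof (intro allI impI)
      fix V assume "V \<subseteq> U"
      then obtain T where "0 < trace_weight P B T" "T \<inter> U = V"
        using U(2) by (auto simp: shatters_def)
      then obtain S where "S \<in> P" "S \<inter> B = T" unfolding trace_weight_def card_gt_0_iff by auto
      with \<open>T \<inter> U = V\<close> U(1) show "\<exists>S\<in>P. S \<inter> U = V" by blast
    qed
    with assms(3) U(1) show "card U \<le> v" by blast
  qed
  finally show ?thesis using assms by (simp add: sum_trace_weight)
qed

text \<open>Ordered pairs of members are counted by the points in which they differ, all of which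
  lie outside \<open>A\<close>. A point that splits the class into n0 and n1 members separates 2 n0
  n1 \<le> 2 |Q| min(n0, n1) ordered pairs; a factor |Q| cancels.\<close>

lemma separated_class:
  assumes fin: "finite Y" "finite Q" and sub: "Q \<subseteq> Pow Y"
    and agree: "\<And>S. S \<in> Q \<Longrightarrow> S \<inter> A = T"
    and sep: "\<And>S S'. S \<in> Q \<Longrightarrow> S' \<in> Q \<Longrightarrow> S \<noteq> S' \<Longrightarrow> \<delta> \<le> card (sym_diff S S')"
  shows "\<delta> * (card Q - 1) \<le> 2 * (\<Sum>x\<in>Y - A. min (card {S \<in> Q. x \<notin> S}) (card {S \<in> Q. x \<in> S}))"
proof (cases "Q = {}")
  case False
  let ?n0 = "\<lambda>x. card {S \<in> Q. x \<notin> S}" and ?n1 = "\<lambda>x. card {S \<in> Q. x \<in> S}"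
  have tot: "?n0 x + ?n1 x = card Q" for x
  proof -
    have "Q = {S \<in> Q. x \<notin> S} \<union> {S \<in> Q. x \<in> S}" by auto
    then have "card Q = card ({S \<in> Q. x \<notin> S} \<union> {S \<in> Q. x \<in> S})" by simp
    then show ?thesis using fin by (subst (asm) card_Un_disjoint) auto
  qed
  have diff: "card (sym_diff S S') = (\<Sum>x\<in>Y - A. of_bool (x \<in> S \<longleftrightarrow> x \<notin> S'))"
    if "S \<in> Q" "S' \<in> Q" for S S'
  proof -
    have "sym_diff S S' = {x \<in> Y - A. x \<in> S \<longleftrightarrow> x \<notin> S'}"
      using that sub agree by blast
    then show ?thesis using fin by (simp add: sum.If_cases of_bool_def Int_def)
  qed
  have pair: "(\<Sum>S\<in>Q. \<Sum>S'\<in>Q. of_bool (x \<in> S \<longleftrightarrow> x \<notin> S')) = 2 * (?n0 x * ?n1 x)" for x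
  proof -
    have inner: "(\<Sum>S'\<in>Q. of_bool (x \<in> S \<longleftrightarrow> x \<notin> S')) = (if x \<in> S then ?n0 x else ?n1 x)" for S
      using fin by (simp add: of_bool_def sum.If_cases Int_def)
    show ?thesis unfolding inner using fin
      by (simp add: sum.If_cases Int_def)
  qed
  have "\<delta> * (card Q - 1) * card Q = (\<Sum>S\<in>Q. \<Sum>S'\<in>Q - {S}. \<delta>)"
    using fin by simp
  also have "\<dots> \<le> (\<Sum>S\<in>Q. \<Sum>S'\<in>Q - {S}. card (sym_diff S S'))"
    using sep by (intro sum_mono) auto
  also have "\<dots> \<le> (\<Sum>S\<in>Q. \<Sum>S'\<in>Q. card (sym_diff S S'))"
    using fin by (intro sum_mono sum_mono2) auto
  also have "\<dots> = (\<Sum>S\<in>Q. \<Sum>S'\<in>Q. \<Sum>x\<in>Y - A. of_bool (x \<in> S \<longleftrightarrow> x \<notin> S'))"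
    by (intro sum.cong refl diff)
  also have "\<dots> = (\<Sum>x\<in>Y - A. \<Sum>S\<in>Q. \<Sum>S'\<in>Q. of_bool (x \<in> S \<longleftrightarrow> x \<notin> S'))"
    by (rule trans[OF sum.cong[OF refl sum.swap] sum.swap])
  also have "\<dots> \<le> (\<Sum>x\<in>Y - A. 2 * (card Q * min (?n0 x) (?n1 x)))"
    unfolding pair
  proof (intro sum_mono mult_left_mono)
    fix x
    have "?n0 x \<le> card Q" "?n1 x \<le> card Q" using tot[of x] by auto
    then show "?n0 x * ?n1 x \<le> card Q * min (?n0 x) (?n1 x)"
      by (cases "?n0 x \<le> ?n1 x") (auto simp: min_def mult.commute[of "card Q"])
  qed simp
  finally have "card Q * (\<delta> * (card Q - 1)) \<le> card Q * (2 * (\<Sum>x\<in>Y - A. min (?n0 x) (?n1 x)))"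
    by (simp add: sum_distrib_left mult_ac)
  moreover have "0 < card Q" using False fin by (simp add: card_gt_0_iff)
  ultimately show ?thesis by (rule nat_mult_le_cancel1[THEN iffD1, rotated])
qed simp

text \<open>\<open>separated_class\<close> applied to every class of equal traces on
  \<open>A\<close> controls all but one member of the class. The exceptions add up to the number of
  traces.\<close>

lemma separated_traces:
  assumes fin: "finite Y" "A \<subseteq> Y" and sub: "P \<subseteq> Pow Y"
    and sep: "\<And>S S'. S \<in> P \<Longrightarrow> S' \<in> P \<Longrightarrow> S \<noteq> S' \<Longrightarrow> \<delta> \<le> card (sym_diff S S')"
  shows "\<delta> * card P \<le> \<delta> * card (restrict_sys P A) + 2 * (\<Sum>x\<in>Y - A. split_weight P A x)"
proof -
  have finP: "finite P" using fin sub finite_subset by blast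
  have finA: "finite A" using fin finite_subset by blast
  let ?w = "trace_weight P A"
  let ?R = "restrict_sys P A"
  let ?Q = "\<lambda>T. {S \<in> P. S \<inter> A = T}"
  have R: "?R \<subseteq> Pow A" "finite ?R" using finP by (auto simp: restrict_sys_def)
  have "card P = (\<Sum>T\<in>?R. ?w T)"
  proof -
    have "(\<Sum>T\<in>Pow A. ?w T) = (\<Sum>T\<in>?R. ?w T)"
    proof (intro sum.mono_neutral_right ballI)
      fix T assume "T \<in> Pow A - ?R"
      then have "?Q T = {}" by (auto simp: restrict_sys_def)
      then show "?w T = 0" unfolding trace_weight_def by (simp only: card.empty)
    qed (use R finA in auto)
    then show ?thesis using sum_trace_weight[OF finP finA] by simp
  qed
  also have "\<dots> \<le> (\<Sum>T\<in>?R. 1 + (?w T - 1))" by (intro sum_mono) simp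
  also have "\<dots> = card ?R + (\<Sum>T\<in>?R. ?w T - 1)" by (simp only: sum.distrib card_eq_sum)
  finally have "\<delta> * card P \<le> \<delta> * (card ?R + (\<Sum>T\<in>?R. ?w T - 1))" by (rule mult_le_mono2)
  then have "\<delta> * card P \<le> \<delta> * card ?R + (\<Sum>T\<in>?R. \<delta> * (?w T - 1))"
    by (simp only: distrib_left sum_distrib_left)
  also have "(\<Sum>T\<in>?R. \<delta> * (?w T - 1)) \<le>
      (\<Sum>T\<in>?R. 2 * (\<Sum>x\<in>Y - A. min (card {S \<in> ?Q T. x \<notin> S}) (card {S \<in> ?Q T. x \<in> S})))"
    unfolding trace_weight_def
    using finP sub sep fin by (intro sum_mono separated_class) auto
  also have "\<dots> \<le> (\<Sum>T\<in>Pow A. 2 * (\<Sum>x\<in>Y - A. min (card {S \<in> ?Q T. x \<notin> S}) (card {S \<in> ?Q T. x \<in> S})))"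
    using R finA by (intro sum_mono2) auto
  also have "\<dots> = 2 * (\<Sum>x\<in>Y - A. split_weight P A x)"
  proof -
    have eq: "{S \<in> ?Q T. x \<notin> S} = {S \<in> P. S \<inter> insert x A = T}"
      "{S \<in> ?Q T. x \<in> S} = {S \<in> P. S \<inter> insert x A = insert x T}"
      if "T \<in> Pow A" "x \<in> Y - A" for T x using that by auto
    have "(\<Sum>T\<in>Pow A. 2 * (\<Sum>x\<in>Y - A. min (card {S \<in> ?Q T. x \<notin> S}) (card {S \<in> ?Q T. x \<in> S})))
      = (\<Sum>T\<in>Pow A. 2 * (\<Sum>x\<in>Y - A. min (trace_weight P (insert x A) T)
            (trace_weight P (insert x A) (insert x T))))"
      unfolding trace_weight_def
      by (rule sum.cong[OF refl], rule arg_cong[where f = "\<lambda>z. 2 * z"], rule sum.cong[OF refl])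
        (simp only: eq)
    also have "\<dots> = 2 * (\<Sum>x\<in>Y - A. split_weight P A x)"
      unfolding split_weight_def sum_distrib_left[symmetric] by (subst sum.swap) simp
    finally show ?thesis .
  qed
  finally show ?thesis by simp
qed

section \<open>Averages over samples of a fixed size\<close>

definition subsets_of_card :: "'a set \<Rightarrow> nat \<Rightarrow> 'a set set" where
  "subsets_of_card Y s = {A. A \<subseteq> Y \<and> card A = s}"

text \<open>A sample with an extra point outside it is the same as a sample larger by one with a
  marked point.\<close>

lemma sum_subsets_extend:
  assumes "finite Y"
  shows "(\<Sum>A\<in>subsets_of_card Y s. \<Sum>x\<in>Y - A. f A x)
       = (\<Sum>B\<in>subsets_of_card Y (Suc s). \<Sum>x\<in>B. (f (B - {x}) x :: nat))"
proof -
  have fin: "finite (subsets_of_card Y s')" for s'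
    using assms by (simp add: subsets_of_card_def)
  have fin2: "finite Z" if "Z \<in> subsets_of_card Y s'" for Z s'
    using assms that by (auto simp: subsets_of_card_def intro: finite_subset)
  have "(\<Sum>A\<in>subsets_of_card Y s. \<Sum>x\<in>Y - A. f A x)
      = (\<Sum>(A, x)\<in>Sigma (subsets_of_card Y s) (\<lambda>A. Y - A). f A x)"
    using fin assms by (intro sum.Sigma) auto
  also have "\<dots> = (\<Sum>(B, x)\<in>Sigma (subsets_of_card Y (Suc s)) (\<lambda>B. B). f (B - {x}) x)"
  proof (rule sum.reindex_bij_witness[where i = "\<lambda>(B, x). (B - {x}, x)" and j = "\<lambda>(A, x). (insert x A, x)"],
      goal_cases)
    case (2 a)
    then show ?case using fin2[of "fst a" s] by (auto simp: subsets_of_card_def)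
  next
    case (4 a)
    then show ?case using fin2[of "fst a" "Suc s"] by (auto simp: subsets_of_card_def)
  qed (auto simp: insert_absorb)
  also have "\<dots> = (\<Sum>B\<in>subsets_of_card Y (Suc s). \<Sum>x\<in>B. f (B - {x}) x)"
    using fin fin2 by (intro sum.Sigma[symmetric]) auto
  finally show ?thesis .
qed

text \<open>A uniformly random \<open>s\<close>-subset of \<open>Y\<close> meets \<open>S\<close> in
  s |S| / |Y| points on average; this is written without division.\<close>

lemma sum_card_inter_subsets:
  assumes "finite Y" "S \<subseteq> Y" "0 < s"
  shows "card Y * (\<Sum>A\<in>subsets_of_card Y s. card (S \<inter> A)) = card S * s * (card Y choose s)"
proof -
  obtain s' where s': "s = Suc s'" using assms(3) by (cases s) auto
  have fin: "finite (subsets_of_card Y s)"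
    using assms by (simp add: subsets_of_card_def)
  have finS: "finite S" using assms finite_subset by auto
  have "card {A \<in> subsets_of_card Y s. x \<in> A} = (card Y - 1) choose s'" if "x \<in> S" for x
  proof -
    have "{A \<in> subsets_of_card Y s. x \<in> A} = insert x ` {A. A \<subseteq> Y - {x} \<and> card A = s'}" (is "?l = ?r")
    proof (intro equalityI subsetI)
      fix A assume "A \<in> ?l"
      then have "A = insert x (A - {x})" "A - {x} \<subseteq> Y - {x}" "card (A - {x}) = s'"
        by (auto simp: subsets_of_card_def s')
      then show "A \<in> ?r" by blast
    next
      fix A assume "A \<in> ?r"
      then obtain A' where "A = insert x A'" "A' \<subseteq> Y - {x}" "card A' = s'" by auto
      moreover have "finite A'" using \<open>A' \<subseteq> Y - {x}\<close> assms(1) by (meson finite_Diff finite_subset)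
      moreover have "x \<in> Y" using that assms by auto
      ultimately show "A \<in> ?l" by (auto simp: subsets_of_card_def s' card_insert_if)
    qed
    moreover have "inj_on (insert x) {A. A \<subseteq> Y - {x} \<and> card A = s'}" by (auto simp: inj_on_def)
    ultimately have "card ?l = card {A. A \<subseteq> Y - {x} \<and> card A = s'}" by (simp add: card_image)
    also have "\<dots> = card (Y - {x}) choose s'" using assms by (intro n_subsets) auto
    finally show ?thesis using that assms by (simp add: card_Diff_singleton subset_iff)
  qed
  moreover have "(\<Sum>A\<in>subsets_of_card Y s. card (S \<inter> A))
      = (\<Sum>x\<in>S. card {A \<in> subsets_of_card Y s. x \<in> A})"
  proof -
    have "(\<Sum>A\<in>subsets_of_card Y s. card (S \<inter> A)) = (\<Sum>A\<in>subsets_of_card Y s. \<Sum>x\<in>S. of_bool (x \<in> A))"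
      using finS by (intro sum.cong) (auto simp: of_bool_def sum.If_cases Int_def)
    also have "\<dots> = (\<Sum>x\<in>S. \<Sum>A\<in>subsets_of_card Y s. of_bool (x \<in> A))" by (rule sum.swap)
    finally show ?thesis using fin by (simp add: of_bool_def sum.If_cases Int_def)
  qed
  ultimately have "(\<Sum>A\<in>subsets_of_card Y s. card (S \<inter> A)) = card S * ((card Y - 1) choose s')"
    by simp
  then have "card Y * (\<Sum>A\<in>subsets_of_card Y s. card (S \<inter> A))
      = card S * (card Y * ((card Y - 1) choose s'))" by (simp only: mult.left_commute)
  also have "card Y * ((card Y - 1) choose s') = s * (card Y choose s)"
    using Suc_times_binomial_eq[of "card Y - 1" s'] s'
    by (cases "card Y") (auto simp: mult_ac simp del: binomial_Suc_Suc)
  finally show ?thesis by (simp only: mult.assoc)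
qed

text \<open>Haussler's argument: on a random \<open>s\<close>-subset \<open>A\<close> of \<open>Y\<close> the traces of a separated family rarely
  collide, and by Markov's inequality most of them are small.\<close>

lemma shallow_packing:
  assumes fin: "finite Y" and sub: "P \<subseteq> Pow Y"
    and sep: "\<And>S S'. S \<in> P \<Longrightarrow> S' \<in> P \<Longrightarrow> S \<noteq> S' \<Longrightarrow> \<delta> \<le> card (sym_diff S S')"
    and vc: "\<And>U. U \<subseteq> Y \<Longrightarrow> shatters P U \<Longrightarrow> card U \<le> v"
    and small: "\<And>S. S \<in> P \<Longrightarrow> card S \<le> h"
    and s: "0 < s" "s \<le> card Y" and "0 < \<delta>"
    and s\<delta>: "8 * v * card Y \<le> Suc s * \<delta>"
    and \<kappa>: "4 * h * s \<le> \<kappa> * card Y" "0 < \<kappa>"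
    and N: "\<And>A. A \<subseteq> Y \<Longrightarrow> card A = s \<Longrightarrow> card {T \<in> restrict_sys P A. card T \<le> \<kappa>} \<le> N"
  shows "card P \<le> 2 * N"
proof -
  let ?m = "card Y"
  let ?I = "subsets_of_card Y s"
  let ?c = "?m choose s"
  have finP: "finite P" using fin sub finite_subset by blast
  have finI: "finite ?I" using fin by (simp add: subsets_of_card_def)
  have cI: "card (subsets_of_card Y s') = ?m choose s'" for s'
    unfolding subsets_of_card_def using fin by (rule n_subsets)
  have cpos: "0 < ?c" using s by simp
  have m: "0 < ?m" using s by simp
  \<comment> \<open>\<open>separated_traces\<close> summed over all samples. In the last term the
    sample and its extra point are merged, so that \<open>sum_split_weight_le\<close> applies to
    samples of size \<open>Suc s\<close>.\<close>
  have 1: "?c * (\<delta> * card P) \<le> \<delta> * (\<Sum>A\<in>?I. card (restrict_sys P A)) + 2 * ((?m choose Suc s) * (v * card P))"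
  proof -
    have "?c * (\<delta> * card P) = (\<Sum>A\<in>?I. \<delta> * card P)" by (simp add: cI)
    also have "\<dots> \<le> (\<Sum>A\<in>?I. \<delta> * card (restrict_sys P A) + 2 * (\<Sum>x\<in>Y - A. split_weight P A x))"
      by (intro sum_mono separated_traces[OF fin _ sub sep]) (auto simp: subsets_of_card_def)
    also have "\<dots> = \<delta> * (\<Sum>A\<in>?I. card (restrict_sys P A))
        + 2 * (\<Sum>B\<in>subsets_of_card Y (Suc s). \<Sum>x\<in>B. split_weight P (B - {x}) x)"
      by (simp add: sum.distrib sum_distrib_left[symmetric] sum_subsets_extend[OF fin])
    also have "(\<Sum>B\<in>subsets_of_card Y (Suc s). \<Sum>x\<in>B. split_weight P (B - {x}) x)
        \<le> (\<Sum>B\<in>subsets_of_card Y (Suc s). v * card P)"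
      using fin finP vc
      by (intro sum_mono sum_split_weight_le) (auto simp: subsets_of_card_def intro: finite_subset)
    finally show ?thesis by (simp add: cI)
  qed
  \<comment> \<open>By \<open>s\<delta>\<close> the split term is at most a quarter of the left-hand
    side of 1: passing to \<open>Suc s\<close> multiplies the number of samples by (m - s)/(s + 1)
    \<le> m/(s + 1).\<close>
  have 2: "4 * (2 * ((?m choose Suc s) * (v * card P))) \<le> ?c * (\<delta> * card P)"
  proof -
    have "(?m choose Suc s) * Suc s \<le> ?c * ?m"
      using binomial_absorb_comp[of ?m s]
      by (metis mult.commute diff_le_self binomial_absorption mult_le_mono2)
    from mult_le_mono1[OF this, of "8 * v"]
    have "Suc s * (8 * (?m choose Suc s) * v) \<le> ?c * (8 * v * ?m)" by (simp only: mult_ac)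
    also have "\<dots> \<le> ?c * (Suc s * \<delta>)" using s\<delta> by (intro mult_le_mono2)
    also have "\<dots> = Suc s * (?c * \<delta>)" by (simp only: mult_ac)
    finally have "8 * (?m choose Suc s) * v \<le> ?c * \<delta>" by (simp only: Suc_mult_le_cancel1)
    from mult_le_mono1[OF this, of "card P"] show ?thesis by (simp add: mult_ac)
  qed
  let ?b = "\<Sum>A\<in>?I. card {S \<in> P. \<kappa> < card (S \<inter> A)}"
  \<comment> \<open>Markov's inequality: the threshold \<open>\<kappa>\<close> is at least four
    times the mean size h s / m of a trace.\<close>
  have 3: "4 * (\<Sum>A\<in>?I. card {S \<in> P. \<kappa> < card (S \<inter> A)}) \<le> ?c * card P"
  proof -
    have "\<kappa> * ?m * (\<Sum>A\<in>?I. card {S \<in> P. \<kappa> < card (S \<inter> A)})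
        = ?m * (\<Sum>A\<in>?I. \<Sum>S\<in>P. if \<kappa> < card (S \<inter> A) then \<kappa> else 0)"
      using finP by (simp add: sum.If_cases Int_def sum_distrib_left mult_ac)
    also have "\<dots> \<le> ?m * (\<Sum>A\<in>?I. \<Sum>S\<in>P. card (S \<inter> A))"
      by (intro mult_left_mono sum_mono) auto
    also have "\<dots> = (\<Sum>S\<in>P. ?m * (\<Sum>A\<in>?I. card (S \<inter> A)))"
      by (subst sum.swap) (simp add: sum_distrib_left)
    also have "\<dots> = (\<Sum>S\<in>P. card S * s * ?c)"
      using sub fin s by (intro sum.cong sum_card_inter_subsets) auto
    also have "\<dots> \<le> (\<Sum>S\<in>P. h * s * ?c)"
      using small by (intro sum_mono mult_right_mono) auto
    finally have le: "\<kappa> * ?m * ?b \<le> card P * (h * s * ?c)" by (simp only: sum_constant of_nat_id)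
    have "\<kappa> * ?m * (4 * ?b) = 4 * (\<kappa> * ?m * ?b)" by (simp only: mult_ac)
    also have "\<dots> \<le> 4 * (card P * (h * s * ?c))" by (rule mult_le_mono2[OF le])
    also have "\<dots> = 4 * h * s * (?c * card P)" by (simp only: mult_ac)
    also have "\<dots> \<le> \<kappa> * ?m * (?c * card P)" using \<kappa> by (intro mult_le_mono1)
    finally have "\<kappa> * ?m * (4 * ?b) \<le> \<kappa> * ?m * (?c * card P)" .
    moreover have "0 < \<kappa> * ?m" using \<kappa> m by simp
    ultimately show ?thesis by (rule nat_mult_le_cancel1[THEN iffD1, rotated])
  qed
  \<comment> \<open>A trace on a sample is either small, hence one of at most \<open>N\<close>, or
    it is charged to a set counted in \<open>?b\<close>.\<close>
  have 4: "(\<Sum>A\<in>?I. card (restrict_sys P A)) \<le> ?c * N + (\<Sum>A\<in>?I. card {S \<in> P. \<kappa> < card (S \<inter> A)})"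
  proof -
    have "card (restrict_sys P A) \<le> N + card {S \<in> P. \<kappa> < card (S \<inter> A)}" if "A \<in> ?I" for A
    proof -
      have "restrict_sys P A \<subseteq> {T \<in> restrict_sys P A. card T \<le> \<kappa>}
          \<union> (\<lambda>S. S \<inter> A) ` {S \<in> P. \<kappa> < card (S \<inter> A)}"
      proof
        fix T assume T: "T \<in> restrict_sys P A"
        then obtain S where "S \<in> P" "T = S \<inter> A" unfolding restrict_sys_def by blast
        with T show "T \<in> {T \<in> restrict_sys P A. card T \<le> \<kappa>}
          \<union> (\<lambda>S. S \<inter> A) ` {S \<in> P. \<kappa> < card (S \<inter> A)}"
          by (cases "card T \<le> \<kappa>") (simp, blast intro: not_le_imp_less)
      qed
      then have "card (restrict_sys P A) \<le> card ({T \<in> restrict_sys P A. card T \<le> \<kappa>}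
          \<union> (\<lambda>S. S \<inter> A) ` {S \<in> P. \<kappa> < card (S \<inter> A)})"
        using finP by (intro card_mono) (auto simp: restrict_sys_def)
      also have "\<dots> \<le> card {T \<in> restrict_sys P A. card T \<le> \<kappa>}
          + card ((\<lambda>S. S \<inter> A) ` {S \<in> P. \<kappa> < card (S \<inter> A)})" by (rule card_Un_le)
      also have "\<dots> \<le> N + card {S \<in> P. \<kappa> < card (S \<inter> A)}"
        using N[of A] that finP by (intro add_mono card_image_le) (auto simp: subsets_of_card_def)
      finally show ?thesis .
    qed
    then have "(\<Sum>A\<in>?I. card (restrict_sys P A)) \<le> (\<Sum>A\<in>?I. N + card {S \<in> P. \<kappa> < card (S \<inter> A)})"
      by (rule sum_mono)
    then show ?thesis by (simp add: sum.distrib cI)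
  qed
  \<comment> \<open>Once \<open>?c * \<delta>\<close> is cancelled, the bounds together say 4 |P|
    \<le> 4 N + |P| + |P|.\<close>
  have "4 * (?c * (\<delta> * card P)) \<le> 4 * (\<delta> * (\<Sum>A\<in>?I. card (restrict_sys P A))) + ?c * (\<delta> * card P)"
    using 1 2 by linarith
  also have "\<dots> \<le> \<delta> * (4 * (?c * N + ?b)) + ?c * (\<delta> * card P)"
    using mult_le_mono2[OF mult_le_mono2[OF 4, of 4], of \<delta>] by (simp only: mult.left_commute add_le_mono1)
  also have "\<dots> \<le> \<delta> * (4 * (?c * N) + ?c * card P) + ?c * (\<delta> * card P)"
    using 3 by (intro add_right_mono mult_left_mono) auto
  finally have "?c * \<delta> * (2 * card P) \<le> ?c * \<delta> * (4 * N)" by (simp add: algebra_simps)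
  moreover have "0 < ?c * \<delta>" using cpos \<open>0 < \<delta>\<close> by simp
  ultimately have "2 * card P \<le> 4 * N" by (rule nat_mult_le_cancel1[THEN iffD1, rotated])
  then show ?thesis by linarith
qed

section \<open>Nets from the shattering bounds\<close>

lemma shatter_function_ge:
  assumes "finite X" "Y \<subseteq> X"
  shows "card (restrict_sys \<S> Y) \<le> shatter_function X \<S> (card Y)"
proof -
  have "{card (restrict_sys \<S> Z) |Z. Z \<subseteq> X \<and> card Z = card Y} \<subseteq> (\<lambda>Z. card (restrict_sys \<S> Z)) ` Pow X"
    by auto
  then have "finite {card (restrict_sys \<S> Z) |Z. Z \<subseteq> X \<and> card Z = card Y}"
    using assms(1) finite_subset by blast
  then show ?thesis unfolding shatter_function_def using assms by (intro Max_ge) auto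
qed

text \<open>A shattered set of size u has 2^u traces, which exceeds C u^d for large u. The threshold
  depends on \<open>d\<close> and \<open>C\<close> alone; this makes the later constants uniform
  over all systems.\<close>

lemma shattered_card_le:
  fixes d C :: real
  obtains v :: nat where "1 \<le> v"
    "\<And>(X :: 'a set) \<S> U. finite X \<Longrightarrow> primal_shatter_dim X \<S> d C \<Longrightarrow> U \<subseteq> X \<Longrightarrow> shatters \<S> U \<Longrightarrow> card U \<le> v"
proof -
  have "eventually (\<lambda>u::nat. C * real u powr d < 2 ^ u) at_top" by real_asymp
  then obtain v0 where v0: "\<And>u. v0 \<le> u \<Longrightarrow> C * real u powr d < 2 ^ u"
    by (auto simp: eventually_at_top_linorder)
  show thesis
  proof (rule that[of "Suc v0"])
    fix X :: "'a set" and \<S> U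
    assume fin: "finite X" and dim: "primal_shatter_dim X \<S> d C" and U: "U \<subseteq> X" "shatters \<S> U"
    show "card U \<le> Suc v0"
    proof (rule ccontr)
      assume "\<not> card U \<le> Suc v0"
      then have big: "v0 \<le> card U" "1 \<le> card U" by auto
      have finU: "finite U" using fin U finite_subset by blast
      have "Pow U \<subseteq> restrict_sys \<S> U"
        using U(2) unfolding shatters_def restrict_sys_def by blast
      moreover have "restrict_sys \<S> U \<subseteq> Pow U" unfolding restrict_sys_def by blast
      ultimately have "card (restrict_sys \<S> U) = 2 ^ card U"
        using finU by (metis card_Pow subset_antisym)
      with shatter_function_ge[OF fin U(1), of \<S>] have "2 ^ card U \<le> shatter_function X \<S> (card U)" by simp
      then have "(2::real) ^ card U \<le> real (shatter_function X \<S> (card U))"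
        by (metis of_nat_le_iff of_nat_numeral of_nat_power)
      also have "\<dots> \<le> C * real (card U) powr d"
        using dim big card_mono[OF fin U(1)] unfolding primal_shatter_dim_def by auto
      also have "\<dots> < 2 ^ card U" using v0 big by blast
      finally show False by simp
    qed
  qed simp
qed

text \<open>An inclusion-maximal separated subfamily is a net, since a member far from all of it
  could be added.\<close>

lemma separated_net:
  assumes "finite F"
  obtains P where "P \<subseteq> F" "\<And>S S'. S \<in> P \<Longrightarrow> S' \<in> P \<Longrightarrow> S \<noteq> S' \<Longrightarrow> \<delta> \<le> card (sym_diff S S')"
    "\<And>S. S \<in> F \<Longrightarrow> \<exists>S'\<in>P. S = S' \<or> card (sym_diff S S') < \<delta>"
proof -
  let ?sep = "\<lambda>P. \<forall>S\<in>P. \<forall>S'\<in>P. S \<noteq> S' \<longrightarrow> \<delta> \<le> card (sym_diff S S')"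
  let ?A = "{P. P \<subseteq> F \<and> ?sep P}"
  have "finite ?A" using assms by simp
  moreover have "?A \<noteq> {}" by auto
  ultimately obtain P where P: "P \<in> ?A" "\<forall>Q\<in>?A. P \<subseteq> Q \<longrightarrow> P = Q"
    by (rule finite_has_maximal[elim_format]) auto
  show thesis
  proof (rule that[of P])
    show "\<exists>S'\<in>P. S = S' \<or> card (sym_diff S S') < \<delta>" if "S \<in> F" for S
    proof (rule ccontr)
      assume far: "\<not> ?thesis"
      then have far': "\<delta> \<le> card (sym_diff S S')" if "S' \<in> P" for S' using that by (meson not_less)
      have "?sep (insert S P)"
      proof (intro ballI impI)
        fix T T' assume T: "T \<in> insert S P" "T' \<in> insert S P" "T \<noteq> T'"
        show "\<delta> \<le> card (sym_diff T T')"
        proof (cases "T = S")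
          case True
          then show ?thesis using T far' by blast
        next
          case False
          then have "T \<in> P" using T by blast
          show ?thesis
          proof (cases "T' = S")
            case True
            then show ?thesis using far'[OF \<open>T \<in> P\<close>] by (subst Un_commute) simp
          next
            case False
            then show ?thesis using T \<open>T \<in> P\<close> P(1) by blast
          qed
        qed
      qed
      then have "insert S P \<in> ?A" using P(1) \<open>S \<in> F\<close> by blast
      from P(2)[THEN bspec, OF this] have "P = insert S P" by (rule mp) (rule subset_insertI)
      then have "S \<in> P" by (metis insertI1)
      with far show False by blast
    qed
  qed (use P(1) in auto)
qed

text \<open>Double counting of the incidences inside \<open>Y\<close>: there are at most t |Y| of
  them, and each large set uses more than 8 t.\<close>

lemma card_large_sets:
  assumes "finite Y" "finite \<S>" "\<And>x. x \<in> Y \<Longrightarrow> card {S \<in> \<S>. x \<in> S} \<le> t"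
  shows "8 * t * card {S \<in> \<S>. 8 * t < card (S \<inter> Y)} \<le> card Y * t"
proof -
  have "8 * t * card {S \<in> \<S>. 8 * t < card (S \<inter> Y)} = (\<Sum>S\<in>{S \<in> \<S>. 8 * t < card (S \<inter> Y)}. 8 * t)"
    by simp
  also have "\<dots> \<le> (\<Sum>S\<in>{S \<in> \<S>. 8 * t < card (S \<inter> Y)}. card (S \<inter> Y))" by (intro sum_mono) auto
  also have "\<dots> \<le> (\<Sum>S\<in>\<S>. card (S \<inter> Y))" using assms by (intro sum_mono2) auto
  also have "\<dots> = (\<Sum>S\<in>\<S>. \<Sum>x\<in>Y. of_bool (x \<in> S))"
    using assms by (intro sum.cong) (auto simp: of_bool_def sum.If_cases Int_def conj_commute)
  also have "\<dots> = (\<Sum>x\<in>Y. \<Sum>S\<in>\<S>. of_bool (x \<in> S))" by (rule sum.swap)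
  also have "\<dots> = (\<Sum>x\<in>Y. card {S \<in> \<S>. x \<in> S})"
    using assms by (intro sum.cong) (auto simp: of_bool_def sum.If_cases Int_def)
  also have "\<dots> \<le> (\<Sum>x\<in>Y. t)" using assms by (intro sum_mono)
  finally show ?thesis by simp
qed

text \<open>\<open>shallow_packing\<close> with samples of size s ~ 8 v m / e and threshold \<kappa>
  ~ 512 v t / e, where e = c t^(1 - 1/d). Since \<kappa> = O(t^(1/d)), the size-sensitive bound s
  \<kappa>^(d - 1) is of order (m / e) t^(1 - 1/d), and the powers of t cancel. What remains is a
  multiple of m, made small by the choice of \<open>c\<close>.\<close>

lemma small_net:
  fixes d C :: real and t v :: nat
  assumes d: "1 \<le> d" and C: "1 \<le> C" and v: "1 \<le> v" and t: "1 \<le> t"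
    and fin: "finite X" and Y: "Y \<subseteq> X" and F: "F \<subseteq> restrict_sys \<S> Y"
    and vc: "\<And>U. U \<subseteq> X \<Longrightarrow> shatters \<S> U \<Longrightarrow> card U \<le> v"
    and sss: "size_sensitive_shattering X \<S> 1 (d - 1) C"
    and small: "\<And>S. S \<in> F \<Longrightarrow> card S \<le> 8 * t"
    and sep: "\<And>S S'. S \<in> F \<Longrightarrow> S' \<in> F \<Longrightarrow> S \<noteq> S' \<Longrightarrow> \<delta> \<le> card (sym_diff S S')"
    and c: "c = 512 * C * v * 2 powr d"
    and \<delta>: "c * t powr (1 - 1 / d) \<le> real \<delta>" and m: "c * t powr (1 - 1 / d) \<le> card Y" "2 \<le> card Y"
  shows "8 * card F \<le> card Y"
proof -
  define e where "e = c * t powr (1 - 1 / d)"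
  have c512: "512 * v \<le> c"
  proof -
    have "1 * 1 \<le> C * 2 powr d" using C d by (intro mult_mono) (auto intro: ge_one_powr_ge_zero)
    then have "512 * real v * 1 \<le> 512 * real v * (C * 2 powr d)" by (intro mult_left_mono) auto
    then show ?thesis by (simp add: c mult_ac)
  qed
  have tp: "1 \<le> t powr (1 - 1 / d)" using t d by (intro ge_one_powr_ge_zero) auto
  have ce: "c \<le> e" unfolding e_def using tp c512 v by (simp add: mult_le_cancel_left1)
  have e0: "0 < e" "1 \<le> e" using ce c512 v by linarith+
  have te: "t / e = t powr (1 / d) / c"
  proof -
    have "t powr (1 / d) * t powr (1 - 1 / d) = t" using t by (simp add: powr_add[symmetric])
    then show ?thesis unfolding e_def using c512 v t by (simp add: field_simps)
  qed
  \<comment> \<open>The sample size makes s e at least 8 v m. The threshold is four times the bound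
    8 t s / m on the mean trace size, with s \<le> 16 v m / e.\<close>
  define s where "s = nat \<lceil>8 * v * card Y / e\<rceil>"
  define \<kappa> where "\<kappa> = nat \<lceil>512 * v * (t / e)\<rceil>"
  have me: "1 \<le> card Y / e" using m e0 by (simp add: e_def)
  have s_ge: "8 * v * card Y / e \<le> s" unfolding s_def by (meson real_nat_ceiling_ge)
  have v1: "1 \<le> v * (card Y / e)" using mult_mono[of 1 "real v" 1 "card Y / e"] me v by simp
  have s_le: "s \<le> 8 * v * card Y / e + 1" unfolding s_def using e0 by (simp add: of_nat_ceiling)
  have s_le16: "s \<le> 16 * v * card Y / e" 
  proof -
    have "16 * v * card Y / e = 8 * v * card Y / e + 8 * (v * (card Y / e))" by simp
    with s_le v1 show ?thesis by linarith
  qed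
  have spos: "0 < s" using s_ge v1 by (cases s) auto
  have "16 * v \<le> e" using ce c512 by linarith
  then have "real (16 * v) * card Y \<le> e * card Y" by (intro mult_right_mono) auto
  then have "8 * v * card Y / e \<le> card Y / 2" using e0 by (simp add: field_simps)
  then have sm: "s \<le> card Y" using s_le m(2) by linarith
  have \<kappa>_ge: "512 * v * (t / e) \<le> \<kappa>" unfolding \<kappa>_def by (meson real_nat_ceiling_ge)
  have "0 < 512 * v * (t / e)" using v t e0 by simp
  then have \<kappa>pos: "0 < \<kappa>" using \<kappa>_ge by (cases \<kappa>) auto
  have \<kappa>_le: "\<kappa> \<le> 2 * t powr (1 / d)"
  proof -
    have "\<kappa> \<le> 512 * v * (t / e) + 1" unfolding \<kappa>_def using e0 by (simp add: of_nat_ceiling)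
    also have "512 * v * (t / e) = 512 * v / c * t powr (1 / d)" unfolding te by simp
    also have "\<dots> \<le> 1 * t powr (1 / d)" using c512 v by (intro mult_right_mono) (auto simp: field_simps)
    finally have "\<kappa> \<le> t powr (1 / d) + 1" by simp
    moreover have "1 \<le> t powr (1 / d)" using t d by (intro ge_one_powr_ge_zero) auto
    ultimately show ?thesis by linarith
  qed
  define N where "N = nat \<lfloor>C * s * \<kappa> powr (d - 1)\<rfloor>"
  have "card F \<le> 2 * N"
  proof (rule shallow_packing[where Y = Y and s = s and \<delta> = \<delta> and v = v and h = "8 * t" and \<kappa> = \<kappa>])
    show "finite Y" using fin Y finite_subset by blast
    show "F \<subseteq> Pow Y" using F by (auto simp: restrict_sys_def)
    have sh: "shatters \<S> U" if U: "U \<subseteq> Y" "shatters F U" for U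
      unfolding shatters_def
    proof (intro allI impI)
      fix V assume "V \<subseteq> U"
      then obtain T where "T \<in> F" "T \<inter> U = V" using U(2) unfolding shatters_def by blast
      then obtain S where "S \<in> \<S>" "T = S \<inter> Y" using F unfolding restrict_sys_def by blast
      then show "\<exists>T\<in>\<S>. T \<inter> U = V" using U(1) \<open>T \<inter> U = V\<close> by (intro bexI[of _ S]) auto
    qed
    show "card U \<le> v" if "U \<subseteq> Y" "shatters F U" for U
      using vc sh that Y by blast
    show "0 < \<delta>" using \<delta> e0 by (cases \<delta>) (auto simp: e_def)
    have "real (8 * v * card Y) \<le> s * e" using s_ge e0 by (simp add: field_simps)
    also have "\<dots> \<le> Suc s * real \<delta>" using \<delta> e0 by (intro mult_mono) (auto simp: e_def)
    finally show "8 * v * card Y \<le> Suc s * \<delta>" by (simp only: of_nat_mult[symmetric] of_nat_le_iff)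
    have "real (4 * (8 * t) * s) \<le> 32 * t * (16 * v * card Y / e)"
      using mult_left_mono[OF s_le16, of "32 * real t"] by simp
    also have "\<dots> = (512 * v * (t / e)) * card Y" by simp
    also have "\<dots> \<le> real \<kappa> * card Y" using \<kappa>_ge by (intro mult_right_mono) auto
    also have "\<dots> = real (\<kappa> * card Y)" by simp
    finally show "4 * (8 * t) * s \<le> \<kappa> * card Y" by (simp only: of_nat_mult[symmetric] of_nat_le_iff)
    show "card {T \<in> restrict_sys F A. card T \<le> \<kappa>} \<le> N" if A: "A \<subseteq> Y" "card A = s" for A
    proof -
      have finA: "finite A" using A spos card_ge_0_finite by auto
      have fR: "finite (restrict_sys \<S> A)"
        by (rule finite_subset[of _ "Pow A"]) (use finA in \<open>auto simp: restrict_sys_def\<close>)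
      have RA: "card T \<le> s" if "T \<in> restrict_sys \<S> A" for T
        using that A finA by (auto simp: restrict_sys_def intro: card_mono)
      have "restrict_sys F A \<subseteq> restrict_sys \<S> A"
      proof
        fix T assume "T \<in> restrict_sys F A"
        then obtain S where "S \<in> \<S>" "T = S \<inter> Y \<inter> A" using F unfolding restrict_sys_def by blast
        then have "T = S \<inter> A" using A by blast
        with \<open>S \<in> \<S>\<close> show "T \<in> restrict_sys \<S> A" by (auto simp: restrict_sys_def)
      qed
      \<comment> \<open>The size-sensitive bound speaks only of sizes up to the cardinality of the
        ground set, so the threshold is cut down to \<open>min \<kappa> s\<close>; no trace on
        \<open>A\<close> has more than \<open>s\<close> elements anyway.\<close>
      then have "{T \<in> restrict_sys F A. card T \<le> \<kappa>} \<subseteq> {T \<in> restrict_sys \<S> A. card T \<le> min \<kappa> s}"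
        using RA by auto
      then have "card {T \<in> restrict_sys F A. card T \<le> \<kappa>} \<le> card {T \<in> restrict_sys \<S> A. card T \<le> min \<kappa> s}"
        using fR by (intro card_mono) auto
      also have "real \<dots> \<le> C * real (card A) powr 1 * real (min \<kappa> s) powr (d - 1)"
      proof (rule sss[unfolded size_sensitive_shattering_def, rule_format])
        show "A \<subseteq> X" using A Y by blast
        show "min \<kappa> s \<in> {1..card A}" using A \<kappa>pos spos by simp
      qed
      also have "\<dots> \<le> C * s * \<kappa> powr (d - 1)"
        using C d A spos by (intro mult_mono powr_mono2) auto
      finally have "int (card {T \<in> restrict_sys F A. card T \<le> \<kappa>}) \<le> \<lfloor>C * s * \<kappa> powr (d - 1)\<rfloor>"
        by (simp add: le_floor_iff)
      then show ?thesis unfolding N_def by linarith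
    qed
  qed (use small sep spos sm \<kappa>pos in auto)
  then have "real (8 * card F) \<le> 16 * N" by simp
  also have "\<dots> \<le> 16 * (C * s * \<kappa> powr (d - 1))" unfolding N_def using C by (simp add: of_nat_floor)
  also have "\<dots> \<le> 16 * (C * (16 * v * card Y / e) * (2 * t powr (1 / d)) powr (d - 1))"
    using C d s_le16 \<kappa>_le e0 by (intro mult_left_mono mult_mono powr_mono2) auto
  also have "(2 * t powr (1 / d)) powr (d - 1) = 2 powr (d - 1) * t powr (1 - 1 / d)"
    using d by (simp add: powr_mult powr_powr diff_divide_distrib)
  also have "2 powr (d - 1) = 2 powr d / (2 :: real)" by (simp add: powr_diff)
  also have "16 * (C * (16 * v * card Y / e) * (2 powr d / 2 * t powr (1 - 1 / d)))
      = card Y * (128 * C * v * 2 powr d * t powr (1 - 1 / d)) / e" by simp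
  also have "128 * C * v * 2 powr d * t powr (1 - 1 / d) = e / 4" by (simp add: e_def c)
  also have "card Y * (e / 4) / e \<le> card Y" using e0 by simp
  finally show ?thesis by linarith
qed

text \<open>Both the net of the small traces and the collection of large traces have at most m/8
  members. If \<open>card Y\<close> is below the distance bound, the empty set alone is a net, and
  \<open>4 \<le> card Y\<close> is what admits one member.\<close>

lemma shallow_net:
  fixes d C :: real
  assumes d: "1 \<le> d"
  obtains c :: real where "1 \<le> c"
    "\<And>(X :: 'a set) \<S> t Y. finite X \<Longrightarrow> primal_shatter_dim X \<S> d C \<Longrightarrow>
      size_sensitive_shattering X \<S> 1 (d - 1) C \<Longrightarrow> \<S> \<subseteq> Pow X \<Longrightarrow> 1 \<le> t \<Longrightarrow>
      (\<And>x. x \<in> X \<Longrightarrow> card {S \<in> \<S>. x \<in> S} \<le> t) \<Longrightarrow> Y \<subseteq> X \<Longrightarrow> 4 \<le> card Y \<Longrightarrow>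
      \<exists>N. N \<subseteq> Pow Y \<and> 4 * card N \<le> card Y \<and>
        (\<forall>S\<in>\<S>. \<exists>P\<in>N. card (sym_diff (S \<inter> Y) P) \<le> c * real t powr (1 - 1 / d))"
proof -
  obtain v :: nat where v: "1 \<le> v"
    "\<And>(X :: 'a set) \<S> U. finite X \<Longrightarrow> primal_shatter_dim X \<S> d C \<Longrightarrow> U \<subseteq> X \<Longrightarrow> shatters \<S> U \<Longrightarrow> card U \<le> v"
    using shattered_card_le[where ?'a = 'a] by blast
  \<comment> \<open>\<open>C\<close> is an arbitrary real, whereas the parameter choices of
    \<open>small_net\<close> want a constant of at least 1.\<close>
  define C1 where "C1 = max C 1"
  define c where "c = 512 * C1 * v * 2 powr d"
  have c1: "1 \<le> c"
  proof -
    have "1 \<le> 2 powr d" using d by (intro ge_one_powr_ge_zero) auto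
    then have "1 * 1 * 1 \<le> C1 * v * 2 powr d"
      using v(1) by (intro mult_mono) (auto simp: C1_def)
    then show ?thesis by (simp add: c_def)
  qed
  show thesis
  proof (rule that[OF c1])
    fix X :: "'a set" and \<S> t Y
    assume fin: "finite X" and dim: "primal_shatter_dim X \<S> d C"
      and sss: "size_sensitive_shattering X \<S> 1 (d - 1) C" and sub: "\<S> \<subseteq> Pow X" and t: "1 \<le> t"
      and deg: "\<And>x. x \<in> X \<Longrightarrow> card {S \<in> \<S>. x \<in> S} \<le> t" and Y: "Y \<subseteq> X" "4 \<le> card Y"
    define e where "e = c * real t powr (1 - 1 / d)"
    have "1 \<le> real t powr (1 - 1 / d)" using t d by (intro ge_one_powr_ge_zero) auto
    then have e1: "1 \<le> e" using c1 mult_mono[of 1 c 1 "real t powr (1 - 1 / d)"] by (simp add: e_def)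
    have finY: "finite Y" "finite \<S>" using fin Y sub by (auto intro: finite_subset)
    show "\<exists>N. N \<subseteq> Pow Y \<and> 4 * card N \<le> card Y \<and>
        (\<forall>S\<in>\<S>. \<exists>P\<in>N. card (sym_diff (S \<inter> Y) P) \<le> c * real t powr (1 - 1 / d))"
    proof (cases "card Y \<le> e")
      case True
      have "card (sym_diff (S \<inter> Y) {}) \<le> e" if "S \<in> \<S>" for S
        using card_mono[of Y "S \<inter> Y"] finY True by auto
      then show ?thesis using Y by (intro exI[of _ "{{}}"]) (auto simp: e_def)
    next
      case False
      define F where "F = {T \<in> restrict_sys \<S> Y. card T \<le> 8 * t}"
      define G where "G = (\<lambda>S. S \<inter> Y) ` {S \<in> \<S>. 8 * t < card (S \<inter> Y)}"
      \<comment> \<open>The least integer above \<open>e\<close>: distances below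
        \<open>\<delta>\<close> are at most \<open>e\<close>, and \<open>\<delta>\<close> itself
        meets the separation that \<open>small_net\<close> asks for.\<close>
      define \<delta> where "\<delta> = Suc (nat \<lfloor>e\<rfloor>)"
      have finF: "finite F" using finY by (simp add: F_def restrict_sys_def)
      obtain P where P: "P \<subseteq> F" "\<And>S S'. S \<in> P \<Longrightarrow> S' \<in> P \<Longrightarrow> S \<noteq> S' \<Longrightarrow> \<delta> \<le> card (sym_diff S S')"
        "\<And>S. S \<in> F \<Longrightarrow> \<exists>S'\<in>P. S = S' \<or> card (sym_diff S S') < \<delta>"
        using separated_net[OF finF, of \<delta>] by blast
      have "8 * card P \<le> card Y"
      proof (rule small_net[OF d _ v(1) t fin Y(1)])
        show "1 \<le> C1" by (simp add: C1_def)
        show "P \<subseteq> restrict_sys \<S> Y" using P(1) by (auto simp: F_def)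
        show "size_sensitive_shattering X \<S> 1 (d - 1) C1"
          unfolding size_sensitive_shattering_def
        proof (intro allI impI ballI)
          fix Z k assume "Z \<subseteq> X" "k \<in> {1..card Z}"
          then have "real (card {R \<in> restrict_sys \<S> Z. card R \<le> k}) \<le> C * real (card Z) powr 1 * real k powr (d - 1)"
            using sss unfolding size_sensitive_shattering_def by blast
          also have "\<dots> \<le> C1 * real (card Z) powr 1 * real k powr (d - 1)"
            by (intro mult_right_mono) (auto simp: C1_def)
          finally show "real (card {R \<in> restrict_sys \<S> Z. card R \<le> k}) \<le> C1 * real (card Z) powr 1 * real k powr (d - 1)" .
        qed
        show "card U \<le> v" if "U \<subseteq> X" "shatters \<S> U" for U
          using v(2)[OF fin dim] that by blast
        show "c = 512 * C1 * v * 2 powr d" by (rule c_def)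
        show "c * t powr (1 - 1 / d) \<le> \<delta>" using e1 unfolding e_def[symmetric] \<delta>_def by linarith
        show "c * t powr (1 - 1 / d) \<le> card Y" using False by (simp add: e_def)
      qed (use P F_def Y in auto)
      moreover have "8 * card G \<le> card Y"
      proof -
        have "card G \<le> card {S \<in> \<S>. 8 * t < card (S \<inter> Y)}"
          unfolding G_def using finY by (intro card_image_le) auto
        then have "t * (8 * card G) \<le> 8 * t * card {S \<in> \<S>. 8 * t < card (S \<inter> Y)}" by simp
        also have "\<dots> \<le> card Y * t" using deg Y finY by (intro card_large_sets) auto
        finally show ?thesis using t by (simp add: mult.commute[of _ t])
      qed
      moreover have "card (P \<union> G) \<le> card P + card G" by (rule card_Un_le)
      ultimately have "4 * card (P \<union> G) \<le> card Y" by linarith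
      moreover have "P \<union> G \<subseteq> Pow Y" using P(1) by (auto simp: F_def G_def restrict_sys_def)
      moreover have "\<exists>T\<in>P \<union> G. card (sym_diff (S \<inter> Y) T) \<le> e" if S: "S \<in> \<S>" for S
      proof (cases "8 * t < card (S \<inter> Y)")
        case True
        then have "S \<inter> Y \<in> G" using S by (auto simp: G_def)
        then show ?thesis using e1 by (intro bexI[of _ "S \<inter> Y"]) auto
      next
        case False
        then have "S \<inter> Y \<in> F" using S by (auto simp: F_def restrict_sys_def)
        from P(3)[OF this] obtain T where T: "T \<in> P" "S \<inter> Y = T \<or> card (sym_diff (S \<inter> Y) T) < \<delta>" by blast
        from T(2) have "card (sym_diff (S \<inter> Y) T) \<le> e"
        proof
          assume "S \<inter> Y = T"
          then show ?thesis using e1 by simp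
        next
          assume "card (sym_diff (S \<inter> Y) T) < \<delta>"
          then have "card (sym_diff (S \<inter> Y) T) \<le> nat \<lfloor>e\<rfloor>" by (simp only: \<delta>_def less_Suc_eq_le)
          then show ?thesis using e1 by linarith
        qed
        then show ?thesis using T(1) by (intro bexI[of _ T]) auto
      qed
      ultimately show ?thesis unfolding e_def by blast
    qed
  qed
qed

section \<open>Directions of low energy\<close>

definition dot :: "'i set \<Rightarrow> ('i \<Rightarrow> real) \<Rightarrow> ('i \<Rightarrow> real) \<Rightarrow> real" where
  "dot I u v = (\<Sum>i\<in>I. u i * v i)"

lemma dot_commute: "dot I u v = dot I v u"
  by (simp add: dot_def mult.commute)

lemma dot_self_nonneg [simp]: "0 \<le> dot I u u"
  by (simp add: dot_def sum_nonneg)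

lemma dot_self_eq_0: "finite I \<Longrightarrow> dot I u u = 0 \<longleftrightarrow> (\<forall>i\<in>I. u i = 0)"
  by (simp add: dot_def sum_nonneg_eq_0_iff)

lemma dot_Cauchy_Schwarz: "(dot I u v)\<^sup>2 \<le> dot I u u * dot I v v"
  using Cauchy_Schwarz_ineq_sum[of u v I] by (simp add: dot_def power2_eq_square)

lemma dot_sum_left: "dot I (\<lambda>i. \<Sum>x\<in>J. f x i) v = (\<Sum>x\<in>J. dot I (f x) v)"
  unfolding dot_def sum_distrib_right by (rule sum.swap)

lemma dot_scale: "dot I (\<lambda>i. c * u i) v = c * dot I u v" "dot I u (\<lambda>i. c * v i) = c * dot I u v"
  by (simp_all add: dot_def sum_distrib_left mult_ac)

lemma dot_diff: "dot I (\<lambda>i. u i - v i) w = dot I u w - dot I v w"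
  "dot I w (\<lambda>i. u i - v i) = dot I w u - dot I w v"
  by (simp_all add: dot_def sum_subtractf algebra_simps)

lemma dot_cong: "(\<And>i. i \<in> I \<Longrightarrow> u i = u' i) \<Longrightarrow> (\<And>i. i \<in> I \<Longrightarrow> v i = v' i) \<Longrightarrow> dot I u v = dot I u' v'"
  by (simp add: dot_def)

definition mat_vec :: "'i set \<Rightarrow> ('i \<Rightarrow> 'i \<Rightarrow> real) \<Rightarrow> ('i \<Rightarrow> real) \<Rightarrow> 'i \<Rightarrow> real" where
  "mat_vec I G v i = dot I (G i) v"

lemma mat_vec_cong: "(\<And>i. i \<in> I \<Longrightarrow> u i = u' i) \<Longrightarrow> mat_vec I G u = mat_vec I G u'"
  by (simp add: mat_vec_def dot_def fun_eq_iff)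

lemma mat_vec_self_adjoint:
  assumes "\<And>i j. G i j = G j i"
  shows "dot I (mat_vec I G u) v = dot I u (mat_vec I G v)"
proof -
  have "dot I (mat_vec I G u) v = (\<Sum>i\<in>I. \<Sum>j\<in>I. G i j * u j * v i)"
    by (simp add: dot_def mat_vec_def sum_distrib_right)
  also have "\<dots> = (\<Sum>j\<in>I. \<Sum>i\<in>I. G i j * u j * v i)" by (rule sum.swap)
  also have "\<dots> = dot I u (mat_vec I G v)"
    unfolding dot_def mat_vec_def sum_distrib_left
    by (intro sum.cong refl) (metis assms mult.assoc mult.commute)
  finally show ?thesis .
qed

text \<open>Gram-Schmidt on the level of projections, starting from the identity. A vector
  \<open>c\<close> with nonzero residue e = p c removes the rank-one projection onto e; the new
  matrix annihilates \<open>c\<close> along with all earlier vectors, and its trace drops by exactly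
  one.\<close>

lemma projection_exists:
  assumes "finite I"
  obtains p :: "'i \<Rightarrow> 'i \<Rightarrow> real" where "\<And>i j. p i j = p j i"
    "\<And>v i. i \<in> I \<Longrightarrow> mat_vec I p (mat_vec I p v) i = mat_vec I p v i"
    "\<And>c i. c \<in> set cs \<Longrightarrow> i \<in> I \<Longrightarrow> mat_vec I p c i = 0"
    "real (card I) - real (length cs) \<le> (\<Sum>i\<in>I. p i i)"
proof -
  have "\<exists>p :: 'i \<Rightarrow> 'i \<Rightarrow> real. (\<forall>i j. p i j = p j i) \<and>
    (\<forall>v. \<forall>i\<in>I. mat_vec I p (mat_vec I p v) i = mat_vec I p v i) \<and>
    (\<forall>c\<in>set cs. \<forall>i\<in>I. mat_vec I p c i = 0) \<and>
    real (card I) - real (length cs) \<le> (\<Sum>i\<in>I. p i i)"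
  proof (induction cs)
    case Nil
    have "mat_vec I (\<lambda>i j. of_bool (i = j)) v i = v i" if "i \<in> I" for v i
      using assms that by (simp add: mat_vec_def dot_def of_bool_def if_distrib if_distribR cong: if_cong)
    then show ?case by (intro exI[of _ "\<lambda>i j. of_bool (i = j)"]) auto
  next
    case (Cons c cs)
    then obtain p :: "'i \<Rightarrow> 'i \<Rightarrow> real" where p: "\<And>i j. p i j = p j i"
      "\<And>v i. i \<in> I \<Longrightarrow> mat_vec I p (mat_vec I p v) i = mat_vec I p v i"
      "\<And>c i. c \<in> set cs \<Longrightarrow> i \<in> I \<Longrightarrow> mat_vec I p c i = 0"
      "real (card I) - real (length cs) \<le> (\<Sum>i\<in>I. p i i)" by blast
    note sa = mat_vec_self_adjoint[of p, OF p(1)]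
    define e where "e = mat_vec I p c"
    show ?case
    proof (cases "dot I e e = 0")
      case True
      then have "\<forall>i\<in>I. e i = 0" using assms by (simp add: dot_self_eq_0)
      with p show ?thesis by (intro exI[of _ p]) (auto simp: e_def)
    next
      case False
      define E where "E = dot I e e"
      define q where "q i j = p i j - e i * e j / E" for i j
      have q: "mat_vec I q v = (\<lambda>i. mat_vec I p v i - dot I e v / E * e i)" for v
        unfolding mat_vec_def q_def dot_def
        by (simp add: fun_eq_iff sum_subtractf sum_distrib_left sum_distrib_right algebra_simps sum_divide_distrib)
      have pe: "mat_vec I p e i = e i" if "i \<in> I" for i unfolding e_def using p(2) that .
      have ep: "dot I e (mat_vec I p v) = dot I e v" for v
        unfolding sa[symmetric] by (rule dot_cong) (simp_all add: pe)
      have ec: "dot I e c = E"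
        using ep[of c] by (simp add: e_def E_def)
      have eo: "dot I e c' = 0" if "c' \<in> set cs" for c'
        unfolding e_def sa using p(3)[OF that] by (simp add: dot_def)
      have E0: "E \<noteq> 0" using False by (simp add: E_def)
      have "mat_vec I q (mat_vec I q v) i = mat_vec I q v i" if "i \<in> I" for v i
      proof -
        have "mat_vec I p (mat_vec I q v) i = mat_vec I p (mat_vec I p v) i - dot I e v / E * mat_vec I p e i"
          unfolding q mat_vec_def[of I p "\<lambda>i. mat_vec I p v i - dot I e v / E * e i"] dot_diff dot_scale
          by (simp add: mat_vec_def[abs_def])
        also have "\<dots> = mat_vec I q v i" using p(2) pe that by (simp add: q)
        finally have *: "mat_vec I p (mat_vec I q v) i = mat_vec I q v i" .
        have "dot I e (mat_vec I q v) = dot I e (mat_vec I p v) - dot I e v / E * dot I e e"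
          unfolding q dot_diff dot_scale ..
        also have "\<dots> = 0" using E0 ep by (simp add: E_def)
        finally have "dot I e (mat_vec I q v) = 0" .
        with * show ?thesis by (subst q) simp
      qed
      moreover have "\<forall>c'\<in>set (c # cs). \<forall>i\<in>I. mat_vec I q c' i = 0"
        using p(3) eo ec E0 by (auto simp: q e_def[symmetric])
      moreover have "(\<Sum>i\<in>I. q i i) = (\<Sum>i\<in>I. p i i) - 1"
        using False by (simp add: q_def E_def sum_subtractf sum_divide_distrib[symmetric] dot_def)
      moreover have "q i j = q j i" for i j using p(1) by (simp add: q_def mult.commute)
      ultimately show ?thesis using p(4) by (intro exI[of _ q]) auto
    qed
  qed
  then show thesis using that by blast
qed

text \<open>Averaging over the columns \<open>p x\<close> of the projection orthogonal to
  \<open>cs\<close>. Their squared lengths add up to the trace, at least half of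
  \<open>card I\<close>, whereas the squared products with a fixed \<open>a j\<close> add up to |p
  (a j)|^2 = |p (a j - c)|^2 \<le> \<delta>. If every nonzero column violated the claim, the
  weighted totals would contradict each other.\<close>

lemma low_energy_direction:
  fixes w :: "'j \<Rightarrow> real" and a :: "'j \<Rightarrow> 'i \<Rightarrow> real"
  assumes I: "finite I" "I \<noteq> {}" and w: "\<And>j. j \<in> J \<Longrightarrow> 0 \<le> w j"
    and len: "2 * length cs \<le> card I"
    and near: "\<And>j. j \<in> J \<Longrightarrow> \<exists>c\<in>set cs. dot I (\<lambda>i. a j i - c i) (\<lambda>i. a j i - c i) \<le> \<delta>"
  obtains u where "0 < dot I u u" "\<And>c. c \<in> set cs \<Longrightarrow> dot I c u = 0"
    "(\<Sum>j\<in>J. w j * (dot I (a j) u)\<^sup>2) \<le> 2 * \<delta> / card I * (\<Sum>j\<in>J. w j) * dot I u u"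
proof (rule ccontr)
  note thesisI = that
  assume contra: "\<not> thesis"
  obtain p :: "'i \<Rightarrow> 'i \<Rightarrow> real" where p: "\<And>i j. p i j = p j i"
    "\<And>v i. i \<in> I \<Longrightarrow> mat_vec I p (mat_vec I p v) i = mat_vec I p v i"
    "\<And>c i. c \<in> set cs \<Longrightarrow> i \<in> I \<Longrightarrow> mat_vec I p c i = 0"
    "real (card I) - real (length cs) \<le> (\<Sum>i\<in>I. p i i)"
    using projection_exists[OF I(1), of cs] by blast
  note sa = mat_vec_self_adjoint[of p, OF p(1)]
  let ?m = "real (card I)" and ?W = "\<Sum>j\<in>J. w j"
  have m: "0 < ?m" using I by (simp add: card_gt_0_iff)
  have pp: "dot I (p x) (p x) = p x x" if "x \<in> I" for x
  proof -
    have eq: "mat_vec I p (\<lambda>i. of_bool (i = x)) i = p x i" for i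
      using I that p(1)[of i x]
      by (simp add: mat_vec_def dot_def of_bool_def if_distrib cong: if_cong)
    have "dot I (p x) (p x) = mat_vec I p (mat_vec I p (\<lambda>i. of_bool (i = x))) x"
      by (simp add: eq[abs_def] mat_vec_def)
    also have "\<dots> = p x x" using p(2)[OF that] eq by simp
    finally show ?thesis .
  qed
  have contract: "(\<Sum>x\<in>I. (dot I (a j) (p x))\<^sup>2) \<le> \<delta>" if "j \<in> J" for j
  proof -
    obtain c where c: "c \<in> set cs" "dot I (\<lambda>i. a j i - c i) (\<lambda>i. a j i - c i) \<le> \<delta>"
      using near[OF \<open>j \<in> J\<close>] by blast
    define b where "b i = a j i - c i" for i
    have "dot I (a j) (p x) = mat_vec I p b x" if "x \<in> I" for x
      using p(3)[OF c(1) that] by (simp add: b_def[abs_def] mat_vec_def dot_diff dot_commute[of I "p x"])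
    then have n1: "(\<Sum>x\<in>I. (dot I (a j) (p x))\<^sup>2) = dot I (mat_vec I p b) (mat_vec I p b)"
      by (simp add: dot_def power2_eq_square)
    have "dot I (mat_vec I p b) (mat_vec I p b) = dot I b (mat_vec I p (mat_vec I p b))" by (rule sa)
    also have "\<dots> = dot I b (mat_vec I p b)" by (rule dot_cong) (simp_all add: p(2))
    finally have n2: "dot I (mat_vec I p b) (mat_vec I p b) = dot I b (mat_vec I p b)" .
    have "0 \<le> dot I (\<lambda>i. b i - mat_vec I p b i) (\<lambda>i. b i - mat_vec I p b i)" by simp
    also have "\<dots> = dot I b b - dot I b (mat_vec I p b)"
      using n2 by (simp add: dot_diff dot_commute[of I "mat_vec I p b" b])
    finally show ?thesis using n1 n2 c(2) by (simp add: b_def[abs_def])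
  qed
  \<comment> \<open>A column of \<open>p\<close> is orthogonal to all of \<open>cs\<close>, so each
    nonzero column would be a legitimate choice of \<open>u\<close>.\<close>
  have bad: "2 * \<delta> / ?m * ?W * dot I (p x) (p x) < (\<Sum>j\<in>J. w j * (dot I (a j) (p x))\<^sup>2)"
    if "x \<in> I" "0 < dot I (p x) (p x)" for x
  proof (rule ccontr)
    assume "\<not> ?thesis"
    moreover have "dot I c (p x) = 0" if "c \<in> set cs" for c
      using p(3)[OF that \<open>x \<in> I\<close>] by (simp add: mat_vec_def dot_commute)
    ultimately show False using contra thesisI[of "p x"] \<open>0 < dot I (p x) (p x)\<close> by (auto simp: not_less)
  qed
  have bad': "2 * \<delta> / ?m * ?W * dot I (p x) (p x) \<le> (\<Sum>j\<in>J. w j * (dot I (a j) (p x))\<^sup>2)"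
    if "x \<in> I" for x
  proof (cases "0 < dot I (p x) (p x)")
    case False
    then have "dot I (p x) (p x) = 0" using dot_self_nonneg[of I "p x"] by linarith
    then show ?thesis using w by (simp add: sum_nonneg)
  qed (use bad that less_imp_le in blast)
  have tr: "?m / 2 \<le> (\<Sum>x\<in>I. dot I (p x) (p x))" using p(4) len pp by simp
  \<comment> \<open>At least one column is nonzero; it makes the summed inequality below
    strict.\<close>
  then obtain x0 where x0: "x0 \<in> I" "0 < dot I (p x0) (p x0)"
    using m sum_nonpos[of I "\<lambda>x. dot I (p x) (p x)"] by (meson half_gt_zero less_le_trans not_le)
  have W: "0 \<le> ?W" using w by (rule sum_nonneg)
  have \<delta>: "0 \<le> \<delta>" if "j \<in> J" for j using near[OF that] dot_self_nonneg order_trans by blast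
  have \<delta>W: "0 \<le> \<delta> * ?W" using \<delta> W by (cases "J = {}") auto
  define G where "G = 2 * \<delta> / ?m * ?W"
  have "\<delta> * ?W = G * (?m / 2)" using m by (simp add: G_def)
  also have "\<dots> \<le> G * (\<Sum>x\<in>I. dot I (p x) (p x))"
    using tr \<delta>W m by (intro mult_left_mono) (auto simp: G_def)
  also have "\<dots> = (\<Sum>x\<in>I. G * dot I (p x) (p x))" by (rule sum_distrib_left)
  also have "\<dots> < (\<Sum>x\<in>I. \<Sum>j\<in>J. w j * (dot I (a j) (p x))\<^sup>2)"
    using bad bad' x0 I(1) unfolding G_def[symmetric] by (intro sum_strict_mono_ex1) auto
  also have "\<dots> = (\<Sum>j\<in>J. w j * (\<Sum>x\<in>I. (dot I (a j) (p x))\<^sup>2))"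
    by (subst sum.swap) (simp add: sum_distrib_left)
  also have "\<dots> \<le> (\<Sum>j\<in>J. w j * \<delta>)"
    using contract w by (intro sum_mono mult_left_mono) auto
  also have "\<dots> = \<delta> * ?W" by (simp add: sum_distrib_left mult.commute)
  finally show False by simp
qed

text \<open>The quotients of successive terms of a log-convex sequence do not decrease, so a lower
  bound on one of them persists.\<close>

lemma log_convex_ratio:
  fixes a :: "nat \<Rightarrow> real"
  assumes lc: "\<And>j. (a (Suc j))\<^sup>2 \<le> a j * a (Suc (Suc j))"
    and "0 < a i" "0 < \<gamma>" "\<gamma> * a i \<le> a (Suc i)" "i \<le> j"
  shows "0 < a j \<and> \<gamma> * a j \<le> a (Suc j)"
  using \<open>i \<le> j\<close>
proof (induction j rule: dec_induct)
  case base
  then show ?case using assms by simp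
next
  case (step j)
  then have pos: "0 < a (Suc j)" using \<open>0 < \<gamma>\<close> by (meson less_le_trans mult_pos_pos)
  have "a j * (\<gamma> * a (Suc j)) \<le> a (Suc j) * a (Suc j)"
    using mult_right_mono[of "\<gamma> * a j" "a (Suc j)" "a (Suc j)"] step.IH pos
    by (simp only: mult_ac less_imp_le simp_thms)
  also have "\<dots> \<le> a j * a (Suc (Suc j))" using lc[of j] by (simp add: power2_eq_square)
  finally show ?case using pos step by simp
qed

lemma log_convex_lower:
  fixes a :: "nat \<Rightarrow> real"
  assumes lc: "\<And>j. (a (Suc j))\<^sup>2 \<le> a j * a (Suc (Suc j))"
    and "0 < a 0" "0 < \<gamma>" "\<gamma> * a 0 \<le> a 1"
  shows "\<gamma> ^ j * a 0 \<le> a j"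
proof (induction j)
  case (Suc j)
  have "\<gamma> * a j \<le> a (Suc j)" using log_convex_ratio[of a 0 \<gamma> j] assms by simp
  moreover have "\<gamma> * (\<gamma> ^ j * a 0) \<le> \<gamma> * a j" using Suc assms by simp
  ultimately show ?case by (simp add: mult_ac)
qed simp

text \<open>By the same monotonicity an upper bound on the last quotient holds for all earlier ones.
  Positivity travels backwards, because log-convexity makes the neighbours of a positive term
  positive.\<close>

lemma log_convex_upper:
  fixes a :: "nat \<Rightarrow> real"
  assumes lc: "\<And>j. (a (Suc j))\<^sup>2 \<le> a j * a (Suc (Suc j))" and nn: "\<And>j. 0 \<le> a j"
    and "0 < a N" "0 < \<gamma>" "a (Suc N) < \<gamma> * a N" "0 < N"
  shows "a N < \<gamma> ^ N * a 0"
proof -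
  have pos: "0 < a j" if "j \<le> N" for j
    using that
  proof (induction j rule: inc_induct)
    case (step j)
    then have "0 < a j * a (Suc (Suc j))" using lc[of j] by (meson less_le_trans zero_less_power)
    then show ?case using nn[of j] by (auto simp: zero_less_mult_iff)
  qed (rule \<open>0 < a N\<close>)
  have r: "a (Suc j) < \<gamma> * a j" if "j \<le> N" for j
    using log_convex_ratio[of a j \<gamma> N, OF lc pos[OF that] \<open>0 < \<gamma>\<close> _ that] assms(5) by linarith
  have "a j \<le> \<gamma> ^ j * a 0 \<and> (0 < j \<longrightarrow> a j < \<gamma> ^ j * a 0)" if "j \<le> N" for j
    using that
  proof (induction j)
    case (Suc j)
    then have "a j \<le> \<gamma> ^ j * a 0" by simp
    then have "\<gamma> * a j \<le> \<gamma> * (\<gamma> ^ j * a 0)" using \<open>0 < \<gamma>\<close> by simp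
    with r[of j] Suc.prems show ?case by (simp add: mult_ac)
  qed simp
  then show ?thesis using \<open>0 < N\<close> by blast
qed

text \<open>Moving one factor \<open>B\<close> across the product turns the middle term into a
  product of the iterates \<open>j\<close> and \<open>j + 2\<close>; Cauchy-Schwarz is then applied
  over \<open>J\<close> and \<open>I\<close> jointly.\<close>

lemma iterate_log_convex:
  assumes sa: "\<And>u v. dot I (B u) v = dot I u (B v)"
  shows "(\<Sum>x\<in>J. dot I ((B ^^ Suc j) (f x)) ((B ^^ Suc j) (f x)))\<^sup>2
    \<le> (\<Sum>x\<in>J. dot I ((B ^^ j) (f x)) ((B ^^ j) (f x)))
      * (\<Sum>x\<in>J. dot I ((B ^^ Suc (Suc j)) (f x)) ((B ^^ Suc (Suc j)) (f x)))"
proof -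
  have "dot I ((B ^^ Suc j) (f x)) ((B ^^ Suc j) (f x)) = dot I ((B ^^ j) (f x)) ((B ^^ Suc (Suc j)) (f x))" for x
    by (simp add: sa)
  then have "(\<Sum>x\<in>J. dot I ((B ^^ Suc j) (f x)) ((B ^^ Suc j) (f x)))
      = (\<Sum>(x, i)\<in>J \<times> I. (B ^^ j) (f x) i * (B ^^ Suc (Suc j)) (f x) i)"
    by (simp add: dot_def sum.cartesian_product)
  then show ?thesis
    using Cauchy_Schwarz_ineq_sum[of "\<lambda>(x, i). (B ^^ j) (f x) i" "\<lambda>(x, i). (B ^^ Suc (Suc j)) (f x) i" "J \<times> I"]
    by (simp add: dot_def sum.cartesian_product power2_eq_square case_prod_unfold)
qed

section \<open>Power iteration for a shifted quadratic form\<close>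

definition unit_vec :: "'i \<Rightarrow> 'i \<Rightarrow> real" where
  "unit_vec x i = of_bool (i = x)"

text \<open>The matrix M with entries \<open>\<Sum>c\<in>K. \<omega> c * (a c i * a c l)\<close> is
  positive semidefinite with trace at most \<open>\<tau>\<close>. Hence \<tau> - M is positive
  semidefinite as well, and it stretches most the directions in which M has least energy.
  Eigenvectors are avoided; inequalities between norms and the form suffice.\<close>

locale shifted_form =
  fixes I :: "'i set" and K :: "'k set" and \<omega> :: "'k \<Rightarrow> real" and a :: "'k \<Rightarrow> 'i \<Rightarrow> real" and \<tau> :: real
  assumes finI: "finite I" and \<omega>_nonneg: "\<And>c. c \<in> K \<Longrightarrow> 0 \<le> \<omega> c" and \<tau>_pos: "0 < \<tau>"
    and \<tau>_bound: "(\<Sum>c\<in>K. \<omega> c * dot I (a c) (a c)) \<le> \<tau>"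
begin

definition form :: "('i \<Rightarrow> real) \<Rightarrow> real" where
  "form v = (\<Sum>c\<in>K. \<omega> c * (dot I (a c) v)\<^sup>2)"

definition mat :: "'i \<Rightarrow> 'i \<Rightarrow> real" where
  "mat i l = (\<Sum>c\<in>K. \<omega> c * (a c i * a c l))"

definition shift :: "('i \<Rightarrow> real) \<Rightarrow> 'i \<Rightarrow> real" where
  "shift v i = \<tau> * v i - mat_vec I mat v i"

lemma form_nonneg: "0 \<le> form v"
  unfolding form_def using \<omega>_nonneg by (intro sum_nonneg) simp

lemma mat_vec_mat: "mat_vec I mat v i = (\<Sum>c\<in>K. \<omega> c * dot I (a c) v * a c i)"
  unfolding mat_vec_def mat_def dot_sum_left
  by (intro sum.cong refl) (simp add: dot_def sum_distrib_left sum_distrib_right mult_ac)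

lemma dot_mat_vec: "dot I v (mat_vec I mat v) = form v"
proof -
  have "dot I v (mat_vec I mat v) = dot I (\<lambda>i. \<Sum>c\<in>K. \<omega> c * dot I (a c) v * a c i) v"
    by (simp add: mat_vec_mat[abs_def] dot_commute)
  also have "\<dots> = form v"
    unfolding dot_sum_left form_def dot_scale(1) by (simp add: power2_eq_square mult_ac)
  finally show ?thesis .
qed

lemma form_le: "form v \<le> \<tau> * dot I v v"
proof -
  have "form v \<le> (\<Sum>c\<in>K. \<omega> c * (dot I (a c) (a c) * dot I v v))"
    unfolding form_def using \<omega>_nonneg dot_Cauchy_Schwarz by (intro sum_mono mult_left_mono) auto
  also have "\<dots> = (\<Sum>c\<in>K. \<omega> c * dot I (a c) (a c)) * dot I v v"
    by (simp only: sum_distrib_right mult.assoc)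
  also have "\<dots> \<le> \<tau> * dot I v v" by (intro mult_right_mono \<tau>_bound dot_self_nonneg)
  finally show ?thesis .
qed

text \<open>This says M^2 \<le> \<tau> M. Cauchy-Schwarz for the semi-inner product of the form
  gives |M v|^4 \<le> form(v) form(M v), and form(M v) \<le> \<tau> |M v|^2.\<close>

lemma mat_vec_norm_le: "dot I (mat_vec I mat v) (mat_vec I mat v) \<le> \<tau> * form v"
proof -
  let ?M = "mat_vec I mat v"
  have eq: "dot I ?M ?M = (\<Sum>c\<in>K. (sqrt (\<omega> c) * dot I (a c) v) * (sqrt (\<omega> c) * dot I (a c) ?M))"
  proof -
    have "dot I ?M ?M = dot I (\<lambda>i. \<Sum>c\<in>K. \<omega> c * dot I (a c) v * a c i) ?M"
      by (simp add: mat_vec_mat[abs_def])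
    also have "\<dots> = (\<Sum>c\<in>K. \<omega> c * dot I (a c) v * dot I (a c) ?M)"
      unfolding dot_sum_left dot_scale(1) ..
    also have "\<dots> = (\<Sum>c\<in>K. (sqrt (\<omega> c) * sqrt (\<omega> c)) * dot I (a c) v * dot I (a c) ?M)"
      using \<omega>_nonneg by (intro sum.cong refl) simp
    finally show ?thesis by (simp only: mult_ac)
  qed
  have sq: "(\<Sum>c\<in>K. (sqrt (\<omega> c) * f c)\<^sup>2) = (\<Sum>c\<in>K. \<omega> c * (f c)\<^sup>2)" for f
    using \<omega>_nonneg by (intro sum.cong refl) (simp add: power_mult_distrib)
  have "(dot I ?M ?M)\<^sup>2 \<le> form v * form ?M"
    unfolding eq form_def using Cauchy_Schwarz_ineq_sum[of "\<lambda>c. sqrt (\<omega> c) * dot I (a c) v" "\<lambda>c. sqrt (\<omega> c) * dot I (a c) ?M" K]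
    by (simp only: sq)
  also have "\<dots> \<le> form v * (\<tau> * dot I ?M ?M)"
    by (intro mult_left_mono form_le form_nonneg)
  finally have "(dot I ?M ?M)\<^sup>2 \<le> (\<tau> * form v) * dot I ?M ?M" by (simp only: mult_ac)
  then show ?thesis
    using dot_self_nonneg[of I ?M] form_nonneg[of v] \<tau>_pos
    by (cases "dot I ?M ?M = 0") (auto simp: power2_eq_square)
qed

lemma shift_self_adjoint: "dot I (shift u) v = dot I u (shift v)"
proof -
  have "mat i j = mat j i" for i j by (simp add: mat_def mult.commute)
  from mat_vec_self_adjoint[of mat, OF this]
  show ?thesis unfolding shift_def[abs_def] dot_diff dot_scale by simp
qed

lemma shift_expand:
  assumes "i \<in> I"
  shows "(shift ^^ N) u i = (\<Sum>x\<in>I. u x * (shift ^^ N) (unit_vec x) i)"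
  using assms
proof (induction N arbitrary: i)
  case 0
  then show ?case using finI by (simp add: unit_vec_def of_bool_def if_distrib cong: if_cong)
next
  case (Suc N)
  have s: "(shift ^^ Suc N) w i = \<tau> * (shift ^^ N) w i - mat_vec I mat ((shift ^^ N) w) i" for w
    unfolding funpow.simps o_apply by (rule shift_def)
  have "mat_vec I mat ((shift ^^ N) u) i = mat_vec I mat (\<lambda>i. \<Sum>x\<in>I. u x * (shift ^^ N) (unit_vec x) i) i"
    by (rule fun_cong[OF mat_vec_cong]) (rule Suc.IH)
  also have "\<dots> = (\<Sum>x\<in>I. u x * mat_vec I mat ((shift ^^ N) (unit_vec x)) i)"
    unfolding mat_vec_def dot_commute[of I "mat i"] dot_sum_left dot_scale(1) ..
  finally show ?case
    unfolding s Suc.IH[OF Suc.prems]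
    by (simp add: sum_distrib_left sum_subtractf right_diff_distrib mult_ac)
qed

text \<open>Power iteration: if some direction is almost annihilated by the form, then so is some column of
  a high power of the shifted matrix. The squared norms of iterates are log-convex.\<close>

lemma power_iteration:
  assumes u: "0 < dot I u u" "form u \<le> \<epsilon> * dot I u u" and "0 \<le> \<epsilon>" and N: "0 < N"
    and \<kappa>: "\<kappa> = 2 * \<epsilon> / \<tau> + ln (card I) / N" "\<kappa> < 1"
  obtains x where "x \<in> I" "0 < dot I ((shift ^^ N) (unit_vec x)) ((shift ^^ N) (unit_vec x))"
    "form ((shift ^^ N) (unit_vec x))
      \<le> \<tau> * \<kappa> * dot I ((shift ^^ N) (unit_vec x)) ((shift ^^ N) (unit_vec x))"
proof -
  have Ine: "I \<noteq> {}" using u(1) by (auto simp: dot_def)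
  then have m1: "1 \<le> card I" using finI by (simp add: Suc_leI card_gt_0_iff)
  define L where "L = ln (real (card I)) / N"
  have L0: "0 \<le> L" using m1 by (simp add: L_def)
  define \<beta> where "\<beta> = 1 - \<epsilon> / \<tau>"
  have e0: "0 \<le> \<epsilon> / \<tau>" using \<open>0 \<le> \<epsilon>\<close> \<tau>_pos by simp
  have \<kappa>': "\<kappa> = 2 * (\<epsilon> / \<tau>) + L" using \<kappa> by (simp add: L_def)
  have \<beta>0: "0 < \<beta>" using \<kappa>' \<kappa>(2) e0 L0 unfolding \<beta>_def by linarith
  define n where "n j v = dot I ((shift ^^ j) v) ((shift ^^ j) v)" for j v
  \<comment> \<open>The squared Frobenius norm of the \<open>j\<close>-th power of the shift, summed
    by columns: a log-convex sequence that starts at \<open>card I\<close>.\<close>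
  define A where "A j = (\<Sum>x\<in>I. n j (unit_vec x))" for j
  have lcA: "(A (Suc j))\<^sup>2 \<le> A j * A (Suc (Suc j))" for j
    unfolding A_def n_def by (rule iterate_log_convex[OF shift_self_adjoint])
  have lcu: "(n (Suc j) u)\<^sup>2 \<le> n j u * n (Suc (Suc j)) u" for j
    using iterate_log_convex[where J = "{()}" and f = "\<lambda>_. u" and B = shift and I = I and j = j, OF shift_self_adjoint]
    by (simp add: n_def)
  have nn: "0 \<le> n j v" for j v by (simp add: n_def)
  have A0: "A 0 = card I"
  proof -
    have "n 0 (unit_vec x) = 1" if "x \<in> I" for x
      using that finI by (simp add: n_def dot_def unit_vec_def of_bool_def if_distrib cong: if_cong)
    then show ?thesis by (simp add: A_def)
  qed
  \<comment> \<open>The low energy of \<open>u\<close> means that one application of the shift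
    stretches it by at least \<open>\<tau> * \<beta>\<close>; by log-convexity every further
    application does so too.\<close>
  have "(\<tau> * \<beta>)\<^sup>2 * n 0 u \<le> n 1 u"
  proof -
    have "\<tau> * \<beta> * dot I u u \<le> dot I u (shift u)"
      using u(2) \<tau>_pos unfolding shift_def[abs_def] dot_diff dot_scale dot_mat_vec \<beta>_def
      by (simp add: algebra_simps)
    then have "(\<tau> * \<beta> * dot I u u)\<^sup>2 \<le> (dot I u (shift u))\<^sup>2"
      using u \<tau>_pos \<beta>0 by (intro power_mono) auto
    also have "\<dots> \<le> dot I u u * n 1 u" using dot_Cauchy_Schwarz[of I u "shift u"] by (simp add: n_def)
    finally have "dot I u u * ((\<tau> * \<beta>)\<^sup>2 * n 0 u) \<le> dot I u u * n 1 u"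
      by (simp add: n_def power2_eq_square mult_ac)
    then show ?thesis using u(1) by simp
  qed
  then have "((\<tau> * \<beta>)\<^sup>2) ^ N * n 0 u \<le> n N u"
    using u(1) \<tau>_pos \<beta>0 by (intro log_convex_lower lcu) (auto simp: n_def)
  also have "n N u \<le> dot I u u * A N"
  proof -
    have "n N u = (\<Sum>i\<in>I. (\<Sum>x\<in>I. u x * (shift ^^ N) (unit_vec x) i)\<^sup>2)"
      unfolding n_def dot_def by (intro sum.cong refl) (simp add: shift_expand power2_eq_square)
    also have "\<dots> \<le> (\<Sum>i\<in>I. (\<Sum>x\<in>I. (u x)\<^sup>2) * (\<Sum>x\<in>I. ((shift ^^ N) (unit_vec x) i)\<^sup>2))"
      by (intro sum_mono Cauchy_Schwarz_ineq_sum)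
    also have "\<dots> = dot I u u * A N"
      unfolding A_def n_def dot_def sum_distrib_left[symmetric] power2_eq_square
      by (rule arg_cong[where f = "(*) _"], rule sum.swap)
    finally show ?thesis .
  qed
  finally have AN: "((\<tau> * \<beta>)\<^sup>2) ^ N \<le> A N" using u(1) by (simp add: n_def mult.commute)
  have "0 < ((\<tau> * \<beta>)\<^sup>2) ^ N" using \<tau>_pos \<beta>0 by simp
  then have ANpos: "0 < A N" using AN by linarith
  \<comment> \<open>If the quotient at \<open>N\<close> were smaller, so would be all earlier ones,
    and \<open>A N\<close> would fall below (1 - \<kappa>)^N \<tau>^(2N) m. But 1 - \<kappa> \<le>
    \<beta>^2 exp(-L) with exp(-L N) = 1/m, against \<open>AN\<close>. The term ln m / N in
    \<open>\<kappa>\<close> thus pays for the m columns.\<close>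
  have ratio: "(1 - \<kappa>) * \<tau>\<^sup>2 * A N \<le> A (Suc N)"
  proof (rule ccontr)
    assume "\<not> ?thesis"
    then have "A N < ((1 - \<kappa>) * \<tau>\<^sup>2) ^ N * A 0"
      using ANpos \<kappa>(2) \<tau>_pos N by (intro log_convex_upper lcA) (auto simp: A_def intro!: sum_nonneg nn)
    moreover have "(1 - \<kappa>) ^ N * card I \<le> (\<beta>\<^sup>2) ^ N"
    proof -
      have L1: "L < 1" using \<kappa>' \<kappa>(2) e0 by linarith
      have "1 - \<kappa> \<le> (1 - 2 * (\<epsilon> / \<tau>)) * (1 - L)"
      proof -
        have "(1 - 2 * y) * (1 - L) = 1 - 2 * y - L + 2 * (y * L)" for y :: real by (simp add: algebra_simps)
        from this[of "\<epsilon> / \<tau>"] show ?thesis using \<kappa>' mult_nonneg_nonneg[OF e0 L0] by linarith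
      qed
      also have "\<dots> \<le> \<beta>\<^sup>2 * exp (- L)"
      proof (intro mult_mono)
        have "1 - 2 * y \<le> (1 - y)\<^sup>2" for y :: real by (simp add: power2_eq_square algebra_simps)
        then show "1 - 2 * (\<epsilon> / \<tau>) \<le> \<beta>\<^sup>2" unfolding \<beta>_def .
      qed (use L1 exp_ge_add_one_self[of "- L"] in auto)
      finally have "(1 - \<kappa>) ^ N \<le> (\<beta>\<^sup>2 * exp (- L)) ^ N" using \<kappa>(2) by (intro power_mono) auto
      also have "\<dots> = (\<beta>\<^sup>2) ^ N / card I"
      proof -
        have "exp (- L) ^ N = inverse (real (card I))"
        proof -
          have "exp (- L) ^ N = exp (of_nat N * (- L))" by (simp only: exp_of_nat_mult)
          also have "of_nat N * (- L) = - ln (card I)" using N by (simp add: L_def)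
          finally show ?thesis using m1 by (simp add: exp_minus)
        qed
        then show ?thesis by (simp add: power_mult_distrib divide_inverse)
      qed
      finally show ?thesis using m1 by (simp add: field_simps)
    qed
    then have "(\<tau>\<^sup>2) ^ N * ((1 - \<kappa>) ^ N * card I) \<le> (\<tau>\<^sup>2) ^ N * (\<beta>\<^sup>2) ^ N"
      by (intro mult_left_mono) auto
    ultimately show False using AN by (simp add: A0 power_mult_distrib mult_ac)
  qed
  \<comment> \<open>Some nonvanishing column attains the quotient of the sums. Columns that have
    become zero stay zero and contribute to neither side.\<close>
  have "\<exists>x\<in>I. 0 < n N (unit_vec x) \<and> (1 - \<kappa>) * \<tau>\<^sup>2 * n N (unit_vec x) \<le> n (Suc N) (unit_vec x)"
  proof (rule ccontr)
    assume c: "\<not> ?thesis"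
    then have lt: "n (Suc N) (unit_vec x) < (1 - \<kappa>) * \<tau>\<^sup>2 * n N (unit_vec x)"
      if "x \<in> I" "0 < n N (unit_vec x)" for x using that by (meson not_le)
    have z: "n (Suc N) (unit_vec x) = 0" if "n N (unit_vec x) = 0" for x
    proof -
      have "\<forall>i\<in>I. (shift ^^ N) (unit_vec x) i = 0" using that finI by (simp add: n_def dot_self_eq_0)
      then show ?thesis by (simp add: n_def dot_def shift_def mat_vec_def)
    qed
    have le: "n (Suc N) (unit_vec x) \<le> (1 - \<kappa>) * \<tau>\<^sup>2 * n N (unit_vec x)" if "x \<in> I" for x
      using lt[OF that] z[of x] nn[of N "unit_vec x"] by (cases "n N (unit_vec x) = 0") auto
    obtain x0 where "x0 \<in> I" "0 < n N (unit_vec x0)"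
      using ANpos sum_nonpos[of I "\<lambda>x. n N (unit_vec x)"] unfolding A_def by (meson not_le)
    then have "A (Suc N) < (\<Sum>x\<in>I. (1 - \<kappa>) * \<tau>\<^sup>2 * n N (unit_vec x))"
      unfolding A_def using le lt finI by (intro sum_strict_mono_ex1) auto
    with ratio show False by (simp add: A_def sum_distrib_left)
  qed
  then obtain x where x: "x \<in> I" "0 < n N (unit_vec x)"
    "(1 - \<kappa>) * \<tau>\<^sup>2 * n N (unit_vec x) \<le> n (Suc N) (unit_vec x)" by blast
  define v where "v = (shift ^^ N) (unit_vec x)"
  have "n (Suc N) (unit_vec x) = dot I (shift v) (shift v)" by (simp add: n_def v_def)
  \<comment> \<open>The shortfall of |shift v|^2 from \<tau>^2 |v|^2 is 2 \<tau> form(v) - |M v|^2,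
    hence at least \<tau> form(v); a high quotient therefore means a small form.\<close>
  also have "\<dots> = \<tau>\<^sup>2 * dot I v v - 2 * \<tau> * form v + dot I (mat_vec I mat v) (mat_vec I mat v)"
    unfolding shift_def[abs_def] dot_diff dot_scale dot_commute[of I "mat_vec I mat v" v] dot_mat_vec
    by (simp add: power2_eq_square algebra_simps)
  also have "\<dots> \<le> \<tau>\<^sup>2 * dot I v v - \<tau> * form v" using mat_vec_norm_le[of v] by simp
  finally have "(1 - \<kappa>) * \<tau>\<^sup>2 * dot I v v \<le> \<tau>\<^sup>2 * dot I v v - \<tau> * form v"
    using x(3) by (simp add: n_def v_def)
  then have "\<tau> * form v \<le> \<tau> * (\<tau> * \<kappa> * dot I v v)" by (simp add: algebra_simps power2_eq_square)
  then have "form v \<le> \<tau> * \<kappa> * dot I v v" using \<tau>_pos by simp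
  then show thesis using x that[of x] by (simp add: n_def v_def)
qed

end

section \<open>The potential walk\<close>

text \<open>A point \<open>x\<close> of the cube is stored as the vector \<open>Z = x + radius n\<close> of natural numbers. Powers of
  \<open>1 + 1/r\<close> are scaled by a fixed power of \<open>r\<close> and their exponents shifted by \<open>offset n\<close>, so that all
  quantities below are natural numbers and the truncated subtractions are exact on the cube.\<close>

definition move_bound :: "nat \<Rightarrow> nat" where "move_bound n = 2048 * n\<^sup>2"

text \<open>The factor 8192 n over the move length makes a single move change the exponents by less
  than 1. It also makes n deviations of size \<open>move_bound n\<close> amount to at most one
  radius.\<close>

definition radius :: "nat \<Rightarrow> nat" where "radius n = 8192 * n * move_bound n"

definition slope :: "nat \<Rightarrow> nat" where "slope n = radius n * (n + 1)"

text \<open>Bounds the absolute values of the linear term and of the damping term on the cube, the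
  latter for the largest possible damping 4096 n (n + 1). Shifted exponents then lie between 0 and
  \<open>2 * offset n\<close>.\<close>

definition offset :: "nat \<Rightarrow> nat" where
  "offset n = slope n * n * radius n + 4096 * n * (n + 1) * n * (radius n)\<^sup>2"

text \<open>The third power arises because the level of the form exceeds the admissible energy by a
  factor of order n^2 and ln m \<le> n.\<close>

definition power_steps :: "nat \<Rightarrow> nat" where "power_steps n = 8388608 * n ^ 3"

text \<open>The margin on both sides is the length of a move, so that moving a live coordinate never
  leaves the cube.\<close>

definition alive :: "nat \<Rightarrow> nat \<Rightarrow> nat" where
  "alive n z = of_bool (move_bound n < z \<and> z < 2 * radius n - move_bound n)"

definition live :: "nat \<Rightarrow> (nat \<Rightarrow> nat) \<Rightarrow> nat" where
  "live n Z = (\<Sum>i<n. alive n (Z i))"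

definition energy :: "nat \<Rightarrow> (nat \<Rightarrow> nat) \<Rightarrow> nat" where
  "energy n Z = (\<Sum>i<n. (Z i)\<^sup>2 + (radius n)\<^sup>2 - 2 * radius n * Z i)"

text \<open>With this base r and radius D, \<open>slope n\<close> / r is 1/(q D) and
  \<open>damp n q m\<close> / r is about 4096/((m + 1) D^2): signed sums are measured in units of q
  D and the energy in units of D^2. The common factor n + 1 keeps \<open>damp\<close> at least 1
  after its integer division.\<close>

definition res_base :: "nat \<Rightarrow> nat \<Rightarrow> nat" where
  "res_base n q = q * (radius n)\<^sup>2 * (n + 1)"

definition damp :: "nat \<Rightarrow> nat \<Rightarrow> nat \<Rightarrow> nat" where
  "damp n q m = 4096 * q * (n + 1) div (m + 1)"

definition scaled_power :: "nat \<Rightarrow> nat \<Rightarrow> nat \<Rightarrow> nat" where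
  "scaled_power h r u = (r + 1) ^ u * r ^ (2 * h - u)"

definition up_exp :: "nat \<Rightarrow> (nat \<Rightarrow> nat) \<Rightarrow> nat \<Rightarrow> (nat \<Rightarrow> nat) \<Rightarrow> nat" where
  "up_exp n s b Z = offset n + slope n * (\<Sum>i<n. s i * Z i)
     - slope n * radius n * (\<Sum>i<n. s i) - b * energy n Z"

definition down_exp :: "nat \<Rightarrow> (nat \<Rightarrow> nat) \<Rightarrow> nat \<Rightarrow> (nat \<Rightarrow> nat) \<Rightarrow> nat" where
  "down_exp n s b Z = offset n + slope n * radius n * (\<Sum>i<n. s i)
     - slope n * (\<Sum>i<n. s i * Z i) - b * energy n Z"

definition weight :: "nat \<Rightarrow> nat \<Rightarrow> (nat \<Rightarrow> nat) \<Rightarrow> nat \<Rightarrow> (nat \<Rightarrow> nat) \<Rightarrow> nat" where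
  "weight n q s b Z = scaled_power (offset n) (res_base n q) (up_exp n s b Z)
     + scaled_power (offset n) (res_base n q) (down_exp n s b Z)"

lemma exp_add_exp_minus_le:
  fixes y :: real
  assumes "\<bar>y\<bar> \<le> 1"
  shows "exp y + exp (- y) \<le> 2 * (1 + y\<^sup>2)"
proof -
  have *: "exp y + exp (- y) \<le> 2 * (1 + y\<^sup>2)" if y: "0 \<le> y" "y \<le> 1" for y :: real
  proof -
    have 1: "exp y \<le> 1 + y + y\<^sup>2" using exp_bound[OF y] .
    \<comment> \<open>The product is 1 + y^3.\<close>
    have "1 \<le> (1 - y + y\<^sup>2) * (1 + y)"
      using y by (simp add: algebra_simps power2_eq_square)
    also have "\<dots> \<le> (1 - y + y\<^sup>2) * exp y"
      using exp_ge_add_one_self[of y] y by (intro mult_left_mono) auto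
    finally have "1 \<le> (1 - y + y\<^sup>2) * exp y" .
    then have "exp (- y) * 1 \<le> exp (- y) * ((1 - y + y\<^sup>2) * exp y)"
      using y by (intro mult_left_mono) auto
    then have "exp (- y) \<le> 1 - y + y\<^sup>2" by (simp add: exp_minus field_simps)
    with 1 show ?thesis by simp
  qed
  show ?thesis
  proof (cases "0 \<le> y")
    case False
    then show ?thesis using *[of "- y"] assms by simp
  qed (use * assms in auto)
qed

lemma scaled_power_eq:
  assumes "0 < r" "u \<le> 2 * h"
  shows "real (scaled_power h r u) = real r ^ (2 * h) * exp (ln (1 + 1 / r) * u)"
proof -
  have 1: "exp (ln (1 + 1 / r) * u) = (1 + 1 / r) ^ u"
    using assms by (simp add: mult.commute[of _ "real u"] exp_of_nat_mult add_pos_nonneg add.commute)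
  have 2: "real (scaled_power h r u) = (real r + 1) ^ u * real r ^ (2 * h - u)"
    by (simp add: scaled_power_def add.commute)
  have 3: "real r ^ (2 * h) = real r ^ u * real r ^ (2 * h - u)"
    using assms by (simp add: power_add[symmetric])
  have 4: "(1 + 1 / real r) ^ u * real r ^ u = (real r + 1) ^ u"
    using assms by (simp add: power_mult_distrib[symmetric] distrib_right add.commute)
  show ?thesis unfolding 1 2 3 4[symmetric] by (simp only: mult_ac)
qed

section \<open>The potential and its change under two opposite moves\<close>

locale walk =
  fixes n k :: nat and a :: "nat \<Rightarrow> nat \<Rightarrow> nat" and q :: nat
  assumes n_pos: "0 < n" and k_pos: "0 < k" and q_pos: "0 < q" and a_le: "a j i \<le> 1"
begin

abbreviation "P \<equiv> move_bound n"
abbreviation "D \<equiv> radius n"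
abbreviation "A \<equiv> slope n"
abbreviation "r \<equiv> res_base n q"

definition pot :: "nat \<Rightarrow> (nat \<Rightarrow> nat) \<Rightarrow> nat" where
  "pot b Z = (\<Sum>j<k. weight n q (a j) b Z)"

definition dev :: "(nat \<Rightarrow> nat) \<Rightarrow> nat \<Rightarrow> real" where
  "dev Z j = (\<Sum>i<n. a j i * (real (Z i) - D))"

definition en :: "(nat \<Rightarrow> nat) \<Rightarrow> real" where
  "en Z = (\<Sum>i<n. (real (Z i) - D)\<^sup>2)"

definition L :: real where "L = ln (1 + 1 / r)"

definition scale :: real where "scale = real r ^ (2 * offset n) * exp (L * offset n)"

definition inside :: "(nat \<Rightarrow> nat) \<Rightarrow> bool" where
  "inside Z \<longleftrightarrow> (\<forall>i<n. Z i \<le> 2 * D)"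

lemma P_pos: "0 < P" using n_pos by (simp add: move_bound_def)

lemma D_pos: "0 < D" using n_pos P_pos by (simp add: radius_def)

lemma r_pos: "0 < r" using q_pos D_pos by (simp add: res_base_def)

lemma scale_pos: "0 < scale" using r_pos by (simp add: scale_def)

lemma L_pos: "0 < L" using r_pos by (simp add: L_def ln_gt_zero)

lemma L_le: "L \<le> 1 / r" unfolding L_def using r_pos by (intro ln_add_one_self_le_self) auto

text \<open>From ln y \<ge> 1 - 1/y at y = 1 + 1/r. Together with \<open>L_le\<close> it pins
  \<open>L\<close> to 1/r up to a factor of two.\<close>

lemma L_ge: "1 / (2 * r) \<le> L"
proof -
  have r1: "1 \<le> real r" using r_pos by linarith
  have "1 - 1 / (1 + 1 / real r) \<le> ln (1 + 1 / real r)"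
  proof -
    have "0 < 1 + 1 / real r" by (simp add: add_pos_nonneg)
    then show ?thesis
      using ln_le_minus_one[of "inverse (1 + 1 / real r)"] by (simp add: ln_inverse divide_inverse)
  qed
  moreover have "1 - 1 / (1 + 1 / real r) = 1 / (real r + 1)" using r1 by (simp add: field_simps)
  moreover have "1 / (2 * real r) \<le> 1 / (real r + 1)" using r1 by (intro divide_left_mono) auto
  ultimately show ?thesis by (simp add: L_def)
qed

lemma inside_abs: "inside Z \<Longrightarrow> i < n \<Longrightarrow> \<bar>real (Z i) - D\<bar> \<le> D"
  by (auto simp: inside_def abs_le_iff)

lemma energy_eq: "real (energy n Z) = en Z"
proof -
  have "real ((Z i)\<^sup>2 + D\<^sup>2 - 2 * D * Z i) = (real (Z i) - D)\<^sup>2" for i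
  proof -
    have "real (2 * D * Z i) \<le> real ((Z i)\<^sup>2 + D\<^sup>2)"
      using sum_squares_bound[of "real D" "real (Z i)"] by (simp add: power2_eq_square)
    then have "2 * D * Z i \<le> (Z i)\<^sup>2 + D\<^sup>2" by (simp only: of_nat_le_iff)
    then show ?thesis by (subst of_nat_diff) (simp_all add: power2_eq_square algebra_simps)
  qed
  then show ?thesis by (simp add: energy_def en_def)
qed

lemma en_le: "inside Z \<Longrightarrow> en Z \<le> n * (real D)\<^sup>2"
proof -
  assume "inside Z"
  then have "en Z \<le> (\<Sum>i<n. (real D)\<^sup>2)"
    unfolding en_def using inside_abs by (intro sum_mono) (metis abs_le_square_iff abs_of_nat lessThan_iff)
  then show ?thesis by simp
qed

lemma en_nonneg: "0 \<le> en Z" by (simp add: en_def sum_nonneg)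

lemma dev_abs_le: "inside Z \<Longrightarrow> \<bar>dev Z j\<bar> \<le> n * real D"
proof -
  assume Z: "inside Z"
  have "\<bar>dev Z j\<bar> \<le> (\<Sum>i<n. \<bar>a j i * (real (Z i) - D)\<bar>)" unfolding dev_def by (rule sum_abs)
  also have "\<dots> \<le> (\<Sum>i<n. 1 * real D)"
    unfolding abs_mult using inside_abs[OF Z] a_le
    by (intro sum_mono mult_mono) auto
  finally show ?thesis by simp
qed

text \<open>The linear term is at most the first summand of \<open>offset n\<close> and the damping
  term at most the second, so no subtraction in \<open>up_exp\<close> and \<open>down_exp\<close>
  truncates.\<close>

lemma exponents:
  assumes "inside Z" "b \<le> 4096 * q * (n + 1)" "q \<le> n"
  shows "real (up_exp n (a j) b Z) = offset n + (A * dev Z j - real b * en Z)"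
    "real (down_exp n (a j) b Z) = offset n + (- real A * dev Z j - real b * en Z)"
    "up_exp n (a j) b Z \<le> 2 * offset n" "down_exp n (a j) b Z \<le> 2 * offset n"
proof -
  have b: "b * en Z \<le> 4096 * n * (n + 1) * n * (real D)\<^sup>2"
  proof -
    have "b * en Z \<le> b * (n * (real D)\<^sup>2)" using en_le[OF assms(1)] by (intro mult_left_mono) auto
    also have "\<dots> \<le> real (4096 * n * (n + 1)) * (n * (real D)\<^sup>2)"
      using assms(2,3) mult_le_mono[of "4096 * q" "4096 * n" "n + 1" "n + 1"]
      by (intro mult_right_mono) (simp_all only: of_nat_le_iff, auto)
    finally show ?thesis by (simp add: mult_ac)
  qed
  have off: "real (offset n) = A * n * D + 4096 * n * (n + 1) * n * (real D)\<^sup>2"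
    by (simp add: offset_def algebra_simps)
  have dv: "dev Z j = real (\<Sum>i<n. a j i * Z i) - real D * real (\<Sum>i<n. a j i)"
    by (simp add: dev_def sum_subtractf right_diff_distrib sum_distrib_left mult_ac)
  have Ad: "\<bar>A * dev Z j\<bar> \<le> A * n * D"
    unfolding abs_mult using mult_left_mono[OF dev_abs_le[OF assms(1), of j], of "real A"] by simp
  have bn: "0 \<le> b * en Z" using en_nonneg by simp
  have eqs: "real (slope n * (\<Sum>i<n. a j i * Z i)) = real A * real (\<Sum>i<n. a j i * Z i)"
     "real (slope n * radius n * (\<Sum>i<n. a j i)) = real A * (real D * real (\<Sum>i<n. a j i))"
     "real (b * energy n Z) = b * en Z" by (simp_all add: energy_eq)
  have Adv: "A * dev Z j = real (slope n * (\<Sum>i<n. a j i * Z i)) - real (slope n * radius n * (\<Sum>i<n. a j i))"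
    unfolding dv eqs by (simp add: right_diff_distrib)
  show 1: "real (up_exp n (a j) b Z) = offset n + (A * dev Z j - real b * en Z)"
    unfolding up_exp_def using Ad b bn off Adv eqs(3) by linarith
  show 2: "real (down_exp n (a j) b Z) = offset n + (- real A * dev Z j - real b * en Z)"
    unfolding down_exp_def using Ad b bn off Adv eqs(3) by linarith
  have nn: "0 \<le> 4096 * n * (n + 1) * n * (real D)\<^sup>2" by simp
  show "up_exp n (a j) b Z \<le> 2 * offset n" using 1 Ad bn off nn by linarith
  show "down_exp n (a j) b Z \<le> 2 * offset n" using 2 Ad bn off nn by linarith
qed

lemma weight_eq:
  assumes "inside Z" "b \<le> 4096 * q * (n + 1)" "q \<le> n"
  shows "real (weight n q (a j) b Z)
    = scale * (exp (L * (real A * dev Z j - real b * en Z)) + exp (L * (- real A * dev Z j - real b * en Z)))"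
  unfolding weight_def of_nat_add scaled_power_eq[OF r_pos exponents(3)[OF assms]]
    scaled_power_eq[OF r_pos exponents(4)[OF assms]] exponents(1,2)[OF assms] L_def[symmetric] scale_def
  by (simp only: distrib_left[of L] exp_add distrib_left mult_ac)

text \<open>Averaging the weights over the two moves \<open>\<plusminus>V\<close> replaces the linear terms of the exponents by
  hyperbolic cosines, while the quadratic term contributes the gain \<open>exp (- L * real b * v)\<close>.\<close>

lemma weight_average:
  fixes V :: "nat \<Rightarrow> int" and s x v :: real
  assumes Z: "inside Z" "inside Zp" "inside Zm" and b: "b \<le> 4096 * q * (n + 1)" "q \<le> n"
    and p: "\<And>i. i < n \<Longrightarrow> int (Zp i) = int (Z i) + V i"
    and m: "\<And>i. i < n \<Longrightarrow> int (Zm i) = int (Z i) - V i"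
    and s: "s = (\<Sum>i<n. a j i * real_of_int (V i))"
    and x: "x = (\<Sum>i<n. (real (Z i) - D) * real_of_int (V i))"
    and v: "v = (\<Sum>i<n. (real_of_int (V i))\<^sup>2)"
    and small: "\<bar>L * (real A * s)\<bar> + \<bar>L * (2 * real b * x)\<bar> \<le> 1"
  shows "real (weight n q (a j) b Zp) + real (weight n q (a j) b Zm)
    \<le> 2 * exp (- L * real b * v) * weight n q (a j) b Z * (1 + L\<^sup>2 * (2 * (real A)\<^sup>2 * s\<^sup>2 + 8 * (real b)\<^sup>2 * x\<^sup>2))"
proof -
  have rp: "real (Zp i) = real (Z i) + V i" "real (Zm i) = real (Z i) - V i" if "i < n" for i
    using p[OF that] m[OF that] by linarith+
  have dp: "dev Zp j = dev Z j + s" "dev Zm j = dev Z j - s"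
    unfolding dev_def s sum.distrib[symmetric] sum_subtractf[symmetric]
    by (intro sum.cong refl; simp add: rp algebra_simps)+
  have ep: "en Zp = en Z + 2 * x + v" "en Zm = en Z - 2 * x + v"
    unfolding en_def x v sum_distrib_left sum.distrib[symmetric] sum_subtractf[symmetric]
    by (intro sum.cong refl; simp add: rp power2_eq_square algebra_simps)+
  define e1 where "e1 = exp (L * (real A * dev Z j - real b * en Z))"
  define e2 where "e2 = exp (L * (- real A * dev Z j - real b * en Z))"
  define f where "f = exp (- L * real b * v)"
  \<comment> \<open>The two moves change one exponent of a set by +-y1 and the other by +-y2, apart
    from the common damping gain; summing over both moves cancels the odd parts.\<close>
  define y1 where "y1 = L * (real A * s) - L * (2 * real b * x)"
  define y2 where "y2 = L * (real A * s) + L * (2 * real b * x)"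
  define Q where "Q = L\<^sup>2 * (2 * (real A)\<^sup>2 * s\<^sup>2 + 8 * (real b)\<^sup>2 * x\<^sup>2)"
  have small': "\<bar>y1\<bar> \<le> 1" "\<bar>y2\<bar> \<le> 1" using small unfolding y1_def y2_def by linarith+
  have eq: "exp (L * (real A * (dev Z j + s) - real b * (en Z + 2 * x + v))) = e1 * f * exp y1"
    "exp (L * (- real A * (dev Z j + s) - real b * (en Z + 2 * x + v))) = e2 * f * exp (- y2)"
    "exp (L * (real A * (dev Z j - s) - real b * (en Z - 2 * x + v))) = e1 * f * exp (- y1)"
    "exp (L * (- real A * (dev Z j - s) - real b * (en Z - 2 * x + v))) = e2 * f * exp y2"
    unfolding e1_def e2_def f_def y1_def y2_def exp_add[symmetric]
    by (simp_all add: algebra_simps)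
  have sq: "y1\<^sup>2 \<le> Q" "y2\<^sup>2 \<le> Q"
  proof -
    have "(u - w)\<^sup>2 \<le> 2 * u\<^sup>2 + 2 * w\<^sup>2" "(u + w)\<^sup>2 \<le> 2 * u\<^sup>2 + 2 * w\<^sup>2" for u w :: real
      using zero_le_power2[of "u + w"] zero_le_power2[of "u - w"] by (simp_all add: power2_eq_square algebra_simps)
    from this[of "L * (real A * s)" "L * (2 * real b * x)"] show "y1\<^sup>2 \<le> Q" "y2\<^sup>2 \<le> Q"
      unfolding y1_def y2_def Q_def by (simp_all add: power_mult_distrib distrib_left)
  qed
  have c: "exp y1 + exp (- y1) \<le> 2 * (1 + Q)"
    using exp_add_exp_minus_le[OF small'(1)] sq(1) by argo
  have c': "exp y2 + exp (- y2) \<le> 2 * (1 + Q)"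
    using exp_add_exp_minus_le[OF small'(2)] sq(2) by argo
  have "real (weight n q (a j) b Zp) + real (weight n q (a j) b Zm)
      = scale * f * (e1 * (exp y1 + exp (- y1)) + e2 * (exp y2 + exp (- y2)))"
    unfolding weight_eq[OF Z(2) b] weight_eq[OF Z(3) b] dp ep eq by (simp add: algebra_simps)
  also have "\<dots> \<le> scale * f * (e1 * (2 * (1 + Q)) + e2 * (2 * (1 + Q)))"
    using c c' scale_pos by (intro mult_left_mono add_mono) (auto simp: e1_def e2_def f_def)
  also have "\<dots> = 2 * f * (scale * (e1 + e2)) * (1 + Q)" by (simp add: algebra_simps)
  also have "scale * (e1 + e2) = weight n q (a j) b Z"
    unfolding weight_eq[OF Z(1) b] e1_def e2_def ..
  finally show ?thesis unfolding f_def Q_def .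
qed

lemma weight_pos: "0 < weight n q s b Z"
  using r_pos by (simp add: weight_def scaled_power_def)

lemma pot_pos: "0 < pot b Z"
  unfolding pot_def using k_pos by (intro sum_pos) (auto simp: weight_pos)

text \<open>The square of the product of \<open>v\<close> with Z - D is replaced by twice the
  squares of the products with Z and with D (hence 16 instead of 8). In this form all matrix entries
  are natural numbers.\<close>

definition quad :: "nat \<Rightarrow> (nat \<Rightarrow> nat) \<Rightarrow> (nat \<Rightarrow> real) \<Rightarrow> real" where
  "quad b Z v = 2 * (real A)\<^sup>2 * (\<Sum>j<k. real (weight n q (a j) b Z) * (\<Sum>i<n. real (a j i) * v i)\<^sup>2)
    + 16 * (real b)\<^sup>2 * real (pot b Z) * ((\<Sum>i<n. real (Z i) * v i)\<^sup>2 + (real D)\<^sup>2 * (\<Sum>i<n. v i)\<^sup>2)"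

text \<open>With z = L b v the two potentials average to at most exp(-z) (1 + z/4) times the old
  one, and exp(-z) \<le> 1 - z/2 on [0, 1] turns this factor into 1 - z/4. The smaller of the two is
  at most the average.\<close>

lemma pot_average:
  fixes V :: "nat \<Rightarrow> int" and v :: real
  assumes Z: "inside Z" "inside Zp" "inside Zm" and b: "b \<le> 4096 * q * (n + 1)" "q \<le> n"
    and p: "\<And>i. i < n \<Longrightarrow> int (Zp i) = int (Z i) + V i"
    and m: "\<And>i. i < n \<Longrightarrow> int (Zm i) = int (Z i) - V i"
    and VP: "\<And>i. i < n \<Longrightarrow> \<bar>V i\<bar> \<le> P"
    and small: "L * (real A * (real n * real P)) + L * (2 * real b * (real n * real D * real P)) \<le> 1"
    and v: "v = (\<Sum>i<n. (real_of_int (V i))\<^sup>2)" and z1: "L * real b * v \<le> 1"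
    and quad: "L\<^sup>2 * quad b Z (\<lambda>i. real_of_int (V i)) \<le> pot b Z * (L * real b * v) / 4"
  shows "min (real (pot b Zp)) (pot b Zm) \<le> (1 - L * real b * v / 4) * pot b Z"
proof -
  define s where "s j = (\<Sum>i<n. a j i * real_of_int (V i))" for j
  define x where "x = (\<Sum>i<n. (real (Z i) - D) * real_of_int (V i))"
  define f where "f = exp (- L * real b * v)"
  have VP': "\<bar>real_of_int (V i)\<bar> \<le> P" if "i < n" for i using VP[OF that] by linarith
  have s: "\<bar>s j\<bar> \<le> real n * real P" for j
  proof -
    have "\<bar>s j\<bar> \<le> (\<Sum>i<n. \<bar>a j i * real_of_int (V i)\<bar>)" unfolding s_def by (rule sum_abs)
    also have "\<dots> \<le> (\<Sum>i<n. 1 * real P)"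
      unfolding abs_mult using VP' a_le by (intro sum_mono mult_mono) auto
    finally show ?thesis by simp
  qed
  have x: "\<bar>x\<bar> \<le> real n * real D * real P"
  proof -
    have "\<bar>x\<bar> \<le> (\<Sum>i<n. \<bar>(real (Z i) - D) * real_of_int (V i)\<bar>)" unfolding x_def by (rule sum_abs)
    also have "\<dots> \<le> (\<Sum>i<n. real D * real P)"
      unfolding abs_mult using VP' inside_abs[OF Z(1)] by (intro sum_mono mult_mono) auto
    finally show ?thesis by simp
  qed
  have sm: "\<bar>L * (real A * s j)\<bar> + \<bar>L * (2 * real b * x)\<bar> \<le> 1" for j
  proof -
    have "\<bar>L * (real A * s j)\<bar> \<le> L * (real A * (real n * real P))"
      unfolding abs_mult using L_pos s by (simp add: mult_left_mono)
    moreover have "\<bar>L * (2 * real b * x)\<bar> \<le> L * (2 * real b * (real n * real D * real P))"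
      unfolding abs_mult using L_pos x by (simp add: mult_left_mono)
    ultimately show ?thesis using small by linarith
  qed
  have x2: "x\<^sup>2 \<le> 2 * ((\<Sum>i<n. Z i * real_of_int (V i))\<^sup>2 + (real D)\<^sup>2 * (\<Sum>i<n. real_of_int (V i))\<^sup>2)"
  proof -
    have eq: "x = (\<Sum>i<n. Z i * real_of_int (V i)) - D * (\<Sum>i<n. real_of_int (V i))"
      by (simp add: x_def left_diff_distrib sum_subtractf sum_distrib_left)
    have "(u - w)\<^sup>2 \<le> 2 * (u\<^sup>2 + w\<^sup>2)" for u w :: real
      using zero_le_power2[of "u + w"] by (simp add: power2_eq_square algebra_simps)
    then show ?thesis unfolding eq by (simp only: power_mult_distrib[symmetric])
  qed
  let ?w = "\<lambda>j. real (weight n q (a j) b Z)"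
  have W: "real (pot b Z) = (\<Sum>j<k. ?w j)" by (simp add: pot_def)
  have "real (pot b Zp) + pot b Zm
      = (\<Sum>j<k. real (weight n q (a j) b Zp) + real (weight n q (a j) b Zm))"
    by (simp add: pot_def sum.distrib)
  also have "\<dots> \<le> (\<Sum>j<k. 2 * f * ?w j * (1 + L\<^sup>2 * (2 * (real A)\<^sup>2 * (s j)\<^sup>2 + 8 * (real b)\<^sup>2 * x\<^sup>2)))"
    unfolding f_def
    by (intro sum_mono weight_average[OF Z b p m s_def x_def v sm]) auto
  also have "\<dots> = 2 * f * (pot b Z + L\<^sup>2 * (2 * (real A)\<^sup>2 * (\<Sum>j<k. ?w j * (s j)\<^sup>2) + 8 * (real b)\<^sup>2 * pot b Z * x\<^sup>2))"
    unfolding W by (simp add: sum_distrib_left sum_distrib_right sum.distrib algebra_simps)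
  also have "\<dots> \<le> 2 * f * (pot b Z + L\<^sup>2 * quad b Z (\<lambda>i. real_of_int (V i)))"
  proof -
    have "8 * (real b)\<^sup>2 * pot b Z * x\<^sup>2
        \<le> 8 * (real b)\<^sup>2 * pot b Z * (2 * ((\<Sum>i<n. Z i * real_of_int (V i))\<^sup>2 + (real D)\<^sup>2 * (\<Sum>i<n. real_of_int (V i))\<^sup>2))"
      using x2 by (intro mult_left_mono) auto
    then have "2 * (real A)\<^sup>2 * (\<Sum>j<k. ?w j * (s j)\<^sup>2) + 8 * (real b)\<^sup>2 * pot b Z * x\<^sup>2
        \<le> quad b Z (\<lambda>i. real_of_int (V i))"
      unfolding quad_def s_def by (simp add: algebra_simps)
    then show ?thesis by (intro mult_left_mono add_left_mono) (auto simp: f_def)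
  qed
  also have "\<dots> \<le> 2 * f * (pot b Z + pot b Z * (L * real b * v) / 4)"
    using quad by (intro mult_left_mono add_left_mono) (auto simp: f_def)
  also have "\<dots> = 2 * (f * (1 + (L * real b * v) / 4)) * pot b Z" by (simp add: algebra_simps)
  also have "\<dots> \<le> 2 * (1 - L * real b * v / 4) * pot b Z"
  proof (intro mult_right_mono mult_left_mono)
    define z where "z = L * real b * v"
    have z0: "0 \<le> z" unfolding z_def v using L_pos by (intro mult_nonneg_nonneg sum_nonneg) auto
    have z: "z \<le> 1" using z1 by (simp add: z_def)
    have "f \<le> 1 - z / 2"
    proof -
      have "exp z \<ge> 1 + z" by (rule exp_ge_add_one_self)
      then have "f \<le> 1 / (1 + z)"
        using z0 by (simp add: f_def z_def[symmetric] exp_minus divide_inverse le_imp_inverse_le)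
      also have "\<dots> \<le> 1 - z / 2" using z0 z mult_nonneg_nonneg[OF z0, of "1 - z"] by (simp add: field_simps)
      finally show ?thesis .
    qed
    then have "f * (1 + z / 4) \<le> (1 - z / 2) * (1 + z / 4)" using z0 by (intro mult_right_mono) auto
    also have "\<dots> \<le> 1 - z / 4" using z0 by (simp add: field_simps)
    finally show "f * (1 + L * real b * v / 4) \<le> 1 - L * real b * v / 4" by (simp add: z_def)
  qed auto
  finally show ?thesis by linarith
qed

end

section \<open>Power iteration and moves in natural numbers\<close>

context walk
begin

definition alive_set :: "(nat \<Rightarrow> nat) \<Rightarrow> nat set" where
  "alive_set Z = {i. i < n \<and> P < Z i \<and> Z i < 2 * D - P}"

text \<open>The matrix of \<open>quad\<close>. The factors \<open>alive\<close> cut it down to the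
  live coordinates, so that no vector computed from it moves a frozen one.\<close>

definition coef :: "nat \<Rightarrow> (nat \<Rightarrow> nat) \<Rightarrow> nat \<Rightarrow> nat \<Rightarrow> nat" where
  "coef b Z i l = alive n (Z i) * alive n (Z l) *
     (2 * A\<^sup>2 * (\<Sum>j<k. weight n q (a j) b Z * a j i * a j l) + 16 * b\<^sup>2 * pot b Z * (Z i * Z l + D\<^sup>2))"

text \<open>A bound on the trace of \<open>coef\<close>: a diagonal entry contains (Z i)^2 + D^2
  \<le> 5 D^2, and 16 times 5 is 80.\<close>

definition level :: "nat \<Rightarrow> (nat \<Rightarrow> nat) \<Rightarrow> nat" where
  "level b Z = pot b Z * (2 * A\<^sup>2 * n + 80 * b\<^sup>2 * D\<^sup>2 * n)"

text \<open>The iterates of level - coef on a unit vector have entries of both signs. They are kept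
  as the difference of two vectors of natural numbers, and the product with the matrix changes
  sides.\<close>

primrec iter :: "nat \<Rightarrow> (nat \<Rightarrow> nat) \<Rightarrow> nat \<Rightarrow> nat \<Rightarrow> (nat \<Rightarrow> nat) \<times> (nat \<Rightarrow> nat)" where
  "iter b Z x 0 = (\<lambda>i. alive n (Z i) * of_bool (i = x), \<lambda>i. 0)"
| "iter b Z x (Suc t) =
     (\<lambda>i. level b Z * fst (iter b Z x t) i + (\<Sum>l<n. coef b Z i l * snd (iter b Z x t) l),
      \<lambda>i. level b Z * snd (iter b Z x t) i + (\<Sum>l<n. coef b Z i l * fst (iter b Z x t) l))"

definition vmax :: "(nat \<Rightarrow> nat) \<Rightarrow> (nat \<Rightarrow> nat) \<Rightarrow> nat" where
  "vmax p m = Max (insert 0 ((\<lambda>i. (p i - m i) + (m i - p i)) ` {..<n}))"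

definition cand :: "(nat \<Rightarrow> nat) \<Rightarrow> (nat \<Rightarrow> nat) \<Rightarrow> (nat \<Rightarrow> nat) \<Rightarrow> nat \<Rightarrow> nat" where
  "cand Z p m i = Z i + P * (p i - m i) div vmax p m - P * (m i - p i) div vmax p m"

text \<open>The move behind \<open>cand\<close> as an integer vector: p - m scaled to maximum norm P
  and rounded towards zero.\<close>

definition rounded :: "(nat \<Rightarrow> nat) \<Rightarrow> (nat \<Rightarrow> nat) \<Rightarrow> nat \<Rightarrow> int" where
  "rounded p m i = int (P * (p i - m i) div vmax p m) - int (P * (m i - p i) div vmax p m)"

lemma finite_alive_set: "finite (alive_set Z)" by (simp add: alive_set_def)

lemma live_eq: "live n Z = card (alive_set Z)"
  by (simp add: live_def alive_def alive_set_def of_bool_def sum.If_cases Int_def)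

lemma alive_eq: "i < n \<Longrightarrow> alive n (Z i) = of_bool (i \<in> alive_set Z)"
  by (simp add: alive_def alive_set_def)

lemma vmax_commute: "vmax m p = vmax p m"
  by (simp add: vmax_def add.commute)

lemma vmax_ge: "i < n \<Longrightarrow> (p i - m i) + (m i - p i) \<le> vmax p m"
  unfolding vmax_def by (intro Max_ge) auto

lemma rounded_abs_le: "i < n \<Longrightarrow> \<bar>rounded p m i\<bar> \<le> P"
proof -
  assume i: "i < n"
  have *: "P * y div vmax p m \<le> P" if "y \<le> vmax p m" for y
  proof (cases "vmax p m = 0")
    case False
    then have "P * y div vmax p m \<le> P * vmax p m div vmax p m"
      using that by (intro div_le_mono mult_le_mono2)
    then show ?thesis using False by simp
  qed simp
  have "p i - m i \<le> vmax p m" "m i - p i \<le> vmax p m" using vmax_ge[OF i, of p m] by linarith+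
  from this[THEN *] show ?thesis unfolding rounded_def by linarith
qed

lemma rounded_commute: "rounded m p i = - rounded p m i"
  by (simp add: rounded_def vmax_commute)

lemma rounded_zero: "p i = m i \<Longrightarrow> rounded p m i = 0"
  by (simp add: rounded_def)

lemma rounded_close:
  assumes "0 < vmax p m"
  shows "\<bar>P / vmax p m * (real (p i) - real (m i)) - rounded p m i\<bar> \<le> 1"
proof -
  have div: "0 \<le> real x / real y - real (x div y) \<and> real x / real y - real (x div y) \<le> 1" for x y
    using of_nat_div_le_of_nat[where ?'a = real, of x y] divide_nat_diff_div_nat_less_one[of x y] by auto
  show ?thesis
  proof (cases "m i \<le> p i")
    case True
    then have "P / vmax p m * (real (p i) - real (m i)) = real (P * (p i - m i)) / vmax p m"
      by (simp add: of_nat_diff)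
    then show ?thesis using div[of "P * (p i - m i)" "vmax p m"] True by (simp add: rounded_def)
  next
    case False
    then have "P / vmax p m * (real (p i) - real (m i)) = - (real (P * (m i - p i)) / vmax p m)"
      by (simp add: of_nat_diff minus_divide_left[symmetric] algebra_simps diff_divide_distrib)
    then show ?thesis using div[of "P * (m i - p i)" "vmax p m"] False by (simp add: rounded_def)
  qed
qed

text \<open>The division is exact at the entry of largest absolute value. This keeps the squared
  length of a move at least P^2, against a squared rounding error of at most n.\<close>

lemma rounded_attains:
  assumes "0 < vmax p m"
  obtains i where "i < n" "\<bar>rounded p m i\<bar> = P"
proof -
  let ?S = "insert 0 ((\<lambda>i. (p i - m i) + (m i - p i)) ` {..<n})"
  have "vmax p m \<in> ?S" unfolding vmax_def by (intro Max_in) auto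
  then obtain i where i: "i < n" "vmax p m = (p i - m i) + (m i - p i)" using assms by auto
  have "\<bar>rounded p m i\<bar> = P"
  proof (cases "m i \<le> p i")
    case True
    then have "vmax p m = p i - m i" using i(2) by simp
    then have "rounded p m i = int (P * vmax p m div vmax p m)" using True by (simp add: rounded_def)
    then show ?thesis using assms by simp
  next
    case False
    then have "vmax p m = m i - p i" using i(2) by simp
    then have "rounded p m i = - int (P * vmax p m div vmax p m)" using False by (simp add: rounded_def)
    then show ?thesis using assms by simp
  qed
  with i(1) that show thesis by blast
qed

lemma P_le_D: "2 * P \<le> D"
  using n_pos by (simp add: radius_def)

text \<open>A live coordinate has room P on both sides, as much as a move can use, so the truncated
  subtraction is exact; a frozen coordinate does not move because \<open>p\<close> and
  \<open>m\<close> agree there.\<close>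

lemma cand_eq:
  assumes "i < n" "Z i \<le> 2 * D" "i \<notin> alive_set Z \<Longrightarrow> p i = m i"
  shows "int (cand Z p m i) = int (Z i) + rounded p m i" "cand Z p m i \<le> 2 * D"
    "int (cand Z m p i) = int (Z i) - rounded p m i" "cand Z m p i \<le> 2 * D"
proof -
  have *: "int (cand Z p m i) = int (Z i) + rounded p m i \<and> cand Z p m i \<le> 2 * D"
    if h: "i \<notin> alive_set Z \<Longrightarrow> p i = m i" for p m
  proof (cases "i \<in> alive_set Z")
    case True
    then have Zi: "P < Z i" "Z i < 2 * D - P" by (auto simp: alive_set_def)
    have "P * (m i - p i) div vmax p m \<le> P"
    proof (cases "m i \<le> p i")
      case False
      then show ?thesis using rounded_abs_le[OF assms(1), of p m] by (simp add: rounded_def)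
    qed simp
    then have "int (cand Z p m i) = int (Z i) + rounded p m i"
      using Zi unfolding cand_def rounded_def by linarith
    then show ?thesis using Zi rounded_abs_le[OF assms(1), of p m] by linarith
  next
    case False
    then show ?thesis using h assms(2) by (simp add: cand_def rounded_def)
  qed
  show "int (cand Z p m i) = int (Z i) + rounded p m i" "cand Z p m i \<le> 2 * D"
    using *[of p m] assms(3) by auto
  show "int (cand Z m p i) = int (Z i) - rounded p m i" "cand Z m p i \<le> 2 * D"
    using *[of m p] assms(3) rounded_commute[of m p i] by auto
qed

lemma iter_off:
  assumes "i < n" "i \<notin> alive_set Z"
  shows "fst (iter b Z x t) i = 0" "snd (iter b Z x t) i = 0"
proof -
  have "alive n (Z i) = 0" using assms by (simp add: alive_eq)
  then have "fst (iter b Z x t) i = 0 \<and> snd (iter b Z x t) i = 0"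
    by (induction t) (auto simp: coef_def)
  then show "fst (iter b Z x t) i = 0" "snd (iter b Z x t) i = 0" by auto
qed

text \<open>\<open>quad\<close> as a form built from k + 2 vectors: the k rows of the matrix, the
  point Z at index k, and the constant vector D at index \<open>Suc k\<close>.\<close>

definition form_weight :: "nat \<Rightarrow> (nat \<Rightarrow> nat) \<Rightarrow> nat \<Rightarrow> real" where
  "form_weight b Z c = (if c < k then 2 * (real A)\<^sup>2 * real (weight n q (a c) b Z)
     else 16 * (real b)\<^sup>2 * real (pot b Z))"

definition form_vec :: "(nat \<Rightarrow> nat) \<Rightarrow> nat \<Rightarrow> nat \<Rightarrow> real" where
  "form_vec Z c i = (if c < k then real (a c i) else if c = k then real (Z i) else real D)"

lemma sum_form: "(\<Sum>c<Suc (Suc k). form_weight b Z c * f (form_vec Z c))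
  = 2 * (real A)\<^sup>2 * (\<Sum>j<k. real (weight n q (a j) b Z) * f (\<lambda>i. real (a j i)))
    + 16 * (real b)\<^sup>2 * real (pot b Z) * (f (\<lambda>i. real (Z i)) + f (\<lambda>i. real D))"
proof -
  have "form_vec Z c = (\<lambda>i. real (a c i))" if "c < k" for c using that by (simp add: form_vec_def fun_eq_iff)
  moreover have "form_vec Z k = (\<lambda>i. real (Z i))" "form_vec Z (Suc k) = (\<lambda>i. real D)"
    by (simp_all add: form_vec_def fun_eq_iff)
  ultimately show ?thesis
    by (simp add: form_weight_def sum_distrib_left distrib_left mult_ac cong: sum.cong_simp)
qed

lemma level_pos: "0 < level b Z"
  using pot_pos n_pos D_pos by (simp add: level_def slope_def)

lemma shifted_form_alive:
  assumes "inside Z"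
  shows "shifted_form (alive_set Z) {..<Suc (Suc k)} (form_weight b Z) (form_vec Z) (level b Z)"
proof
  let ?Y = "alive_set Z"
  show "finite ?Y" by (rule finite_alive_set)
  show "0 \<le> form_weight b Z c" for c by (simp add: form_weight_def)
  show "0 < real (level b Z)" using level_pos by simp
  have card: "card ?Y \<le> n"
    using card_mono[of "{..<n}" ?Y] by (auto simp: alive_set_def)
  have le: "dot ?Y v v \<le> n * c\<^sup>2" if "\<And>i. i \<in> ?Y \<Longrightarrow> \<bar>v i\<bar> \<le> c" for v :: "nat \<Rightarrow> real" and c :: real
  proof -
    have "0 \<le> c\<^sup>2" by simp
    have "dot ?Y v v \<le> (\<Sum>i\<in>?Y. c\<^sup>2)"
      unfolding dot_def power2_eq_square[symmetric]
    proof (rule sum_mono)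
      fix i assume "i \<in> ?Y"
      from that[OF this] have "\<bar>v i\<bar> \<le> \<bar>c\<bar>" by linarith
      then show "(v i)\<^sup>2 \<le> c\<^sup>2" by (simp add: abs_le_square_iff)
    qed
    also have "\<dots> \<le> n * c\<^sup>2" using card by (simp add: mult_right_mono)
    finally show ?thesis .
  qed
  have "(\<Sum>c<Suc (Suc k). form_weight b Z c * dot ?Y (form_vec Z c) (form_vec Z c))
      = 2 * (real A)\<^sup>2 * (\<Sum>j<k. real (weight n q (a j) b Z) * dot ?Y (\<lambda>i. real (a j i)) (\<lambda>i. real (a j i)))
    + 16 * (real b)\<^sup>2 * real (pot b Z) * (dot ?Y (\<lambda>i. real (Z i)) (\<lambda>i. real (Z i)) + dot ?Y (\<lambda>i. real D) (\<lambda>i. real D))"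
    by (rule sum_form)
  also have "\<dots> \<le> 2 * (real A)\<^sup>2 * (\<Sum>j<k. real (weight n q (a j) b Z) * (real n * 1\<^sup>2))
    + 16 * (real b)\<^sup>2 * real (pot b Z) * (real n * (2 * real D)\<^sup>2 + real n * (real D)\<^sup>2)"
  proof (intro add_mono mult_left_mono sum_mono)
    have a1: "\<bar>real (a j i)\<bar> \<le> 1" for j i using a_le[of j i] by (simp only: abs_of_nat of_nat_le_1_iff)
    show "dot ?Y (\<lambda>i. real (a j i)) (\<lambda>i. real (a j i)) \<le> real n * 1\<^sup>2" for j
      by (rule le) (rule a1)
    show "dot ?Y (\<lambda>i. real (Z i)) (\<lambda>i. real (Z i)) \<le> real n * (2 * real D)\<^sup>2"
      by (rule le) (use assms in \<open>auto simp: inside_def alive_set_def\<close>)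
    show "dot ?Y (\<lambda>i. real D) (\<lambda>i. real D) \<le> real n * (real D)\<^sup>2"
      by (rule le) simp
  qed simp_all
  also have "\<dots> = real (level b Z)"
  proof -
    have "(\<Sum>j<k. real (weight n q (a j) b Z) * (real n * 1\<^sup>2)) = real (pot b Z) * n"
      by (simp add: pot_def sum_distrib_right)
    then show ?thesis by (simp add: level_def power_mult_distrib algebra_simps)
  qed
  finally show "(\<Sum>c<Suc (Suc k). form_weight b Z c * dot ?Y (form_vec Z c) (form_vec Z c)) \<le> real (level b Z)" .
qed

lemma mat_alive:
  assumes "inside Z" "i \<in> alive_set Z" "l \<in> alive_set Z"
  shows "shifted_form.mat {..<Suc (Suc k)} (form_weight b Z) (form_vec Z) i l = coef b Z i l"
proof -
  interpret F: shifted_form "alive_set Z" "{..<Suc (Suc k)}" "form_weight b Z" "form_vec Z" "level b Z"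
    by (rule shifted_form_alive[OF assms(1)])
  have il: "alive n (Z i) = 1" "alive n (Z l) = 1"
    using assms by (auto simp: alive_set_def alive_def)
  show ?thesis
    unfolding F.mat_def sum_form[where f = "\<lambda>v. v i * v l"]
    by (simp add: coef_def il power2_eq_square mult_ac)
qed

lemma quad_eq_form:
  assumes "inside Z" "\<And>i. i < n \<Longrightarrow> i \<notin> alive_set Z \<Longrightarrow> v i = 0"
  shows "quad b Z v = shifted_form.form (alive_set Z) {..<Suc (Suc k)} (form_weight b Z) (form_vec Z) v"
proof -
  interpret F: shifted_form "alive_set Z" "{..<Suc (Suc k)}" "form_weight b Z" "form_vec Z" "level b Z"
    by (rule shifted_form_alive[OF assms(1)])
  have s: "dot (alive_set Z) u v = (\<Sum>i<n. u i * v i)" for u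
    unfolding dot_def using assms(2) by (intro sum.mono_neutral_left) (auto simp: alive_set_def)
  show ?thesis
    unfolding F.form_def sum_form[where f = "\<lambda>u. (dot (alive_set Z) u v)\<^sup>2", of b Z]
    unfolding s quad_def by (simp add: sum_distrib_left[symmetric] power_mult_distrib)
qed

lemma iter_shift:
  assumes Z: "inside Z" and x: "x \<in> alive_set Z" and i: "i \<in> alive_set Z"
  shows "real (fst (iter b Z x t) i) - real (snd (iter b Z x t) i)
    = (shifted_form.shift (alive_set Z) {..<Suc (Suc k)} (form_weight b Z) (form_vec Z) (level b Z) ^^ t) (unit_vec x) i"
  using i
proof (induction t arbitrary: i)
  case 0
  then show ?case by (auto simp: unit_vec_def alive_eq alive_set_def alive_def)
next
  case (Suc t)
  interpret F: shifted_form "alive_set Z" "{..<Suc (Suc k)}" "form_weight b Z" "form_vec Z" "level b Z"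
    by (rule shifted_form_alive[OF Z])
  let ?p = "fst (iter b Z x t)" and ?m = "snd (iter b Z x t)"
  have s: "(\<Sum>l<n. real (coef b Z i l) * (real (?p l) - real (?m l)))
      = mat_vec (alive_set Z) F.mat ((F.shift ^^ t) (unit_vec x)) i"
  proof -
    have "(\<Sum>l<n. real (coef b Z i l) * (real (?p l) - real (?m l)))
        = (\<Sum>l\<in>alive_set Z. real (coef b Z i l) * (real (?p l) - real (?m l)))"
      by (intro sum.mono_neutral_right) (auto simp: alive_set_def iter_off)
    also have "\<dots> = mat_vec (alive_set Z) F.mat ((F.shift ^^ t) (unit_vec x)) i"
      unfolding mat_vec_def dot_def
      by (intro sum.cong refl arg_cong2[where f = "(*)"]) (simp_all add: mat_alive[OF Z Suc.prems] Suc.IH)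
    finally show ?thesis .
  qed
  have "real (fst (iter b Z x (Suc t)) i) - real (snd (iter b Z x (Suc t)) i)
      = level b Z * (real (?p i) - real (?m i)) - (\<Sum>l<n. real (coef b Z i l) * (real (?p l) - real (?m l)))"
    by (simp add: right_diff_distrib sum_subtractf)
  also have "\<dots> = F.shift ((F.shift ^^ t) (unit_vec x)) i"
    unfolding s Suc.IH[OF Suc.prems] by (rule F.shift_def[symmetric])
  finally show ?case by simp
qed

end

context walk
begin

text \<open>The damping exceeds all three error terms of a direction obtained by rounded power iteration.\<close>

lemma damp_bounds:
  assumes "1 \<le> m" "m \<le> n" "q \<le> n"
  shows "damp n q m * (m + 1) \<le> 4096 * q * (n + 1)" "1 \<le> damp n q m"
    "1024 * real q * (n + 1) / m \<le> damp n q m"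
proof -
  let ?B = "4096 * q * (n + 1)"
  show 1: "damp n q m * (m + 1) \<le> ?B" unfolding damp_def by (rule div_times_less_eq_dividend)
  have "1 * (m + 1) \<le> 4096 * q * (n + 1)" using assms q_pos by (intro mult_le_mono) auto
  then have "m + 1 \<le> ?B" by simp
  then have "(m + 1) div (m + 1) \<le> damp n q m" unfolding damp_def by (rule div_le_mono)
  then show 2: "1 \<le> damp n q m" by simp
  have "?B < (damp n q m + 1) * (m + 1)"
    unfolding damp_def using dividend_less_div_times[of "m + 1" ?B] by simp
  also have "\<dots> \<le> (2 * damp n q m) * (2 * m)" using 2 assms by (intro mult_le_mono) auto
  finally have "?B < 4 * (damp n q m * m)" by simp
  then have "real ?B < real (4 * (damp n q m * m))" by (simp only: of_nat_less_iff)
  then show "1024 * real q * (n + 1) / m \<le> damp n q m" using assms by (simp add: field_simps)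
qed

lemma r_eq: "real r = real q * (real D)\<^sup>2 * (real n + 1)" by (simp add: res_base_def distrib_left add.commute)

lemma A_eq: "real A = real D * (real n + 1)" by (simp add: slope_def distrib_left add.commute)

lemma L_mult_le: "0 \<le> c \<Longrightarrow> c \<le> d * real r \<Longrightarrow> L * c \<le> d"
proof -
  assume c: "0 \<le> c" "c \<le> d * real r"
  have "L * c \<le> 1 / r * c" using L_le c(1) by (rule mult_right_mono)
  also have "\<dots> \<le> d" using c(2) r_pos by (simp add: field_simps)
  finally show ?thesis .
qed

text \<open>The errors from the distance to the net, from finitely many power steps and from
  rounding. \<open>pot_average\<close> tolerates b/4 in total, so each may take b/12.\<close>

lemma error_terms:
  assumes m: "8 \<le> m" "m \<le> n" "q \<le> n" and b: "b = damp n q m" and \<delta>: "\<delta> \<le> (real q)\<^sup>2"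
  shows "L * (64 * (real A)\<^sup>2 * \<delta> / m) \<le> real b / 12"
    "L * (8 * (2 * (real A)\<^sup>2 * n + 80 * (real b)\<^sup>2 * (real D)\<^sup>2 * n) * (ln m / power_steps n)) \<le> real b / 12"
    "L * (2 * (2 * (real A)\<^sup>2 * n + 80 * (real b)\<^sup>2 * (real D)\<^sup>2 * n) * n / (real P)\<^sup>2) \<le> real b / 12"
proof -
  note bd = damp_bounds[OF _ m(2,3), folded b]
  have m1: "1 \<le> m" using m by simp
  have q1: "1 \<le> real q" using q_pos by linarith
  have n1: "1 \<le> real n" using n_pos by linarith
  have b1: "1 \<le> real b" using bd(2)[OF m1] by linarith
  have D0: "0 < real D" using D_pos by simp
  show "L * (64 * (real A)\<^sup>2 * \<delta> / m) \<le> real b / 12"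
  proof -
    have "L * (64 * (real A)\<^sup>2 * \<delta> / m) \<le> L * (64 * (real A)\<^sup>2 * (real q)\<^sup>2 / m)"
      using \<delta> L_pos by (intro mult_left_mono divide_right_mono) auto
    \<comment> \<open>A^2 q^2 / r equals q (n + 1), while the damping is at least 1024 q (n + 1) /
      m, and 64 \<le> 1024/12.\<close>
    also have "\<dots> \<le> 64 * (real q * (real n + 1) / m)"
    proof (rule L_mult_le)
      show "64 * (real A)\<^sup>2 * (real q)\<^sup>2 / m \<le> 64 * (real q * (real n + 1) / m) * real r"
        unfolding r_eq A_eq by (simp add: power2_eq_square field_simps)
    qed simp
    also have "\<dots> \<le> 1024 * real q * (n + 1) / m / 12" using q1 n1 m1 by (simp add: field_simps)
    also have "\<dots> \<le> real b / 12" using bd(3)[OF m1] by (simp only: divide_right_mono zero_le_numeral)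
    finally show ?thesis .
  qed
  define \<tau> where "\<tau> = 2 * (real A)\<^sup>2 * n + 80 * (real b)\<^sup>2 * (real D)\<^sup>2 * n"
  have \<tau>0: "0 \<le> \<tau>" by (simp add: \<tau>_def)
  \<comment> \<open>One factor b is kept on the right, since the errors are compared with b. The
    summand without b uses 1 \<le> b q; the summand with b^2 uses 9 b \<le> 4096 q (n + 1), which is
    where m \<ge> 8 enters.\<close>
  have L\<tau>: "L * \<tau> \<le> 65536 * (real n)\<^sup>2 * b"
  proof (rule L_mult_le[OF \<tau>0])
    have b9: "real b * 9 \<le> 4096 * real q * (real n + 1)"
    proof -
      have "b * 9 \<le> b * (m + 1)" using m by (intro mult_le_mono) auto
      also have "\<dots> \<le> 4096 * q * (n + 1)" by (rule bd(1)[OF m1])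
      finally have "real (b * 9) \<le> real (4096 * q * (n + 1))" by (simp only: of_nat_le_iff)
      then show ?thesis by (simp add: algebra_simps)
    qed
    have t1: "2 * (real A)\<^sup>2 * n \<le> 4 * (real n)\<^sup>2 * b * r"
    proof -
      have "2 * (real A)\<^sup>2 * n = 2 * (real n + 1) * n * ((real D)\<^sup>2 * (real n + 1))"
        unfolding A_eq by (simp add: power2_eq_square algebra_simps)
      also have "\<dots> \<le> 4 * (real n)\<^sup>2 * ((real D)\<^sup>2 * (real n + 1))"
        using n1 by (intro mult_right_mono) (auto simp: power2_eq_square algebra_simps)
      also have "\<dots> \<le> 4 * (real n)\<^sup>2 * ((b * real q) * ((real D)\<^sup>2 * (real n + 1)))"
      proof (intro mult_left_mono)
        have "1 \<le> b * real q" using mult_mono[of 1 "real b" 1 "real q"] b1 q1 by simp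
        then have "1 * ((real D)\<^sup>2 * (real n + 1)) \<le> (b * real q) * ((real D)\<^sup>2 * (real n + 1))"
          by (rule mult_right_mono) simp
        then show "(real D)\<^sup>2 * (real n + 1) \<le> (b * real q) * ((real D)\<^sup>2 * (real n + 1))" by simp
      qed simp
      also have "\<dots> = 4 * (real n)\<^sup>2 * b * r" unfolding r_eq by (simp only: mult_ac)
      finally show ?thesis .
    qed
    have "80 * (real b)\<^sup>2 * (real D)\<^sup>2 * n = 80 / 9 * (real b * 9) * (real b * (real D)\<^sup>2 * n)"
      by (simp add: power2_eq_square)
    also have "\<dots> \<le> 80 / 9 * (4096 * real q * (real n + 1)) * (real b * (real D)\<^sup>2 * n)"
      using b9 by (intro mult_right_mono mult_left_mono) auto
    also have "\<dots> = (80 / 9 * 4096) * real n * (real b * r)" unfolding r_eq by (simp only: mult_ac)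
    also have "\<dots> \<le> 65532 * (real n)\<^sup>2 * (real b * r)"
      using n1 by (intro mult_right_mono mult_mono) (auto simp: power2_eq_square)
    finally have t2: "80 * (real b)\<^sup>2 * (real D)\<^sup>2 * n \<le> 65532 * (real n)\<^sup>2 * (real b * r)" .
    show "\<tau> \<le> 65536 * (real n)\<^sup>2 * b * r"
      unfolding \<tau>_def using t1 t2 by (simp add: algebra_simps)
  qed
  have N: "real (power_steps n) = 8388608 * real n ^ 3" by (simp add: power_steps_def)
  show "L * (8 * (2 * (real A)\<^sup>2 * n + 80 * (real b)\<^sup>2 * (real D)\<^sup>2 * n) * (ln m / power_steps n)) \<le> real b / 12"
    unfolding \<tau>_def[symmetric]
  proof -
    have "ln (real m) \<le> n" using ln_le_minus_one[of "real m"] m by simp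
    have "L * (8 * \<tau> * (ln m / power_steps n)) = 8 * (L * \<tau>) * (ln m / power_steps n)" by simp
    also have "\<dots> \<le> 8 * (65536 * (real n)\<^sup>2 * b) * (n / power_steps n)"
    proof (rule mult_mono)
      show "8 * (L * \<tau>) \<le> 8 * (65536 * (real n)\<^sup>2 * b)" using L\<tau> by (rule mult_left_mono) simp
      show "ln m / power_steps n \<le> n / power_steps n" using \<open>ln (real m) \<le> n\<close> by (intro divide_right_mono) auto
    qed (use m in auto)
    also have "\<dots> \<le> real b / 12" unfolding N using n1 b1 by (simp add: power2_eq_square power3_eq_cube field_simps)
    finally show "L * (8 * \<tau> * (ln m / power_steps n)) \<le> real b / 12" .
  qed
  have P: "real P = 2048 * (real n)\<^sup>2" by (simp add: move_bound_def)
  show "L * (2 * (2 * (real A)\<^sup>2 * n + 80 * (real b)\<^sup>2 * (real D)\<^sup>2 * n) * n / (real P)\<^sup>2) \<le> real b / 12"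
    unfolding \<tau>_def[symmetric]
  proof -
    have "L * (2 * \<tau> * n / (real P)\<^sup>2) = 2 * (L * \<tau>) * n / (real P)\<^sup>2" by simp
    also have "\<dots> \<le> 2 * (65536 * (real n)\<^sup>2 * b) * n / (real P)\<^sup>2"
      using L\<tau> by (intro divide_right_mono mult_right_mono mult_left_mono) auto
    also have "\<dots> \<le> real b / 12"
      unfolding P using n1 b1 by (simp add: power2_eq_square field_simps)
    finally show "L * (2 * \<tau> * n / (real P)\<^sup>2) \<le> real b / 12" .
  qed
qed

text \<open>Ensures that one move changes the exponents by at most 1, the range in which the
  quadratic bound on the hyperbolic cosine holds.\<close>

lemma small_moves:
  assumes m: "8 \<le> m" "m \<le> n" "q \<le> n" and b: "b = damp n q m"
  shows "L * (real A * (real n * real P)) + L * (2 * real b * (real n * real D * real P)) \<le> 1"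
    "v \<le> n * (real P)\<^sup>2 \<Longrightarrow> 0 \<le> v \<Longrightarrow> L * real b * v \<le> 1" "b \<le> 4096 * q * (n + 1)"
proof -
  have m1: "1 \<le> m" using m by simp
  note bd = damp_bounds[OF m1 m(2,3), folded b]
  have q1: "1 \<le> real q" using q_pos by linarith
  have n1: "1 \<le> real n" using n_pos by linarith
  have "b * 1 \<le> b * (m + 1)" by (intro mult_le_mono) auto
  with bd(1) show bB: "b \<le> 4096 * q * (n + 1)" by simp
  then have "real b \<le> real (4096 * q * (n + 1))" by (simp only: of_nat_le_iff)
  then have b': "real b \<le> 4096 * real q * (real n + 1)" by (simp add: algebra_simps)
  have b9: "real b * 9 \<le> 4096 * real q * (real n + 1)"
  proof -
    have "b * 9 \<le> b * (m + 1)" using m by (intro mult_le_mono) auto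
    also have "\<dots> \<le> 4096 * q * (n + 1)" by (rule bd(1))
    finally have "real (b * 9) \<le> real (4096 * q * (n + 1))" by (simp only: of_nat_le_iff)
    then show ?thesis by (simp add: algebra_simps)
  qed
  have D: "real D = 8192 * (real n * real P)" by (simp add: radius_def)
  have nP: "0 \<le> real n * real P" by simp
  have "L * (real A * (real n * real P)) \<le> 1 / 8192"
  proof (rule L_mult_le)
    have "real A * (real n * real P) = 1 * (real n + 1) * (real D)\<^sup>2 / 8192"
      unfolding A_eq D by (simp add: power2_eq_square)
    also have "\<dots> \<le> real q * (real n + 1) * (real D)\<^sup>2 / 8192"
      using q1 by (intro divide_right_mono mult_right_mono) auto
    finally show "real A * (real n * real P) \<le> 1 / 8192 * real r" unfolding r_eq by (simp add: mult_ac)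
  qed simp
  moreover have "L * (2 * real b * (real n * real D * real P)) \<le> 1 / 9"
  proof (rule L_mult_le)
    have "2 * real b * (real n * real D * real P) = (real b * 9) * (2 / 9) * (real D)\<^sup>2 / 8192"
      unfolding D by (simp add: power2_eq_square)
    also have "\<dots> \<le> (4096 * real q * (real n + 1)) * (2 / 9) * (real D)\<^sup>2 / 8192"
      using b9 by (intro divide_right_mono mult_right_mono) auto
    also have "\<dots> = 1 / 9 * real r" unfolding r_eq by simp
    finally show "2 * real b * (real n * real D * real P) \<le> 1 / 9 * real r" .
  qed simp
  ultimately show "L * (real A * (real n * real P)) + L * (2 * real b * (real n * real D * real P)) \<le> 1"
    by linarith
  show "L * real b * v \<le> 1" if "v \<le> n * (real P)\<^sup>2" "0 \<le> v"
  proof -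
    have "L * (real b * v) \<le> 1"
    proof (rule L_mult_le)
      have "real n * (real P)\<^sup>2 \<le> (real n * real P)\<^sup>2" using n1 
        using mult_right_mono[of 1 "real n" "real n * (real P)\<^sup>2"] by (simp add: power2_eq_square mult_ac)
      then have "v \<le> (real D)\<^sup>2 / 8192\<^sup>2" using that(1) unfolding D by (simp add: power_mult_distrib)
      then have "real b * v \<le> (4096 * real q * (real n + 1)) * ((real D)\<^sup>2 / 8192\<^sup>2)"
        using b' that(2) by (intro mult_mono) auto
      also have "\<dots> \<le> 1 * real r" unfolding r_eq by (simp add: field_simps)
      finally show "real b * v \<le> 1 * real r" .
    qed (use that in auto)
    then show ?thesis by (simp add: mult.assoc)
  qed
qed

end

section \<open>Existence of a move that lowers the potential\<close>

context walk
begin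

text \<open>The outcome of the packing argument as a property of the matrix; the walk relies on
  nothing else about shattering.\<close>

definition near_net :: bool where
  "near_net \<longleftrightarrow> (\<forall>Y\<subseteq>{..<n}. 4 \<le> card Y \<longrightarrow> (\<exists>N. N \<subseteq> Pow Y \<and> 4 * card N \<le> card Y \<and>
     (\<forall>j<k. \<exists>T\<in>N. card (sym_diff {i \<in> Y. a j i = 1} T) \<le> q\<^sup>2)))"

lemma alive_set_subset: "alive_set Z \<subseteq> {..<n}"
  by (auto simp: alive_set_def)

lemma card_alive_set: "card (alive_set Z) \<le> n"
  using card_mono[OF _ alive_set_subset[of Z]] by simp

text \<open>The vectors Z and D join the net members as constraints, so that the energy has no
  first-order change either. With up to m/4 net members, 2 (m/4 + 2) \<le> m holds from m = 8
  on.\<close>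

lemma good_direction:
  assumes net: near_net and m: "m = card (alive_set Z)" "8 \<le> m" and \<delta>: "\<delta> = min ((real q)\<^sup>2) m"
  obtains u where "0 < dot (alive_set Z) u u"
    "dot (alive_set Z) (\<lambda>i. real (Z i)) u = 0" "dot (alive_set Z) (\<lambda>i. real D) u = 0"
    "(\<Sum>j<k. real (weight n q (a j) b Z) * (dot (alive_set Z) (\<lambda>i. real (a j i)) u)\<^sup>2)
      \<le> 2 * \<delta> / m * pot b Z * dot (alive_set Z) u u"
proof -
  let ?Y = "alive_set Z"
  have fin: "finite ?Y" by (rule finite_alive_set)
  have cardsum: "(\<Sum>i\<in>?Y. of_bool (i \<in> S)) = real (card (?Y \<inter> S))" for S
    using fin by (simp add: of_bool_def sum.If_cases Int_def)
  obtain N where N: "N \<subseteq> Pow ?Y" "4 * card N \<le> m"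
    "\<And>j. j < k \<Longrightarrow> \<exists>T\<in>N. card (sym_diff {i \<in> ?Y. a j i = 1} T) \<le> q\<^sup>2"
    using net[unfolded near_net_def, rule_format, OF alive_set_subset[of Z]] m by auto
  have "finite N" using N(1) fin finite_subset by blast
  then obtain Ns where Ns: "set Ns = N" "distinct Ns" using finite_distinct_list by blast
  have lenNs: "length Ns = card N" using Ns distinct_card by fastforce
  define cs where "cs = map (\<lambda>T i. of_bool (i \<in> T) :: real) Ns @ [\<lambda>i. real (Z i), \<lambda>i. real D]"
  have len: "2 * length cs \<le> card ?Y"
    using N(2) m lenNs by (simp add: cs_def)
  have near: "\<exists>c\<in>set cs. dot ?Y (\<lambda>i. real (a j i) - c i) (\<lambda>i. real (a j i) - c i) \<le> \<delta>" if "j \<in> {..<k}" for j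
  proof -
    obtain T where T: "T \<in> N" "card (sym_diff {i \<in> ?Y. a j i = 1} T) \<le> q\<^sup>2"
      using N(3) \<open>j \<in> {..<k}\<close> by blast
    have TY: "T \<subseteq> ?Y" using T(1) N(1) by blast
    have eq: "(real (a j i) - of_bool (i \<in> T)) * (real (a j i) - of_bool (i \<in> T))
        = of_bool (i \<in> sym_diff {i \<in> ?Y. a j i = 1} T)" if "i \<in> ?Y" for i
      using that a_le[of j i] by (cases "a j i") auto
    have "dot ?Y (\<lambda>i. real (a j i) - of_bool (i \<in> T)) (\<lambda>i. real (a j i) - of_bool (i \<in> T))
        = (\<Sum>i\<in>?Y. of_bool (i \<in> sym_diff {i \<in> ?Y. a j i = 1} T))"
      unfolding dot_def by (rule sum.cong[OF refl eq])
    also have "\<dots> = card (?Y \<inter> sym_diff {i \<in> ?Y. a j i = 1} T)"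
      by (rule cardsum)
    also have "?Y \<inter> sym_diff {i \<in> ?Y. a j i = 1} T = sym_diff {i \<in> ?Y. a j i = 1} T" using TY by blast
    also have "real (card \<dots>) \<le> \<delta>"
    proof -
      have "real (card (sym_diff {i \<in> ?Y. a j i = 1} T)) \<le> real (q\<^sup>2)" using T(2) by (simp only: of_nat_le_iff)
      moreover have "sym_diff {i \<in> ?Y. a j i = 1} T \<subseteq> ?Y" using TY by blast
      then have "card (sym_diff {i \<in> ?Y. a j i = 1} T) \<le> m" unfolding m(1) by (rule card_mono[OF fin])
      ultimately show ?thesis by (simp add: \<delta>)
    qed
    finally show ?thesis using T(1) Ns(1) by (intro bexI[of _ "\<lambda>i. of_bool (i \<in> T)"]) (auto simp: cs_def)
  qed
  have "?Y \<noteq> {}" using m by auto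
  have wn: "0 \<le> real (weight n q (a j) b Z)" if "j \<in> {..<k}" for j by simp
  show thesis
  proof (rule low_energy_direction[where w = "\<lambda>j. real (weight n q (a j) b Z)", OF fin \<open>?Y \<noteq> {}\<close> wn len near])
    fix u assume u: "0 < dot ?Y u u" "\<And>c. c \<in> set cs \<Longrightarrow> dot ?Y c u = 0"
      "(\<Sum>j<k. real (weight n q (a j) b Z) * (dot ?Y (\<lambda>i. real (a j i)) u)\<^sup>2)
        \<le> 2 * \<delta> / card ?Y * (\<Sum>j<k. real (weight n q (a j) b Z)) * dot ?Y u u"
    have "dot ?Y (\<lambda>i. real (Z i)) u = 0" "dot ?Y (\<lambda>i. real D) u = 0"
      by (rule u(2), simp add: cs_def)+
    with u(1,3) show thesis by (intro that[of u]) (simp_all add: pot_def m(1))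
  qed
qed

text \<open>The direction from the net is never computed: its existence only shows that power
  iteration from some unit vector yields an integer move of small form. The decrease is L b |V|^2 /
  4, where L \<ge> 1/(2 r) and both b and |V|^2 are at least 1.\<close>

lemma good_candidate:
  assumes net: near_net and Z: "inside Z" and q: "q \<le> n"
    and m: "m = card (alive_set Z)" "8 \<le> m" and b: "b = damp n q m"
  obtains x Z' where "x < n"
    "Z' = cand Z (fst (iter b Z x (power_steps n))) (snd (iter b Z x (power_steps n)))
      \<or> Z' = cand Z (snd (iter b Z x (power_steps n))) (fst (iter b Z x (power_steps n)))"
    "real (pot b Z') \<le> (1 - 1 / (8 * real r)) * pot b Z"
proof -
  let ?Y = "alive_set Z" and ?N = "power_steps n"
  interpret F: shifted_form ?Y "{..<Suc (Suc k)}" "form_weight b Z" "form_vec Z" "level b Z"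
    by (rule shifted_form_alive[OF Z])
  have mn: "m \<le> n" using card_alive_set m by simp
  have n1: "8 \<le> real n" using m(2) mn by linarith
  have m0: "0 < real m" using m(2) by linarith
  define W where "W = real (pot b Z)"
  have W0: "0 < W" using pot_pos by (simp add: W_def)
  define \<delta> where "\<delta> = min ((real q)\<^sup>2) m"
  have \<delta>: "0 \<le> \<delta>" "\<delta> \<le> (real q)\<^sup>2" "\<delta> \<le> m" by (auto simp: \<delta>_def)
  define \<tau>0 where "\<tau>0 = 2 * (real A)\<^sup>2 * n + 80 * (real b)\<^sup>2 * (real D)\<^sup>2 * n"
  have lev: "real (level b Z) = W * \<tau>0" by (simp add: level_def W_def \<tau>0_def)
  have "0 < A" using D_pos by (simp add: slope_def)
  then have A0: "0 < real A" by (simp only: of_nat_0_less_iff)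
  have \<tau>0: "2 * (real A)\<^sup>2 * n \<le> \<tau>0" "0 < 2 * (real A)\<^sup>2 * n" using A0 n1 by (auto simp: \<tau>0_def)
  define \<epsilon> where "\<epsilon> = 4 * (real A)\<^sup>2 * \<delta> / m * W"
  have \<epsilon>0: "0 \<le> \<epsilon>" using \<delta> W0 by (simp add: \<epsilon>_def)
  define \<kappa> where "\<kappa> = 2 * \<epsilon> / level b Z + ln (card ?Y) / ?N"
  have N: "real ?N = 8388608 * real n ^ 3" by (simp add: power_steps_def)
  have \<kappa>1: "\<kappa> < 1"
  proof -
    have "2 * \<epsilon> / level b Z = 8 * (real A)\<^sup>2 * (\<delta> / m) / \<tau>0" using W0 by (simp add: \<epsilon>_def lev)
    also have "\<dots> \<le> 8 * (real A)\<^sup>2 * 1 / (2 * (real A)\<^sup>2 * n)"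
      using \<delta> m0 \<tau>0 by (intro frac_le mult_left_mono) auto
    also have "\<dots> = 4 / n" using A0 by simp
    also have "\<dots> \<le> 1 / 2" using n1 by (simp add: field_simps)
    finally have 1: "2 * \<epsilon> / level b Z \<le> 1 / 2" .
    have "ln (real m) \<le> n" using ln_le_minus_one[OF m0] mn by simp
    then have "ln (real m) / ?N \<le> n / ?N" by (intro divide_right_mono) auto
    also have "\<dots> = 1 / (8388608 * (real n)\<^sup>2)" unfolding N using n1 by (simp add: power2_eq_square power3_eq_cube)
    also have "\<dots> < 1 / 2"
    proof -
      have "1 * 1 \<le> real n * real n" using n1 by (intro mult_mono) auto
      then show ?thesis by (simp add: power2_eq_square field_simps)
    qed
    finally have "ln (real m) / ?N < 1 / 2" .
    with 1 show ?thesis unfolding \<kappa>_def m(1)[symmetric] by linarith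
  qed
  obtain u where u: "0 < dot ?Y u u" "dot ?Y (\<lambda>i. real (Z i)) u = 0" "dot ?Y (\<lambda>i. real D) u = 0"
    "(\<Sum>j<k. real (weight n q (a j) b Z) * (dot ?Y (\<lambda>i. real (a j i)) u)\<^sup>2) \<le> 2 * \<delta> / m * W * dot ?Y u u"
    using good_direction[OF net m \<delta>_def, of b] unfolding W_def by blast
  have "F.form u \<le> \<epsilon> * dot ?Y u u"
  proof -
    have "F.form u = 2 * (real A)\<^sup>2 * (\<Sum>j<k. real (weight n q (a j) b Z) * (dot ?Y (\<lambda>i. real (a j i)) u)\<^sup>2)"
      unfolding F.form_def sum_form[where f = "\<lambda>v. (dot ?Y v u)\<^sup>2"] using u by simp
    also have "\<dots> \<le> 2 * (real A)\<^sup>2 * (2 * \<delta> / m * W * dot ?Y u u)"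
      by (rule mult_left_mono[OF u(4)]) simp
    finally show ?thesis by (simp add: \<epsilon>_def mult_ac)
  qed
  moreover have "0 < ?N" using n_pos by (simp add: power_steps_def)
  ultimately obtain x where x: "x \<in> ?Y" "0 < dot ?Y ((F.shift ^^ ?N) (unit_vec x)) ((F.shift ^^ ?N) (unit_vec x))"
    "F.form ((F.shift ^^ ?N) (unit_vec x))
      \<le> level b Z * \<kappa> * dot ?Y ((F.shift ^^ ?N) (unit_vec x)) ((F.shift ^^ ?N) (unit_vec x))"
    using F.power_iteration[OF u(1) _ \<epsilon>0 _ \<kappa>_def \<kappa>1] by blast
  define p where "p = fst (iter b Z x ?N)"
  define p' where "p' = snd (iter b Z x ?N)"
  define v where "v i = real (p i) - real (p' i)" for i
  have vs: "v i = (F.shift ^^ ?N) (unit_vec x) i" if "i \<in> ?Y" for i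
    unfolding v_def p_def p'_def by (rule iter_shift[OF Z x(1) that])
  have off: "p i = p' i" if "i < n" "i \<notin> ?Y" for i
    unfolding p_def p'_def using iter_off[OF that] by simp
  have vv: "0 < dot ?Y v v"
    using x(2) dot_cong[of ?Y v "(F.shift ^^ ?N) (unit_vec x)" v "(F.shift ^^ ?N) (unit_vec x)", OF vs vs] by simp
  have fv: "F.form v \<le> level b Z * \<kappa> * dot ?Y v v"
  proof -
    have "dot ?Y c v = dot ?Y c ((F.shift ^^ ?N) (unit_vec x))" for c by (rule dot_cong) (simp_all add: vs)
    then have "F.form v = F.form ((F.shift ^^ ?N) (unit_vec x))" by (simp add: F.form_def)
    then show ?thesis using x(3) dot_cong[of ?Y v "(F.shift ^^ ?N) (unit_vec x)" v "(F.shift ^^ ?N) (unit_vec x)", OF vs vs] by simp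
  qed
  have vpos: "0 < vmax p p'"
  proof -
    have "\<exists>i\<in>?Y. v i \<noteq> 0" using vv dot_self_eq_0[OF finite_alive_set, of Z v] by auto
    then obtain i where "i \<in> ?Y" "p i \<noteq> p' i" by (auto simp: v_def)
    then show ?thesis using vmax_ge[of i p p'] alive_set_subset[of Z] by fastforce
  qed
  define V where "V i = real_of_int (rounded p p' i)" for i
  define g where "g = P / vmax p p'"
  \<comment> \<open>The rounding error, at most 1 per coordinate. The form of \<open>V\<close> is
    bounded by twice the sum of the forms of the scaled iterate and of the error.\<close>
  define e where "e i = g * v i - V i" for i
  have e1: "\<bar>e i\<bar> \<le> 1" for i
    using rounded_close[OF vpos, of i] by (simp add: e_def g_def v_def V_def)
  have Voff: "V i = 0" if "i < n" "i \<notin> ?Y" for i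
    using rounded_zero[of p i p', OF off[OF that]] by (simp add: V_def)
  define v2 where "v2 = (\<Sum>i<n. (V i)\<^sup>2)"
  have v2: "dot ?Y V V = v2"
    unfolding v2_def dot_def power2_eq_square[symmetric]
    by (intro sum.mono_neutral_left) (auto simp: Voff alive_set_subset)
  have ee: "dot ?Y e e \<le> n"
  proof -
    have "dot ?Y e e \<le> (\<Sum>i\<in>?Y. 1)"
      unfolding dot_def power2_eq_square[symmetric]
      by (intro sum_mono) (use e1 abs_le_square_iff[of _ "1 :: real"] in auto)
    then show ?thesis using mn m(1) by simp
  qed
  have P2: "(real P)\<^sup>2 \<le> v2"
  proof -
    obtain i where i: "i < n" "\<bar>rounded p p' i\<bar> = P" using rounded_attains[OF vpos] by blast
    then have "\<bar>V i\<bar> = real P" unfolding V_def by linarith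
    then have "(real P)\<^sup>2 = (V i)\<^sup>2" by (metis power2_abs)
    also have "\<dots> \<le> v2" unfolding v2_def using i(1) by (intro member_le_sum) auto
    finally show ?thesis .
  qed
  have nP: "real n \<le> (real P)\<^sup>2"
  proof -
    have "n * 1 \<le> n * (2048\<^sup>2 * n ^ 3)" using n_pos by (intro mult_le_mono2) simp
    also have "\<dots> = P\<^sup>2" by (simp add: move_bound_def power2_eq_square power3_eq_cube mult_ac)
    finally show ?thesis by (metis mult_1_right of_nat_le_iff of_nat_power)
  qed
  have P0: "0 < (real P)\<^sup>2" using P_pos by simp
  \<comment> \<open>|g v|^2 \<le> 2 |V|^2 + 2 |e|^2, and |e|^2 \<le> n \<le> P^2 \<le>
    |V|^2.\<close>
  have gv: "dot ?Y (\<lambda>i. g * v i) (\<lambda>i. g * v i) \<le> 4 * v2"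
  proof -
    have "dot ?Y (\<lambda>i. g * v i) (\<lambda>i. g * v i) \<le> (\<Sum>i\<in>?Y. 2 * (V i * V i) + 2 * (e i * e i))"
      unfolding dot_def
    proof (rule sum_mono)
      fix i
      have "(y + z) * (y + z) \<le> 2 * (y * y) + 2 * (z * z)" for y z :: real
        using zero_le_square[of "y - z"] by (simp add: algebra_simps)
      from this[of "V i" "e i"] show "g * v i * (g * v i) \<le> 2 * (V i * V i) + 2 * (e i * e i)" by (simp add: e_def)
    qed
    also have "\<dots> = 2 * dot ?Y V V + 2 * dot ?Y e e" by (simp add: dot_def sum.distrib sum_distrib_left)
    also have "\<dots> \<le> 4 * v2" using v2 ee nP P2 by linarith
    finally show ?thesis .
  qed
  have \<kappa>0: "0 \<le> level b Z * \<kappa>"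
    using \<epsilon>0 m0 m(1) m(2) by (intro mult_nonneg_nonneg) (auto simp: \<kappa>_def intro!: add_nonneg_nonneg divide_nonneg_nonneg)
  have fV: "F.form V \<le> 8 * (level b Z * \<kappa>) * v2 + 2 * level b Z * (n * v2 / (real P)\<^sup>2)"
  proof -
    have "F.form V \<le> 2 * F.form (\<lambda>i. g * v i) + 2 * F.form e"
      unfolding F.form_def sum_distrib_left sum.distrib[symmetric]
    proof (rule sum_mono)
      fix c
      have d: "dot ?Y (form_vec Z c) V = dot ?Y (form_vec Z c) (\<lambda>i. g * v i) - dot ?Y (form_vec Z c) e"
        unfolding dot_diff(2)[symmetric] by (simp add: e_def)
      have "(y - z)\<^sup>2 \<le> 2 * y\<^sup>2 + 2 * z\<^sup>2" for y z :: real
        using zero_le_power2[of "y + z"] by (simp add: power2_eq_square algebra_simps)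
      then have "form_weight b Z c * (dot ?Y (form_vec Z c) V)\<^sup>2 \<le> form_weight b Z c *
          (2 * (dot ?Y (form_vec Z c) (\<lambda>i. g * v i))\<^sup>2 + 2 * (dot ?Y (form_vec Z c) e)\<^sup>2)"
        unfolding d by (intro mult_left_mono) (auto simp: form_weight_def)
      then show "form_weight b Z c * (dot ?Y (form_vec Z c) V)\<^sup>2 \<le>
          2 * (form_weight b Z c * (dot ?Y (form_vec Z c) (\<lambda>i. g * v i))\<^sup>2) +
          2 * (form_weight b Z c * (dot ?Y (form_vec Z c) e)\<^sup>2)" by (simp add: algebra_simps)
    qed
    also have "F.form (\<lambda>i. g * v i) = g\<^sup>2 * F.form v"
      unfolding F.form_def dot_scale
      by (simp add: sum_distrib_left power_mult_distrib mult_ac del: sum.lessThan_Suc)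
    also have "g\<^sup>2 * F.form v \<le> g\<^sup>2 * (level b Z * \<kappa> * dot ?Y v v)" using fv by (rule mult_left_mono) simp
    also have "\<dots> = level b Z * \<kappa> * dot ?Y (\<lambda>i. g * v i) (\<lambda>i. g * v i)"
      unfolding dot_scale by (simp add: power2_eq_square mult_ac)
    also have "\<dots> \<le> level b Z * \<kappa> * (4 * v2)" using gv \<kappa>0 by (rule mult_left_mono)
    also have "F.form e \<le> level b Z * dot ?Y e e" by (rule F.form_le)
    also have "level b Z * dot ?Y e e \<le> level b Z * (n * v2 / (real P)\<^sup>2)"
    proof (rule mult_left_mono)
      have "real n * (real P)\<^sup>2 \<le> n * v2" using P2 by (rule mult_left_mono) simp
      then have "real n \<le> n * v2 / (real P)\<^sup>2" using P0 by (simp add: field_simps)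
      with ee show "dot ?Y e e \<le> n * v2 / (real P)\<^sup>2" by linarith
    qed simp
    finally show ?thesis by simp
  qed
  have v20: "0 \<le> v2" using P2 P0 by linarith
  have LF: "L * F.form V \<le> W * (b / 4) * v2"
  proof -
    have k: "8 * (level b Z * \<kappa>) = 16 * \<epsilon> + 8 * (W * \<tau>0) * (ln m / ?N)"
    proof -
      have "level b Z * \<kappa> = 2 * \<epsilon> + level b Z * (ln m / ?N)"
        using level_pos[of b Z] m(1) by (simp add: \<kappa>_def distrib_left)
      then show ?thesis by (simp add: lev)
    qed
    have "L * F.form V \<le> L * (8 * (level b Z * \<kappa>) * v2 + 2 * level b Z * (n * v2 / (real P)\<^sup>2))"
      using fV L_pos by (intro mult_left_mono) auto
    also have "\<dots> = W * (L * (64 * (real A)\<^sup>2 * \<delta> / m) + L * (8 * \<tau>0 * (ln m / ?N))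
         + L * (2 * \<tau>0 * n / (real P)\<^sup>2)) * v2"
      unfolding k unfolding \<epsilon>_def by (simp add: algebra_simps lev)
    also have "\<dots> \<le> W * (b / 12 + b / 12 + b / 12) * v2"
      using error_terms[OF m(2) mn q b \<delta>(2)] W0 v20 unfolding \<tau>0_def
      by (intro mult_right_mono mult_left_mono add_mono) auto
    finally show ?thesis by simp
  qed
  have bd: "1 \<le> real b" using damp_bounds(2)[of m] m mn q b by simp
  have qf: "quad b Z V = F.form V" by (rule quad_eq_form[OF Z Voff])
  have in1: "inside (cand Z p p')" "inside (cand Z p' p)"
  proof -
    have "cand Z p p' i \<le> 2 * D \<and> cand Z p' p i \<le> 2 * D" if "i < n" for i
    proof -
      have Zi: "Z i \<le> 2 * D" using Z that by (simp add: inside_def)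
      show ?thesis 
        using cand_eq(2)[of i Z p p', OF that Zi off[OF that]] cand_eq(4)[of i Z p p', OF that Zi off[OF that]] by simp
    qed
    then show "inside (cand Z p p')" "inside (cand Z p' p)" by (auto simp: inside_def)
  qed
  have v2n: "v2 \<le> n * (real P)\<^sup>2"
  proof -
    have "v2 \<le> (\<Sum>i<n. (real P)\<^sup>2)"
      unfolding v2_def
    proof (rule sum_mono)
      fix i assume "i \<in> {..<n}"
      then have "\<bar>V i\<bar> \<le> \<bar>real P\<bar>" using rounded_abs_le[of i p p'] unfolding V_def by simp
      then show "(V i)\<^sup>2 \<le> (real P)\<^sup>2" by (simp only: abs_le_square_iff)
    qed
    then show ?thesis by simp
  qed
  have "min (real (pot b (cand Z p p'))) (pot b (cand Z p' p)) \<le> (1 - L * real b * v2 / 4) * pot b Z"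
  proof (rule pot_average[OF Z in1 small_moves(3)[OF m(2) mn q b] q])
    show "int (cand Z p p' i) = int (Z i) + rounded p p' i" "int (cand Z p' p i) = int (Z i) - rounded p p' i"
      "\<bar>rounded p p' i\<bar> \<le> P" if "i < n" for i
    proof -
      have Zi: "Z i \<le> 2 * D" using Z that by (simp add: inside_def)
      show "int (cand Z p p' i) = int (Z i) + rounded p p' i"
        by (rule cand_eq(1)[of i Z p p', OF that Zi off[OF that]])
      show "int (cand Z p' p i) = int (Z i) - rounded p p' i"
        by (rule cand_eq(3)[of i Z p p', OF that Zi off[OF that]])
      show "\<bar>rounded p p' i\<bar> \<le> P" by (rule rounded_abs_le[OF that])
    qed
    show "v2 = (\<Sum>i<n. (real_of_int (rounded p p' i))\<^sup>2)" by (simp add: v2_def V_def)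
    show "L * real b * v2 \<le> 1" using small_moves(2)[OF m(2) mn q b v2n] P2 P0 by linarith
    have "L * (L * F.form V) \<le> L * (W * (b / 4) * v2)" using LF L_pos by (intro mult_left_mono) auto
    then show "L\<^sup>2 * quad b Z (\<lambda>i. real_of_int (rounded p p' i)) \<le> pot b Z * (L * real b * v2) / 4"
      using qf unfolding V_def[abs_def] W_def by (simp add: power2_eq_square mult_ac)
  qed (rule small_moves(1)[OF m(2) mn q b])
  also have "\<dots> \<le> (1 - 1 / (8 * real r)) * pot b Z"
  proof (intro mult_right_mono diff_left_mono)
    have v21: "1 \<le> v2" using nP P2 n1 by linarith
    have "1 / (2 * real r) * 1 * 1 \<le> L * real b * v2"
      using L_ge L_pos bd v21 by (intro mult_mono) auto
    then show "1 / (8 * real r) \<le> L * real b * v2 / 4" by simp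
  qed simp
  finally have "real (pot b (cand Z p p')) \<le> (1 - 1 / (8 * real r)) * pot b Z
      \<or> real (pot b (cand Z p' p)) \<le> (1 - 1 / (8 * real r)) * pot b Z" by linarith
  moreover have "x < n" using x(1) by (simp add: alive_set_def)
  ultimately show thesis using that unfolding p_def p'_def by blast
qed

end

text \<open>A round with enough live coordinates loses a factor 1 - 1/(8 r), and the potential can
  shrink by a factor exp(4096 n) at most, so 8 * 4096 n r rounds and one more suffice. The base for
  q = n serves all smaller q.\<close>

definition rounds :: "nat \<Rightarrow> nat" where "rounds n = 32768 * n * res_base n n + 1"

text \<open>Summation by parts. The weight j + 2 is the bound on the slack, in units of D^2, with j
  live coordinates.\<close>

lemma Abel_damping:
  fixes f :: "nat \<Rightarrow> real"
  shows "(\<Sum>j<n. (real j + 2) * (f j - f (Suc j))) + (real n + 1) * f n = f 0 + (\<Sum>j<n. f j)"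
  by (induction n) (simp_all add: algebra_simps)

lemma harm_le_ln:
  assumes "0 < n"
  shows "harm n \<le> 1 + ln (real n)"
proof -
  obtain m where m: "n = Suc m" using assms by (cases n) auto
  have "harm (Suc m) - ln (real (Suc m)) \<le> harm (Suc 0) - ln (real (Suc 0))"
    using decseq_harm_diff_ln unfolding decseq_def by blast
  then show ?thesis by (simp add: m harm_def)
qed

section \<open>Freezing, accumulated damping and the final deviations\<close>

context walk
begin

text \<open>The specification of one step of the program: the new point is the best among the old
  one and all candidates. Because standing still is allowed, the potential does not increase even
  for a q without a net.\<close>

definition step_ok :: "(nat \<Rightarrow> nat) \<Rightarrow> (nat \<Rightarrow> nat) \<Rightarrow> bool" where
  "step_ok Z Z' \<longleftrightarrow> (\<exists>b it. b = damp n q (live n Z) \<and> it = (\<lambda>x. iter b Z x (power_steps n)) \<and>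
     ((\<forall>i<n. Z' i = Z i) \<or>
      (\<exists>x<n. (\<forall>i<n. Z' i = cand Z (fst (it x)) (snd (it x)) i) \<or> (\<forall>i<n. Z' i = cand Z (snd (it x)) (fst (it x)) i))) \<and>
     pot b Z' \<le> pot b Z \<and>
     (\<forall>x<n. pot b Z' \<le> pot b (cand Z (fst (it x)) (snd (it x))) \<and> pot b Z' \<le> pot b (cand Z (snd (it x)) (fst (it x)))))"

abbreviation "dmp Z \<equiv> damp n q (live n Z)"

lemma step_moves:
  assumes "step_ok Z Z'" "inside Z"
  shows "inside Z'" "alive_set Z' \<subseteq> alive_set Z"
proof -
  have "Z' i \<le> 2 * D \<and> (i \<notin> alive_set Z \<longrightarrow> Z' i = Z i)" if i: "i < n" for i
  proof -
    have Zi: "Z i \<le> 2 * D" using assms(2) i by (simp add: inside_def)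
    have c: "cand Z p m i \<le> 2 * D \<and> (i \<notin> alive_set Z \<longrightarrow> cand Z p m i = Z i)"
      if "i \<notin> alive_set Z \<Longrightarrow> p i = m i" for p m
      using cand_eq(2)[of i Z p m, OF i Zi that] that by (auto simp: cand_def)
    have o: "fst (iter b Z x t) i = snd (iter b Z x t) i" if "i \<notin> alive_set Z" for b x t
      using iter_off[OF i that] by simp
    have c1: "cand Z (fst (iter b Z x t)) (snd (iter b Z x t)) i \<le> 2 * D
        \<and> (i \<notin> alive_set Z \<longrightarrow> cand Z (fst (iter b Z x t)) (snd (iter b Z x t)) i = Z i)" for b x t
      by (rule c) (rule o)
    have c2: "cand Z (snd (iter b Z x t)) (fst (iter b Z x t)) i \<le> 2 * D
        \<and> (i \<notin> alive_set Z \<longrightarrow> cand Z (snd (iter b Z x t)) (fst (iter b Z x t)) i = Z i)" for b x t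
      by (rule c) (rule o[symmetric])
    from assms(1) obtain b it where "it = (\<lambda>x. iter b Z x (power_steps n))" and
      "(\<forall>i<n. Z' i = Z i) \<or>
      (\<exists>x<n. (\<forall>i<n. Z' i = cand Z (fst (it x)) (snd (it x)) i) \<or> (\<forall>i<n. Z' i = cand Z (snd (it x)) (fst (it x)) i))"
      unfolding step_ok_def by blast
    then show ?thesis
      using c1 c2 Zi i by (elim disjE exE conjE) simp_all
  qed
  then have *: "Z' i \<le> 2 * D" "i \<notin> alive_set Z \<Longrightarrow> Z' i = Z i" if "i < n" for i using that by auto
  then show "inside Z'" by (simp add: inside_def)
  show "alive_set Z' \<subseteq> alive_set Z"
  proof
    fix i assume i: "i \<in> alive_set Z'"
    then have "i < n" by (simp add: alive_set_def)
    show "i \<in> alive_set Z"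
    proof (rule ccontr)
      assume "i \<notin> alive_set Z"
      with *(2)[OF \<open>i < n\<close> this] i show False by (simp add: alive_set_def)
    qed
  qed
qed

lemma damp_le: "damp n q m \<le> 4096 * q * (n + 1)"
  by (simp add: damp_def div_le_dividend del: mult_Suc_right)

lemma damp_antimono: "m' \<le> m \<Longrightarrow> damp n q m \<le> damp n q m'"
  unfolding damp_def by (intro div_le_mono2) auto

text \<open>The potential without damping and scaling. It equals 2 k at the centre and is never
  smaller, the hyperbolic cosine being at least 1.\<close>

definition amp :: "(nat \<Rightarrow> nat) \<Rightarrow> real" where
  "amp Z = (\<Sum>j<k. exp (L * (real A * dev Z j)) + exp (- (L * (real A * dev Z j))))"

lemma pot_eq:
  assumes "inside Z" "b \<le> 4096 * q * (n + 1)" "q \<le> n"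
  shows "real (pot b Z) = scale * exp (- (L * (real b * en Z))) * amp Z"
proof -
  have "real (pot b Z) = (\<Sum>j<k. scale * exp (- (L * (real b * en Z))) *
      (exp (L * (real A * dev Z j)) + exp (- (L * (real A * dev Z j)))))"
    unfolding pot_def of_nat_sum weight_eq[OF assms]
    by (intro sum.cong refl) (simp add: exp_add[symmetric] distrib_left algebra_simps)
  then show ?thesis by (simp add: amp_def sum_distrib_left)
qed

lemma amp_ge: "2 * real k \<le> amp Z"
proof -
  have "2 \<le> exp y + exp (- y)" for y :: real
    using exp_ge_add_one_self[of y] exp_ge_add_one_self[of "- y"] by linarith
  then have "(\<Sum>j<k. 2) \<le> amp Z" unfolding amp_def by (intro sum_mono)
  then show ?thesis by simp
qed

lemma amp_pos: "0 < amp Z"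
  using amp_ge[of Z] k_pos by (simp add: less_le_trans)

lemma L_base_le: "L * (real (4096 * q * (n + 1)) * (real D)\<^sup>2) \<le> 4096"
proof (rule L_mult_le)
  show "real (4096 * q * (n + 1)) * (real D)\<^sup>2 \<le> 4096 * real r"
    unfolding r_eq by (simp add: algebra_simps)
qed simp

lemma damping_le:
  assumes "inside Z" "b \<le> 4096 * q * (n + 1)"
  shows "L * (real b * en Z) \<le> 4096 * n"
proof -
  have "real b * en Z \<le> real (4096 * q * (n + 1)) * (n * (real D)\<^sup>2)"
    using assms(2) en_le[OF assms(1)] en_nonneg by (intro mult_mono) (simp_all only: of_nat_le_iff of_nat_0_le_iff)
  then have "L * (real b * en Z) \<le> L * (real (4096 * q * (n + 1)) * (n * (real D)\<^sup>2))"
    using L_pos by (intro mult_left_mono) auto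
  also have "\<dots> = n * (L * (real (4096 * q * (n + 1)) * (real D)\<^sup>2))" by (simp only: mult_ac)
  also have "\<dots> \<le> real n * 4096" using L_base_le by (intro mult_left_mono) auto
  finally show ?thesis by simp
qed

lemma step_progress:
  assumes "near_net" "q \<le> n" "inside Z" "step_ok Z Z'" "8 \<le> live n Z"
  shows "real (pot (dmp Z) Z') \<le> (1 - 1 / (8 * real r)) * pot (dmp Z) Z"
proof -
  obtain x Z'' where x: "x < n"
    "Z'' = cand Z (fst (iter (dmp Z) Z x (power_steps n))) (snd (iter (dmp Z) Z x (power_steps n)))
      \<or> Z'' = cand Z (snd (iter (dmp Z) Z x (power_steps n))) (fst (iter (dmp Z) Z x (power_steps n)))"
    "real (pot (dmp Z) Z'') \<le> (1 - 1 / (8 * real r)) * pot (dmp Z) Z"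
    using good_candidate[OF assms(1,3,2) live_eq assms(5) refl] by blast
  have "pot (dmp Z) Z' \<le> pot (dmp Z) Z''" using assms(4) x(1,2) unfolding step_ok_def by blast
  then show ?thesis using x(3) by linarith
qed

lemma step_pot_le: "step_ok Z Z' \<Longrightarrow> pot (dmp Z) Z' \<le> pot (dmp Z) Z"
  unfolding step_ok_def by blast

lemma pot_antimono:
  assumes "inside Z" "b \<le> b'" "b' \<le> 4096 * q * (n + 1)" "q \<le> n"
  shows "real (pot b' Z) \<le> pot b Z"
proof -
  have "b \<le> 4096 * q * (n + 1)" using assms by simp
  note pot_eq[OF assms(1) this assms(4)] pot_eq[OF assms(1,3,4)]
  moreover have "exp (- (L * (real b' * en Z))) \<le> exp (- (L * (real b * en Z)))"
    using assms(2) L_pos en_nonneg by (simp add: mult_left_mono mult_right_mono)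
  ultimately show ?thesis using scale_pos amp_pos[of Z] by (simp add: mult_left_mono mult_right_mono)
qed

lemma live_mono: "step_ok Z Z' \<Longrightarrow> inside Z \<Longrightarrow> live n Z' \<le> live n Z"
  unfolding live_eq by (rule card_mono[OF finite_alive_set step_moves(2)])

definition slack :: "(nat \<Rightarrow> nat) \<Rightarrow> real" where "slack Z = n * (real D)\<^sup>2 - en Z"

text \<open>A live coordinate contributes at most D^2. A frozen one lies within P of an end and
  contributes at most 2 D P; n of these make at most 2 D^2, the summand 2.\<close>

lemma slack_le:
  assumes "inside Z"
  shows "slack Z \<le> (live n Z + 2) * (real D)\<^sup>2"
proof -
  have "slack Z = (\<Sum>i<n. (real D)\<^sup>2 - (real (Z i) - D)\<^sup>2)"
    by (simp add: slack_def en_def sum_subtractf)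
  also have "\<dots> \<le> (\<Sum>i<n. (if i \<in> alive_set Z then (real D)\<^sup>2 else 0) + 2 * real D * real P)"
  proof (rule sum_mono)
    fix i assume "i \<in> {..<n}"
    then have i: "i < n" by simp
    show "(real D)\<^sup>2 - (real (Z i) - D)\<^sup>2 \<le> (if i \<in> alive_set Z then (real D)\<^sup>2 else 0) + 2 * real D * real P"
    proof (cases "i \<in> alive_set Z")
      case True
      then show ?thesis using zero_le_power2[of "real (Z i) - D"] by (simp add: add_increasing2)
    next
      case False
      have "real D - real P \<le> \<bar>real (Z i) - D\<bar>"
        using False i assms P_le_D unfolding alive_set_def inside_def by (auto simp: abs_if)
      moreover have "0 \<le> real D - real P" using P_le_D by linarith
      ultimately have "(real D - real P)\<^sup>2 \<le> \<bar>real (Z i) - D\<bar>\<^sup>2" by (intro power_mono)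
      moreover have "(real D - real P)\<^sup>2 = (real D)\<^sup>2 - 2 * real D * real P + (real P)\<^sup>2"
        by (simp add: power2_eq_square algebra_simps)
      ultimately have "(real D)\<^sup>2 - (real (Z i) - D)\<^sup>2 \<le> 2 * real D * real P"
        unfolding power2_abs using zero_le_power2[of "real P"] by linarith
      then show ?thesis using False by simp
    qed
  qed
  also have "\<dots> = live n Z * (real D)\<^sup>2 + n * (2 * real D * real P)"
  proof -
    have "{..<n} \<inter> {i. i \<in> alive_set Z} = alive_set Z" using alive_set_subset[of Z] by auto
    then show ?thesis by (simp add: sum.distrib sum.If_cases live_eq)
  qed
  also have "n * (2 * real D * real P) = 2 * real D * (real n * real P)" by simp
  also have "\<dots> \<le> 2 * real D * real D"
  proof -
    have "n * P \<le> D" by (simp add: radius_def)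
    then have "real n * real P \<le> D" by (simp only: of_nat_mult[symmetric] of_nat_le_iff)
    then show ?thesis by (intro mult_left_mono) auto
  qed
  finally show ?thesis by (simp add: algebra_simps power2_eq_square)
qed

lemma slack_nonneg: "inside Z \<Longrightarrow> 0 \<le> slack Z"
  using en_le by (simp add: slack_def)

definition freeze_cost :: "nat \<Rightarrow> real" where
  "freeze_cost m = (\<Sum>j=m..<n. (real j + 2) * (real (damp n q j) - real (damp n q (Suc j))))"

text \<open>Freezing coordinates raises the damping; each frozen coordinate \<open>j\<close> costs an amount
  proportional to the remaining slack, which is harmonic in the number of live coordinates.\<close>

definition balanced :: "(nat \<Rightarrow> nat) \<Rightarrow> bool" where
  "balanced Z \<longleftrightarrow> ln (amp Z) + L * (real (dmp Z) * slack Z)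
     \<le> ln (2 * real k) + L * ((real D)\<^sup>2 * (real (damp n q n) * n + freeze_cost (live n Z)))"

lemma live_le: "live n Z \<le> n"
  using card_alive_set by (simp add: live_eq)

text \<open>Several coordinates may freeze in one step. The telescoping difference is weighted with
  the smallest of the factors, the one that \<open>slack_le\<close> provides after the step.\<close>

lemma freeze_step:
  assumes "m' \<le> m" "m \<le> n"
  shows "(real m' + 2) * (real (damp n q m') - real (damp n q m)) \<le> freeze_cost m' - freeze_cost m"
proof -
  have "freeze_cost m' - freeze_cost m
      = (\<Sum>j=m'..<m. (real j + 2) * (real (damp n q j) - real (damp n q (Suc j))))"
  proof -
    have "freeze_cost m'
        = (\<Sum>j=m'..<m. (real j + 2) * (real (damp n q j) - real (damp n q (Suc j)))) + freeze_cost m"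
      unfolding freeze_cost_def by (rule sum.atLeastLessThan_concat[OF assms, symmetric])
    then show ?thesis by simp
  qed
  also have "\<dots> \<ge> (\<Sum>j=m'..<m. (real m' + 2) * (real (damp n q j) - real (damp n q (Suc j))))"
    using damp_antimono by (intro sum_mono mult_right_mono) auto
  also have "(\<Sum>j=m'..<m. (real m' + 2) * (real (damp n q j) - real (damp n q (Suc j))))
      = (real m' + 2) * (\<Sum>j=m'..<m. real (damp n q j) - real (damp n q (Suc j)))"
    by (simp add: sum_distrib_left)
  also have "(\<Sum>j=m'..<m. real (damp n q j) - real (damp n q (Suc j))) = real (damp n q m') - real (damp n q m)"
    using sum_Suc_diff'[OF assms(1), of "\<lambda>j. - real (damp n q j)"] by simp
  finally show ?thesis .
qed

text \<open>At fixed damping b, the quantity ln(amp) + L b slack is ln(pot) up to a constant, so the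
  step does not raise it. Passing to the new damping b' adds L (b' - b) slack, which the freezing
  cost covers.\<close>

lemma balanced_step:
  assumes "q \<le> n" "inside Z" "step_ok Z Z'" "balanced Z"
  shows "balanced Z'"
proof -
  let ?b = "real (dmp Z)" and ?b' = "real (dmp Z')"
  have Z': "inside Z'" by (rule step_moves(1)[OF assms(3,2)])
  have lv: "live n Z' \<le> live n Z" by (rule live_mono[OF assms(3,2)])
  have "real (pot (dmp Z) Z') \<le> pot (dmp Z) Z" using step_pot_le[OF assms(3)] by simp
  then have "exp (- (L * (?b * en Z'))) * amp Z' \<le> exp (- (L * (?b * en Z))) * amp Z"
    unfolding pot_eq[OF Z' damp_le assms(1)] pot_eq[OF assms(2) damp_le assms(1)]
    using scale_pos by (simp add: mult.assoc)
  then have "ln (exp (- (L * (?b * en Z'))) * amp Z') \<le> ln (exp (- (L * (?b * en Z))) * amp Z)"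
    using amp_pos by (subst ln_le_cancel_iff) auto
  then have "ln (amp Z') - L * (?b * en Z') \<le> ln (amp Z) - L * (?b * en Z)"
  proof -
    have "ln (exp (- y) * amp W) = ln (amp W) - y" for y W
      using ln_mult_pos[of "exp (- y)" "amp W"] amp_pos[of W] by simp
    with \<open>ln (exp _ * _) \<le> _\<close> show ?thesis by simp
  qed
  then have 1: "ln (amp Z') + L * (?b * slack Z') \<le> ln (amp Z) + L * (?b * slack Z)"
    by (simp add: slack_def algebra_simps)
  have 2: "?b' * slack Z' \<le> ?b * slack Z' + (real D)\<^sup>2 * (freeze_cost (live n Z') - freeze_cost (live n Z))"
  proof -
    have d: "0 \<le> ?b' - ?b" using damp_antimono[OF lv] by simp
    have "(?b' - ?b) * slack Z' \<le> (?b' - ?b) * ((live n Z' + 2) * (real D)\<^sup>2)"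
      using slack_le[OF Z'] d by (rule mult_left_mono)
    also have "\<dots> = (real D)\<^sup>2 * ((real (live n Z') + 2) * (?b' - ?b))" by (simp add: algebra_simps)
    also have "\<dots> \<le> (real D)\<^sup>2 * (freeze_cost (live n Z') - freeze_cost (live n Z))"
      using freeze_step[OF lv live_le] by (intro mult_left_mono) auto
    finally show ?thesis by (simp add: algebra_simps)
  qed
  have "L * (?b' * slack Z') \<le> L * (?b * slack Z' + (real D)\<^sup>2 * (freeze_cost (live n Z') - freeze_cost (live n Z)))"
    using 2 L_pos by (intro mult_left_mono) auto
  with 1 assms(4) show ?thesis
    unfolding balanced_def by (simp add: algebra_simps)
qed

text \<open>Summation by parts replaces the differences of the damping by its values, at most B/(j +
  1) each; their sum is harmonic.\<close>

lemma freeze_cost_bound: "real (damp n q n) * n + freeze_cost m \<le> real (4096 * q * (n + 1)) * (2 + ln n)"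
proof -
  let ?d = "\<lambda>j. real (damp n q j)" and ?B = "real (4096 * q * (n + 1))"
  have nn: "0 \<le> (real j + 2) * (?d j - ?d (Suc j))" for j using damp_antimono[of j "Suc j"] by simp
  have "freeze_cost m \<le> (\<Sum>j<n. (real j + 2) * (?d j - ?d (Suc j)))"
    unfolding freeze_cost_def using nn by (intro sum_mono2) auto
  then have "?d n * n + freeze_cost m \<le> ?d 0 + (\<Sum>j<n. ?d j)"
    using Abel_damping[of ?d n] by (simp add: algebra_simps)
  also have "\<dots> \<le> ?B + (\<Sum>j<n. ?B * inverse (real (Suc j)))"
  proof (intro add_mono sum_mono)
    show "?d 0 \<le> ?B" using damp_le by (simp only: of_nat_le_iff)
    have "real (damp n q j) \<le> ?B / real (j + 1)" for j
      unfolding damp_def by (rule of_nat_div_le_of_nat)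
    then show "?d j \<le> ?B * inverse (real (Suc j))" for j by (simp add: divide_inverse)
  qed
  also have "\<dots> = ?B * (1 + harm n)" by (simp add: harm_altdef sum_distrib_left distrib_left)
  also have "\<dots> \<le> ?B * (2 + ln n)" using harm_le_ln[OF n_pos] by (intro mult_left_mono) auto
  finally show ?thesis .
qed

text \<open>The slack is nonnegative, so balance bounds ln(amp). Each |L A dev| is below it, and L A
  \<ge> 1/(2 q D).\<close>

lemma balanced_dev:
  assumes "balanced Z" "inside Z" "j < k"
  shows "\<bar>dev Z j\<bar> \<le> 2 * real q * real D * (ln (2 * real k) + 4096 * (2 + ln n))"
proof -
  have ln0: "0 \<le> 2 + ln (real n)" using n_pos by (intro add_nonneg_nonneg ln_ge_zero) auto
  have "0 \<le> L * (real (dmp Z) * slack Z)" using L_pos slack_nonneg[OF assms(2)] by simp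
  then have "ln (amp Z) \<le> ln (2 * real k) + L * ((real D)\<^sup>2 * (real (damp n q n) * n + freeze_cost (live n Z)))"
    using assms(1) unfolding balanced_def by linarith
  also have "L * ((real D)\<^sup>2 * (real (damp n q n) * n + freeze_cost (live n Z)))
      \<le> L * ((real D)\<^sup>2 * (real (4096 * q * (n + 1)) * (2 + ln n)))"
    using L_pos freeze_cost_bound by (intro mult_left_mono) auto
  also have "\<dots> = (L * (real (4096 * q * (n + 1)) * (real D)\<^sup>2)) * (2 + ln n)" by (simp only: mult_ac)
  also have "\<dots> \<le> 4096 * (2 + ln n)" using L_base_le ln0 by (rule mult_right_mono)
  finally have amp: "ln (amp Z) \<le> ln (2 * real k) + 4096 * (2 + ln n)" by simp
  let ?y = "L * (real A * dev Z j)"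
  have "exp \<bar>?y\<bar> \<le> exp ?y + exp (- ?y)" by (cases "0 \<le> ?y") auto
  also have "\<dots> \<le> amp Z" unfolding amp_def using assms(3) by (intro member_le_sum) auto
  finally have "\<bar>?y\<bar> \<le> ln (amp Z)" using amp_pos by (simp add: ln_ge_iff)
  then have y: "L * real A * \<bar>dev Z j\<bar> \<le> ln (2 * real k) + 4096 * (2 + ln n)"
    using amp L_pos by (simp add: abs_mult)
  have LA: "1 \<le> L * real A * (2 * real q * real D)"
  proof -
    have "1 = 1 / (2 * real r) * (real A * (2 * real q * real D))"
    proof -
      have "real A * (2 * real q * real D) = 2 * real r" unfolding r_eq A_eq by (simp add: power2_eq_square)
      then show ?thesis using r_pos by simp
    qed
    also have "\<dots> \<le> L * (real A * (2 * real q * real D))" 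
      using mult_right_mono[OF L_ge, of "real A * (2 * real q * real D)"] by simp
    finally show ?thesis by (simp only: mult.assoc)
  qed
  have "\<bar>dev Z j\<bar> \<le> L * real A * (2 * real q * real D) * \<bar>dev Z j\<bar>"
    using mult_right_mono[OF LA, of "\<bar>dev Z j\<bar>"] by simp
  also have "\<dots> = 2 * real q * real D * (L * real A * \<bar>dev Z j\<bar>)" by (simp only: mult_ac)
  also have "\<dots> \<le> 2 * real q * real D * (ln (2 * real k) + 4096 * (2 + ln n))"
    using y by (intro mult_left_mono) auto
  finally show ?thesis .
qed

text \<open>Rounding moves each of the at most seven live coordinates by up to D, and deviations of
  size P in all coordinates add n P \<le> D.\<close>

lemma rounded_dev:
  assumes "inside Z" "live n Z < 8"
  shows "real D * \<bar>\<Sum>i<n. real (a j i) * (if D < Z i then 1 else - 1)\<bar> \<le> \<bar>dev Z j\<bar> + 8 * real D"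
proof -
  define sg where "sg i = (if D < Z i then 1 else - 1 :: real)" for i
  have pt: "\<bar>real D * sg i - (real (Z i) - D)\<bar> \<le> (if i \<in> alive_set Z then real D else 0) + real P" if "i < n" for i
    using that assms(1) unfolding sg_def alive_set_def inside_def by (auto simp: abs_if)
  have "real D * (\<Sum>i<n. real (a j i) * sg i) = dev Z j + (\<Sum>i<n. real (a j i) * (real D * sg i - (real (Z i) - D)))"
    by (simp add: dev_def sum.distrib[symmetric] sum_distrib_left algebra_simps)
  moreover have "\<bar>\<Sum>i<n. real (a j i) * (real D * sg i - (real (Z i) - D))\<bar> \<le> 8 * real D"
  proof -
    have "\<bar>\<Sum>i<n. real (a j i) * (real D * sg i - (real (Z i) - D))\<bar>
        \<le> (\<Sum>i<n. \<bar>real (a j i) * (real D * sg i - (real (Z i) - D))\<bar>)" by (rule sum_abs)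
    also have "\<dots> \<le> (\<Sum>i<n. 1 * ((if i \<in> alive_set Z then real D else 0) + real P))"
      unfolding abs_mult using pt a_le by (intro sum_mono mult_mono) auto
    also have "\<dots> = live n Z * real D + n * real P"
    proof -
      have "{..<n} \<inter> {i. i \<in> alive_set Z} = alive_set Z" using alive_set_subset[of Z] by auto
      then show ?thesis by (simp add: sum.distrib sum.If_cases live_eq)
    qed
    also have "\<dots> \<le> 7 * real D + real D"
    proof (intro add_mono mult_right_mono)
      have "n * P \<le> D" by (simp add: radius_def)
      then show "real n * real P \<le> D" by (simp only: of_nat_mult[symmetric] of_nat_le_iff)
    qed (use assms(2) in auto)
    finally show ?thesis by simp
  qed
  ultimately have "\<bar>real D * (\<Sum>i<n. real (a j i) * sg i)\<bar> \<le> \<bar>dev Z j\<bar> + 8 * real D" by linarith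
  then show ?thesis by (simp add: abs_mult sg_def)
qed

text \<open>If eight coordinates stayed live, every step would lose the factor 1 - 1/(8 r), and a
  growing damping lowers the potential further. In the end it would be below the bound that follows
  from \<open>amp_ge\<close> and \<open>damping_le\<close>.\<close>

lemma walk_freezes:
  assumes net: near_net and q: "q \<le> n"
    and Z: "\<And>i. i < n \<Longrightarrow> Z 0 i = D" "\<And>t. t < rounds n \<Longrightarrow> step_ok (Z t) (Z (Suc t))"
  shows "inside (Z (rounds n)) \<and> balanced (Z (rounds n)) \<and> live n (Z (rounds n)) < 8"
proof -
  let ?\<eta> = "1 / (8 * real r)"
  have dev0: "dev (Z 0) j = 0" for j using Z(1) by (simp add: dev_def)
  have en0: "en (Z 0) = 0" using Z(1) by (simp add: en_def)
  have ins0: "inside (Z 0)" using Z(1) by (simp add: inside_def)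
  have amp0: "amp (Z 0) = 2 * k" by (simp add: amp_def dev0)
  have ins: "inside (Z t)" if "t \<le> rounds n" for t
    using that
  proof (induction t)
    case (Suc t)
    then show ?case using step_moves(1)[OF Z(2)[of t]] by simp
  qed (rule ins0)
  have bal: "balanced (Z t)" if "t \<le> rounds n" for t
    using that
  proof (induction t)
    case 0
    have live0: "live n (Z 0) = n"
    proof -
      have "alive n (Z 0 i) = 1" if "i < n" for i
        using Z(1)[OF that] P_le_D P_pos by (simp add: alive_def)
      then show ?thesis by (simp add: live_def)
    qed
    show ?case by (simp add: balanced_def amp0 live0 slack_def en0 freeze_cost_def mult_ac)
  next
    case (Suc t)
    then show ?case using balanced_step[OF q ins[of t] Z(2)[of t]] by simp
  qed
  have lvm: "live n (Z t') \<le> live n (Z t)" if "t \<le> t'" "t' \<le> rounds n" for t t'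
    using that
  proof (induction t' rule: dec_induct)
    case (step t')
    then show ?case using live_mono[OF Z(2)[of t'] ins[of t']] by simp
  qed simp
  have "live n (Z (rounds n)) < 8"
  proof (rule ccontr)
    assume "\<not> ?thesis"
    then have lv: "8 \<le> live n (Z t)" if "t \<le> rounds n" for t using lvm[OF that order_refl] by simp
    have dec: "real (pot (dmp (Z t)) (Z t)) \<le> (1 - ?\<eta>) ^ t * (scale * (2 * k))" if "t \<le> rounds n" for t
      using that
    proof (induction t)
      case 0
      then show ?case using pot_eq[OF ins0 damp_le q] by (simp add: en0 amp0)
    next
      case (Suc t)
      then have t: "t < rounds n" "t \<le> rounds n" by auto
      have r1: "0 \<le> 1 - ?\<eta>" using r_pos by (simp add: field_simps)
      have "real (pot (dmp (Z (Suc t))) (Z (Suc t))) \<le> pot (dmp (Z t)) (Z (Suc t))"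
        using Suc.prems by (intro pot_antimono ins damp_antimono lvm damp_le q) auto
      also have "\<dots> \<le> (1 - ?\<eta>) * pot (dmp (Z t)) (Z t)"
        by (rule step_progress[OF net q ins[OF t(2)] Z(2)[OF t(1)] lv[OF t(2)]])
      also have "\<dots> \<le> (1 - ?\<eta>) * ((1 - ?\<eta>) ^ t * (scale * (2 * k)))"
        using Suc.IH[OF t(2)] r1 by (rule mult_left_mono)
      finally show ?case by simp
    qed
    let ?Z = "Z (rounds n)"
    have "scale * exp (- (4096 * real n)) * (2 * k) \<le> scale * exp (- (L * (real (dmp ?Z) * en ?Z))) * amp ?Z"
      using scale_pos amp_ge[of ?Z] damping_le[OF ins damp_le, of "rounds n"]
      by (intro mult_mono) auto
    also have "\<dots> \<le> (1 - ?\<eta>) ^ rounds n * (scale * (2 * k))"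
      using dec[of "rounds n"] pot_eq[OF ins damp_le q, of "rounds n"] by simp
    finally have "(scale * (2 * k)) * exp (- (4096 * real n)) \<le> (scale * (2 * k)) * (1 - ?\<eta>) ^ rounds n"
      by (simp only: mult_ac)
    then have "exp (- (4096 * real n)) \<le> (1 - ?\<eta>) ^ rounds n"
      using scale_pos k_pos by simp
    also have "\<dots> \<le> exp (- ?\<eta>) ^ rounds n"
      using r_pos exp_ge_add_one_self[of "- ?\<eta>"] by (intro power_mono) (auto simp: field_simps)
    also have "\<dots> = exp (- (?\<eta> * rounds n))" by (simp add: exp_of_nat_mult[symmetric] mult.commute)
    finally have "?\<eta> * rounds n \<le> 4096 * n" by simp
    then have "real (rounds n) \<le> real (32768 * n * r)" using r_pos by (simp add: field_simps)
    moreover have "32768 * n * r < rounds n"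
    proof -
      have "r \<le> res_base n n" unfolding res_base_def using q by (intro mult_le_mono1)
      then have "32768 * n * r \<le> 32768 * n * res_base n n" by (rule mult_le_mono2)
      then show ?thesis unfolding rounds_def by linarith
    qed
    ultimately show False by linarith
  qed
  with ins bal show ?thesis by simp
qed

lemma walk_discrepancy:
  assumes "near_net" "q \<le> n"
    and "\<And>i. i < n \<Longrightarrow> Z 0 i = D" "\<And>t. t < rounds n \<Longrightarrow> step_ok (Z t) (Z (Suc t))"
    and "j < k"
  shows "\<bar>\<Sum>i<n. real (a j i) * (if D < Z (rounds n) i then 1 else - 1)\<bar>
    \<le> 2 * real q * (ln (2 * real k) + 4096 * (2 + ln n)) + 8"
proof -
  let ?Z = "Z (rounds n)" and ?S = "\<bar>\<Sum>i<n. real (a j i) * (if D < Z (rounds n) i then 1 else - 1)\<bar>"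
  have w: "inside ?Z" "balanced ?Z" "live n ?Z < 8" using walk_freezes[OF assms(1-4)] by auto
  have "real D * ?S \<le> \<bar>dev ?Z j\<bar> + 8 * real D" by (rule rounded_dev[OF w(1,3)])
  also have "\<dots> \<le> real D * (2 * real q * (ln (2 * real k) + 4096 * (2 + ln n)) + 8)"
    using balanced_dev[OF w(2,1) assms(5)] by (simp add: algebra_simps)
  finally show ?thesis using D_pos by simp
qed

end

section \<open>A loop language on the random access machine\<close>

text \<open>A loop language with named arrays, in which every loop runs a number of times that is a
  fixed polynomial of the input dimensions and every stored value is truncated at \<open>Q\<close>. Polynomial
  running time is then a property of the syntax alone.\<close>

datatype hexp =
    HL nat
  | HN
  | HK
  | HIn hexp hexp
  | HV nat hexp
  | HAdd hexp hexp
  | HSub hexp hexp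
  | HMul hexp hexp
  | HDiv hexp hexp

datatype hcom =
    HAsg nat hexp hexp
  | HSeq hcom hcom
  | HIf hexp hcom
  | HFor nat hexp hcom

type_synonym hstate = "nat \<Rightarrow> nat \<Rightarrow> nat"

definition set_var :: "nat \<Rightarrow> nat \<Rightarrow> nat \<Rightarrow> hstate \<Rightarrow> hstate" where
  "set_var v i x h = h(v := (h v)(i := x))"

text \<open>The reduction modulo \<open>w 0 * w 1 + 1\<close> keeps every access to the incidence matrix inside the
  part of the memory that is never overwritten.\<close>

primrec hev :: "memory \<Rightarrow> hexp \<Rightarrow> hstate \<Rightarrow> nat" where
  "hev w (HL c) h = c"
| "hev w HN h = w 0"
| "hev w HK h = w 1"
| "hev w (HIn a b) h = w (2 + (hev w a h * w 0 + hev w b h) mod (w 0 * w 1 + 1))"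
| "hev w (HV v a) h = h v (hev w a h)"
| "hev w (HAdd a b) h = hev w a h + hev w b h"
| "hev w (HSub a b) h = hev w a h - hev w b h"
| "hev w (HMul a b) h = hev w a h * hev w b h"
| "hev w (HDiv a b) h = hev w a h div hev w b h"

text \<open>Only assignments are truncated. Loop counters are not: they stay within the static loop
  bound.\<close>

primrec hsem :: "memory \<Rightarrow> nat \<Rightarrow> hcom \<Rightarrow> hstate \<Rightarrow> hstate" where
  "hsem w Q (HAsg v a b) h = set_var v (hev w a h) (min (hev w b h) Q) h"
| "hsem w Q (HSeq c d) h = hsem w Q d (hsem w Q c h)"
| "hsem w Q (HIf e c) h = (if hev w e h \<noteq> 0 then hsem w Q c h else h)"
| "hsem w Q (HFor v e c) h =
     ((\<lambda>h. set_var v 0 (Suc (hsem w Q c h v 0)) (hsem w Q c h)) ^^ hev w e h) (set_var v 0 0 h)"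

text \<open>Built from constants and the two dimensions only, hence polynomial in the input size and
  unaffected by the loop body.\<close>

primrec static :: "hexp \<Rightarrow> bool" where
  "static (HL c) = True"
| "static HN = True"
| "static HK = True"
| "static (HIn a b) = False"
| "static (HV v a) = False"
| "static (HAdd a b) = (static a \<and> static b)"
| "static (HSub a b) = (static a \<and> static b)"
| "static (HMul a b) = (static a \<and> static b)"
| "static (HDiv a b) = (static a \<and> static b)"

definition max_vars :: nat where "max_vars = 64"

primrec evars :: "hexp \<Rightarrow> nat set" where
  "evars (HL c) = {}"
| "evars HN = {}"
| "evars HK = {}"
| "evars (HIn a b) = evars a \<union> evars b"
| "evars (HV v a) = insert v (evars a)"
| "evars (HAdd a b) = evars a \<union> evars b"
| "evars (HSub a b) = evars a \<union> evars b"
| "evars (HMul a b) = evars a \<union> evars b"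
| "evars (HDiv a b) = evars a \<union> evars b"

primrec assigned :: "hcom \<Rightarrow> nat set" where
  "assigned (HAsg v a b) = {v}"
| "assigned (HSeq c d) = assigned c \<union> assigned d"
| "assigned (HIf e c) = assigned c"
| "assigned (HFor v e c) = insert v (assigned c)"

primrec wf :: "hcom \<Rightarrow> bool" where
  "wf (HAsg v a b) \<longleftrightarrow> v < max_vars \<and> evars a \<subseteq> {..<max_vars} \<and> evars b \<subseteq> {..<max_vars}"
| "wf (HSeq c d) \<longleftrightarrow> wf c \<and> wf d"
| "wf (HIf e c) \<longleftrightarrow> evars e \<subseteq> {..<max_vars} \<and> wf c"
| "wf (HFor v e c) \<longleftrightarrow> v < max_vars \<and> static e \<and> v \<notin> assigned c \<and> wf c"

lemma set_var_same [simp]: "set_var v i x h v = (h v)(i := x)"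
  by (simp add: set_var_def)

lemma set_var_other [simp]: "u \<noteq> v \<Longrightarrow> set_var v i x h u = h u"
  by (simp add: set_var_def)

lemma hsem_unassigned: "u \<notin> assigned c \<Longrightarrow> hsem w Q c h u = h u"
proof (induction c arbitrary: h)
  case (HFor v e c)
  have "((\<lambda>h. set_var v 0 (Suc (hsem w Q c h v 0)) (hsem w Q c h)) ^^ m) h' u = h' u" for m h'
    by (induction m) (use HFor in auto)
  then show ?case using HFor.prems by simp
qed auto

lemma hev_static: "static e \<Longrightarrow> hev w e h = hev w e h'"
  by (induction e) auto

definition dims :: "memory \<Rightarrow> nat" where "dims w = w 0 + w 1 + 2"

lemma dims_ge: "2 \<le> dims w" by (simp add: dims_def)

lemma le_dims_power: "c \<le> dims w ^ c"
proof -
  have "c \<le> 2 ^ c" by (rule less_imp_le[OF less_exp])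
  also have "\<dots> \<le> dims w ^ c" by (rule power_mono[OF dims_ge]) simp
  finally show ?thesis .
qed

lemma add_le_dims_power:
  assumes "u \<le> dims w ^ i" "v \<le> dims w ^ j"
  shows "u + v \<le> dims w ^ (i + j + 1)"
proof -
  have 1: "1 \<le> dims w" using dims_ge[of w] by simp
  have "u + v \<le> dims w ^ (i + j) + dims w ^ (i + j)"
    using assms power_increasing[OF le_add1[of i j] 1] power_increasing[OF le_add2[of j i] 1] by linarith
  also have "\<dots> = 2 * dims w ^ (i + j)" by simp
  also have "\<dots> \<le> dims w * dims w ^ (i + j)" using dims_ge by (rule mult_le_mono1)
  finally show ?thesis by simp
qed

lemma static_bound: "static e \<Longrightarrow> \<exists>g. \<forall>w h. hev w e h \<le> dims w ^ g"
proof (induction e)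
  case (HL c)
  then show ?case using le_dims_power by auto
next
  case HN
  show ?case by (intro exI[of _ 1]) (simp add: dims_def)
next
  case HK
  show ?case by (intro exI[of _ 1]) (simp add: dims_def)
next
  case (HAdd a b)
  then obtain i j where "\<forall>w h. hev w a h \<le> dims w ^ i" "\<forall>w h. hev w b h \<le> dims w ^ j" by auto
  then show ?case using add_le_dims_power by (intro exI[of _ "i + j + 1"]) auto
next
  case (HSub a b)
  then obtain i where "\<forall>w h. hev w a h \<le> dims w ^ i" by auto
  then show ?case by (intro exI[of _ i]) (auto intro: le_trans[OF diff_le_self])
next
  case (HMul a b)
  then obtain i j where "\<forall>w h. hev w a h \<le> dims w ^ i" "\<forall>w h. hev w b h \<le> dims w ^ j" by auto
  then show ?case by (intro exI[of _ "i + j"]) (simp add: power_add mult_le_mono)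
next
  case (HDiv a b)
  then obtain i where "\<forall>w h. hev w a h \<le> dims w ^ i" by auto
  then show ?case by (intro exI[of _ i]) (auto intro: le_trans[OF div_le_dividend])
qed auto

section \<open>Compilation and memory layout\<close>

definition base_exp :: aexp where
  "base_exp = Add (Lit 3) (Mul (Cell (Lit 0)) (Add (Cell (Lit 1)) (Lit 1)))"

definition cap_exp :: aexp where
  "cap_exp = Add (Lit 2) (Mul (Cell (Lit 0)) (Add (Cell (Lit 1)) (Lit 1)))"

definition var_exp :: "nat \<Rightarrow> aexp \<Rightarrow> aexp" where
  "var_exp v a = Add base_exp (Add (Mul (Lit max_vars) a) (Lit v))"

primrec cexp :: "hexp \<Rightarrow> aexp" where
  "cexp (HL c) = Lit c"
| "cexp HN = Cell (Lit 0)"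
| "cexp HK = Cell (Lit 1)"
| "cexp (HIn a b) = Cell (Add (Lit 2)
     (Sub (Add (Mul (cexp a) (Cell (Lit 0))) (cexp b))
       (Mul (Add (Mul (Cell (Lit 0)) (Cell (Lit 1))) (Lit 1))
          (Quot (Add (Mul (cexp a) (Cell (Lit 0))) (cexp b))
             (Add (Mul (Cell (Lit 0)) (Cell (Lit 1))) (Lit 1))))))"
| "cexp (HV v a) = Cell (var_exp v (cexp a))"
| "cexp (HAdd a b) = Add (cexp a) (cexp b)"
| "cexp (HSub a b) = Sub (cexp a) (cexp b)"
| "cexp (HMul a b) = Mul (cexp a) (cexp b)"
| "cexp (HDiv a b) = Quot (cexp a) (cexp b)"

text \<open>Truncated subtraction provides the cap: e - (e - Q) is the minimum of e and Q. It also
  provides the loop test, which is zero as soon as the counter reaches the bound.\<close>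

primrec comp :: "hcom \<Rightarrow> com" where
  "comp (HAsg v a b) = Assign (var_exp v (cexp a)) (Sub (cexp b) (Sub (cexp b) (Cell cap_exp)))"
| "comp (HSeq c d) = Seq (comp c) (comp d)"
| "comp (HIf e c) = If (cexp e) (comp c) Skip"
| "comp (HFor v e c) = Seq (Assign (var_exp v (Lit 0)) (Lit 0))
     (While (Sub (cexp e) (Cell (var_exp v (Lit 0))))
        (Seq (comp c) (Assign (var_exp v (Lit 0)) (Add (Cell (var_exp v (Lit 0))) (Lit 1)))))"

text \<open>The layout is: the two dimensions, the matrix, the cap Q, and then the arrays
  interleaved with stride \<open>max_vars\<close>, as no lengths are fixed for them. The factor w 1
  + 1 keeps cells 0, ..., w 0 below the arrays even when there are no sets, so that they can receive
  the output.\<close>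

definition base :: "memory \<Rightarrow> nat" where "base w = 3 + w 0 * (w 1 + 1)"

definition var_addr :: "memory \<Rightarrow> nat \<Rightarrow> nat \<Rightarrow> nat" where
  "var_addr w v i = base w + (max_vars * i + v)"

definition cap_addr :: "memory \<Rightarrow> nat" where "cap_addr w = 2 + w 0 * (w 1 + 1)"

text \<open>The cell just behind the matrix is included because the reduction modulo
  \<open>w 0 * w 1 + 1\<close> can reach it.\<close>

definition frozen :: "memory \<Rightarrow> memory \<Rightarrow> bool" where
  "frozen w s \<longleftrightarrow> (\<forall>x \<le> 2 + w 0 * w 1. s x = w x)"

definition represents :: "memory \<Rightarrow> nat \<Rightarrow> memory \<Rightarrow> hstate \<Rightarrow> bool" where
  "represents w Q s h \<longleftrightarrow> frozen w s \<and> s (cap_addr w) = Q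
     \<and> (\<forall>v<max_vars. \<forall>i. s (var_addr w v i) = h v i)"

lemma var_addr_inj:
  assumes "v < max_vars" "u < max_vars" "var_addr w v i = var_addr w u j"
  shows "v = u \<and> i = j"
proof -
  have "max_vars * i + v = max_vars * j + u" using assms(3) by (simp add: var_addr_def)
  then have "(max_vars * i + v) div max_vars = (max_vars * j + u) div max_vars"
    "(max_vars * i + v) mod max_vars = (max_vars * j + u) mod max_vars" by auto
  then show ?thesis using assms(1,2) by (simp add: max_vars_def)
qed

lemma cap_not_var: "cap_addr w \<noteq> var_addr w v i"
  by (simp add: cap_addr_def var_addr_def base_def)

lemma frozen_dims: "frozen w s \<Longrightarrow> s 0 = w 0 \<and> s (Suc 0) = w 1"
  by (simp add: frozen_def)

lemma frozen_upd: "1 \<le> w 0 \<Longrightarrow> frozen w s \<Longrightarrow> cap_addr w \<le> x \<Longrightarrow> frozen w (s(x := y))"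
  by (auto simp: frozen_def cap_addr_def)

lemma represents_upd:
  assumes "1 \<le> w 0" "v < max_vars" "represents w Q s h"
  shows "represents w Q (s(var_addr w v i := x)) (set_var v i x h)"
proof -
  have "frozen w (s(var_addr w v i := x))"
    using assms by (intro frozen_upd) (auto simp: represents_def cap_addr_def var_addr_def base_def)
  moreover have "(s(var_addr w v i := x)) (var_addr w u j) = set_var v i x h u j" if "u < max_vars" for u j
    using assms(3) that var_addr_inj[OF assms(2) that, of w i j]
    by (auto simp: represents_def set_var_def)
  ultimately show ?thesis
    using assms(3) cap_not_var[of w] by (simp add: represents_def)
qed

lemma aval_base: "frozen w s \<Longrightarrow> aval base_exp s = base w"
  by (simp add: base_exp_def base_def frozen_dims)

lemma aval_cap: "frozen w s \<Longrightarrow> aval cap_exp s = cap_addr w"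
  by (simp add: cap_exp_def cap_addr_def frozen_dims)

lemma aval_var: "frozen w s \<Longrightarrow> aval (var_exp v a) s = var_addr w v (aval a s)"
  by (simp add: var_exp_def var_addr_def aval_base)

lemma aval_cexp:
  assumes "represents w Q s h" "evars e \<subseteq> {..<max_vars}"
  shows "aval (cexp e) s = hev w e h"
  using assms(2)
proof (induction e)
  case (HIn a b)
  have fr: "frozen w s" using assms(1) by (simp add: represents_def)
  let ?x = "hev w a h * w 0 + hev w b h"
  have "aval (cexp (HIn a b)) s = s (2 + (?x - (w 0 * w 1 + 1) * (?x div (w 0 * w 1 + 1))))"
    using HIn by (simp add: frozen_dims[OF fr])
  also have "?x - (w 0 * w 1 + 1) * (?x div (w 0 * w 1 + 1)) = ?x mod (w 0 * w 1 + 1)"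
    by (rule minus_mult_div_eq_mod)
  also have "s (2 + ?x mod (w 0 * w 1 + 1)) = w (2 + ?x mod (w 0 * w 1 + 1))"
  proof -
    have "?x mod (w 0 * w 1 + 1) < w 0 * w 1 + 1" by (rule mod_less_divisor) simp
    then show ?thesis using fr unfolding frozen_def by simp
  qed
  finally show ?case by simp
next
  case (HV v a)
  have fr: "frozen w s" using assms(1) by (simp add: represents_def)
  show ?case using HV assms(1) by (simp add: aval_var[OF fr] represents_def)
qed (use assms(1) in \<open>auto simp: represents_def frozen_dims\<close>)

section \<open>Running time of compiled programs\<close>

definition bounded_mem :: "nat \<Rightarrow> memory \<Rightarrow> bool" where
  "bounded_mem \<beta> s \<longleftrightarrow> (\<forall>x. s x < 2 ^ \<beta>)"

text \<open>Bit length of a value in multiples of the word length \<beta>: a cell counts one, and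
  both sums and products add the counts of their operands.\<close>

primrec asize :: "aexp \<Rightarrow> nat" where
  "asize (Lit c) = c + 1"
| "asize (Cell a) = 1"
| "asize (Add a b) = asize a + asize b"
| "asize (Sub a b) = asize a + asize b"
| "asize (Mul a b) = asize a + asize b"
| "asize (Quot a b) = asize a + asize b"

lemma aval_bound:
  assumes "bounded_mem \<beta> s" "1 \<le> \<beta>"
  shows "aval a s < 2 ^ (\<beta> * asize a)"
proof (induction a)
  case (Lit c)
  have "c < 2 ^ c" by simp
  also have "(2::nat) ^ c \<le> 2 ^ (\<beta> * (c + 1))"
  proof (intro power_increasing)
    have "1 * (c + 1) \<le> \<beta> * (c + 1)" using assms(2) by (rule mult_le_mono1)
    moreover have "c \<le> 1 * (c + 1)" by simp
    ultimately show "c \<le> \<beta> * (c + 1)" by (rule order_trans[rotated])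
  qed simp
  finally show ?case by simp
next
  case (Cell a)
  then show ?case using assms by (simp add: bounded_mem_def)
next
  case (Add a b)
  have "aval a s + aval b s + 1 \<le> (aval a s + 1) * (aval b s + 1)" by simp
  also have "\<dots> \<le> 2 ^ (\<beta> * asize a) * 2 ^ (\<beta> * asize b)"
    using Add by (intro mult_le_mono) auto
  finally show ?case by (simp add: power_add distrib_left)
next
  case (Mul a b)
  then show ?case by (simp add: power_add distrib_left mult_strict_mono)
next
  case (Sub a b)
  have "aval a s - aval b s \<le> aval a s" by simp
  also have "\<dots> < 2 ^ (\<beta> * asize a)" by (rule Sub.IH(1))
  also have "(2::nat) ^ (\<beta> * asize a) \<le> 2 ^ (\<beta> * asize (Sub a b))" by (intro power_increasing) auto
  finally show ?case by simp
next
  case (Quot a b)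
  have "aval a s div aval b s \<le> aval a s" by simp
  also have "\<dots> < 2 ^ (\<beta> * asize a)" by (rule Quot.IH(1))
  also have "(2::nat) ^ (\<beta> * asize a) \<le> 2 ^ (\<beta> * asize (Quot a b))" by (intro power_increasing) auto
  finally show ?case by simp
qed

lemma len_le: "v < 2 ^ e \<Longrightarrow> len v \<le> e + 1"
proof -
  assume v: "v < 2 ^ e"
  have "floorlog 2 v \<le> e"
  proof (cases "v = 0")
    case False
    then have "2 ^ (floorlog 2 v - 1) \<le> v" using floorlog_bounds[of v 2] by simp
    then have "(2::nat) ^ (floorlog 2 v - 1) < 2 ^ e" using v by linarith
    then have "floorlog 2 v - 1 < e" by (simp add: power_strict_increasing_iff)
    then show ?thesis by linarith
  qed (simp add: floorlog_def)
  then show ?thesis by (simp add: len_def)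
qed

primrec acsize :: "aexp \<Rightarrow> nat" where
  "acsize (Lit c) = asize (Lit c) + 1"
| "acsize (Cell a) = acsize a + asize (Cell a) + 1"
| "acsize (Add a b) = acsize a + acsize b + asize (Add a b) + 1"
| "acsize (Sub a b) = acsize a + acsize b + asize (Sub a b) + 1"
| "acsize (Mul a b) = acsize a + acsize b + asize (Mul a b) + 1"
| "acsize (Quot a b) = acsize a + acsize b + asize (Quot a b) + 1"

lemma acost_bound:
  assumes "bounded_mem \<beta> s" "1 \<le> \<beta>"
  shows "acost a s \<le> acsize a * \<beta>"
proof -
  have l: "len (aval a s) \<le> asize a * \<beta> + \<beta>" for a
    using len_le[OF aval_bound[OF assms, of a]] assms(2) by (simp add: mult.commute)
  show ?thesis
  proof (induction a)
    case (Lit c)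
    then show ?case using l[of "Lit c"] by (simp add: algebra_simps)
  next
    case (Cell a)
    then show ?case using l[of "Cell a"] by (simp add: algebra_simps)
  next
    case (Add a b)
    then show ?case using l[of "Add a b"] by (simp add: algebra_simps)
  next
    case (Sub a b)
    then show ?case using l[of "Sub a b"] by (simp add: algebra_simps)
  next
    case (Mul a b)
    then show ?case using l[of "Mul a b"] by (simp add: algebra_simps)
  next
    case (Quot a b)
    then show ?case using l[of "Quot a b"] by (simp add: algebra_simps)
  qed
qed

text \<open>The invariant is indexed by the round and each round has the same time bound. The coin
  stream is unchanged throughout, as compiled code flips no coins.\<close>

lemma exec_loop:
  assumes step: "\<And>j s. j < b \<Longrightarrow> R j s \<Longrightarrow> aval e s \<noteq> 0 \<and> acost e s \<le> \<kappa>
      \<and> (\<exists>T s'. exec c s \<omega> T s' \<omega> \<and> R (Suc j) s' \<and> T \<le> \<tau>)"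
    and last: "\<And>s. R b s \<Longrightarrow> aval e s = 0 \<and> acost e s \<le> \<kappa>"
    and "R j s" "j \<le> b"
  shows "\<exists>T s'. exec (While e c) s \<omega> T s' \<omega> \<and> R b s' \<and> T \<le> (b - j + 1) * (1 + \<kappa> + \<tau>)"
  using assms(3,4)
proof (induction "b - j" arbitrary: j s)
  case 0
  then have "R b s" "b - j = 0" by auto
  with last[of s] exec.WhileFalse[of e s c \<omega>] show ?case by (intro exI[of _ "1 + acost e s"] exI[of _ s]) auto
next
  case (Suc m)
  then have j: "j < b" by simp
  from step[OF j Suc.prems(1)] obtain T1 s1 where 1: "aval e s \<noteq> 0" "acost e s \<le> \<kappa>"
    "exec c s \<omega> T1 s1 \<omega>" "R (Suc j) s1" "T1 \<le> \<tau>" by blast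
  have "m = b - Suc j" using Suc.hyps(2) by simp
  from Suc.hyps(1)[OF this 1(4)] j obtain T2 s2 where 2: "exec (While e c) s1 \<omega> T2 s2 \<omega>" "R b s2"
    "T2 \<le> (b - Suc j + 1) * (1 + \<kappa> + \<tau>)" by auto
  have "exec (While e c) s \<omega> (1 + acost e s + T1 + T2) s2 \<omega>"
    by (rule exec.WhileTrue[OF 1(1,3) 2(1)])
  moreover have "1 + acost e s + T1 + T2 \<le> (b - j + 1) * (1 + \<kappa> + \<tau>)"
  proof -
    have "1 + acost e s + T1 + T2 \<le> (1 + \<kappa> + \<tau>) + (b - Suc j + 1) * (1 + \<kappa> + \<tau>)"
      using 1(2,5) 2(3) by linarith
    also have "\<dots> = (b - Suc j + 1 + 1) * (1 + \<kappa> + \<tau>)" by (simp only: distrib_right mult_1 add.commute)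
    also have "b - Suc j + 1 + 1 = b - j + 1" using j by simp
    finally show ?thesis .
  qed
  ultimately show ?case using 2(2) by blast
qed

lemma bounded_mem_upd: "bounded_mem \<beta> s \<Longrightarrow> y < 2 ^ \<beta> \<Longrightarrow> bounded_mem \<beta> (s(x := y))"
  by (simp add: bounded_mem_def)

lemma static_evars: "static e \<Longrightarrow> evars e = {}"
  by (induction e) auto

text \<open>The exponent \<open>g\<close> is uniform over inputs. Time factors into a polynomial in
  the dimensions and the word length \<beta>; \<open>dims w ^ g < 2 ^ \<beta>\<close> guarantees
  that loop counters fit into a word.\<close>

definition simulates :: "nat \<Rightarrow> com \<Rightarrow> (memory \<Rightarrow> nat \<Rightarrow> hstate \<Rightarrow> hstate) \<Rightarrow> bool" where
  "simulates g c f \<longleftrightarrow> (\<forall>w Q s h \<beta> \<omega>. 1 \<le> w 0 \<longrightarrow> represents w Q s h \<longrightarrow> bounded_mem \<beta> s \<longrightarrow>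
     dims w ^ g < 2 ^ \<beta> \<longrightarrow> (\<exists>T s'. exec c s \<omega> T s' \<omega> \<and> represents w Q s' (f w Q h)
        \<and> bounded_mem \<beta> s' \<and> T \<le> dims w ^ g * \<beta>))"

lemma dims_power_mono: "i \<le> j \<Longrightarrow> dims w ^ i \<le> dims w ^ j"
  using dims_ge[of w] by (intro power_increasing) auto

lemma pos_exponent: "dims w ^ g < 2 ^ \<beta> \<Longrightarrow> 1 \<le> \<beta>"
  using dims_ge[of w] by (cases \<beta>) auto

text \<open>Induction on the syntax: running times add along a sequence, and a loop multiplies the
  time of its body by its static bound, so the exponents stay finite sums.\<close>

lemma comp_simulates: "wf c \<Longrightarrow> \<exists>g. simulates g (comp c) (\<lambda>w Q. hsem w Q c)"
proof (induction c)
  case (HAsg v a b)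
  let ?l = "var_exp v (cexp a)" and ?r = "Sub (cexp b) (Sub (cexp b) (Cell cap_exp))"
  let ?g = "1 + acsize ?l + acsize ?r"
  have "simulates ?g (comp (HAsg v a b)) (\<lambda>w Q. hsem w Q (HAsg v a b))"
    unfolding simulates_def
  proof (intro allI impI)
    fix w Q s h \<beta> \<omega>
    assume w: "1 \<le> w 0" and rep: "represents w Q s h" and bd: "bounded_mem \<beta> s"
      and gb: "dims w ^ ?g < 2 ^ \<beta>"
    have fr: "frozen w s" using rep by (simp add: represents_def)
    have \<beta>: "1 \<le> \<beta>" by (rule pos_exponent[OF gb])
    have Q: "aval (Cell cap_exp) s = Q" using rep by (simp add: aval_cap[OF fr] represents_def)
    have l: "aval ?l s = var_addr w v (hev w a h)"
      using HAsg aval_cexp[OF rep] by (simp add: aval_var[OF fr])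
    have r: "aval ?r s = min (hev w b h) Q"
      using HAsg aval_cexp[OF rep] Q by simp
    have "Q < 2 ^ \<beta>" using bd Q by (auto simp: bounded_mem_def)
    then have "bounded_mem \<beta> (s(aval ?l s := aval ?r s))" using bd r by (intro bounded_mem_upd) auto
    moreover have "represents w Q (s(aval ?l s := aval ?r s)) (hsem w Q (HAsg v a b) h)"
      unfolding l r using HAsg represents_upd[OF w _ rep] by simp
    moreover have "1 + acost ?l s + acost ?r s \<le> dims w ^ ?g * \<beta>"
    proof -
      have "1 + acost ?l s + acost ?r s \<le> \<beta> + acsize ?l * \<beta> + acsize ?r * \<beta>"
        by (intro add_mono \<beta> acost_bound bd)
      also have "\<dots> = ?g * \<beta>" by (simp add: distrib_right)
      also have "\<dots> \<le> dims w ^ ?g * \<beta>" by (intro mult_le_mono1 le_dims_power)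
      finally show ?thesis .
    qed
    ultimately show "\<exists>T s'. exec (comp (HAsg v a b)) s \<omega> T s' \<omega> \<and> represents w Q s' (hsem w Q (HAsg v a b) h)
        \<and> bounded_mem \<beta> s' \<and> T \<le> dims w ^ ?g * \<beta>"
      using exec.Assign[of ?l ?r s \<omega>] unfolding comp.simps by blast
  qed
  then show ?case by blast
next
  case (HSeq c d)
  then obtain i j where ij: "simulates i (comp c) (\<lambda>w Q. hsem w Q c)" "simulates j (comp d) (\<lambda>w Q. hsem w Q d)"
    by auto
  have "simulates (i + j + 1) (comp (HSeq c d)) (\<lambda>w Q. hsem w Q (HSeq c d))"
    unfolding simulates_def
  proof (intro allI impI)
    fix w Q s h \<beta> \<omega>
    assume w: "1 \<le> w 0" and rep: "represents w Q s h" and bd: "bounded_mem \<beta> s"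
      and gb: "dims w ^ (i + j + 1) < 2 ^ \<beta>"
    have gi: "dims w ^ i < 2 ^ \<beta>" "dims w ^ j < 2 ^ \<beta>"
      using gb dims_power_mono[of i "i + j + 1" w] dims_power_mono[of j "i + j + 1" w] by linarith+
    obtain T1 s1 where 1: "exec (comp c) s \<omega> T1 s1 \<omega>" "represents w Q s1 (hsem w Q c h)"
      "bounded_mem \<beta> s1" "T1 \<le> dims w ^ i * \<beta>"
      using ij(1)[unfolded simulates_def, rule_format, OF w rep bd gi(1)] by blast
    obtain T2 s2 where 2: "exec (comp d) s1 \<omega> T2 s2 \<omega>" "represents w Q s2 (hsem w Q d (hsem w Q c h))"
      "bounded_mem \<beta> s2" "T2 \<le> dims w ^ j * \<beta>"
      using ij(2)[unfolded simulates_def, rule_format, OF w 1(2,3) gi(2)] by blast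
    have "T1 + T2 \<le> (dims w ^ i + dims w ^ j) * \<beta>" using 1(4) 2(4) by (simp add: distrib_right)
    also have "\<dots> \<le> dims w ^ (i + j + 1) * \<beta>" by (intro mult_le_mono1 add_le_dims_power) auto
    finally have "T1 + T2 \<le> dims w ^ (i + j + 1) * \<beta>" .
    then show "\<exists>T s'. exec (comp (HSeq c d)) s \<omega> T s' \<omega> \<and> represents w Q s' (hsem w Q (HSeq c d) h)
        \<and> bounded_mem \<beta> s' \<and> T \<le> dims w ^ (i + j + 1) * \<beta>"
      using exec.Seq[OF 1(1) 2(1)] 2(2,3) unfolding comp.simps hsem.simps by blast
  qed
  then show ?case by blast
next
  case (HIf e c)
  then obtain i where i: "simulates i (comp c) (\<lambda>w Q. hsem w Q c)" by auto
  let ?K = "2 + acsize (cexp e)"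
  have "simulates (?K + i + 1) (comp (HIf e c)) (\<lambda>w Q. hsem w Q (HIf e c))"
    unfolding simulates_def
  proof (intro allI impI)
    fix w Q s h \<beta> \<omega>
    assume w: "1 \<le> w 0" and rep: "represents w Q s h" and bd: "bounded_mem \<beta> s"
      and gb: "dims w ^ (?K + i + 1) < 2 ^ \<beta>"
    have gi: "dims w ^ i < 2 ^ \<beta>" using gb dims_power_mono[of i "?K + i + 1" w] by linarith
    have \<beta>: "1 \<le> \<beta>" by (rule pos_exponent[OF gb])
    have ev: "aval (cexp e) s = hev w e h" using HIf by (intro aval_cexp[OF rep]) simp
    have K: "2 + acost (cexp e) s \<le> ?K * \<beta>"
      using acost_bound[OF bd \<beta>, of "cexp e"] \<beta> by (simp add: distrib_right)
    have tot: "?K * \<beta> + dims w ^ i * \<beta> \<le> dims w ^ (?K + i + 1) * \<beta>"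
      unfolding distrib_right[symmetric] by (intro mult_le_mono1 add_le_dims_power le_dims_power) auto
    show "\<exists>T s'. exec (comp (HIf e c)) s \<omega> T s' \<omega> \<and> represents w Q s' (hsem w Q (HIf e c) h)
        \<and> bounded_mem \<beta> s' \<and> T \<le> dims w ^ (?K + i + 1) * \<beta>"
    proof (cases "hev w e h = 0")
      case True
      have "exec (comp (HIf e c)) s \<omega> (1 + acost (cexp e) s + 1) s \<omega>"
        unfolding comp.simps by (rule exec.IfFalse[OF _ exec.Skip]) (simp add: ev True)
      moreover have "1 + acost (cexp e) s + 1 \<le> dims w ^ (?K + i + 1) * \<beta>" using K tot by linarith
      ultimately show ?thesis using rep bd True by auto
    next
      case False
      obtain T1 s1 where 1: "exec (comp c) s \<omega> T1 s1 \<omega>" "represents w Q s1 (hsem w Q c h)"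
        "bounded_mem \<beta> s1" "T1 \<le> dims w ^ i * \<beta>"
        using i[unfolded simulates_def, rule_format, OF w rep bd gi] by blast
      have "exec (comp (HIf e c)) s \<omega> (1 + acost (cexp e) s + T1) s1 \<omega>"
        unfolding comp.simps by (rule exec.IfTrue[OF _ 1(1)]) (simp add: ev False)
      moreover have "1 + acost (cexp e) s + T1 \<le> dims w ^ (?K + i + 1) * \<beta>" using K tot 1(4) by linarith
      ultimately show ?thesis using 1 False by auto
    qed
  qed
  then show ?case by blast
next
  case (HFor v e c)
  then have wfc: "v < max_vars" "static e" "v \<notin> assigned c" "wf c" by auto
  obtain i where i: "simulates i (comp c) (\<lambda>w Q. hsem w Q c)" using HFor.IH wfc by blast
  obtain b where b: "\<And>w h. hev w e h \<le> dims w ^ b" using static_bound[OF wfc(2)] by blast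
  let ?x = "var_exp v (Lit 0)"
  let ?cond = "Sub (cexp e) (Cell ?x)" and ?inc = "Add (Cell ?x) (Lit 1)"
  let ?K = "2 + acsize ?cond + acsize ?x + acsize ?inc"
  let ?Kinit = "1 + acsize ?x + acsize (Lit 0)"
  let ?G = "?Kinit + ((b + 1) + (?K + i + 1)) + 1"
  have "simulates ?G (comp (HFor v e c)) (\<lambda>w Q. hsem w Q (HFor v e c))"
    unfolding simulates_def
  proof (intro allI impI)
    fix w Q s h \<beta> \<omega>
    assume w: "1 \<le> w 0" and rep: "represents w Q s h" and bd: "bounded_mem \<beta> s"
      and gb: "dims w ^ ?G < 2 ^ \<beta>"
    have \<beta>: "1 \<le> \<beta>" by (rule pos_exponent[OF gb])
    have gi: "dims w ^ i < 2 ^ \<beta>" "dims w ^ b < 2 ^ \<beta>"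
      using gb dims_power_mono[of i ?G w] dims_power_mono[of b ?G w] by linarith+
    define B where "B = hev w e h"
    have B: "hev w e h' = B" for h' unfolding B_def by (rule hev_static[OF wfc(2)])
    have Bb: "B \<le> dims w ^ b" unfolding B_def by (rule b)
    define F where "F h = set_var v 0 (Suc (hsem w Q c h v 0)) (hsem w Q c h)" for h
    define H where "H j = (F ^^ j) (set_var v 0 0 h)" for j
    have H0: "H 0 = set_var v 0 0 h" and HS: "H (Suc j) = F (H j)" for j by (simp_all add: H_def)
    \<comment> \<open>The body cannot assign the counter, so the counter in memory is the number of
      completed rounds.\<close>
    have Hv: "H j v 0 = j" for j
      by (induction j) (simp_all add: H0 HS F_def hsem_unassigned[OF wfc(3)])
    have ex: "aval ?x s = var_addr w v 0" if "frozen w s" for s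
      using that by (simp add: aval_var)
    define R where "R j s \<longleftrightarrow> represents w Q s (H j) \<and> bounded_mem \<beta> s" for j s
    have R: "frozen w s" "aval ?x s = var_addr w v 0" "aval (Cell ?x) s = j" "aval ?cond s = B - j"
      "acost ?cond s \<le> acsize ?cond * \<beta>" if "R j s" for j s
    proof -
      have r: "represents w Q s (H j)" "bounded_mem \<beta> s" using that by (auto simp: R_def)
      show fr: "frozen w s" using r by (simp add: represents_def)
      show x: "aval ?x s = var_addr w v 0" by (rule ex[OF fr])
      show cx: "aval (Cell ?x) s = j" using r wfc(1) x Hv by (simp add: represents_def)
      have "aval (cexp e) s = B" using aval_cexp[OF r(1), of e] static_evars[OF wfc(2)] B by simp
      then show "aval ?cond s = B - j" using cx by simp
      show "acost ?cond s \<le> acsize ?cond * \<beta>" by (rule acost_bound[OF r(2) \<beta>])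
    qed
    let ?\<tau> = "dims w ^ i * \<beta> + (1 + acsize ?x * \<beta> + acsize ?inc * \<beta>)"
    let ?body = "Seq (comp c) (Assign ?x ?inc)"
    have s0: "exec (Assign ?x (Lit 0)) s \<omega> (1 + acost ?x s + acost (Lit 0) s) (s(var_addr w v 0 := 0)) \<omega>"
      using exec.Assign[of ?x "Lit 0" s \<omega>] ex[of s] rep by (simp add: represents_def)
    have R0: "R 0 (s(var_addr w v 0 := 0))"
      unfolding R_def H0 using represents_upd[OF w wfc(1) rep] bounded_mem_upd[OF bd] by simp
    have "\<exists>T s'. exec (While ?cond ?body) (s(var_addr w v 0 := 0)) \<omega> T s' \<omega> \<and> R B s'
        \<and> T \<le> (B - 0 + 1) * (1 + acsize ?cond * \<beta> + ?\<tau>)"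
    proof (rule exec_loop[where R = R and b = B and j = 0])
      show "aval ?cond s = 0 \<and> acost ?cond s \<le> acsize ?cond * \<beta>" if "R B s" for s
        using R(4,5)[OF that] by simp
    next
      fix j s assume j: "j < B" and Rj: "R j s"
      have r: "represents w Q s (H j)" "bounded_mem \<beta> s" using Rj by (auto simp: R_def)
      obtain T1 s1 where 1: "exec (comp c) s \<omega> T1 s1 \<omega>" "represents w Q s1 (hsem w Q c (H j))"
        "bounded_mem \<beta> s1" "T1 \<le> dims w ^ i * \<beta>"
        using i[unfolded simulates_def, rule_format, OF w r gi(1)] by blast
      have fr1: "frozen w s1" using 1(2) by (simp add: represents_def)
      have vj: "hsem w Q c (H j) v 0 = j" by (simp add: hsem_unassigned[OF wfc(3)] Hv)
      have inc: "aval ?inc s1 = Suc j"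
        using 1(2) wfc(1) vj by (simp add: ex[OF fr1] represents_def)
      let ?s2 = "s1(var_addr w v 0 := Suc j)"
      have 2: "exec (Assign ?x ?inc) s1 \<omega> (1 + acost ?x s1 + acost ?inc s1) ?s2 \<omega>"
        using exec.Assign[of ?x ?inc s1 \<omega>] unfolding inc ex[OF fr1] .
      have "H (Suc j) = set_var v 0 (Suc j) (hsem w Q c (H j))" by (simp add: HS F_def vj)
      then have "represents w Q ?s2 (H (Suc j))" using represents_upd[OF w wfc(1) 1(2)] by simp
      moreover have "bounded_mem \<beta> ?s2"
        using 1(3) j Bb gi(2) by (intro bounded_mem_upd) auto
      ultimately have R2: "R (Suc j) ?s2" by (simp add: R_def)
      have "T1 + (1 + acost ?x s1 + acost ?inc s1) \<le> ?\<tau>"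
        by (intro add_mono 1(4) acost_bound[OF 1(3) \<beta>] order_refl)
      then have "\<exists>T s'. exec ?body s \<omega> T s' \<omega> \<and> R (Suc j) s' \<and> T \<le> ?\<tau>"
        using exec.Seq[OF 1(1) 2] R2 by blast
      moreover have "aval ?cond s \<noteq> 0" using R(4)[OF Rj] j by simp
      ultimately show "aval ?cond s \<noteq> 0 \<and> acost ?cond s \<le> acsize ?cond * \<beta>
          \<and> (\<exists>T s'. exec ?body s \<omega> T s' \<omega> \<and> R (Suc j) s' \<and> T \<le> ?\<tau>)"
        using R(5)[OF Rj] by blast
    qed (use R0 in auto)
    then obtain T s' where l: "exec (While ?cond ?body) (s(var_addr w v 0 := 0)) \<omega> T s' \<omega>" "R B s'"
      "T \<le> (B + 1) * (1 + acsize ?cond * \<beta> + ?\<tau>)" by auto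
    have sem: "hsem w Q (HFor v e c) h = H B" by (simp add: H_def F_def[abs_def] B_def)
    have "1 + acost ?x s + acost (Lit 0) s + T \<le> dims w ^ ?G * \<beta>"
    proof -
      have "1 + acsize ?cond * \<beta> + ?\<tau> \<le> (?K + dims w ^ i) * \<beta>"
      proof -
        have "1 + p * \<beta> + (X * \<beta> + (1 + u * \<beta> + v * \<beta>)) \<le> (2 + p + u + v + X) * \<beta>" for p u v X
          using \<beta> by (simp add: algebra_simps)
        then show ?thesis .
      qed
      also have "\<dots> \<le> dims w ^ (?K + i + 1) * \<beta>"
        by (intro mult_le_mono1 add_le_dims_power le_dims_power) auto
      finally have "T \<le> (B + 1) * (dims w ^ (?K + i + 1) * \<beta>)"
        using l(3) mult_le_mono2 le_trans by blast
      also have "B + 1 \<le> dims w ^ (b + 0 + 1)"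
        using Bb by (intro add_le_dims_power) auto
      also have "dims w ^ (b + 0 + 1) * (dims w ^ (?K + i + 1) * \<beta>) = dims w ^ ((b + 1) + (?K + i + 1)) * \<beta>"
        by (simp only: power_add mult_ac add_0_right)
      finally have T: "T \<le> dims w ^ ((b + 1) + (?K + i + 1)) * \<beta>" by simp
      have "1 + acost ?x s + acost (Lit 0) s \<le> \<beta> + acsize ?x * \<beta> + acsize (Lit 0) * \<beta>"
        by (intro add_mono \<beta> acost_bound bd)
      also have "\<dots> = ?Kinit * \<beta>" by (simp only: distrib_right mult_1)
      finally have "1 + acost ?x s + acost (Lit 0) s + T \<le> (?Kinit + dims w ^ ((b + 1) + (?K + i + 1))) * \<beta>"
        using T unfolding distrib_right by linarith
      also have "\<dots> \<le> dims w ^ ?G * \<beta>"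
        by (intro mult_le_mono1 add_le_dims_power le_dims_power) auto
      finally show ?thesis .
    qed
    then show "\<exists>T s'. exec (comp (HFor v e c)) s \<omega> T s' \<omega> \<and> represents w Q s' (hsem w Q (HFor v e c) h)
        \<and> bounded_mem \<beta> s' \<and> T \<le> dims w ^ ?G * \<beta>"
      using exec.Seq[OF s0 l(1)] l(2) unfolding sem R_def comp.simps by blast
  qed
  then show ?case by blast
qed

section \<open>The program\<close>

lemma HFor_inv:
  assumes "v \<notin> assigned c" "hev w e h = b" "I 0 (set_var v 0 0 h)"
    and step: "\<And>j h'. j < b \<Longrightarrow> h' v 0 = j \<Longrightarrow> I j h' \<Longrightarrow> I (Suc j) (set_var v 0 (Suc j) (hsem w Q c h'))"
  shows "I b (hsem w Q (HFor v e c) h)"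
proof -
  let ?F = "\<lambda>h. set_var v 0 (Suc (hsem w Q c h v 0)) (hsem w Q c h)"
  have "I j ((?F ^^ j) (set_var v 0 0 h)) \<and> (?F ^^ j) (set_var v 0 0 h) v 0 = j" if "j \<le> b" for j
    using that
  proof (induction j)
    case (Suc j)
    then show ?case using step[of j "(?F ^^ j) (set_var v 0 0 h)"] by (simp add: hsem_unassigned[OF assms(1)])
  qed (simp add: assms(3))
  from this[of b] show ?thesis by (simp add: assms(2))
qed

definition agree :: "nat set \<Rightarrow> hstate \<Rightarrow> hstate \<Rightarrow> bool" where
  "agree S h h' \<longleftrightarrow> (\<forall>u. u \<notin> S \<longrightarrow> h' u = h u)"

lemma agree_refl [simp]: "agree S h h" by (simp add: agree_def)

lemma agreeD: "agree S h h' \<Longrightarrow> u \<notin> S \<Longrightarrow> h' u = h u" by (simp add: agree_def)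

lemma agree_set_var: "agree S h h' \<Longrightarrow> v \<in> S \<Longrightarrow> agree S h (set_var v i x h')"
  by (auto simp: agree_def set_var_def)

lemma agree_hsem: "agree S h h' \<Longrightarrow> assigned c \<subseteq> S \<Longrightarrow> agree S h (hsem w Q c h')"
  unfolding agree_def by (metis hsem_unassigned subsetD)

lemma map_loop:
  assumes "v \<notin> assigned c" "v \<noteq> x" "hev w e h = b"
    and body: "\<And>j h'. j < b \<Longrightarrow> h' v 0 = j \<Longrightarrow> agree (insert v (assigned c)) h h' \<Longrightarrow>
      hsem w Q c h' x = (h' x)(j := F j)"
  shows "hsem w Q (HFor v e c) h x = (\<lambda>i. if i < b then F i else h x i)"
proof -
  let ?S = "insert v (assigned c)"
  have "agree ?S h (hsem w Q (HFor v e c) h) \<and> hsem w Q (HFor v e c) h x = (\<lambda>i. if i < b then F i else h x i)"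
  proof (rule HFor_inv[where I = "\<lambda>j h'. agree ?S h h' \<and> h' x = (\<lambda>i. if i < j then F i else h x i)"])
    fix j h' assume j: "j < b" "h' v 0 = j" "agree ?S h h' \<and> h' x = (\<lambda>i. if i < j then F i else h x i)"
    have "hsem w Q c h' x = (\<lambda>i. if i < Suc j then F i else h x i)"
      using body[of j h'] j by (auto simp: fun_eq_iff)
    then show "agree ?S h (set_var v 0 (Suc j) (hsem w Q c h')) \<and>
        set_var v 0 (Suc j) (hsem w Q c h') x = (\<lambda>i. if i < Suc j then F i else h x i)"
      using j assms(2) by (auto intro!: agree_set_var agree_hsem)
  qed (use assms(1-3) in \<open>auto intro!: agree_set_var\<close>)
  then show ?thesis ..
qed

lemma sum_loop:
  assumes "v \<notin> assigned c" "v \<noteq> s" "hev w e h = b"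
    and body: "\<And>j h'. j < b \<Longrightarrow> h' v 0 = j \<Longrightarrow> agree (insert v (assigned c)) h h' \<Longrightarrow>
      h' s 0 + F j \<le> Q \<Longrightarrow> hsem w Q c h' s 0 = h' s 0 + F j"
    and Q: "h s 0 + (\<Sum>j<b. F j) \<le> Q"
  shows "hsem w Q (HFor v e c) h s 0 = h s 0 + (\<Sum>j<b. F j)"
proof -
  let ?S = "insert v (assigned c)"
  have "agree ?S h (hsem w Q (HFor v e c) h) \<and> hsem w Q (HFor v e c) h s 0 = h s 0 + (\<Sum>j<b. F j)"
  proof (rule HFor_inv[where I = "\<lambda>j h'. agree ?S h h' \<and> h' s 0 = h s 0 + (\<Sum>j<j. F j)"])
    fix j h' assume j: "j < b" "h' v 0 = j" "agree ?S h h' \<and> h' s 0 = h s 0 + (\<Sum>j<j. F j)"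
    have "(\<Sum>j<Suc j. F j) \<le> (\<Sum>j<b. F j)" using j(1) by (intro sum_mono2) auto
    then have "h' s 0 + F j \<le> Q" using j(3) Q by simp
    then have "hsem w Q c h' s 0 = h s 0 + (\<Sum>j<Suc j. F j)"
      using body[of j h'] j by simp
    then show "agree ?S h (set_var v 0 (Suc j) (hsem w Q c h')) \<and>
        set_var v 0 (Suc j) (hsem w Q c h') s 0 = h s 0 + (\<Sum>j<Suc j. F j)"
      using j assms(2) by (auto intro!: agree_set_var agree_hsem)
  qed (use assms(1-3) in \<open>auto intro!: agree_set_var\<close>)
  then show ?thesis ..
qed

section \<open>Sums, maps and maxima as loops\<close>

abbreviation "Sc v \<equiv> HV v (HL 0)"

definition sum_com :: "nat \<Rightarrow> nat \<Rightarrow> hexp \<Rightarrow> hexp \<Rightarrow> hcom" where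
  "sum_com s v e f = HSeq (HAsg s (HL 0) (HL 0)) (HFor v e (HAsg s (HL 0) (HAdd (Sc s) f)))"

definition map_com :: "nat \<Rightarrow> nat \<Rightarrow> hexp \<Rightarrow> hexp \<Rightarrow> hcom" where
  "map_com x v e f = HFor v e (HAsg x (Sc v) f)"

definition max_com :: "nat \<Rightarrow> hexp \<Rightarrow> hcom" where
  "max_com s f = HAsg s (HL 0) (HAdd (Sc s) (HSub f (Sc s)))"

lemma assigned_macros [simp]:
  "assigned (sum_com s v e f) = {s, v}" "assigned (map_com s v e f) = {s, v}" "assigned (max_com s f) = {s}"
  by (auto simp: sum_com_def map_com_def max_com_def)

lemma wf_macros [simp]:
  "wf (sum_com s v e f) \<longleftrightarrow> s < max_vars \<and> v < max_vars \<and> v \<noteq> s \<and> static e \<and> evars f \<subseteq> {..<max_vars}"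
  "wf (map_com s v e f) \<longleftrightarrow> s < max_vars \<and> v < max_vars \<and> v \<noteq> s \<and> static e \<and> evars f \<subseteq> {..<max_vars}"
  "wf (max_com s f) \<longleftrightarrow> s < max_vars \<and> evars f \<subseteq> {..<max_vars}"
  by (auto simp: sum_com_def map_com_def max_com_def)

lemma sum_com:
  assumes "v \<noteq> s" "static e" "hev w e h = b"
    and F: "\<And>j h'. j < b \<Longrightarrow> h' v 0 = j \<Longrightarrow> agree {v, s} h h' \<Longrightarrow> hev w f h' = F j"
    and Q: "(\<Sum>j<b. F j) \<le> Q"
  shows "hsem w Q (sum_com s v e f) h s 0 = (\<Sum>j<b. F j)"
proof -
  let ?h = "set_var s 0 0 h"
  have ag: "agree {v, s} h h'" if "agree {v, s} ?h h'" for h'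
    using that by (auto simp: agree_def set_var_def)
  have "hsem w Q (HFor v e (HAsg s (HL 0) (HAdd (Sc s) f))) ?h s 0 = ?h s 0 + (\<Sum>j<b. F j)"
    using assms ag by (intro sum_loop) (auto simp: hev_static[OF assms(2), of w ?h h])
  then show ?thesis by (simp add: sum_com_def)
qed

lemma map_com:
  assumes "v \<noteq> x" "hev w e h = b"
    and F: "\<And>j h'. j < b \<Longrightarrow> h' v 0 = j \<Longrightarrow> agree {v, x} h h' \<Longrightarrow> hev w f h' = F j"
    and Q: "\<And>j. j < b \<Longrightarrow> F j \<le> Q"
  shows "hsem w Q (map_com x v e f) h x = (\<lambda>i. if i < b then F i else h x i)"
  unfolding map_com_def using assms by (intro map_loop) auto

lemma max_com: "hev w f h \<le> Q \<Longrightarrow> h s 0 \<le> Q \<Longrightarrow> hsem w Q (max_com s f) h s 0 = max (h s 0) (hev w f h)"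
  by (auto simp: max_com_def)

text \<open>1 - x is 1 for x = 0 and 0 for any positive x; applied twice it yields a 0/1 truth
  value.\<close>

definition lt_exp :: "hexp \<Rightarrow> hexp \<Rightarrow> hexp" where
  "lt_exp a b = HSub (HL 1) (HSub (HL 1) (HSub b a))"

lemma hev_lt [simp]: "hev w (lt_exp a b) h = of_bool (hev w a h < hev w b h)"
  by (auto simp: lt_exp_def)

lemma evars_lt [simp]: "evars (lt_exp a b) = evars a \<union> evars b"
  by (auto simp: lt_exp_def)

definition sq_exp :: "hexp \<Rightarrow> hexp" where "sq_exp a = HMul a a"

lemma sq_exp_simps [simp]: "hev w (sq_exp a) h = (hev w a h)\<^sup>2" "evars (sq_exp a) = evars a" "static (sq_exp a) = static a"
  by (auto simp: sq_exp_def power2_eq_square)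

definition move_exp :: hexp where "move_exp = HMul (HL 2048) (sq_exp HN)"
definition radius_exp :: hexp where "radius_exp = HMul (HMul (HL 8192) HN) move_exp"
definition slope_exp :: hexp where "slope_exp = HMul radius_exp (HAdd HN (HL 1))"
definition offset_exp :: hexp where
  "offset_exp = HAdd (HMul (HMul slope_exp HN) radius_exp)
     (HMul (HMul (HMul (HMul (HL 4096) HN) (HAdd HN (HL 1))) HN) (sq_exp radius_exp))"
definition iters_exp :: hexp where "iters_exp = HMul (HL 8388608) (HMul HN (sq_exp HN))"
definition rounds_exp :: hexp where
  "rounds_exp = HAdd (HMul (HMul (HL 32768) HN) (HMul (HMul HN (sq_exp radius_exp)) (HAdd HN (HL 1)))) (HL 1)"

lemma hev_consts [simp]:
  "hev w move_exp h = move_bound (w 0)" "hev w radius_exp h = radius (w 0)" "hev w slope_exp h = slope (w 0)"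
  "hev w offset_exp h = offset (w 0)" "hev w iters_exp h = power_steps (w 0)" "hev w rounds_exp h = rounds (w 0)"
  by (simp_all add: move_exp_def move_bound_def radius_exp_def radius_def slope_exp_def slope_def
      offset_exp_def offset_def iters_exp_def power_steps_def power3_eq_cube power2_eq_square rounds_exp_def
      rounds_def res_base_def)

lemma static_consts [simp]: "static move_exp" "static radius_exp" "static slope_exp" "static offset_exp"
  "static iters_exp" "static rounds_exp"
  by (simp_all add: move_exp_def radius_exp_def slope_exp_def offset_exp_def iters_exp_def rounds_exp_def)

lemma evars_consts [simp]: "evars move_exp = {}" "evars radius_exp = {}" "evars slope_exp = {}" "evars offset_exp = {}"
  "evars iters_exp = {}" "evars rounds_exp = {}"
  by (simp_all add: static_evars)

text \<open>Variable numbers: 0--8 are loop counters, 10--29 scalars and 30--41 arrays.\<close>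

abbreviation (input) "q_ctr \<equiv> 0 :: nat"
abbreviation (input) "i_ctr \<equiv> 8 :: nat"
abbreviation (input) "l_ctr \<equiv> 2 :: nat"
abbreviation (input) "j_ctr \<equiv> 3 :: nat"
abbreviation (input) "u_ctr \<equiv> 4 :: nat"
abbreviation (input) "t_ctr \<equiv> 5 :: nat"
abbreviation (input) "x_ctr \<equiv> 6 :: nat"
abbreviation (input) "it_ctr \<equiv> 7 :: nat"
abbreviation (input) "b_var \<equiv> 10 :: nat"
abbreviation (input) "r_var \<equiv> 11 :: nat"
abbreviation (input) "m_var \<equiv> 12 :: nat"
abbreviation (input) "en_var \<equiv> 13 :: nat"
abbreviation (input) "zs_var \<equiv> 14 :: nat"
abbreviation (input) "sz_var \<equiv> 15 :: nat"
abbreviation (input) "up_var \<equiv> 16 :: nat"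
abbreviation (input) "dn_var \<equiv> 17 :: nat"
abbreviation (input) "p1_var \<equiv> 18 :: nat"
abbreviation (input) "p2_var \<equiv> 19 :: nat"
abbreviation (input) "pot_var \<equiv> 20 :: nat"
abbreviation (input) "lev_var \<equiv> 21 :: nat"
abbreviation (input) "bp_var \<equiv> 22 :: nat"
abbreviation (input) "vm_var \<equiv> 23 :: nat"
abbreviation (input) "acc_var \<equiv> 24 :: nat"
abbreviation (input) "dsc_var \<equiv> 25 :: nat"
abbreviation (input) "best_var \<equiv> 26 :: nat"
abbreviation (input) "z_arr \<equiv> 30 :: nat"
abbreviation (input) "al_arr \<equiv> 31 :: nat"
abbreviation (input) "w_arr \<equiv> 32 :: nat"
abbreviation (input) "m_arr \<equiv> 33 :: nat"
abbreviation (input) "vp_arr \<equiv> 34 :: nat"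
abbreviation (input) "vn_arr \<equiv> 35 :: nat"
abbreviation (input) "tp_arr \<equiv> 36 :: nat"
abbreviation (input) "tn_arr \<equiv> 37 :: nat"
abbreviation (input) "z2_arr \<equiv> 38 :: nat"
abbreviation (input) "bz_arr \<equiv> 39 :: nat"
abbreviation (input) "col_arr \<equiv> 40 :: nat"
abbreviation (input) "out_arr \<equiv> 41 :: nat"

text \<open>The exponent is data, while loop bounds must be static. So there are always
  \<open>2 * offset n\<close> multiplications, by r + 1 while the counter is below the exponent and
  by r afterwards: exactly \<open>scaled_power\<close>.\<close>

definition power_com :: "nat \<Rightarrow> nat \<Rightarrow> hcom" where
  "power_com p e = HSeq (HAsg p (HL 0) (HL 1)) (HFor u_ctr (HMul (HL 2) offset_exp)
     (HAsg p (HL 0) (HMul (Sc p) (HAdd (Sc r_var) (lt_exp (Sc u_ctr) (Sc e))))))"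

definition weight_com :: "nat \<Rightarrow> hcom" where
  "weight_com z = HSeq (sum_com zs_var i_ctr HN (HMul (HIn (Sc j_ctr) (Sc i_ctr)) (HV z (Sc i_ctr))))
    (HSeq (sum_com sz_var i_ctr HN (HIn (Sc j_ctr) (Sc i_ctr)))
    (HSeq (HAsg up_var (HL 0) (HSub (HSub (HAdd offset_exp (HMul slope_exp (Sc zs_var)))
        (HMul (HMul slope_exp radius_exp) (Sc sz_var))) (HMul (Sc b_var) (Sc en_var))))
    (HSeq (HAsg dn_var (HL 0) (HSub (HSub (HAdd offset_exp (HMul (HMul slope_exp radius_exp) (Sc sz_var)))
        (HMul slope_exp (Sc zs_var))) (HMul (Sc b_var) (Sc en_var))))
    (HSeq (power_com p1_var up_var)
    (HSeq (power_com p2_var dn_var)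
    (HSeq (HAsg w_arr (Sc j_ctr) (HAdd (Sc p1_var) (Sc p2_var)))
      (HAsg pot_var (HL 0) (HAdd (Sc pot_var) (HV w_arr (Sc j_ctr))))))))))"

definition pot_com :: "nat \<Rightarrow> hcom" where
  "pot_com z = HSeq (sum_com en_var i_ctr HN (HSub (HAdd (sq_exp (HV z (Sc i_ctr))) (sq_exp radius_exp))
      (HMul (HMul (HL 2) radius_exp) (HV z (Sc i_ctr)))))
    (HSeq (HAsg pot_var (HL 0) (HL 0)) (HFor j_ctr HK (weight_com z)))"

lemma assigned_pot [simp]:
  "assigned (power_com p e) = {p, u_ctr}"
  "assigned (weight_com z) = {zs_var, sz_var, up_var, dn_var, p1_var, p2_var, w_arr, pot_var, i_ctr, u_ctr}"
  "assigned (pot_com z) = {en_var, zs_var, sz_var, up_var, dn_var, p1_var, p2_var, w_arr, pot_var, i_ctr, j_ctr, u_ctr}"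
  by (auto simp: power_com_def weight_com_def pot_com_def)

lemma wf_pot [simp]: "z < max_vars \<Longrightarrow> wf (pot_com z)"
  by (simp add: power_com_def weight_com_def pot_com_def max_vars_def)

lemma power_com:
  assumes "p \<noteq> u_ctr" "p \<noteq> r_var" "p \<noteq> e" "e \<noteq> u_ctr"
    and E: "h e 0 \<le> 2 * offset (w 0)" and Q: "(h r_var 0 + 1) ^ (2 * offset (w 0)) \<le> Q"
  shows "hsem w Q (power_com p e) h p 0 = scaled_power (offset (w 0)) (h r_var 0) (h e 0)"
proof -
  let ?o = "2 * offset (w 0)" and ?E = "h e 0" and ?r = "h r_var 0"
  let ?S = "{p, u_ctr}" and ?G = "\<lambda>j. (?r + 1) ^ min j ?E * ?r ^ (j - ?E)"
  have le: "?G j \<le> Q" if "j \<le> ?o" for j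
  proof -
    have "?G j \<le> (?r + 1) ^ min j ?E * (?r + 1) ^ (j - ?E)" by (intro mult_le_mono2 power_mono) auto
    also have "\<dots> = (?r + 1) ^ j" by (simp add: power_add[symmetric] min_def)
    also have "\<dots> \<le> (?r + 1) ^ ?o" using that by (intro power_increasing) auto
    finally show ?thesis using Q by linarith
  qed
  have Q1: "1 \<le> Q" using le[of 0] by simp
  let ?h = "set_var p 0 1 h" and ?c = "HAsg p (HL 0) (HMul (Sc p) (HAdd (Sc r_var) (lt_exp (Sc u_ctr) (Sc e))))"
  have "agree ?S h (hsem w Q (HFor u_ctr (HMul (HL 2) offset_exp) ?c) ?h)
      \<and> hsem w Q (HFor u_ctr (HMul (HL 2) offset_exp) ?c) ?h p 0 = ?G ?o"
  proof (rule HFor_inv[where I = "\<lambda>j h'. agree ?S h h' \<and> h' p 0 = ?G j"])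
    fix j h' assume j: "j < ?o" "h' u_ctr 0 = j" "agree ?S h h' \<and> h' p 0 = ?G j"
    have eq: "h' r_var = h r_var" "h' e = h e" using j(3) assms(2-4) by (auto simp: agree_def)
    have step: "?G j * (?r + of_bool (j < ?E)) = ?G (Suc j)"
    proof (cases "j < ?E")
      case False
      then have "Suc j - ?E = Suc (j - ?E)" by simp
      then show ?thesis using False by (simp add: min_def mult_ac)
    qed (simp add: min_def mult_ac)
    have "hsem w Q ?c h' p 0 = ?G (Suc j)"
      using j(2,3) le[of "Suc j"] j(1) unfolding step[symmetric] by (simp add: eq)
    then show "agree ?S h (set_var u_ctr 0 (Suc j) (hsem w Q ?c h'))
        \<and> set_var u_ctr 0 (Suc j) (hsem w Q ?c h') p 0 = ?G (Suc j)"
      using j(3) assms(1) by (auto intro!: agree_set_var agree_hsem)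
  qed (use assms(1) in \<open>auto intro!: agree_set_var\<close>)
  then show ?thesis using E Q1 by (simp add: power_com_def scaled_power_def min_def)
qed

declare hev.simps(4) [simp del]

text \<open>\<open>Q_power\<close> is above every weight and every potential,
  \<open>Q_offset\<close> above every exponent, so that computing them involves no
  truncation.\<close>

locale prog = walk +
  fixes w :: memory and Q :: nat
  assumes w0: "w 0 = n" and w1: "w (Suc 0) = k"
    and matrix: "\<And>j i. j < k \<Longrightarrow> i < n \<Longrightarrow> w (2 + (j * n + i)) = a j i"
    and q_le: "q \<le> n"
    and Q_power: "(r + 1) ^ (2 * offset n) * (2 * k) \<le> Q" and Q_offset: "2 * offset n \<le> Q"
begin

lemma row_index: "j < k \<Longrightarrow> i < n \<Longrightarrow> j * n + i < k * n"
proof -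
  assume "j < k" "i < n"
  then have "j * n + i < Suc j * n" by simp
  also have "\<dots> \<le> k * n" using \<open>j < k\<close> by (intro mult_le_mono1) simp
  finally show ?thesis .
qed

lemma hev_HIn [simp]:
  assumes "hev w e h < k" "hev w f h < n"
  shows "hev w (HIn e f) h = a (hev w e h) (hev w f h)"
proof -
  have "hev w e h * n + hev w f h < n * k + 1" using row_index[OF assms] by (simp add: mult.commute)
  then show ?thesis using matrix[OF assms] by (simp add: w0 w1 hev.simps(4))
qed

lemma en_sum_le: "inside Z \<Longrightarrow> energy n Z \<le> n * D\<^sup>2"
proof -
  assume "inside Z"
  then have "real (energy n Z) \<le> real (n * D\<^sup>2)" using en_le by (simp add: energy_eq)
  then show ?thesis by (simp only: of_nat_le_iff)
qed

lemma offset_ge: "A * n * D \<le> offset n" "n * D\<^sup>2 \<le> offset n"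
proof -
  show "A * n * D \<le> offset n" by (simp add: offset_def)
  have "1 * (n * D\<^sup>2) \<le> (4096 * n * (n + 1)) * (n * D\<^sup>2)"
    using n_pos by (intro mult_le_mono1) (cases n; simp)
  also have "\<dots> \<le> offset n" by (simp add: offset_def mult_ac)
  finally show "n * D\<^sup>2 \<le> offset n" by simp
qed

lemma n_le_offset: "n \<le> offset n"
proof -
  have "n * 1 \<le> n * D\<^sup>2" using D_pos by (intro mult_le_mono2) (simp add: Suc_leI)
  then show ?thesis using offset_ge(2) by linarith
qed

lemma zsum_le: "inside Z \<Longrightarrow> (\<Sum>i<n. a j i * Z i) \<le> 2 * offset n"
proof -
  assume Z: "inside Z"
  have "(\<Sum>i<n. a j i * Z i) \<le> (\<Sum>i<n. 1 * (2 * D))"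
    using Z a_le by (intro sum_mono mult_le_mono) (auto simp: inside_def)
  also have "\<dots> = 2 * (n * D)" by simp
  also have "n * D \<le> n * D\<^sup>2" using D_pos by (intro mult_le_mono2) (simp add: power2_eq_square)
  also have "n * D\<^sup>2 \<le> offset n" by (rule offset_ge(2))
  finally show ?thesis by simp
qed

lemma ssum_le: "(\<Sum>i<n. a j i) \<le> n"
  using sum_mono[of "{..<n}" "a j" "\<lambda>_. 1"] a_le by simp

lemma scaled_power_le: "u \<le> 2 * offset n \<Longrightarrow> scaled_power (offset n) r u \<le> (r + 1) ^ (2 * offset n)"
proof -
  assume u: "u \<le> 2 * offset n"
  have "scaled_power (offset n) r u \<le> (r + 1) ^ u * (r + 1) ^ (2 * offset n - u)"
    unfolding scaled_power_def by (intro mult_le_mono2 power_mono) auto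
  also have "\<dots> = (r + 1) ^ (2 * offset n)" using u by (simp add: power_add[symmetric])
  finally show ?thesis .
qed

lemma weight_le:
  assumes "inside Z" "b \<le> 4096 * q * (n + 1)"
  shows "weight n q (a j) b Z \<le> (r + 1) ^ (2 * offset n) * 2"
  using exponents(3,4)[OF assms q_le, of j] scaled_power_le unfolding weight_def
  by (metis add_mono mult_2_right)

lemma pot_le:
  assumes "inside Z" "b \<le> 4096 * q * (n + 1)"
  shows "pot b Z \<le> (r + 1) ^ (2 * offset n) * (2 * k)"
proof -
  have "pot b Z \<le> (\<Sum>j<k. (r + 1) ^ (2 * offset n) * 2)"
    unfolding pot_def by (intro sum_mono weight_le assms)
  then show ?thesis by (simp add: mult_ac)
qed

lemma weight_com:
  assumes z: "z \<notin> assigned (weight_com z)" "z \<notin> {j_ctr, b_var, en_var, r_var}"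
    and Z: "inside (h z)" and b: "h b_var 0 \<le> 4096 * q * (n + 1)" and r: "h r_var 0 = r"
    and en: "h en_var 0 = energy n (h z)" and j: "h j_ctr 0 = j" "j < k"
    and Q: "h pot_var 0 + weight n q (a j) (h b_var 0) (h z) \<le> Q"
  shows "hsem w Q (weight_com z) h w_arr = (h w_arr)(j := weight n q (a j) (h b_var 0) (h z))"
    "hsem w Q (weight_com z) h pot_var 0 = h pot_var 0 + weight n q (a j) (h b_var 0) (h z)"
proof -
  let ?b = "h b_var 0" and ?Z = "h z"
  have zn: "z \<noteq> 8" "z \<noteq> 3" "z \<noteq> 4" "z \<noteq> 14" "z \<noteq> 15" "z \<noteq> 16" "z \<noteq> 17" "z \<noteq> 18" "z \<noteq> 19" "z \<noteq> 20" "z \<noteq> 32"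
    using z by auto
  have kQ: "(r + 1) ^ (2 * offset n) * 2 \<le> Q"
  proof -
    have "(r + 1) ^ (2 * offset n) * 2 \<le> (r + 1) ^ (2 * offset n) * (2 * k)"
      using k_pos by (intro mult_le_mono2) simp
    then show ?thesis using Q_power by linarith
  qed
  define h1 where "h1 = hsem w Q (sum_com zs_var i_ctr HN (HMul (HIn (Sc j_ctr) (Sc i_ctr)) (HV z (Sc i_ctr)))) h"
  have h1: "h1 zs_var 0 = (\<Sum>i<n. a j i * ?Z i)"
    unfolding h1_def
  proof (rule sum_com)
    fix i h' assume i: "i < n" "h' i_ctr 0 = i" "agree {i_ctr, zs_var} h h'"
    show "hev w (HMul (HIn (Sc j_ctr) (Sc i_ctr)) (HV z (Sc i_ctr))) h' = a j i * ?Z i"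
      using i j zn agreeD[OF i(3), of j_ctr] agreeD[OF i(3), of z] by simp
  qed (use zsum_le[OF Z, of j] Q_offset in \<open>auto simp: w0\<close>)
  have h1u: "h1 u = h u" if "u \<notin> {zs_var, i_ctr}" for u
    unfolding h1_def using that by (intro hsem_unassigned) simp
  define h2 where "h2 = hsem w Q (sum_com sz_var i_ctr HN (HIn (Sc j_ctr) (Sc i_ctr))) h1"
  have h2: "h2 sz_var 0 = (\<Sum>i<n. a j i)"
    unfolding h2_def
  proof (rule sum_com)
    fix i h' assume i: "i < n" "h' i_ctr 0 = i" "agree {i_ctr, sz_var} h1 h'"
    show "hev w (HIn (Sc j_ctr) (Sc i_ctr)) h' = a j i"
      using i j h1u[of j_ctr] agreeD[OF i(3), of j_ctr] by simp
  qed (use ssum_le[of j] n_le_offset Q_offset in \<open>auto simp: w0\<close>)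
  have h2u: "h2 u = h u" if "u \<notin> {zs_var, i_ctr, sz_var}" for u
    using that h1u[of u] hsem_unassigned[of u "sum_com sz_var i_ctr HN (HIn (Sc j_ctr) (Sc i_ctr))" w Q h1]
    by (simp add: h2_def)
  have h2z: "h2 zs_var 0 = (\<Sum>i<n. a j i * ?Z i)"
    using h1 hsem_unassigned[of zs_var "sum_com sz_var i_ctr HN (HIn (Sc j_ctr) (Sc i_ctr))" w Q h1] by (simp add: h2_def)
  let ?U = "up_exp n (a j) ?b ?Z" and ?D = "down_exp n (a j) ?b ?Z"
  have UQ: "?U \<le> 2 * offset n" "?D \<le> 2 * offset n" using exponents(3,4)[OF Z b q_le] by auto
  define h3 where "h3 = set_var dn_var 0 ?D (set_var up_var 0 ?U h2)"
  define h4 where "h4 = hsem w Q (power_com p1_var up_var) h3"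
  have h4: "h4 p1_var 0 = scaled_power (offset n) r ?U"
    using power_com[of p1_var up_var h3 w Q] UQ kQ h2u[of r_var] r by (simp add: h4_def h3_def w0)
  have h4u: "h4 u = h3 u" if "u \<notin> {p1_var, u_ctr}" for u
    unfolding h4_def using that by (intro hsem_unassigned) simp
  define h5 where "h5 = hsem w Q (power_com p2_var dn_var) h4"
  have h5: "h5 p2_var 0 = scaled_power (offset n) r ?D"
    using power_com[of p2_var dn_var h4 w Q] UQ kQ h2u[of r_var] h4u[of r_var] h4u[of dn_var] r
    by (simp add: h5_def h3_def w0)
  have h5u: "h5 u = h4 u" if "u \<notin> {p2_var, u_ctr}" for u
    unfolding h5_def using that by (intro hsem_unassigned) simp
  have h5h: "h5 u = h u" if "u \<notin> {zs_var, sz_var, up_var, dn_var, p1_var, p2_var, i_ctr, u_ctr}" for u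
    using that h5u[of u] h4u[of u] h2u[of u] by (simp add: h3_def)
  have W: "h5 p1_var 0 + h5 p2_var 0 = weight n q (a j) ?b ?Z"
    using h4 h5 h5u[of p1_var] by (simp add: weight_def)
  have WQ: "weight n q (a j) ?b ?Z \<le> Q" using Q by simp
  have e1: "hsem w Q (HAsg up_var (HL 0) (HSub (HSub (HAdd offset_exp (HMul slope_exp (Sc zs_var)))
        (HMul (HMul slope_exp radius_exp) (Sc sz_var))) (HMul (Sc b_var) (Sc en_var)))) h2 = set_var up_var 0 ?U h2"
    using UQ(1) Q_offset h2 h2z h2u[of b_var] h2u[of en_var] en by (simp add: w0 up_exp_def)
  have e2: "hsem w Q (HAsg dn_var (HL 0) (HSub (HSub (HAdd offset_exp (HMul (HMul slope_exp radius_exp) (Sc sz_var)))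
        (HMul slope_exp (Sc zs_var))) (HMul (Sc b_var) (Sc en_var)))) (set_var up_var 0 ?U h2) = h3"
    using UQ(2) Q_offset h2 h2z h2u[of b_var] h2u[of en_var] en by (simp add: w0 down_exp_def h3_def)
  have fin: "hsem w Q (weight_com z) h = set_var pot_var 0 (h pot_var 0 + weight n q (a j) ?b ?Z)
      (set_var w_arr j (weight n q (a j) ?b ?Z) h5)"
    unfolding weight_com_def hsem.simps(2) h1_def[symmetric] h2_def[symmetric] e1 e2 h4_def[symmetric] h5_def[symmetric]
    using W WQ Q h5h[of j_ctr] h5h[of pot_var] j by simp
  show "hsem w Q (weight_com z) h w_arr = (h w_arr)(j := weight n q (a j) (h b_var 0) (h z))"
    "hsem w Q (weight_com z) h pot_var 0 = h pot_var 0 + weight n q (a j) (h b_var 0) (h z)"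
    unfolding fin using h5h[of w_arr] by (simp_all add: fun_eq_iff)
qed

lemma pot_com:
  assumes z: "z \<notin> assigned (pot_com z)" "z \<notin> {b_var, r_var}"
    and Z: "inside (h z)" and b: "h b_var 0 \<le> 4096 * q * (n + 1)" and r: "h r_var 0 = r"
  shows "hsem w Q (pot_com z) h pot_var 0 = pot (h b_var 0) (h z)"
    "\<And>j. j < k \<Longrightarrow> hsem w Q (pot_com z) h w_arr j = weight n q (a j) (h b_var 0) (h z)"
proof -
  let ?b = "h b_var 0" and ?Z = "h z"
  let ?e = "HSub (HAdd (sq_exp (HV z (Sc i_ctr))) (sq_exp radius_exp)) (HMul (HMul (HL 2) radius_exp) (HV z (Sc i_ctr)))"
  define h1 where "h1 = hsem w Q (sum_com en_var i_ctr HN ?e) h"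
  have zn: "z \<noteq> 8" "z \<noteq> 13" "z \<noteq> 3" "z \<noteq> 20" using z by auto
  have h1: "h1 en_var 0 = energy n ?Z"
    unfolding h1_def energy_def
  proof (rule sum_com)
    fix i h' assume i: "i < n" "h' i_ctr 0 = i" "agree {i_ctr, en_var} h h'"
    show "hev w ?e h' = (?Z i)\<^sup>2 + D\<^sup>2 - 2 * D * ?Z i"
      using i zn agreeD[OF i(3), of z] by (simp add: w0)
  next
    show "(\<Sum>i<n. (?Z i)\<^sup>2 + D\<^sup>2 - 2 * D * ?Z i) \<le> Q"
      using en_sum_le[OF Z] offset_ge(2) Q_offset by (simp add: energy_def)
  qed (auto simp: w0)
  have h1u: "h1 u = h u" if "u \<notin> {en_var, i_ctr}" for u
    unfolding h1_def using that by (intro hsem_unassigned) simp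
  define h2 where "h2 = set_var pot_var 0 0 h1"
  have h2u: "h2 u = h u" if "u \<notin> {en_var, i_ctr, pot_var}" for u
    using that h1u[of u] by (simp add: h2_def)
  have h2p: "h2 pot_var 0 = 0" by (simp add: h2_def)
  have PQ: "(\<Sum>j<k. weight n q (a j) ?b ?Z) \<le> Q" using pot_le[OF Z b] Q_power by (simp add: pot_def)
  let ?S = "insert j_ctr (assigned (weight_com z))"
  have step: "hsem w Q (weight_com z) h' w_arr = (h' w_arr)(j := weight n q (a j) ?b ?Z)"
    "h' pot_var 0 + weight n q (a j) ?b ?Z \<le> Q \<Longrightarrow>
      hsem w Q (weight_com z) h' pot_var 0 = h' pot_var 0 + weight n q (a j) ?b ?Z"
    if "j < k" "h' j_ctr 0 = j" "agree ?S h2 h'" "h' pot_var 0 + weight n q (a j) ?b ?Z \<le> Q" for j h'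
  proof -
    have zS: "z \<notin> ?S" using z by auto
    have eq: "h' z = h z" "h' b_var = h b_var" "h' r_var = h r_var" "h' en_var = h1 en_var"
      using agreeD[OF that(3), of z] agreeD[OF that(3), of b_var] agreeD[OF that(3), of r_var]
        agreeD[OF that(3), of en_var] h2u[of z] h2u[of b_var] h2u[of r_var] zS z
      by (auto simp: h2_def)
    have "hsem w Q (weight_com z) h' w_arr = (h' w_arr)(j := weight n q (a j) (h' b_var 0) (h' z))"
      "hsem w Q (weight_com z) h' pot_var 0 = h' pot_var 0 + weight n q (a j) (h' b_var 0) (h' z)"
      by (rule weight_com; use z Z b r h1 that eq in simp)+
    then show "hsem w Q (weight_com z) h' w_arr = (h' w_arr)(j := weight n q (a j) ?b ?Z)"
      "hsem w Q (weight_com z) h' pot_var 0 = h' pot_var 0 + weight n q (a j) ?b ?Z"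
      by (simp_all add: eq)
  qed
  have "agree ?S h2 (hsem w Q (HFor j_ctr HK (weight_com z)) h2)
      \<and> hsem w Q (HFor j_ctr HK (weight_com z)) h2 pot_var 0 = (\<Sum>j<k. weight n q (a j) ?b ?Z)
      \<and> (\<forall>i<k. hsem w Q (HFor j_ctr HK (weight_com z)) h2 w_arr i = weight n q (a i) ?b ?Z)"
  proof (rule HFor_inv[where I = "\<lambda>j h'. agree ?S h2 h' \<and> h' pot_var 0 = (\<Sum>j<j. weight n q (a j) ?b ?Z)
      \<and> (\<forall>i<j. h' w_arr i = weight n q (a i) ?b ?Z)"])
    fix j h' assume j: "j < k" "h' j_ctr 0 = j" "agree ?S h2 h' \<and> h' pot_var 0 = (\<Sum>j<j. weight n q (a j) ?b ?Z)
      \<and> (\<forall>i<j. h' w_arr i = weight n q (a i) ?b ?Z)"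
    have "(\<Sum>j<Suc j. weight n q (a j) ?b ?Z) \<le> (\<Sum>j<k. weight n q (a j) ?b ?Z)"
      using j(1) by (intro sum_mono2) auto
    then have Qj: "h' pot_var 0 + weight n q (a j) ?b ?Z \<le> Q" using j(3) PQ by simp
    have ag: "agree ?S h2 h'" using j(3) by simp
    show "agree ?S h2 (set_var j_ctr 0 (Suc j) (hsem w Q (weight_com z) h'))
      \<and> set_var j_ctr 0 (Suc j) (hsem w Q (weight_com z) h') pot_var 0 = (\<Sum>j<Suc j. weight n q (a j) ?b ?Z)
      \<and> (\<forall>i<Suc j. set_var j_ctr 0 (Suc j) (hsem w Q (weight_com z) h') w_arr i = weight n q (a i) ?b ?Z)"
    proof (intro conjI)
      show "agree ?S h2 (set_var j_ctr 0 (Suc j) (hsem w Q (weight_com z) h'))"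
        using ag by (intro agree_set_var agree_hsem) auto
      show "set_var j_ctr 0 (Suc j) (hsem w Q (weight_com z) h') pot_var 0 = (\<Sum>j<Suc j. weight n q (a j) ?b ?Z)"
        using step(2)[OF j(1,2) ag Qj Qj] j(3) by simp
      show "\<forall>i<Suc j. set_var j_ctr 0 (Suc j) (hsem w Q (weight_com z) h') w_arr i = weight n q (a i) ?b ?Z"
        using step(1)[OF j(1,2) ag Qj] j(3) by (simp add: less_Suc_eq)
    qed
  qed (use h2p in \<open>auto simp: w1 intro!: agree_set_var\<close>)
  moreover have "hsem w Q (pot_com z) h = hsem w Q (HFor j_ctr HK (weight_com z)) h2"
    by (simp add: pot_com_def h1_def h2_def)
  ultimately show "hsem w Q (pot_com z) h pot_var 0 = pot (h b_var 0) (h z)"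
    "\<And>j. j < k \<Longrightarrow> hsem w Q (pot_com z) h w_arr j = weight n q (a j) (h b_var 0) (h z)"
    by (simp_all add: pot_def)
qed

end

section \<open>One step of the walk as a program\<close>

definition eq_exp :: "hexp \<Rightarrow> hexp \<Rightarrow> hexp" where
  "eq_exp a b = HMul (HSub (HL 1) (HSub a b)) (HSub (HL 1) (HSub b a))"

lemma eq_exp_simps [simp]: "hev w (eq_exp a b) h = of_bool (hev w a h = hev w b h)"
  "evars (eq_exp a b) = evars a \<union> evars b"
  by (auto simp: eq_exp_def of_bool_def)

text \<open>The outer loop counts from 0, so q is its counter plus one.\<close>

definition damp_com :: hcom where
  "damp_com = HSeq (map_com al_arr i_ctr HN (HMul (lt_exp move_exp (HV z_arr (Sc i_ctr)))
        (lt_exp (HV z_arr (Sc i_ctr)) (HSub (HMul (HL 2) radius_exp) move_exp))))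
    (HSeq (sum_com m_var i_ctr HN (HV al_arr (Sc i_ctr)))
      (HAsg b_var (HL 0) (HDiv (HMul (HMul (HL 4096) (HAdd (Sc q_ctr) (HL 1))) (HAdd HN (HL 1))) (HAdd (Sc m_var) (HL 1)))))"

definition row_exp :: hexp where "row_exp = HDiv (Sc l_ctr) HN"
definition col_exp :: hexp where "col_exp = HSub (Sc l_ctr) (HMul HN (HDiv (Sc l_ctr) HN))"

text \<open>A single loop over all n^2 entries: its counter serves as the address, and row and
  column are recovered by division.\<close>

definition coef_com :: hcom where
  "coef_com = HFor l_ctr (HMul HN HN)
    (HSeq (sum_com acc_var j_ctr HK (HMul (HMul (HV w_arr (Sc j_ctr)) (HIn (Sc j_ctr) row_exp)) (HIn (Sc j_ctr) col_exp)))
      (HAsg m_arr (Sc l_ctr) (HMul (HMul (HV al_arr row_exp) (HV al_arr col_exp))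
        (HAdd (HMul (HMul (HL 2) (sq_exp slope_exp)) (Sc acc_var))
          (HMul (HMul (HMul (HL 16) (sq_exp (Sc b_var))) (Sc pot_var))
            (HAdd (HMul (HV z_arr row_exp) (HV z_arr col_exp)) (sq_exp radius_exp)))))))"

definition level_com :: hcom where
  "level_com = HAsg lev_var (HL 0) (HMul (Sc pot_var) (HAdd (HMul (HMul (HL 2) (sq_exp slope_exp)) HN)
     (HMul (HMul (HMul (HL 80) (sq_exp (Sc b_var))) (sq_exp radius_exp)) HN)))"

definition row_com :: "nat \<Rightarrow> nat \<Rightarrow> nat \<Rightarrow> hcom" where
  "row_com dst src oth = HFor i_ctr HN
    (HSeq (sum_com acc_var l_ctr HN (HMul (HV m_arr (HAdd (HMul (Sc i_ctr) HN) (Sc l_ctr))) (HV oth (Sc l_ctr))))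
      (HAsg dst (Sc i_ctr) (HAdd (HMul (Sc lev_var) (HV src (Sc i_ctr))) (Sc acc_var))))"

definition copy_com :: "nat \<Rightarrow> nat \<Rightarrow> hcom" where
  "copy_com dst src = map_com dst i_ctr HN (HV src (Sc i_ctr))"

text \<open>Each new vector depends on both old ones, so both are built in temporary arrays before
  being copied back.\<close>

definition iter_body :: hcom where
  "iter_body = HSeq (row_com tp_arr vp_arr vn_arr) (HSeq (row_com tn_arr vn_arr vp_arr)
     (HSeq (copy_com vp_arr tp_arr) (copy_com vn_arr tn_arr)))"

definition iter_com :: hcom where
  "iter_com = HSeq (map_com vp_arr i_ctr HN (HMul (HV al_arr (Sc i_ctr)) (eq_exp (Sc i_ctr) (Sc x_ctr))))
    (HSeq (map_com vn_arr i_ctr HN (HL 0)) (HFor it_ctr iters_exp iter_body))"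

definition cand_com :: "nat \<Rightarrow> nat \<Rightarrow> hcom" where
  "cand_com p m = HSeq (HAsg vm_var (HL 0) (HL 0))
    (HSeq (HFor i_ctr HN (max_com vm_var (HAdd (HSub (HV p (Sc i_ctr)) (HV m (Sc i_ctr))) (HSub (HV m (Sc i_ctr)) (HV p (Sc i_ctr))))))
      (map_com z2_arr i_ctr HN (HSub (HAdd (HV z_arr (Sc i_ctr))
          (HDiv (HMul move_exp (HSub (HV p (Sc i_ctr)) (HV m (Sc i_ctr)))) (Sc vm_var)))
          (HDiv (HMul move_exp (HSub (HV m (Sc i_ctr)) (HV p (Sc i_ctr)))) (Sc vm_var)))))"

definition try_com :: "nat \<Rightarrow> nat \<Rightarrow> hcom" where
  "try_com p m = HSeq (cand_com p m) (HSeq (pot_com z2_arr)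
    (HIf (HSub (Sc bp_var) (Sc pot_var)) (HSeq (HAsg bp_var (HL 0) (Sc pot_var)) (copy_com bz_arr z2_arr))))"

definition search_com :: hcom where
  "search_com = HFor x_ctr HN (HSeq iter_com (HSeq (try_com vp_arr vn_arr) (try_com vn_arr vp_arr)))"

definition step_com :: hcom where
  "step_com = HSeq damp_com (HSeq (pot_com z_arr) (HSeq coef_com (HSeq level_com
    (HSeq (HAsg bp_var (HL 0) (Sc pot_var)) (HSeq (copy_com bz_arr z_arr)
      (HSeq search_com (copy_com z_arr bz_arr)))))))"

lemma assigned_step [simp]:
  "assigned damp_com = {al_arr, m_var, b_var, i_ctr}"
  "assigned coef_com = {m_arr, acc_var, l_ctr, j_ctr}"
  "assigned level_com = {lev_var}"
  "assigned (row_com dst src oth) = {dst, acc_var, i_ctr, l_ctr}"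
  "assigned (copy_com dst src) = {dst, i_ctr}"
  "assigned iter_body = {vp_arr, vn_arr, tp_arr, tn_arr, acc_var, i_ctr, l_ctr}"
  "assigned iter_com = {vp_arr, vn_arr, tp_arr, tn_arr, acc_var, i_ctr, l_ctr, it_ctr}"
  "assigned (cand_com p m) = {vm_var, z2_arr, i_ctr}"
  "assigned (try_com p m) = {vm_var, z2_arr, bp_var, bz_arr, i_ctr} \<union> assigned (pot_com z2_arr)"
  "assigned search_com = {x_ctr} \<union> assigned iter_com \<union> assigned (try_com vp_arr vn_arr)"
  "assigned step_com = {z_arr} \<union> assigned damp_com \<union> assigned coef_com \<union> {lev_var} \<union> assigned search_com"
  by (auto simp: damp_com_def coef_com_def level_com_def row_com_def copy_com_def iter_body_def iter_com_def
      cand_com_def try_com_def search_com_def step_com_def)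

lemma wf_step [simp]: "wf step_com"
  by (simp add: damp_com_def coef_com_def level_com_def row_com_def copy_com_def iter_body_def iter_com_def
      cand_com_def try_com_def search_com_def step_com_def row_exp_def col_exp_def max_vars_def)

lemma copy_com:
  assumes "dst \<noteq> i_ctr" "src \<noteq> i_ctr" "src \<noteq> dst" "\<And>i. i < w 0 \<Longrightarrow> h src i \<le> Q"
  shows "hsem w Q (copy_com dst src) h dst = (\<lambda>i. if i < w 0 then h src i else h dst i)"
  unfolding copy_com_def using assms by (intro map_com) (auto simp: agree_def)

context walk
begin

lemma energy_cong: "(\<And>i. i < n \<Longrightarrow> Z i = Z' i) \<Longrightarrow> energy n Z = energy n Z'"
  by (simp add: energy_def)

lemma pot_cong: "(\<And>i. i < n \<Longrightarrow> Z i = Z' i) \<Longrightarrow> pot b Z = pot b Z'"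
proof -
  assume eq: "\<And>i. i < n \<Longrightarrow> Z i = Z' i"
  then have "(\<Sum>i<n. a j i * Z i) = (\<Sum>i<n. a j i * Z' i)" for j by (intro sum.cong) auto
  with energy_cong[of Z Z', OF eq] show ?thesis
    unfolding pot_def weight_def up_exp_def down_exp_def by simp
qed

lemma cand_cong:
  assumes "\<And>i. i < n \<Longrightarrow> p i = p' i" "\<And>i. i < n \<Longrightarrow> m i = m' i" "i < n"
  shows "cand Z p m i = cand Z p' m' i"
proof -
  have "vmax p m = vmax p' m'"
    unfolding vmax_def using assms by (intro arg_cong[where f = Max] arg_cong[where f = "insert 0"] image_cong) auto
  then show ?thesis using assms by (simp add: cand_def)
qed

end

context prog
begin

definition level_bound :: nat where
  "level_bound = (r + 1) ^ (2 * offset n) * (2 * k) * (2 * A\<^sup>2 * n + 80 * (4096 * q * (n + 1))\<^sup>2 * D\<^sup>2 * n)"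

lemma level_le:
  assumes "inside Z" "b \<le> 4096 * q * (n + 1)"
  shows "level b Z \<le> level_bound"
  unfolding level_def level_bound_def
  by (intro mult_le_mono add_le_mono pot_le assms order_refl power_mono) auto

lemma coef_le:
  assumes "inside Z" "i < n" "l < n"
  shows "coef b Z i l \<le> level b Z"
proof -
  have al: "alive n (Z i) * alive n (Z l) \<le> 1 * 1" by (intro mult_le_mono) (auto simp: alive_def)
  have "(\<Sum>j<k. weight n q (a j) b Z * a j i * a j l) \<le> (\<Sum>j<k. weight n q (a j) b Z * 1 * 1)"
    using a_le by (intro sum_mono mult_le_mono) auto
  then have s: "(\<Sum>j<k. weight n q (a j) b Z * a j i * a j l) \<le> pot b Z" by (simp add: pot_def)
  have zz: "Z i * Z l + D\<^sup>2 \<le> 5 * D\<^sup>2"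
  proof -
    have "Z i * Z l \<le> (2 * D) * (2 * D)" using assms by (intro mult_le_mono) (auto simp: inside_def)
    then show ?thesis by (simp add: power2_eq_square)
  qed
  have "coef b Z i l \<le> 1 * (2 * A\<^sup>2 * pot b Z + 16 * b\<^sup>2 * pot b Z * (5 * D\<^sup>2))"
    unfolding coef_def using al s zz by (intro mult_le_mono add_le_mono) auto
  also have "\<dots> = pot b Z * ((2 * A\<^sup>2 + 80 * b\<^sup>2 * D\<^sup>2) * 1)" by (simp add: algebra_simps)
  also have "\<dots> \<le> pot b Z * ((2 * A\<^sup>2 + 80 * b\<^sup>2 * D\<^sup>2) * n)"
    using n_pos by (intro mult_le_mono order_refl) simp
  also have "\<dots> = level b Z" by (simp add: level_def algebra_simps)
  finally show ?thesis .
qed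

text \<open>Entries of \<open>coef\<close> are at most \<open>level\<close>, so one application of
  the shift multiplies the largest sum of the two parts by at most (n + 1)
  \<open>level\<close>.\<close>

lemma iter_le:
  assumes "inside Z" "b \<le> 4096 * q * (n + 1)" "i < n"
  shows "fst (iter b Z x t) i + snd (iter b Z x t) i \<le> (level_bound * (n + 1)) ^ t"
  using assms(3)
proof (induction t arbitrary: i)
  case 0
  then show ?case by (simp add: alive_def)
next
  case (Suc t)
  let ?p = "fst (iter b Z x t)" and ?m = "snd (iter b Z x t)" and ?B = "(level_bound * (n + 1)) ^ t"
  have lv: "level b Z \<le> level_bound" by (rule level_le[OF assms(1,2)])
  have "fst (iter b Z x (Suc t)) i + snd (iter b Z x (Suc t)) i
      = level b Z * (?p i + ?m i) + (\<Sum>l<n. coef b Z i l * (?p l + ?m l))"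
    by (simp add: distrib_left sum.distrib)
  also have "\<dots> \<le> level_bound * ?B + (\<Sum>l<n. level_bound * ?B)"
    using lv coef_le[OF assms(1) Suc.prems] Suc.IH Suc.prems
    by (intro add_le_mono mult_le_mono sum_mono) (auto intro: order_trans[OF _ lv])
  also have "\<dots> = (level_bound * (n + 1)) ^ Suc t" by (simp add: algebra_simps)
  finally show ?case .
qed

end

text \<open>The bound on the iterates is stated separately because it needs
  \<open>level_bound\<close>, which is defined inside \<open>prog\<close>.\<close>

locale prog_big = prog +
  assumes Q_level: "(level_bound * (n + 1)) ^ (power_steps n + 1) \<le> Q"
begin

lemma level_bound_pos: "1 \<le> level_bound"
proof -
  have "0 < A" using D_pos by (simp add: slope_def)
  then have "0 < 2 * A\<^sup>2 * n + 80 * (4096 * q * (n + 1))\<^sup>2 * D\<^sup>2 * n" using n_pos by simp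
  then show ?thesis unfolding level_bound_def using k_pos by (simp add: Suc_leI del: mult_Suc_right)
qed

lemma iter_Q: 
  assumes "t \<le> power_steps n + 1"
  shows "(level_bound * (n + 1)) ^ t \<le> Q"
proof -
  have "1 * 1 \<le> level_bound * (n + 1)" by (intro mult_le_mono level_bound_pos) simp
  then have "(level_bound * (n + 1)) ^ t \<le> (level_bound * (n + 1)) ^ (power_steps n + 1)"
    using assms by (intro power_increasing) auto
  then show ?thesis using Q_level by linarith
qed

lemma level_Q: "level_bound \<le> Q"
proof -
  have "level_bound * 1 \<le> level_bound * (n + 1)" by (intro mult_le_mono2) simp
  then show ?thesis using iter_Q[of 1] by simp
qed

lemma D_Q: "2 * D \<le> Q" and n_Q: "n + 1 \<le> Q" and b_Q: "4096 * q * (n + 1) \<le> Q"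
proof -
  have nD: "1 * D \<le> n * D\<^sup>2" using n_pos D_pos by (intro mult_le_mono) (auto simp: power2_eq_square)
  then show "2 * D \<le> Q" using offset_ge(2) Q_offset by linarith
  have "n * 1 \<le> n * D\<^sup>2" using D_pos by (intro mult_le_mono2) (simp add: Suc_leI)
  then show "n + 1 \<le> Q" using offset_ge(2) Q_offset n_pos by linarith
  have "4096 * q * (n + 1) * 1 \<le> 4096 * n * (n + 1) * (n * D\<^sup>2)"
    using q_le n_pos D_pos by (intro mult_le_mono) auto
  also have "\<dots> \<le> offset n" by (simp add: offset_def mult_ac)
  finally show "4096 * q * (n + 1) \<le> Q" using Q_offset by linarith
qed

lemma damp_com:
  assumes q: "h q_ctr 0 + 1 = q"
  shows "\<And>i. i < n \<Longrightarrow> hsem w Q damp_com h al_arr i = alive n (h z_arr i)"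
    "hsem w Q damp_com h b_var 0 = damp n q (live n (h z_arr))"
proof -
  let ?e = "HMul (lt_exp move_exp (HV z_arr (Sc i_ctr))) (lt_exp (HV z_arr (Sc i_ctr)) (HSub (HMul (HL 2) radius_exp) move_exp))"
  define h1 where "h1 = hsem w Q (map_com al_arr i_ctr HN ?e) h"
  have h1: "h1 al_arr = (\<lambda>i. if i < n then alive n (h z_arr i) else h al_arr i)"
    unfolding h1_def
  proof (rule map_com)
    fix j h' assume j: "j < n" "h' i_ctr 0 = j" "agree {i_ctr, al_arr} h h'"
    show "hev w ?e h' = alive n (h z_arr j)"
      using j agreeD[OF j(3), of z_arr] by (simp add: w0 alive_def of_bool_conj)
  next
    fix j show "alive n (h z_arr j) \<le> Q" using n_Q by (simp add: alive_def)
  qed (simp_all add: w0)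
  have h1u: "h1 u = h u" if "u \<notin> {al_arr, i_ctr}" for u
    unfolding h1_def using that by (intro hsem_unassigned) simp
  let ?s = "sum_com m_var i_ctr HN (HV al_arr (Sc i_ctr))"
  define h2 where "h2 = hsem w Q ?s h1"
  have lv: "live n (h z_arr) \<le> n" by (rule live_le)
  have h2: "h2 m_var 0 = live n (h z_arr)"
    unfolding h2_def live_def
  proof (rule sum_com)
    fix j h' assume j: "j < n" "h' i_ctr 0 = j" "agree {i_ctr, m_var} h1 h'"
    show "hev w (HV al_arr (Sc i_ctr)) h' = alive n (h z_arr j)"
      using j agreeD[OF j(3), of al_arr] h1 by simp
  next
    show "(\<Sum>i<n. alive n (h z_arr i)) \<le> Q" using lv n_Q by (simp add: live_def)
  qed (simp_all add: w0)
  have h2u: "h2 u = h1 u" if "u \<notin> {m_var, i_ctr}" for u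
    unfolding h2_def using that by (intro hsem_unassigned) simp
  have dQ: "damp n q (live n (h z_arr)) \<le> Q" using damp_le b_Q order_trans by blast
  have "h2 q_ctr 0 + 1 = q" using q h2u[of q_ctr] h1u[of q_ctr] by simp
  then have fin: "hsem w Q damp_com h = set_var b_var 0 (damp n q (live n (h z_arr))) h2"
    unfolding damp_com_def hsem.simps(2) h1_def[symmetric] h2_def[symmetric]
    using h2 dQ by (simp add: w0 damp_def)
  show "\<And>i. i < n \<Longrightarrow> hsem w Q damp_com h al_arr i = alive n (h z_arr i)"
    "hsem w Q damp_com h b_var 0 = damp n q (live n (h z_arr))"
    unfolding fin using h1 h2u[of al_arr] by auto
qed

lemma row_index_div: "l < n * n \<Longrightarrow> l div n < n \<and> l - n * (l div n) < n"
  using n_pos by (simp add: less_mult_imp_div_less minus_mult_div_eq_mod)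

lemma coef_com:
  assumes Z: "inside (h z_arr)" and b: "h b_var 0 \<le> 4096 * q * (n + 1)"
    and al: "\<And>i. i < n \<Longrightarrow> h al_arr i = alive n (h z_arr i)"
    and w: "\<And>j. j < k \<Longrightarrow> h w_arr j = weight n q (a j) (h b_var 0) (h z_arr)"
    and pot: "h pot_var 0 = pot (h b_var 0) (h z_arr)" and il: "i < n" "l < n"
  shows "hsem w Q coef_com h m_arr (i * n + l) = coef (h b_var 0) (h z_arr) i l"
proof -
  let ?b = "h b_var 0" and ?Z = "h z_arr"
  let ?s = "sum_com acc_var j_ctr HK (HMul (HMul (HV w_arr (Sc j_ctr)) (HIn (Sc j_ctr) row_exp)) (HIn (Sc j_ctr) col_exp))"
  let ?F = "\<lambda>x. coef ?b ?Z (x div n) (x - n * (x div n))"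
  let ?u = "HAsg m_arr (Sc l_ctr) (HMul (HMul (HV al_arr row_exp) (HV al_arr col_exp))
        (HAdd (HMul (HMul (HL 2) (sq_exp slope_exp)) (Sc acc_var))
          (HMul (HMul (HMul (HL 16) (sq_exp (Sc b_var))) (Sc pot_var))
            (HAdd (HMul (HV z_arr row_exp) (HV z_arr col_exp)) (sq_exp radius_exp)))))"
  have "hsem w Q coef_com h m_arr = (\<lambda>x. if x < n * n then ?F x else h m_arr x)"
    unfolding coef_com_def
  proof (rule map_loop)
    fix x h' assume x: "x < n * n" "h' l_ctr 0 = x" and
      ag: "agree (insert l_ctr (assigned (HSeq ?s ?u))) h h'"
    have eq: "h' u = h u" if "u \<notin> {l_ctr, acc_var, j_ctr, m_arr}" for u using agreeD[OF ag, of u] that by auto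
    let ?i = "x div n" and ?l = "x - n * (x div n)"
    have il: "?i < n" "?l < n" using row_index_div[OF x(1)] by auto
    define h1 where "h1 = hsem w Q ?s h'"
    have cQ: "coef ?b ?Z ?i ?l \<le> Q" using coef_le[OF Z il, of ?b] level_le[OF Z b] level_Q by linarith
    have h1: "h1 acc_var 0 = (\<Sum>j<k. weight n q (a j) ?b ?Z * a j ?i * a j ?l)"
      unfolding h1_def
    proof (rule sum_com)
      fix j h'' assume j: "j < k" "h'' j_ctr 0 = j" "agree {j_ctr, acc_var} h' h''"
      have "h'' l_ctr 0 = x" "h'' w_arr = h w_arr"
        using agreeD[OF j(3), of l_ctr] agreeD[OF j(3), of w_arr] x eq[of w_arr] by auto
      then show "hev w (HMul (HMul (HV w_arr (Sc j_ctr)) (HIn (Sc j_ctr) row_exp)) (HIn (Sc j_ctr) col_exp)) h''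
          = weight n q (a j) ?b ?Z * a j ?i * a j ?l"
        using j il w by (simp add: row_exp_def col_exp_def w0)
    next
      have "(\<Sum>j<k. weight n q (a j) ?b ?Z * a j ?i * a j ?l) \<le> (\<Sum>j<k. weight n q (a j) ?b ?Z * 1 * 1)"
        using a_le by (intro sum_mono mult_le_mono) auto
      then show "(\<Sum>j<k. weight n q (a j) ?b ?Z * a j ?i * a j ?l) \<le> Q"
        using pot_le[OF Z b] Q_power by (simp add: pot_def)
    qed (simp_all add: w1)
    have h1u: "h1 u = h' u" if "u \<notin> {acc_var, j_ctr}" for u
      unfolding h1_def using that by (intro hsem_unassigned) simp
    have e: "h1 l_ctr 0 = x" "h1 al_arr = h al_arr" "h1 b_var = h b_var" "h1 pot_var = h pot_var" "h1 z_arr = h z_arr"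
      "h1 m_arr = h' m_arr"
      using h1u[of l_ctr] h1u[of al_arr] h1u[of b_var] h1u[of pot_var] h1u[of z_arr] h1u[of m_arr]
        eq[of al_arr] eq[of b_var] eq[of pot_var] eq[of z_arr] x by auto
    show "hsem w Q (HSeq ?s ?u) h' m_arr = (h' m_arr)(x := ?F x)"
      using cQ unfolding hsem.simps(2) h1_def[symmetric]
      by (simp add: e h1 row_exp_def col_exp_def w0 al il pot coef_def)
  qed (auto simp: w0)
  moreover have "i * n + l < n * n"
  proof -
    have "i * n + l < Suc i * n" using il by simp
    also have "\<dots> \<le> n * n" using il by (intro mult_le_mono1) simp
    finally show ?thesis .
  qed
  moreover have "(i * n + l) div n = i" "i * n + l - n * i = l" using il by (simp_all add: mult.commute)
  ultimately show ?thesis by simp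
qed

lemma row_com:
  assumes F: "\<And>i. i < n \<Longrightarrow> F i = h lev_var 0 * h src i + (\<Sum>l<n. h m_arr (i * n + l) * h oth l)"
    and Q: "\<And>i. i < n \<Longrightarrow> F i \<le> Q"
    and d: "src \<notin> {dst, acc_var, i_ctr, l_ctr}" "oth \<notin> {dst, acc_var, i_ctr, l_ctr}"
      "dst \<notin> {m_arr, lev_var, acc_var, i_ctr, l_ctr}"
  shows "hsem w Q (row_com dst src oth) h dst = (\<lambda>i. if i < n then F i else h dst i)"
  unfolding row_com_def
proof (rule map_loop)
  let ?s = "sum_com acc_var l_ctr HN (HMul (HV m_arr (HAdd (HMul (Sc i_ctr) HN) (Sc l_ctr))) (HV oth (Sc l_ctr)))"
  fix i h' assume i: "i < n" "h' i_ctr 0 = i" and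
    ag: "agree (insert i_ctr (assigned (HSeq ?s (HAsg dst (Sc i_ctr) (HAdd (HMul (Sc lev_var) (HV src (Sc i_ctr))) (Sc acc_var)))))) h h'"
  have eq: "h' u = h u" if "u \<notin> {i_ctr, acc_var, l_ctr, dst}" for u using agreeD[OF ag, of u] that by auto
  define h1 where "h1 = hsem w Q ?s h'"
  have sQ: "(\<Sum>l<n. h m_arr (i * n + l) * h oth l) \<le> Q" using F[OF i(1)] Q[OF i(1)] by simp
  have h1: "h1 acc_var 0 = (\<Sum>l<n. h m_arr (i * n + l) * h oth l)"
    unfolding h1_def
  proof (rule sum_com)
    fix l h'' assume l: "l < n" "h'' l_ctr 0 = l" "agree {l_ctr, acc_var} h' h''"
    have "h'' i_ctr 0 = i" "h'' m_arr = h m_arr" "h'' oth = h oth"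
      using agreeD[OF l(3), of i_ctr] agreeD[OF l(3), of m_arr] agreeD[OF l(3), of oth] i eq[of m_arr] eq[of oth] d by auto
    then show "hev w (HMul (HV m_arr (HAdd (HMul (Sc i_ctr) HN) (Sc l_ctr))) (HV oth (Sc l_ctr))) h'' = h m_arr (i * n + l) * h oth l"
      using l by (simp add: w0)
  qed (use sQ in \<open>simp_all add: w0\<close>)
  have h1u: "h1 u = h' u" if "u \<notin> {acc_var, l_ctr}" for u
    unfolding h1_def using that by (intro hsem_unassigned) simp
  have e: "h1 i_ctr 0 = i" "h1 lev_var = h lev_var" "h1 src = h src" "h1 dst = h' dst"
    using h1u[of i_ctr] h1u[of lev_var] h1u[of src] h1u[of dst] eq[of lev_var] eq[of src] i d by auto
  show "hsem w Q (HSeq ?s (HAsg dst (Sc i_ctr) (HAdd (HMul (Sc lev_var) (HV src (Sc i_ctr))) (Sc acc_var)))) h' dst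
      = (h' dst)(i := F i)"
    using Q[OF i(1)] F[OF i(1)] unfolding hsem.simps(2) h1_def[symmetric] by (simp add: e h1)
qed (use d in \<open>auto simp: w0\<close>)

end

section \<open>Search for the best move\<close>

context prog_big
begin

text \<open>Data computed once per step and only read during the search, hence stable under every
  command of it (\<open>tables_agree\<close>).\<close>

definition tables :: "nat \<Rightarrow> (nat \<Rightarrow> nat) \<Rightarrow> hstate \<Rightarrow> bool" where
  "tables b Z h \<longleftrightarrow> h z_arr = Z \<and> h b_var 0 = b \<and> h r_var 0 = r \<and> h lev_var 0 = level b Z
     \<and> (\<forall>i<n. h al_arr i = alive n (Z i)) \<and> (\<forall>i<n. \<forall>l<n. h m_arr (i * n + l) = coef b Z i l)"

lemma tables_agree:
  assumes "tables b Z h" "agree S h h'" "S \<inter> {z_arr, b_var, r_var, lev_var, al_arr, m_arr} = {}"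
  shows "tables b Z h'"
proof -
  have "h' u = h u" if "u \<in> {z_arr, b_var, r_var, lev_var, al_arr, m_arr}" for u
    using assms(2,3) that unfolding agree_def by blast
  then show ?thesis using assms(1) by (simp add: tables_def)
qed

lemma iter_body:
  assumes T: "tables b Z h" and Z: "inside Z" and b: "b \<le> 4096 * q * (n + 1)" and t: "t < power_steps n"
    and v: "\<And>i. i < n \<Longrightarrow> h vp_arr i = fst (iter b Z x t) i" "\<And>i. i < n \<Longrightarrow> h vn_arr i = snd (iter b Z x t) i"
    and i: "i < n"
  shows "hsem w Q iter_body h vp_arr i = fst (iter b Z x (Suc t)) i"
    "hsem w Q iter_body h vn_arr i = snd (iter b Z x (Suc t)) i"
proof -
  let ?F = "fst (iter b Z x (Suc t))" and ?G = "snd (iter b Z x (Suc t))"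
  have FQ: "?F i \<le> Q" "?G i \<le> Q" if "i < n" for i
    using iter_le[OF Z b that, of x "Suc t"] iter_Q[of "Suc t"] t by (linarith, linarith)
  define h1 where "h1 = hsem w Q (row_com tp_arr vp_arr vn_arr) h"
  have h1: "h1 tp_arr = (\<lambda>i. if i < n then ?F i else h tp_arr i)"
    unfolding h1_def
  proof (rule row_com)
    fix i assume i: "i < n"
    then show "?F i = h lev_var 0 * h vp_arr i + (\<Sum>l<n. h m_arr (i * n + l) * h vn_arr l)"
      using T v by (simp add: tables_def)
  qed (use FQ in auto)
  have h1u: "h1 u = h u" if "u \<notin> {tp_arr, acc_var, i_ctr, l_ctr}" for u
    unfolding h1_def using that by (intro hsem_unassigned) simp
  define h2 where "h2 = hsem w Q (row_com tn_arr vn_arr vp_arr) h1"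
  have h2: "h2 tn_arr = (\<lambda>i. if i < n then ?G i else h1 tn_arr i)"
    unfolding h2_def
  proof (rule row_com)
    fix i assume i: "i < n"
    then show "?G i = h1 lev_var 0 * h1 vn_arr i + (\<Sum>l<n. h1 m_arr (i * n + l) * h1 vp_arr l)"
      using T v by (simp add: tables_def h1u)
  qed (use FQ in auto)
  have h2u: "h2 u = h1 u" if "u \<notin> {tn_arr, acc_var, i_ctr, l_ctr}" for u
    unfolding h2_def using that by (intro hsem_unassigned) simp
  define h3 where "h3 = hsem w Q (copy_com vp_arr tp_arr) h2"
  have h3: "h3 vp_arr = (\<lambda>i. if i < n then ?F i else h2 vp_arr i)"
    unfolding h3_def using copy_com[of vp_arr tp_arr w h2 Q] FQ h2u[of tp_arr] h1 by (simp add: w0 fun_eq_iff)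
  have h3u: "h3 u = h2 u" if "u \<notin> {vp_arr, i_ctr}" for u
    unfolding h3_def using that by (intro hsem_unassigned) simp
  define h4 where "h4 = hsem w Q (copy_com vn_arr tn_arr) h3"
  have h4: "h4 vn_arr = (\<lambda>i. if i < n then ?G i else h3 vn_arr i)"
    unfolding h4_def using copy_com[of vn_arr tn_arr w h3 Q] FQ h3u[of tn_arr] h2 by (simp add: w0 fun_eq_iff)
  have h4u: "h4 vp_arr = h3 vp_arr"
    unfolding h4_def by (intro hsem_unassigned) simp
  have "hsem w Q iter_body h = h4"
    by (simp add: iter_body_def h1_def h2_def h3_def h4_def)
  then show "hsem w Q iter_body h vp_arr i = ?F i" "hsem w Q iter_body h vn_arr i = ?G i"
    using h4 h4u h3 i by auto
qed

lemma iter_com: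
  assumes T: "tables b Z h" and Z: "inside Z" and b: "b \<le> 4096 * q * (n + 1)" and x: "h x_ctr 0 = x"
    and i: "i < n"
  shows "hsem w Q iter_com h vp_arr i = fst (iter b Z x (power_steps n)) i"
    "hsem w Q iter_com h vn_arr i = snd (iter b Z x (power_steps n)) i"
proof -
  let ?e = "HMul (HV al_arr (Sc i_ctr)) (eq_exp (Sc i_ctr) (Sc x_ctr))"
  define h1 where "h1 = hsem w Q (map_com vp_arr i_ctr HN ?e) h"
  have h1: "h1 vp_arr = (\<lambda>i. if i < n then fst (iter b Z x 0) i else h vp_arr i)"
    unfolding h1_def
  proof (rule map_com)
    fix j h' assume j: "j < n" "h' i_ctr 0 = j" "agree {i_ctr, vp_arr} h h'"
    have "h' al_arr = h al_arr" "h' x_ctr = h x_ctr"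
      using agreeD[OF j(3), of al_arr] agreeD[OF j(3), of x_ctr] by auto
    then show "hev w ?e h' = fst (iter b Z x 0) j" using j x T by (simp add: tables_def)
  next
    show "fst (iter b Z x 0) j \<le> Q" if "j < n" for j
      using iter_le[OF Z b that, of x 0] iter_Q[of 0] by linarith
  qed (simp_all add: w0)
  have h1u: "h1 u = h u" if "u \<notin> {vp_arr, i_ctr}" for u
    unfolding h1_def using that by (intro hsem_unassigned) simp
  define h2 where "h2 = hsem w Q (map_com vn_arr i_ctr HN (HL 0)) h1"
  have h2: "h2 vn_arr = (\<lambda>i. if i < n then 0 else h1 vn_arr i)"
    unfolding h2_def by (rule map_com) (simp_all add: w0)
  have h2u: "h2 u = h1 u" if "u \<notin> {vn_arr, i_ctr}" for u
    unfolding h2_def using that by (intro hsem_unassigned) simp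
  let ?S = "{it_ctr} \<union> assigned iter_body"
  have T2: "tables b Z h2"
    by (rule tables_agree[OF T, of "{vp_arr, vn_arr, i_ctr}"]) (auto simp: agree_def h2u h1u)
  let ?I = "\<lambda>t h'. agree ?S h2 h' \<and> (\<forall>i<n. h' vp_arr i = fst (iter b Z x t) i \<and> h' vn_arr i = snd (iter b Z x t) i)"
  have "?I (power_steps n) (hsem w Q (HFor it_ctr iters_exp iter_body) h2)"
  proof (rule HFor_inv[where I = ?I])
    fix t h' assume t: "t < power_steps n" "h' it_ctr 0 = t" "?I t h'"
    have "tables b Z h'" using t(3) by (intro tables_agree[OF T2, of ?S]) auto
    from iter_body[OF this Z b t(1)] t(3)
    show "?I (Suc t) (set_var it_ctr 0 (Suc t) (hsem w Q iter_body h'))"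
      by (auto intro!: agree_set_var agree_hsem simp del: iter.simps)
  next
    show "?I 0 (set_var it_ctr 0 0 h2)"
      using h1 h2 h2u[of vp_arr] by (auto intro!: agree_set_var)
  qed (auto simp: w0)
  moreover have "hsem w Q iter_com h = hsem w Q (HFor it_ctr iters_exp iter_body) h2"
    by (simp add: iter_com_def h1_def h2_def)
  ultimately show "hsem w Q iter_com h vp_arr i = fst (iter b Z x (power_steps n)) i"
    "hsem w Q iter_com h vn_arr i = snd (iter b Z x (power_steps n)) i"
    using i by auto
qed

lemma cand_com:
  assumes pm: "p \<in> {vp_arr, vn_arr}" "m \<in> {vp_arr, vn_arr}"
    and pQ: "\<And>i. i < n \<Longrightarrow> h p i + h m i \<le> Q"
    and c: "\<And>i. i < n \<Longrightarrow> cand (h z_arr) (h p) (h m) i \<le> 2 * D"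
  shows "hsem w Q (cand_com p m) h z2_arr = (\<lambda>i. if i < n then cand (h z_arr) (h p) (h m) i else h z2_arr i)"
proof -
  let ?d = "\<lambda>i. (h p i - h m i) + (h m i - h p i)"
  let ?e = "HAdd (HSub (HV p (Sc i_ctr)) (HV m (Sc i_ctr))) (HSub (HV m (Sc i_ctr)) (HV p (Sc i_ctr)))"
  have neq: "p \<notin> {vm_var, i_ctr, z2_arr}" "m \<notin> {vm_var, i_ctr, z2_arr}" using pm by auto
  define h1 where "h1 = set_var vm_var 0 0 h"
  let ?I = "\<lambda>j h'. agree {vm_var, i_ctr} h h' \<and> h' vm_var 0 = Max (insert 0 (?d ` {..<j}))"
  have dQ: "?d i \<le> Q" if "i < n" for i using pQ[OF that] by linarith
  define h2 where "h2 = hsem w Q (HFor i_ctr HN (max_com vm_var ?e)) h1"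
  have "?I n h2"
    unfolding h2_def
  proof (rule HFor_inv[where I = ?I])
    fix j h' assume j: "j < n" "h' i_ctr 0 = j" "?I j h'"
    have eq: "h' p = h p" "h' m = h m" using j(3) neq by (auto simp: agree_def)
    have ev: "hev w ?e h' = ?d j" using j(2) by (simp add: eq)
    have "h' vm_var 0 \<le> Q" using j dQ by (auto intro!: Max.boundedI)
    then have "hsem w Q (max_com vm_var ?e) h' vm_var 0 = max (h' vm_var 0) (?d j)"
      using max_com[of w ?e h' Q vm_var] dQ[OF j(1)] by (simp only: ev)
    also have "\<dots> = Max (insert 0 (?d ` {..<Suc j}))"
    proof -
      have "insert 0 (?d ` {..<Suc j}) = insert (?d j) (insert 0 (?d ` {..<j}))"
        by (simp only: lessThan_Suc image_insert insert_commute)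
      then have "Max (insert 0 (?d ` {..<Suc j})) = max (?d j) (Max (insert 0 (?d ` {..<j})))"
        by (simp only: Max.insert finite_insert finite_imageI finite_lessThan) simp
      then show ?thesis using j(3) by (simp only: max.commute)
    qed
    finally show "?I (Suc j) (set_var i_ctr 0 (Suc j) (hsem w Q (max_com vm_var ?e) h'))"
      using j(3) by (auto intro!: agree_set_var agree_hsem)
  qed (auto simp: w0 h1_def intro!: agree_set_var)
  then have h2: "h2 vm_var 0 = vmax (h p) (h m)" "agree {vm_var, i_ctr} h h2" by (auto simp: vmax_def)
  let ?f = "HSub (HAdd (HV z_arr (Sc i_ctr)) (HDiv (HMul move_exp (HSub (HV p (Sc i_ctr)) (HV m (Sc i_ctr)))) (Sc vm_var)))
          (HDiv (HMul move_exp (HSub (HV m (Sc i_ctr)) (HV p (Sc i_ctr)))) (Sc vm_var))"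
  have "hsem w Q (map_com z2_arr i_ctr HN ?f) h2 z2_arr
      = (\<lambda>i. if i < n then cand (h z_arr) (h p) (h m) i else h2 z2_arr i)"
  proof (rule map_com)
    fix j h' assume j: "j < n" "h' i_ctr 0 = j" "agree {i_ctr, z2_arr} h2 h'"
    have "h' z_arr = h z_arr" "h' p = h p" "h' m = h m" "h' vm_var = h2 vm_var"
      using j(3) h2(2) neq by (auto simp: agree_def)
    then show "hev w ?f h' = cand (h z_arr) (h p) (h m) j"
      using j h2(1) by (simp add: cand_def w0)
  next
    show "cand (h z_arr) (h p) (h m) j \<le> Q" if "j < n" for j using c[OF that] D_Q by linarith
  qed (simp_all add: w0)
  moreover have "hsem w Q (cand_com p m) h = hsem w Q (map_com z2_arr i_ctr HN ?f) h2"
    by (simp add: cand_com_def h1_def h2_def)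
  moreover have "h2 z2_arr = h z2_arr" using h2(2) by (auto simp: agree_def)
  ultimately show ?thesis by (simp add: fun_eq_iff)
qed

lemma try_com:
  assumes pm: "p \<in> {vp_arr, vn_arr}" "m \<in> {vp_arr, vn_arr}" and T: "tables b Z h"
    and b: "b \<le> 4096 * q * (n + 1)"
    and pQ: "\<And>i. i < n \<Longrightarrow> h p i + h m i \<le> Q"
    and c: "\<And>i. i < n \<Longrightarrow> cand Z (h p) (h m) i \<le> 2 * D"
  shows "hsem w Q (try_com p m) h bp_var 0 = min (h bp_var 0) (pot b (cand Z (h p) (h m)))"
    "\<And>i. i < n \<Longrightarrow> hsem w Q (try_com p m) h bz_arr i
      = (if pot b (cand Z (h p) (h m)) < h bp_var 0 then cand Z (h p) (h m) i else h bz_arr i)"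
proof -
  let ?C = "cand Z (h p) (h m)"
  have hz: "h z_arr = Z" "h b_var 0 = b" "h r_var 0 = r" using T by (auto simp: tables_def)
  define h1 where "h1 = hsem w Q (cand_com p m) h"
  have h1: "\<And>i. i < n \<Longrightarrow> h1 z2_arr i = ?C i"
    unfolding h1_def using cand_com[of p m h, OF pm pQ] c by (simp add: hz)
  have h1u: "h1 u = h u" if "u \<notin> {vm_var, z2_arr, i_ctr}" for u
    unfolding h1_def using that by (intro hsem_unassigned) simp
  define h2 where "h2 = hsem w Q (pot_com z2_arr) h1"
  have ins: "inside (h1 z2_arr)" using h1 c by (simp add: inside_def)
  have pot: "h2 pot_var 0 = pot b ?C"
  proof -
    have "h2 pot_var 0 = pot (h1 b_var 0) (h1 z2_arr)"
      unfolding h2_def by (rule pot_com) (use ins hz h1u b in auto)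
    also have "\<dots> = pot b ?C" using h1 hz h1u[of b_var] by (simp add: pot_cong[of "h1 z2_arr" ?C])
    finally show ?thesis .
  qed
  have potQ: "pot b ?C \<le> Q"
  proof -
    have "inside ?C" using c by (simp add: inside_def)
    from pot_le[OF this b] Q_power show ?thesis by linarith
  qed
  have h2u: "h2 u = h1 u" if "u \<notin> assigned (pot_com z2_arr)" for u
    unfolding h2_def using that by (rule hsem_unassigned)
  have e: "h2 bp_var = h bp_var" "h2 bz_arr = h bz_arr" "h2 z2_arr = h1 z2_arr"
    using h2u[of bp_var] h2u[of bz_arr] h2u[of z2_arr] h1u[of bp_var] h1u[of bz_arr] by auto
  have fin: "hsem w Q (try_com p m) h = (if pot b ?C < h bp_var 0
      then hsem w Q (copy_com bz_arr z2_arr) (set_var bp_var 0 (pot b ?C) h2) else h2)"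
    unfolding try_com_def hsem.simps(2) h1_def[symmetric] h2_def[symmetric]
    using pot potQ by (simp add: e)
  have cp: "hsem w Q (copy_com bz_arr z2_arr) (set_var bp_var 0 (pot b ?C) h2) bz_arr
      = (\<lambda>i. if i < w 0 then h2 z2_arr i else h2 bz_arr i)"
  proof -
    have "hsem w Q (copy_com bz_arr z2_arr) (set_var bp_var 0 (pot b ?C) h2) bz_arr
      = (\<lambda>i. if i < w 0 then set_var bp_var 0 (pot b ?C) h2 z2_arr i else set_var bp_var 0 (pot b ?C) h2 bz_arr i)"
      by (rule copy_com) (use h1 c D_Q e in \<open>auto simp: w0 intro: order_trans\<close>)
    then show ?thesis by (simp add: fun_eq_iff)
  qed
  have bp: "hsem w Q (copy_com bz_arr z2_arr) (set_var bp_var 0 (pot b ?C) h2) bp_var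
      = set_var bp_var 0 (pot b ?C) h2 bp_var"
    by (rule hsem_unassigned) simp
  show "hsem w Q (try_com p m) h bp_var 0 = min (h bp_var 0) (pot b ?C)"
    unfolding fin using bp e by (simp add: min_def)
  show "\<And>i. i < n \<Longrightarrow> hsem w Q (try_com p m) h bz_arr i = (if pot b ?C < h bp_var 0 then ?C i else h bz_arr i)"
    unfolding fin using cp e h1 by (simp add: w0)
qed

definition candidates :: "nat \<Rightarrow> (nat \<Rightarrow> nat) \<Rightarrow> nat \<Rightarrow> (nat \<Rightarrow> nat) set" where
  "candidates b Z x = {cand Z (fst (iter b Z x (power_steps n))) (snd (iter b Z x (power_steps n))),
     cand Z (snd (iter b Z x (power_steps n))) (fst (iter b Z x (power_steps n)))}"

text \<open>Loop invariant of the search. Points are compared below n only, because array cells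
  beyond n hold arbitrary values; \<open>pot_cong\<close> makes the potential insensitive to
  them.\<close>

definition best_upto :: "nat \<Rightarrow> (nat \<Rightarrow> nat) \<Rightarrow> nat \<Rightarrow> hstate \<Rightarrow> bool" where
  "best_upto b Z x h \<longleftrightarrow> h bp_var 0 = pot b (h bz_arr) \<and> h bp_var 0 \<le> pot b Z
     \<and> (\<forall>y<x. \<forall>C\<in>candidates b Z y. h bp_var 0 \<le> pot b C)
     \<and> ((\<forall>i<n. h bz_arr i = Z i) \<or> (\<exists>y<x. \<exists>C\<in>candidates b Z y. \<forall>i<n. h bz_arr i = C i))"

lemma candidates_inside:
  assumes "inside Z" "C \<in> candidates b Z x" "i < n"
  shows "C i \<le> 2 * D"
proof -
  have Zi: "Z i \<le> 2 * D" using assms by (simp add: inside_def)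
  have off: "i \<notin> alive_set Z \<Longrightarrow> fst (iter b Z x t) i = snd (iter b Z x t) i" for t
    using iter_off[OF assms(3)] by simp
  show ?thesis
    using assms(2)
      cand_eq(2)[of i Z "fst (iter b Z x (power_steps n))" "snd (iter b Z x (power_steps n))", OF assms(3) Zi off]
      cand_eq(4)[of i Z "fst (iter b Z x (power_steps n))" "snd (iter b Z x (power_steps n))", OF assms(3) Zi off]
    by (auto simp: candidates_def)
qed

lemma search_com:
  assumes T: "tables b Z h" and Z: "inside Z" and b: "b \<le> 4096 * q * (n + 1)" and best: "best_upto b Z 0 h"
  shows "best_upto b Z n (hsem w Q search_com h)"
proof -
  let ?c = "HSeq iter_com (HSeq (try_com vp_arr vn_arr) (try_com vn_arr vp_arr))"
  let ?S = "{x_ctr} \<union> assigned ?c"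
  let ?I = "\<lambda>x h'. agree ?S h h' \<and> best_upto b Z x h'"
  have "?I n (hsem w Q search_com h)"
    unfolding search_com_def
  proof (rule HFor_inv[where I = ?I])
    fix x h' assume x: "x < n" "h' x_ctr 0 = x" "?I x h'"
    let ?p = "fst (iter b Z x (power_steps n))" and ?m = "snd (iter b Z x (power_steps n))"
    have T': "tables b Z h'" using x(3) by (intro tables_agree[OF T, of ?S]) auto
    define h1 where "h1 = hsem w Q iter_com h'"
    have h1: "h1 vp_arr i = ?p i" "h1 vn_arr i = ?m i" if "i < n" for i
      unfolding h1_def using iter_com[OF T' Z b x(2) that] by auto
    have h1u: "h1 u = h' u" if "u \<notin> assigned iter_com" for u
      unfolding h1_def using that by (rule hsem_unassigned)
    have T1: "tables b Z h1"
      by (rule tables_agree[OF T', of "assigned iter_com"]) (auto simp: agree_def h1u)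
    have pQ: "?p i + ?m i \<le> Q" if "i < n" for i
      using iter_le[OF Z b that, of x "power_steps n"] iter_Q[of "power_steps n"] by linarith
    have cc: "cand Z (h1 vp_arr) (h1 vn_arr) i = cand Z ?p ?m i" "cand Z (h1 vn_arr) (h1 vp_arr) i = cand Z ?m ?p i"
      if "i < n" for i using h1 that by (auto intro!: cand_cong)
    have Cin: "cand Z ?p ?m i \<le> 2 * D" "cand Z ?m ?p i \<le> 2 * D" if "i < n" for i
      using candidates_inside[OF Z _ that, of _ b x] by (auto simp: candidates_def)
    have pp: "pot b (cand Z (h1 vp_arr) (h1 vn_arr)) = pot b (cand Z ?p ?m)"
      "pot b (cand Z (h1 vn_arr) (h1 vp_arr)) = pot b (cand Z ?m ?p)"
      using cc by (auto intro!: pot_cong)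
    define h2 where "h2 = hsem w Q (try_com vp_arr vn_arr) h1"
    have h2: "h2 bp_var 0 = min (h' bp_var 0) (pot b (cand Z ?p ?m))"
      "\<And>i. i < n \<Longrightarrow> h2 bz_arr i = (if pot b (cand Z ?p ?m) < h' bp_var 0 then cand Z ?p ?m i else h' bz_arr i)"
      unfolding h2_def
      using try_com[of vp_arr vn_arr, OF _ _ T1 b] h1 pQ cc Cin pp h1u[of bp_var] h1u[of bz_arr] by simp_all
    have h2u: "h2 u = h1 u" if "u \<notin> assigned (try_com vp_arr vn_arr)" for u
      unfolding h2_def using that by (rule hsem_unassigned)
    have T2: "tables b Z h2"
      by (rule tables_agree[OF T1, of "assigned (try_com vp_arr vn_arr)"]) (auto simp: agree_def h2u)
    define h3 where "h3 = hsem w Q (try_com vn_arr vp_arr) h2"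
    have vv: "h2 vp_arr = h1 vp_arr" "h2 vn_arr = h1 vn_arr" using h2u[of vp_arr] h2u[of vn_arr] by auto
    have h3: "h3 bp_var 0 = min (h2 bp_var 0) (pot b (cand Z ?m ?p))"
      "\<And>i. i < n \<Longrightarrow> h3 bz_arr i = (if pot b (cand Z ?m ?p) < h2 bp_var 0 then cand Z ?m ?p i else h2 bz_arr i)"
      unfolding h3_def
      using try_com[of vn_arr vp_arr, OF _ _ T2 b] h1 pQ cc Cin pp by (simp_all add: vv add.commute)
    have B: "best_upto b Z x h'" using x(3) by simp
    have C: "cand Z ?p ?m \<in> candidates b Z x" "cand Z ?m ?p \<in> candidates b Z x" by (auto simp: candidates_def)
    have best2: "h2 bp_var 0 = pot b (h2 bz_arr)"
      using B h2 unfolding best_upto_def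
      by (cases "pot b (cand Z ?p ?m) < h' bp_var 0") (auto intro!: pot_cong simp: min_def)
    have best3: "h3 bp_var 0 = pot b (h3 bz_arr)"
      using best2 h3 by (cases "pot b (cand Z ?m ?p) < h2 bp_var 0") (auto intro!: pot_cong simp: min_def)
    have le: "h3 bp_var 0 \<le> h' bp_var 0" "h3 bp_var 0 \<le> pot b (cand Z ?p ?m)" "h3 bp_var 0 \<le> pot b (cand Z ?m ?p)"
      using h2(1) h3(1) by auto
    have "best_upto b Z (Suc x) h3"
      unfolding best_upto_def
    proof (intro conjI)
      show "h3 bp_var 0 = pot b (h3 bz_arr)" by (rule best3)
      show "h3 bp_var 0 \<le> pot b Z" using B le(1) unfolding best_upto_def by linarith
      show "\<forall>y<Suc x. \<forall>C\<in>candidates b Z y. h3 bp_var 0 \<le> pot b C"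
      proof (intro allI impI ballI)
        fix y C assume y: "y < Suc x" "C \<in> candidates b Z y"
        show "h3 bp_var 0 \<le> pot b C"
        proof (cases "y = x")
          case True
          then show ?thesis using y(2) le(2,3) by (auto simp: candidates_def)
        next
          case False
          then have "y < x" using y(1) by simp
          then have "h' bp_var 0 \<le> pot b C" using B y(2) unfolding best_upto_def by blast
          then show ?thesis using le(1) by linarith
        qed
      qed
      show "(\<forall>i<n. h3 bz_arr i = Z i) \<or> (\<exists>y<Suc x. \<exists>C\<in>candidates b Z y. \<forall>i<n. h3 bz_arr i = C i)"
      proof (cases "pot b (cand Z ?m ?p) < h2 bp_var 0")
        case True
        then show ?thesis using h3(2) C(2) by (intro disjI2 exI[of _ x]) auto
      next
        case F3: False
        show ?thesis
        proof (cases "pot b (cand Z ?p ?m) < h' bp_var 0")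
          case True
          then show ?thesis using h3(2) h2(2) F3 C(1) by (intro disjI2 exI[of _ x]) auto
        next
          case False
          then have "\<forall>i<n. h3 bz_arr i = h' bz_arr i" using h3(2) h2(2) F3 by simp
          then show ?thesis using B less_SucI unfolding best_upto_def by (metis (no_types, lifting))
        qed
      qed
    qed
    moreover have "hsem w Q ?c h' = h3" by (simp add: h1_def h2_def h3_def)
    moreover have "best_upto b Z (Suc x) (set_var x_ctr 0 (Suc x) h3) = best_upto b Z (Suc x) h3"
      by (simp add: best_upto_def)
    moreover have "agree ?S h (set_var x_ctr 0 (Suc x) (hsem w Q ?c h'))"
      using x(3) by (intro agree_set_var agree_hsem) auto
    ultimately show "?I (Suc x) (set_var x_ctr 0 (Suc x) (hsem w Q ?c h'))" by simp
  next
    show "?I 0 (set_var x_ctr 0 0 h)" using best by (auto simp: best_upto_def intro!: agree_set_var)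
  qed (auto simp: w0)
  then show ?thesis by simp
qed

text \<open>The search is seeded with the current point and its potential, so its outcome is never
  worse than standing still.\<close>

lemma step_com:
  assumes Z: "inside (h z_arr)" and q: "h q_ctr 0 + 1 = q" and r: "h r_var 0 = r"
  shows "step_ok (h z_arr) (hsem w Q step_com h z_arr)"
proof -
  let ?Z = "h z_arr"
  define b where "b = damp n q (live n ?Z)"
  have b: "b \<le> 4096 * q * (n + 1)" unfolding b_def by (rule damp_le)
  define h1 where "h1 = hsem w Q damp_com h"
  have h1: "\<And>i. i < n \<Longrightarrow> h1 al_arr i = alive n (?Z i)" "h1 b_var 0 = b"
    using damp_com[of h, OF q] by (simp_all add: h1_def b_def)
  have h1u: "h1 u = h u" if "u \<notin> assigned damp_com" for u unfolding h1_def using that by (rule hsem_unassigned)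
  have h1z: "h1 z_arr = ?Z" "h1 r_var 0 = r" using h1u[of z_arr] h1u[of r_var] r by auto
  define h2 where "h2 = hsem w Q (pot_com z_arr) h1"
  have "h2 pot_var 0 = pot (h1 b_var 0) (h1 z_arr)"
    "\<And>j. j < k \<Longrightarrow> h2 w_arr j = weight n q (a j) (h1 b_var 0) (h1 z_arr)"
    unfolding h2_def by (rule pot_com; use Z b h1 h1z in simp)+
  then have h2: "h2 pot_var 0 = pot b ?Z" "\<And>j. j < k \<Longrightarrow> h2 w_arr j = weight n q (a j) b ?Z"
    by (simp_all add: h1 h1z)
  have h2u: "h2 u = h1 u" if "u \<notin> assigned (pot_com z_arr)" for u unfolding h2_def using that by (rule hsem_unassigned)
  have e2: "h2 z_arr = ?Z" "h2 b_var 0 = b" "h2 r_var 0 = r" "\<And>i. i < n \<Longrightarrow> h2 al_arr i = alive n (?Z i)"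
    using h2u[of z_arr] h2u[of b_var] h2u[of r_var] h2u[of al_arr] h1 h1z by auto
  define h3 where "h3 = hsem w Q coef_com h2"
  have h3: "h3 m_arr (i * n + l) = coef b ?Z i l" if "i < n" "l < n" for i l
  proof -
    have "h3 m_arr (i * n + l) = coef (h2 b_var 0) (h2 z_arr) i l"
      unfolding h3_def by (rule coef_com) (use Z b h2 e2 that in simp_all)
    then show ?thesis by (simp add: e2)
  qed
  have h3u: "h3 u = h2 u" if "u \<notin> assigned coef_com" for u unfolding h3_def using that by (rule hsem_unassigned)
  have lvQ: "level b ?Z \<le> Q" using level_le[OF Z b] level_Q by linarith
  have potQ: "pot b ?Z \<le> Q" using pot_le[OF Z b] Q_power by linarith
  define h4 where "h4 = hsem w Q level_com h3"
  have h4: "h4 = set_var lev_var 0 (level b ?Z) h3"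
    using h3u[of pot_var] h3u[of b_var] h2(1) e2 lvQ by (simp add: h4_def level_com_def level_def w0)
  define h5 where "h5 = set_var bp_var 0 (pot b ?Z) h4"
  define h6 where "h6 = hsem w Q (copy_com bz_arr z_arr) h5"
  have e5: "h5 u = h2 u" if "u \<notin> {bp_var, lev_var, m_arr, acc_var, l_ctr, j_ctr}" for u
    using that h3u[of u] by (simp add: h5_def h4)
  have h6: "h6 bz_arr = (\<lambda>i. if i < n then ?Z i else h5 bz_arr i)"
  proof -
    have "h6 bz_arr = (\<lambda>i. if i < w 0 then h5 z_arr i else h5 bz_arr i)"
      unfolding h6_def
    proof (rule copy_com)
      fix i assume "i < w 0"
      then show "h5 z_arr i \<le> Q" using Z D_Q e5[of z_arr] e2 unfolding inside_def w0 by (auto intro: order_trans)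
    qed auto
    then show ?thesis using e5[of z_arr] e2 by (simp add: w0 fun_eq_iff)
  qed
  have h6u: "h6 u = h5 u" if "u \<notin> {bz_arr, i_ctr}" for u unfolding h6_def using that by (intro hsem_unassigned) simp
  have T: "tables b ?Z h6"
    unfolding tables_def using h6u e5 e2 h3 by (auto simp: h5_def h4)
  have bp6: "h6 bp_var 0 = pot b ?Z" using h6u[of bp_var] by (simp add: h5_def)
  have "pot b (h6 bz_arr) = pot b ?Z" using h6 by (intro pot_cong) simp
  then have best: "best_upto b ?Z 0 h6" using bp6 h6 by (simp add: best_upto_def)
  define h7 where "h7 = hsem w Q search_com h6"
  have B: "best_upto b ?Z n h7" unfolding h7_def by (rule search_com[OF T Z b best])
  have bzD: "h7 bz_arr i \<le> 2 * D" if "i < n" for i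
    using B candidates_inside[OF Z _ that] Z that unfolding best_upto_def inside_def by fastforce
  have bpc: "hsem w Q (copy_com z_arr bz_arr) h7 z_arr = (\<lambda>i. if i < w 0 then h7 bz_arr i else h7 z_arr i)"
    by (rule copy_com) (use bzD D_Q in \<open>auto simp: w0 intro: order_trans\<close>)
  have bp5: "hsem w Q (HAsg bp_var (HL 0) (Sc pot_var)) h4 = h5"
    using potQ h3u[of pot_var] h2(1) by (simp add: h5_def h4)
  have fin: "hsem w Q step_com h z_arr = (\<lambda>i. if i < w 0 then h7 bz_arr i else h7 z_arr i)"
    unfolding step_com_def hsem.simps(2) h1_def[symmetric] h2_def[symmetric] h3_def[symmetric]
      h4_def[symmetric] bp5 h6_def[symmetric] h7_def[symmetric] by (rule bpc)
  have pz: "pot b (hsem w Q step_com h z_arr) = h7 bp_var 0"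
    using B unfolding best_upto_def fin w0 by (auto intro!: pot_cong)
  show ?thesis
    unfolding step_ok_def
  proof (intro exI conjI)
    show "b = damp n q (live n ?Z)" by (rule b_def)
    let ?it = "\<lambda>x. iter b ?Z x (power_steps n)"
    let ?Z' = "hsem w Q step_com h z_arr"
    show "?it = ?it" ..
    show "pot b ?Z' \<le> pot b ?Z" using B unfolding pz best_upto_def by simp
    show "\<forall>x<n. pot b ?Z' \<le> pot b (cand ?Z (fst (?it x)) (snd (?it x))) \<and> pot b ?Z' \<le> pot b (cand ?Z (snd (?it x)) (fst (?it x)))"
    proof -
      have "h7 bp_var 0 \<le> pot b C" if "x < n" "C \<in> candidates b ?Z x" for x C
        using B that unfolding best_upto_def by blast
      then show ?thesis unfolding pz candidates_def by blast
    qed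
    have "\<forall>i<n. ?Z' i = h7 bz_arr i" by (simp add: fin w0)
    then show "(\<forall>i<n. ?Z' i = ?Z i) \<or> (\<exists>x<n. (\<forall>i<n. ?Z' i = cand ?Z (fst (?it x)) (snd (?it x)) i)
        \<or> (\<forall>i<n. ?Z' i = cand ?Z (snd (?it x)) (fst (?it x)) i))"
      using B unfolding best_upto_def candidates_def by auto
  qed
qed

end

section \<open>The whole walk and the choice among its outcomes\<close>

definition round_com :: hcom where
  "round_com = HSeq (HAsg r_var (HL 0) (HMul (HMul (HAdd (Sc q_ctr) (HL 1)) (sq_exp radius_exp)) (HAdd HN (HL 1))))
     (HSeq (map_com z_arr i_ctr HN radius_exp) (HFor t_ctr rounds_exp step_com))"

definition disc_exp :: hexp where
  "disc_exp = HAdd (HSub (HMul (HL 2) (Sc acc_var)) (Sc sz_var)) (HSub (Sc sz_var) (HMul (HL 2) (Sc acc_var)))"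

definition disc_body :: hcom where
  "disc_body = HSeq (sum_com acc_var i_ctr HN (HMul (HIn (Sc j_ctr) (Sc i_ctr)) (HV col_arr (Sc i_ctr))))
     (HSeq (sum_com sz_var i_ctr HN (HIn (Sc j_ctr) (Sc i_ctr))) (max_com dsc_var disc_exp))"

definition final_com :: hcom where
  "final_com = HSeq (map_com col_arr i_ctr HN (lt_exp radius_exp (HV z_arr (Sc i_ctr))))
     (HSeq (HAsg dsc_var (HL 0) (HL 0)) (HSeq (HFor j_ctr HK disc_body)
       (HIf (HSub (Sc best_var) (Sc dsc_var)) (HSeq (HAsg best_var (HL 0) (Sc dsc_var)) (copy_com out_arr col_arr)))))"

text \<open>No coloring has discrepancy above n, so the initial value n + 1 makes the first round
  store its coloring.\<close>

definition main_com :: hcom where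
  "main_com = HSeq (HAsg best_var (HL 0) (HAdd HN (HL 1))) (HFor q_ctr HN (HSeq round_com final_com))"

lemma assigned_main [simp]:
  "assigned round_com = {r_var, i_ctr, z_arr, t_ctr} \<union> assigned step_com"
  "assigned disc_body = {acc_var, i_ctr, sz_var, dsc_var}"
  "assigned final_com = {col_arr, i_ctr, dsc_var, j_ctr, acc_var, sz_var, best_var, out_arr}"
  by (auto simp: round_com_def disc_body_def final_com_def)

lemma wf_main: "wf main_com"
  by (simp add: main_com_def round_com_def final_com_def disc_body_def disc_exp_def copy_com_def max_vars_def)

text \<open>For 0/1 colors the signed sum over set j is twice the sum of a c minus the sum of a. One
  of the two truncated differences vanishes, and their sum is the absolute value.\<close>

definition max_disc :: "nat \<Rightarrow> nat \<Rightarrow> (nat \<Rightarrow> nat \<Rightarrow> nat) \<Rightarrow> (nat \<Rightarrow> nat) \<Rightarrow> nat" where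
  "max_disc n k a c = Max (insert 0 ((\<lambda>j. (2 * (\<Sum>i<n. a j i * c i) - (\<Sum>i<n. a j i))
     + ((\<Sum>i<n. a j i) - 2 * (\<Sum>i<n. a j i * c i))) ` {..<k}))"

lemma max_disc_cong: "(\<And>i. i < n \<Longrightarrow> c i = c' i) \<Longrightarrow> max_disc n k a c = max_disc n k a c'"
proof -
  assume "\<And>i. i < n \<Longrightarrow> c i = c' i"
  then have "(\<Sum>i<n. a j i * c i) = (\<Sum>i<n. a j i * c' i)" for j by (intro sum.cong) auto
  then show ?thesis by (simp add: max_disc_def)
qed

lemma signed_sum_eq:
  "\<bar>\<Sum>i<n. real (a j i) * (2 * real (c i) - 1)\<bar>
    = real ((2 * (\<Sum>i<n. a j i * c i) - (\<Sum>i<n. a j i)) + ((\<Sum>i<n. a j i) - 2 * (\<Sum>i<n. a j i * c i)))"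
proof -
  have "(\<Sum>i<n. real (a j i) * (2 * real (c i) - 1)) = 2 * real (\<Sum>i<n. a j i * c i) - real (\<Sum>i<n. a j i)"
    by (simp add: right_diff_distrib sum_subtractf sum_distrib_left mult_ac)
  moreover have "\<bar>2 * real x - real y\<bar> = real ((2 * x - y) + (y - 2 * x))" for x y :: nat
    by (cases "y \<le> 2 * x") (simp_all add: of_nat_diff)
  ultimately show ?thesis by (simp only:)
qed

lemma max_disc_ge:
  "j < k \<Longrightarrow> \<bar>\<Sum>i<n. real (a j i) * (2 * real (c i) - 1)\<bar> \<le> max_disc n k a c"
  unfolding signed_sum_eq max_disc_def of_nat_le_iff by (intro Max_ge) auto

lemma max_disc_le:
  assumes "0 \<le> B" "\<And>j. j < k \<Longrightarrow> \<bar>\<Sum>i<n. real (a j i) * (2 * real (c i) - 1)\<bar> \<le> B"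
  shows "real (max_disc n k a c) \<le> B"
proof -
  have "max_disc n k a c \<in> insert 0 ((\<lambda>j. (2 * (\<Sum>i<n. a j i * c i) - (\<Sum>i<n. a j i))
     + ((\<Sum>i<n. a j i) - 2 * (\<Sum>i<n. a j i * c i))) ` {..<k})"
    unfolding max_disc_def by (intro Max_in) auto
  then show ?thesis
    using assms unfolding signed_sum_eq by auto
qed

context prog_big
begin

text \<open>The program keeps only the current point, while \<open>walk_discrepancy\<close> speaks
  of a trajectory; this lemma recovers one.\<close>

lemma round_com:
  assumes q: "h q_ctr 0 + 1 = q"
  obtains Z where "\<And>i. i < n \<Longrightarrow> Z 0 i = D" "\<And>t. t < rounds n \<Longrightarrow> step_ok (Z t) (Z (Suc t))"
    "hsem w Q round_com h z_arr = Z (rounds n)"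
proof -
  have rQ: "r \<le> Q"
  proof -
    have "(r + 1) ^ 1 \<le> (r + 1) ^ (2 * offset n)"
      using n_le_offset n_pos by (intro power_increasing) auto
    also have "\<dots> \<le> (r + 1) ^ (2 * offset n) * (2 * k)" using k_pos by simp
    finally show ?thesis using Q_power by simp
  qed
  define h1 where "h1 = set_var r_var 0 r h"
  have e1: "hsem w Q (HAsg r_var (HL 0) (HMul (HMul (HAdd (Sc q_ctr) (HL 1)) (sq_exp radius_exp)) (HAdd HN (HL 1)))) h = h1"
  proof -
    have "(h q_ctr 0 + 1) * D\<^sup>2 * (n + 1) = r" unfolding q by (simp add: res_base_def)
    then show ?thesis using rQ by (simp add: h1_def w0)
  qed
  define h2 where "h2 = hsem w Q (map_com z_arr i_ctr HN radius_exp) h1"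
  have h2: "h2 z_arr = (\<lambda>i. if i < n then D else h1 z_arr i)"
    unfolding h2_def by (rule map_com) (use D_Q in \<open>auto simp: w0\<close>)
  have h2u: "h2 u = h1 u" if "u \<notin> {z_arr, i_ctr}" for u unfolding h2_def using that by (intro hsem_unassigned) simp
  let ?S = "{t_ctr} \<union> assigned step_com"
  let ?I = "\<lambda>t h'. agree ?S h2 h' \<and> (\<exists>Z. (\<forall>i<n. Z 0 i = D) \<and> (\<forall>s<t. step_ok (Z s) (Z (Suc s))) \<and> h' z_arr = Z t)"
  have "?I (rounds n) (hsem w Q (HFor t_ctr rounds_exp step_com) h2)"
  proof (rule HFor_inv[where I = ?I])
    fix t h' assume t: "t < rounds n" "h' t_ctr 0 = t" "?I t h'"
    then obtain Z where Z: "\<forall>i<n. Z 0 i = D" "\<forall>s<t. step_ok (Z s) (Z (Suc s))" "h' z_arr = Z t" by blast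
    have ins: "inside (Z s)" if "s \<le> t" for s
      using that
    proof (induction s)
      case 0
      then show ?case using Z(1) by (simp add: inside_def)
    next
      case (Suc s)
      then show ?case using step_moves(1)[of "Z s" "Z (Suc s)"] Z(2) by simp
    qed
    have e: "h' q_ctr = h q_ctr" "h' r_var = h1 r_var"
      using t(3) h2u[of q_ctr] h2u[of r_var] by (auto simp: agree_def h1_def)
    have ok: "step_ok (Z t) (hsem w Q step_com h' z_arr)"
      using step_com[of h'] ins[of t] q e Z(3) by (simp add: h1_def)
    define Z' where "Z' = Z(Suc t := hsem w Q step_com h' z_arr)"
    have "(\<forall>i<n. Z' 0 i = D) \<and> (\<forall>s<Suc t. step_ok (Z' s) (Z' (Suc s))) \<and> hsem w Q step_com h' z_arr = Z' (Suc t)"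
      using Z(1,2) ok by (auto simp: Z'_def less_Suc_eq)
    then show "?I (Suc t) (set_var t_ctr 0 (Suc t) (hsem w Q step_com h'))"
      using t(3) by (auto intro!: agree_set_var agree_hsem)
  next
    show "?I 0 (set_var t_ctr 0 0 h2)"
      using h2 by (auto intro!: agree_set_var exI[of _ "\<lambda>_. h2 z_arr"])
  qed (auto simp: w0)
  moreover have "hsem w Q round_com h = hsem w Q (HFor t_ctr rounds_exp step_com) h2"
    unfolding round_com_def hsem.simps(2) e1 h2_def ..
  ultimately show thesis using that by auto
qed

definition rounding :: "(nat \<Rightarrow> nat) \<Rightarrow> nat \<Rightarrow> nat" where
  "rounding Z i = of_bool (D < Z i)"

lemma disc_term_le: "(2 * (\<Sum>i<n. a j i * c i) - (\<Sum>i<n. a j i)) + ((\<Sum>i<n. a j i) - 2 * (\<Sum>i<n. a j i * c i)) \<le> n"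
  if "\<And>i. i < n \<Longrightarrow> c i \<le> 1"
proof -
  have "(\<Sum>i<n. a j i * c i) \<le> (\<Sum>i<n. a j i * 1)" using that by (intro sum_mono mult_le_mono2) auto
  then show ?thesis using ssum_le[of j] by simp
qed

lemma final_com:
  assumes best: "h best_var 0 \<le> n + 1"
  shows "hsem w Q final_com h best_var 0 = min (h best_var 0) (max_disc n k a (rounding (h z_arr)))"
    "\<And>i. i < n \<Longrightarrow> hsem w Q final_com h out_arr i
      = (if max_disc n k a (rounding (h z_arr)) < h best_var 0 then rounding (h z_arr) i else h out_arr i)"
proof -
  let ?c = "rounding (h z_arr)"
  have c1: "?c i \<le> 1" for i by (simp add: rounding_def)
  define h1 where "h1 = hsem w Q (map_com col_arr i_ctr HN (lt_exp radius_exp (HV z_arr (Sc i_ctr)))) h"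
  have h1: "h1 col_arr = (\<lambda>i. if i < n then ?c i else h col_arr i)"
    unfolding h1_def
  proof (rule map_com)
    fix j h' assume j: "j < n" "h' i_ctr 0 = j" "agree {i_ctr, col_arr} h h'"
    show "hev w (lt_exp radius_exp (HV z_arr (Sc i_ctr))) h' = ?c j"
      using j agreeD[OF j(3), of z_arr] by (simp add: w0 rounding_def)
  next
    show "?c j \<le> Q" for j using c1[of j] n_Q by linarith
  qed (simp_all add: w0)
  have h1u: "h1 u = h u" if "u \<notin> {col_arr, i_ctr}" for u unfolding h1_def using that by (intro hsem_unassigned) simp
  define h2 where "h2 = set_var dsc_var 0 0 h1"
  let ?S = "{j_ctr} \<union> assigned disc_body"
  let ?g = "\<lambda>j. (2 * (\<Sum>i<n. a j i * ?c i) - (\<Sum>i<n. a j i)) + ((\<Sum>i<n. a j i) - 2 * (\<Sum>i<n. a j i * ?c i))"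
  have gn: "?g j \<le> n" for j using c1 by (intro disc_term_le) auto
  let ?I = "\<lambda>j h'. agree ?S h2 h' \<and> h' dsc_var 0 = Max (insert 0 (?g ` {..<j}))"
  define h3 where "h3 = hsem w Q (HFor j_ctr HK disc_body) h2"
  have I3: "?I k h3"
    unfolding h3_def
  proof (rule HFor_inv[where I = ?I])
    fix j h' assume j: "j < k" "h' j_ctr 0 = j" "?I j h'"
    have col: "h' col_arr = h1 col_arr" using j(3) by (auto simp: agree_def h2_def)
    let ?s1 = "sum_com acc_var i_ctr HN (HMul (HIn (Sc j_ctr) (Sc i_ctr)) (HV col_arr (Sc i_ctr)))"
    let ?s2 = "sum_com sz_var i_ctr HN (HIn (Sc j_ctr) (Sc i_ctr))"
    define g1 where "g1 = hsem w Q ?s1 h'"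
    have g1: "g1 acc_var 0 = (\<Sum>i<n. a j i * ?c i)"
      unfolding g1_def
    proof (rule sum_com)
      fix i h'' assume i: "i < n" "h'' i_ctr 0 = i" "agree {i_ctr, acc_var} h' h''"
      have "h'' j_ctr 0 = j" "h'' col_arr = h1 col_arr"
        using agreeD[OF i(3), of j_ctr] agreeD[OF i(3), of col_arr] j(2) col by auto
      then show "hev w (HMul (HIn (Sc j_ctr) (Sc i_ctr)) (HV col_arr (Sc i_ctr))) h'' = a j i * ?c i"
        using i j(1) h1 by simp
    next
      have "(\<Sum>i<n. a j i * ?c i) \<le> (\<Sum>i<n. a j i * 1)" using c1 by (intro sum_mono mult_le_mono2)
      then show "(\<Sum>i<n. a j i * ?c i) \<le> Q" using ssum_le[of j] n_Q by simp
    qed (simp_all add: w0)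
    have g1u: "g1 u = h' u" if "u \<notin> {acc_var, i_ctr}" for u unfolding g1_def using that by (intro hsem_unassigned) simp
    define g2 where "g2 = hsem w Q ?s2 g1"
    have g2: "g2 sz_var 0 = (\<Sum>i<n. a j i)"
      unfolding g2_def
    proof (rule sum_com)
      fix i h'' assume i: "i < n" "h'' i_ctr 0 = i" "agree {i_ctr, sz_var} g1 h''"
      have "h'' j_ctr 0 = j" using agreeD[OF i(3), of j_ctr] j(2) g1u[of j_ctr] by auto
      then show "hev w (HIn (Sc j_ctr) (Sc i_ctr)) h'' = a j i" using i j(1) by simp
    qed (use ssum_le[of j] n_Q in \<open>simp_all add: w0\<close>)
    have g2u: "g2 u = g1 u" if "u \<notin> {sz_var, i_ctr}" for u unfolding g2_def using that by (intro hsem_unassigned) simp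
    have ev: "hev w disc_exp g2 = ?g j"
      using g1 g2 g2u[of acc_var] by (simp add: disc_exp_def)
    have ds: "g2 dsc_var 0 = Max (insert 0 (?g ` {..<j}))" using g2u[of dsc_var] g1u[of dsc_var] j(3) by simp
    have "Max (insert 0 (?g ` {..<j})) \<le> n" using gn by (auto intro!: Max.boundedI)
    then have mx: "g2 dsc_var 0 \<le> Q" "hev w disc_exp g2 \<le> Q"
      unfolding ds ev using gn[of j] n_Q by linarith+
    have "hsem w Q disc_body h' dsc_var 0 = hsem w Q (max_com dsc_var disc_exp) g2 dsc_var 0"
      by (simp only: disc_body_def hsem.simps(2) g1_def g2_def)
    also have "\<dots> = max (g2 dsc_var 0) (hev w disc_exp g2)" by (rule max_com[OF mx(2,1)])
    also have "\<dots> = max (Max (insert 0 (?g ` {..<j}))) (?g j)" by (simp only: ev ds)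
    also have "\<dots> = Max (insert 0 (?g ` {..<Suc j}))"
    proof -
      have "insert 0 (?g ` {..<Suc j}) = insert (?g j) (insert 0 (?g ` {..<j}))"
        by (simp only: lessThan_Suc image_insert insert_commute)
      then have "Max (insert 0 (?g ` {..<Suc j})) = max (?g j) (Max (insert 0 (?g ` {..<j})))"
        by (simp only: Max.insert finite_insert finite_imageI finite_lessThan) simp
      then show ?thesis by (simp only: max.commute)
    qed
    finally show "?I (Suc j) (set_var j_ctr 0 (Suc j) (hsem w Q disc_body h'))"
      using j(3) by (auto intro!: agree_set_var agree_hsem)
  next
    have "h2 dsc_var 0 = 0" by (simp add: h2_def)
    then show "?I 0 (set_var j_ctr 0 0 h2)" by (auto intro!: agree_set_var)
  qed (auto simp: w1)
  let ?m = "max_disc n k a ?c"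
  have m: "h3 dsc_var 0 = ?m" using I3 by (simp add: max_disc_def)
  have mn: "?m \<le> n" unfolding max_disc_def using gn by (auto intro!: Max.boundedI)
  have e: "h3 best_var = h best_var" "h3 out_arr = h out_arr" "h3 col_arr = h1 col_arr"
    using I3 h1u[of best_var] h1u[of out_arr] by (auto simp: agree_def h2_def)
  have fin: "hsem w Q final_com h = (if ?m < h best_var 0
      then hsem w Q (copy_com out_arr col_arr) (set_var best_var 0 ?m h3) else h3)"
  proof -
    have e2: "hsem w Q (HAsg dsc_var (HL 0) (HL 0)) h1 = h2" by (simp add: h2_def)
    have "(hev w (HSub (Sc best_var) (Sc dsc_var)) h3 \<noteq> 0) = (?m < h best_var 0)" using m e by auto
    moreover have "hsem w Q (HAsg best_var (HL 0) (Sc dsc_var)) h3 = set_var best_var 0 ?m h3"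
      using m mn n_Q by simp
    ultimately show ?thesis
      unfolding final_com_def hsem.simps(2) h1_def[symmetric] e2 h3_def[symmetric] hsem.simps(3) by (simp only:)
  qed
  have cp: "hsem w Q (copy_com out_arr col_arr) (set_var best_var 0 ?m h3) out_arr
      = (\<lambda>i. if i < w 0 then set_var best_var 0 ?m h3 col_arr i else set_var best_var 0 ?m h3 out_arr i)"
  proof (rule copy_com)
    fix i assume "i < w 0"
    then show "set_var best_var 0 ?m h3 col_arr i \<le> Q" using e h1 c1[of i] n_Q by (simp add: w0)
  qed auto
  have bp: "hsem w Q (copy_com out_arr col_arr) (set_var best_var 0 ?m h3) best_var = set_var best_var 0 ?m h3 best_var"
    by (rule hsem_unassigned) simp
  show "hsem w Q final_com h best_var 0 = min (h best_var 0) ?m"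
    unfolding fin using bp e by (simp add: min_def)
  show "\<And>i. i < n \<Longrightarrow> hsem w Q final_com h out_arr i = (if ?m < h best_var 0 then ?c i else h out_arr i)"
    unfolding fin using cp e h1 by (simp add: w0)
qed

lemma max_disc_n: "(\<And>i. c i \<le> 1) \<Longrightarrow> max_disc n k a c \<le> n"
  unfolding max_disc_def using disc_term_le[of c] by (auto intro!: Max.boundedI)

definition disc_bound :: real where
  "disc_bound = 2 * real q * (ln (2 * real k) + 4096 * (2 + ln n)) + 8"

lemma disc_bound_nonneg: "0 \<le> disc_bound"
proof -
  have "0 \<le> ln (2 * real k)" "0 \<le> ln (real n)" using k_pos n_pos by (auto intro!: ln_ge_zero)
  then show ?thesis unfolding disc_bound_def by (intro add_nonneg_nonneg mult_nonneg_nonneg) auto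
qed

lemma round_disc:
  assumes "h q_ctr 0 + 1 = q" near_net
  shows "real (max_disc n k a (rounding (hsem w Q round_com h z_arr))) \<le> disc_bound"
proof -
  obtain Z where Z: "\<And>i. i < n \<Longrightarrow> Z 0 i = D" "\<And>t. t < rounds n \<Longrightarrow> step_ok (Z t) (Z (Suc t))"
    "hsem w Q round_com h z_arr = Z (rounds n)" using round_com[of h, OF assms(1)] by blast
  show ?thesis
  proof (rule max_disc_le[OF disc_bound_nonneg])
    fix j assume "j < k"
    have "2 * real (rounding (Z (rounds n)) i) - 1 = (if D < Z (rounds n) i then 1 else - 1)" for i
      by (simp add: rounding_def)
    then show "\<bar>\<Sum>i<n. real (a j i) * (2 * real (rounding (hsem w Q round_com h z_arr) i) - 1)\<bar> \<le> disc_bound"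
      using walk_discrepancy[OF assms(2) q_le Z(1,2) \<open>j < k\<close>] unfolding Z(3) disc_bound_def by simp
  qed
qed

end

text \<open>Rounds with other parameters may produce any coloring. The stored value never increases,
  so from round \<open>q\<close> on it satisfies the bound for this \<open>q\<close>, the only one
  for which a net is assumed.\<close>

lemma main_com:
  assumes big: "\<And>q. 0 < q \<Longrightarrow> q \<le> n \<Longrightarrow> prog_big n k a q w Q" and n: "0 < n"
    and q: "0 < q" "q \<le> n" and net: "walk.near_net n k a q"
  shows "\<And>i. i < n \<Longrightarrow> hsem w Q main_com h out_arr i \<le> 1"
    "real (max_disc n k a (hsem w Q main_com h out_arr)) \<le> 2 * real q * (ln (2 * real k) + 4096 * (2 + ln n)) + 8"
proof -
  interpret P1: prog_big n k a 1 w Q using big n by simp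
  define h1 where "h1 = set_var best_var 0 (n + 1) h"
  have e1: "hsem w Q (HAsg best_var (HL 0) (HAdd HN (HL 1))) h = h1"
    using P1.n_Q by (simp add: h1_def P1.w0)
  let ?B = "\<lambda>q. 2 * real q * (ln (2 * real k) + 4096 * (2 + ln n)) + 8"
  let ?I = "\<lambda>p h'. h' best_var 0 \<le> n + 1 \<and> (p = 0 \<longrightarrow> h' best_var 0 = n + 1) \<and>
    (0 < p \<longrightarrow> (\<forall>i<n. h' out_arr i \<le> 1) \<and> h' best_var 0 \<le> n \<and> max_disc n k a (h' out_arr) = h' best_var 0) \<and>
    (q \<le> p \<longrightarrow> real (h' best_var 0) \<le> ?B q)"
  have "?I n (hsem w Q (HFor q_ctr HN (HSeq round_com final_com)) h1)"
  proof (rule HFor_inv[where I = ?I])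
    fix p h' assume p: "p < n" "h' q_ctr 0 = p" "?I p h'"
    interpret P: prog_big n k a "Suc p" w Q using big p(1) by simp
    define h2 where "h2 = hsem w Q round_com h'"
    have h2u: "h2 best_var = h' best_var" "h2 out_arr = h' out_arr"
      unfolding h2_def by (rule hsem_unassigned; simp)+
    let ?c = "P.rounding (h2 z_arr)"
    define h3 where "h3 = hsem w Q final_com h2"
    have bl: "h2 best_var 0 \<le> n + 1" using p(3) h2u by simp
    have h3: "h3 best_var 0 = min (h' best_var 0) (max_disc n k a ?c)"
      "\<And>i. i < n \<Longrightarrow> h3 out_arr i = (if max_disc n k a ?c < h' best_var 0 then ?c i else h' out_arr i)"
      unfolding h3_def using P.final_com[of h2, OF bl] h2u by simp_all
    have cn: "max_disc n k a ?c \<le> n" by (rule P.max_disc_n) (simp add: P.rounding_def)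
    have "?I (Suc p) h3"
    proof (intro conjI impI)
      show "h3 best_var 0 \<le> n + 1" "h3 best_var 0 \<le> n" using h3(1) cn by auto
      show "h3 best_var 0 = n + 1" if "Suc p = 0" using that by simp
      show "\<forall>i<n. h3 out_arr i \<le> 1"
      proof (intro allI impI)
        fix i assume i: "i < n"
        show "h3 out_arr i \<le> 1"
        proof (cases "max_disc n k a ?c < h' best_var 0")
          case True
          then show ?thesis using h3(2)[OF i] by (simp add: P.rounding_def)
        next
          case False
          then have "0 < p" using p(3) cn by (cases p) auto
          then show ?thesis using h3(2)[OF i] False p(3) i by simp
        qed
      qed
      show "max_disc n k a (h3 out_arr) = h3 best_var 0"
      proof (cases "max_disc n k a ?c < h' best_var 0")
        case True
        then have "max_disc n k a (h3 out_arr) = max_disc n k a ?c" using h3(2) by (intro max_disc_cong) auto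
        then show ?thesis using h3(1) True by simp
      next
        case False
        then have "0 < p" using p(3) cn by (cases p) auto
        moreover have "max_disc n k a (h3 out_arr) = max_disc n k a (h' out_arr)"
          using h3(2) False by (intro max_disc_cong) auto
        ultimately show ?thesis using h3(1) False p(3) by simp
      qed
      assume qp: "q \<le> Suc p"
      show "real (h3 best_var 0) \<le> ?B q"
      proof (cases "q = Suc p")
        case True
        have "real (max_disc n k a ?c) \<le> P.disc_bound"
          unfolding h2_def by (rule P.round_disc) (use p(2) net True in auto)
        then show ?thesis using h3(1) True unfolding P.disc_bound_def by simp
      next
        case False
        then have "real (h' best_var 0) \<le> ?B q" using qp p(3) by simp
        moreover have "h3 best_var 0 \<le> h' best_var 0" using h3(1) by simp
        ultimately show ?thesis by linarith
      qed
    qed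
    moreover have "hsem w Q (HSeq round_com final_com) h' = h3" by (simp add: h2_def h3_def)
    ultimately show "?I (Suc p) (set_var q_ctr 0 (Suc p) (hsem w Q (HSeq round_com final_com) h'))" by simp
  next
    show "?I 0 (set_var q_ctr 0 0 h1)" using q by (simp add: h1_def)
  qed (auto simp: P1.w0)
  moreover have "hsem w Q main_com h = hsem w Q (HFor q_ctr HN (HSeq round_com final_com)) h1"
    by (simp only: main_com_def hsem.simps(2) e1)
  ultimately show "\<And>i. i < n \<Longrightarrow> hsem w Q main_com h out_arr i \<le> 1"
    "real (max_disc n k a (hsem w Q main_com h out_arr)) \<le> ?B q"
    using n q by auto
qed

section \<open>Set-up and output on the machine\<close>

definition poly_bounded :: "(memory \<Rightarrow> nat) \<Rightarrow> bool" where
  "poly_bounded f \<longleftrightarrow> (\<exists>g. \<forall>w. f w \<le> dims w ^ g)"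

text \<open>Values of polynomial bit length; these, unlike \<open>poly_bounded\<close> ones, are
  closed under powers with polynomially bounded exponents.\<close>

definition bits_bounded :: "(memory \<Rightarrow> nat) \<Rightarrow> bool" where
  "bits_bounded f \<longleftrightarrow> (\<exists>g. \<forall>w. f w \<le> 2 ^ (dims w ^ g))"

lemma poly_bounded_const: "poly_bounded (\<lambda>w. c)"
  unfolding poly_bounded_def using le_dims_power by blast

lemma poly_bounded_size: "poly_bounded (\<lambda>w. w 0)" "poly_bounded (\<lambda>w. w (Suc 0))"
  unfolding poly_bounded_def by (rule exI[of _ 1], simp add: dims_def)+

lemma poly_bounded_add: "poly_bounded f \<Longrightarrow> poly_bounded g \<Longrightarrow> poly_bounded (\<lambda>w. f w + g w)"
  unfolding poly_bounded_def using add_le_dims_power by meson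

lemma poly_bounded_mult: "poly_bounded f \<Longrightarrow> poly_bounded g \<Longrightarrow> poly_bounded (\<lambda>w. f w * g w)"
  unfolding poly_bounded_def using mult_le_mono by (metis power_add)

lemma poly_bounded_power: "poly_bounded f \<Longrightarrow> poly_bounded (\<lambda>w. f w ^ m)"
proof (induction m)
  case 0
  show ?case using poly_bounded_const[of 1] by simp
next
  case (Suc m)
  then show ?case using poly_bounded_mult[of f "\<lambda>w. f w ^ m"] by simp
qed

lemmas poly_bounded_intros =
  poly_bounded_const poly_bounded_size poly_bounded_add poly_bounded_mult poly_bounded_power

lemma bits_bounded_poly: "poly_bounded f \<Longrightarrow> bits_bounded f"
  unfolding poly_bounded_def bits_bounded_def using le_trans[OF _ less_imp_le[OF less_exp]] by blast

lemma bits_bounded_mult: "bits_bounded f \<Longrightarrow> bits_bounded g \<Longrightarrow> bits_bounded (\<lambda>w. f w * g w)"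
proof -
  assume "bits_bounded f" "bits_bounded g"
  then obtain i j where ij: "\<And>w. f w \<le> 2 ^ (dims w ^ i)" "\<And>w. g w \<le> 2 ^ (dims w ^ j)"
    by (auto simp: bits_bounded_def)
  have "f w * g w \<le> 2 ^ (dims w ^ (i + j + 1))" for w
  proof -
    have "f w * g w \<le> 2 ^ (dims w ^ i + dims w ^ j)" using mult_le_mono[OF ij] by (simp add: power_add)
    also have "\<dots> \<le> 2 ^ (dims w ^ (i + j + 1))" by (rule power_increasing[OF add_le_dims_power[OF order_refl order_refl]]) simp
    finally show ?thesis .
  qed
  then show ?thesis unfolding bits_bounded_def by blast
qed

lemma bits_bounded_add: "bits_bounded f \<Longrightarrow> bits_bounded g \<Longrightarrow> bits_bounded (\<lambda>w. f w + g w)"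
proof -
  assume "bits_bounded f" "bits_bounded g"
  then obtain i j where ij: "\<And>w. f w \<le> 2 ^ (dims w ^ i)" "\<And>w. g w \<le> 2 ^ (dims w ^ j)"
    by (auto simp: bits_bounded_def)
  have "f w + g w \<le> 2 ^ (dims w ^ (i + j + 1))" for w
  proof -
    let ?m = "dims w ^ (i + j)"
    have "1 \<le> dims w" using dims_ge[of w] by simp
    then have "(2::nat) ^ (dims w ^ i) \<le> 2 ^ ?m" "(2::nat) ^ (dims w ^ j) \<le> 2 ^ ?m"
      by (intro power_increasing; simp)+
    then have "f w \<le> 2 ^ ?m" "g w \<le> 2 ^ ?m" using ij le_trans by blast+
    then have "f w + g w \<le> 2 ^ (?m + 1)" by simp
    also have "\<dots> \<le> 2 ^ (dims w ^ (i + j + 1))"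
      using add_le_dims_power[of ?m w "i + j" 1 0] by (intro power_increasing) auto
    finally show ?thesis .
  qed
  then show ?thesis unfolding bits_bounded_def by blast
qed

lemma bits_bounded_power: "bits_bounded f \<Longrightarrow> poly_bounded g \<Longrightarrow> bits_bounded (\<lambda>w. f w ^ g w)"
proof -
  assume "bits_bounded f" "poly_bounded g"
  then obtain i j where ij: "\<And>w. f w \<le> 2 ^ (dims w ^ i)" "\<And>w. g w \<le> dims w ^ j"
    by (auto simp: bits_bounded_def poly_bounded_def)
  have "f w ^ g w \<le> 2 ^ (dims w ^ (i + j))" for w
  proof -
    have "f w ^ g w \<le> (2 ^ (dims w ^ i)) ^ g w" using ij(1) by (rule power_mono) simp
    also have "\<dots> \<le> (2 ^ (dims w ^ i)) ^ (dims w ^ j)" using ij(2) by (rule power_increasing) simp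
    also have "\<dots> = 2 ^ (dims w ^ (i + j))" by (simp add: power_mult[symmetric] power_add)
    finally show ?thesis .
  qed
  then show ?thesis unfolding bits_bounded_def by blast
qed

definition weight_cap :: "nat \<Rightarrow> nat \<Rightarrow> nat" where
  "weight_cap n k = (res_base n n + 1) ^ (2 * offset n) * (2 * k)"

text \<open>Exceeds all thresholds demanded by \<open>prog_big\<close>, with n in place of q, so
  that one cap serves every round.\<close>

definition value_cap :: "nat \<Rightarrow> nat \<Rightarrow> nat" where
  "value_cap n k = weight_cap n k + 2 * offset n
    + (weight_cap n k * (2 * (slope n)\<^sup>2 * n + 80 * (4096 * n * (n + 1))\<^sup>2 * (radius n)\<^sup>2 * n) * (n + 1)) ^ (power_steps n + 1)"

lemma bits_bounded_cap: "bits_bounded (\<lambda>w. value_cap (w 0) (w (Suc 0)))"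
  unfolding value_cap_def weight_cap_def
    res_base_def offset_def slope_def radius_def move_bound_def power_steps_def
  by (rule bits_bounded_add bits_bounded_mult bits_bounded_power poly_bounded_intros | rule bits_bounded_poly)+

lemma prog_big_cap:
  assumes "0 < k" "0 < q" "q \<le> n" "\<And>j i. a j i \<le> 1" "w 0 = n" "w (Suc 0) = k"
    and "\<And>j i. j < k \<Longrightarrow> i < n \<Longrightarrow> w (2 + (j * n + i)) = a j i" and Q: "value_cap n k \<le> Q"
  shows "prog_big n k a q w Q"
proof -
  have r: "res_base n q \<le> res_base n n" unfolding res_base_def using assms(3) by (intro mult_le_mono1)
  have wc: "(res_base n q + 1) ^ (2 * offset n) * (2 * k) \<le> weight_cap n k"
    unfolding weight_cap_def using r by (intro mult_le_mono1 power_mono) auto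
  interpret prog n k a q w Q
    by unfold_locales (use assms wc in \<open>auto simp: value_cap_def\<close>)
  show ?thesis
  proof unfold_locales
    have "level_bound \<le> weight_cap n k * (2 * (slope n)\<^sup>2 * n + 80 * (4096 * n * (n + 1))\<^sup>2 * (radius n)\<^sup>2 * n)"
      unfolding level_bound_def using wc assms(3)
      by (intro mult_le_mono wc add_le_mono order_refl power_mono mult_le_mono1 mult_le_mono2) auto
    then have "(level_bound * (n + 1)) ^ (power_steps n + 1) \<le> (weight_cap n k *
        (2 * (slope n)\<^sup>2 * n + 80 * (4096 * n * (n + 1))\<^sup>2 * (radius n)\<^sup>2 * n) * (n + 1)) ^ (power_steps n + 1)"
      by (intro power_mono mult_le_mono1) auto
    then show "(level_bound * (n + 1)) ^ (power_steps n + 1) \<le> Q" using Q by (simp add: value_cap_def)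
  qed
qed

lemma aval_var_sizes: "s 0 = w 0 \<Longrightarrow> s (Suc 0) = w (Suc 0) \<Longrightarrow> aval (var_exp v a) s = var_addr w v (aval a s)"
  by (simp add: var_exp_def var_addr_def base_exp_def base_def)

abbreviation "ctr_exp \<equiv> var_exp 0 (Lit 0)"

primrec dims_power_exp :: "nat \<Rightarrow> aexp" where
  "dims_power_exp 0 = Lit 1"
| "dims_power_exp (Suc g) = Mul (Add (Add (Cell (Lit 0)) (Cell (Lit 1))) (Lit 2)) (dims_power_exp g)"

lemma aval_dims_power: "frozen w s \<Longrightarrow> aval (dims_power_exp g) s = dims w ^ g"
  by (induction g) (simp_all add: frozen_dims dims_def)

lemma exec_Assign:
  "aval a s = x \<Longrightarrow> aval e s = y \<Longrightarrow> exec (Assign a e) s \<omega> (1 + acost a s + acost e s) (s(x := y)) \<omega>"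
  using exec.Assign by metis

text \<open>Expressions have no exponentiation, so the cap is not \<open>value_cap\<close> itself
  but a power of two above it, reached by repeated doubling.\<close>

definition cap_com :: "nat \<Rightarrow> com" where
  "cap_com g = Seq (Seq (Assign ctr_exp (dims_power_exp g)) (Assign cap_exp (Lit 1)))
     (While (Cell ctr_exp) (Seq (Assign cap_exp (Add (Cell cap_exp) (Cell cap_exp)))
        (Assign ctr_exp (Sub (Cell ctr_exp) (Lit 1)))))"

definition cap_cost :: "nat \<Rightarrow> nat" where
  "cap_cost g = 4 + acsize ctr_exp + acsize (dims_power_exp g) + acsize cap_exp
      + acsize (Lit 1) + acsize (Cell ctr_exp) + acsize cap_exp + acsize (Add (Cell cap_exp) (Cell cap_exp))
      + acsize ctr_exp + acsize (Sub (Cell ctr_exp) (Lit 1))"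

lemma cap_com:
  assumes w: "1 \<le> w 0" and fr: "frozen w s" and bd: "bounded_mem \<beta> s" and \<beta>: "dims w ^ g < \<beta>"
  shows "\<exists>T s'. exec (cap_com g) s \<omega> T s' \<omega> \<and> frozen w s' \<and> s' (cap_addr w) = 2 ^ (dims w ^ g)
    \<and> bounded_mem \<beta> s' \<and> T \<le> (dims w ^ g + 2) * (cap_cost g * \<beta>)" (is "\<exists>T s'. _ \<and> _ \<and> _ \<and> _ \<and> T \<le> (?X + 2) * (?K * \<beta>)")
proof -
  have \<beta>1: "1 \<le> \<beta>" using \<beta> by simp
  let ?c = "var_addr w 0 0" and ?q = "cap_addr w"
  have cq: "?q \<noteq> ?c" by (rule cap_not_var)
  have addr: "?q \<le> ?c" by (simp add: cap_addr_def var_addr_def base_def)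
  define R where "R j s \<longleftrightarrow> frozen w s \<and> s ?q = 2 ^ j \<and> s ?c = ?X - j \<and> bounded_mem \<beta> s" for j s
  have fu: "frozen w (s(?q := x))" "frozen w (s(?c := x))" if "frozen w s" for s x
    using frozen_upd[OF w that] addr by auto
  have lt: "y < 2 ^ \<beta>" if "y \<le> ?X" for y
    using that \<beta> less_exp[of \<beta>] by linarith
  let ?s1 = "s(?c := ?X)" and ?s2 = "s(?c := ?X, ?q := 1)"
  have b1: "bounded_mem \<beta> ?s1" using bd lt by (intro bounded_mem_upd) auto
  have f1: "frozen w ?s1" by (rule fu(2)[OF fr])
  have 1: "exec (Assign ctr_exp (dims_power_exp g)) s \<omega> (1 + acost ctr_exp s + acost (dims_power_exp g) s) ?s1 \<omega>"
    by (rule exec_Assign) (simp_all add: aval_var[OF fr] aval_dims_power[OF fr])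
  have 2: "exec (Assign cap_exp (Lit 1)) ?s1 \<omega> (1 + acost cap_exp ?s1 + acost (Lit 1) ?s1) ?s2 \<omega>"
    by (rule exec_Assign) (simp_all add: aval_cap[OF f1])
  have R0: "R 0 ?s2"
    unfolding R_def using fu(1)[OF f1] cq b1 \<beta>1 bounded_mem_upd[OF b1, of 1 ?q] one_less_power[of "2::nat" \<beta>] by simp
  let ?body = "Seq (Assign cap_exp (Add (Cell cap_exp) (Cell cap_exp))) (Assign ctr_exp (Sub (Cell ctr_exp) (Lit 1)))"
  let ?\<tau> = "(1 + acsize cap_exp * \<beta> + acsize (Add (Cell cap_exp) (Cell cap_exp)) * \<beta>)
    + (1 + acsize ctr_exp * \<beta> + acsize (Sub (Cell ctr_exp) (Lit 1)) * \<beta>)"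
  have "\<exists>T s'. exec (While (Cell ctr_exp) ?body) ?s2 \<omega> T s' \<omega> \<and> R ?X s'
      \<and> T \<le> (?X - 0 + 1) * (1 + acsize (Cell ctr_exp) * \<beta> + ?\<tau>)"
  proof (rule exec_loop[where R = R and b = ?X and j = 0])
    fix s assume "R ?X s"
    then show "aval (Cell ctr_exp) s = 0 \<and> acost (Cell ctr_exp) s \<le> acsize (Cell ctr_exp) * \<beta>"
      using acost_bound[OF _ \<beta>1, of s "Cell ctr_exp"] aval_var[of w s] by (simp add: R_def)
  next
    fix j s assume j: "j < ?X" and "R j s"
    then have r: "frozen w s" "s ?q = 2 ^ j" "s ?c = ?X - j" "bounded_mem \<beta> s" by (auto simp: R_def)
    let ?t1 = "s(?q := 2 ^ Suc j)" and ?t2 = "s(?q := 2 ^ Suc j, ?c := ?X - Suc j)"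
    have "(2::nat) ^ Suc j < 2 ^ \<beta>" using j \<beta> by (intro power_strict_increasing) auto
    then have t1: "bounded_mem \<beta> ?t1" using r(4) by (intro bounded_mem_upd) auto
    have ft1: "frozen w ?t1" by (rule fu(1)[OF r(1)])
    have 1: "exec (Assign cap_exp (Add (Cell cap_exp) (Cell cap_exp))) s \<omega>
        (1 + acost cap_exp s + acost (Add (Cell cap_exp) (Cell cap_exp)) s) ?t1 \<omega>"
      by (rule exec_Assign) (simp_all add: aval_cap[OF r(1)] r(2))
    have 2: "exec (Assign ctr_exp (Sub (Cell ctr_exp) (Lit 1))) ?t1 \<omega>
        (1 + acost ctr_exp ?t1 + acost (Sub (Cell ctr_exp) (Lit 1)) ?t1) ?t2 \<omega>"
      using r(3) cq by (intro exec_Assign) (simp_all only: aval.simps aval_var[OF ft1] fun_upd_apply if_False, simp_all)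
    have "R (Suc j) ?t2"
      unfolding R_def using fu(2)[OF ft1] cq t1 lt[of "?X - Suc j"] bounded_mem_upd[OF t1] by simp
    moreover have "(1 + acost cap_exp s + acost (Add (Cell cap_exp) (Cell cap_exp)) s)
        + (1 + acost ctr_exp ?t1 + acost (Sub (Cell ctr_exp) (Lit 1)) ?t1) \<le> ?\<tau>"
      by (intro add_mono order_refl acost_bound[OF r(4) \<beta>1] acost_bound[OF t1 \<beta>1])
    ultimately have "\<exists>T s'. exec ?body s \<omega> T s' \<omega> \<and> R (Suc j) s' \<and> T \<le> ?\<tau>"
      using exec.Seq[OF 1 2] by blast
    moreover have "aval (Cell ctr_exp) s \<noteq> 0" using j r(3) by (simp add: aval_var[OF r(1)])
    moreover have "acost (Cell ctr_exp) s \<le> acsize (Cell ctr_exp) * \<beta>" by (rule acost_bound[OF r(4) \<beta>1])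
    ultimately show "aval (Cell ctr_exp) s \<noteq> 0 \<and> acost (Cell ctr_exp) s \<le> acsize (Cell ctr_exp) * \<beta>
        \<and> (\<exists>T s'. exec ?body s \<omega> T s' \<omega> \<and> R (Suc j) s' \<and> T \<le> ?\<tau>)" by blast
  qed (use R0 in auto)
  then obtain T s' where T: "exec (While (Cell ctr_exp) ?body) ?s2 \<omega> T s' \<omega>" "R ?X s'"
    "T \<le> (?X + 1) * (1 + acsize (Cell ctr_exp) * \<beta> + ?\<tau>)" by auto
  let ?T1 = "(1 + acost ctr_exp s + acost (dims_power_exp g) s) + (1 + acost cap_exp ?s1 + acost (Lit 1) ?s1)"
  have "?T1 \<le> (1 + acsize ctr_exp * \<beta> + acsize (dims_power_exp g) * \<beta>) + (1 + acsize cap_exp * \<beta> + acsize (Lit 1) * \<beta>)"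
    by (intro add_mono order_refl acost_bound[OF bd \<beta>1] acost_bound[OF b1 \<beta>1])
  also have "\<dots> \<le> ?K * \<beta>" using \<beta>1 unfolding cap_cost_def distrib_right by linarith
  finally have 3: "?T1 \<le> ?K * \<beta>" .
  have "1 + acsize (Cell ctr_exp) * \<beta> + ?\<tau> \<le> ?K * \<beta>" using \<beta>1 unfolding cap_cost_def distrib_right by linarith
  then have "T \<le> (?X + 1) * (?K * \<beta>)" using T(3) mult_le_mono2 le_trans by blast
  then have "?T1 + T \<le> ?K * \<beta> + (?X + 1) * (?K * \<beta>)" using 3 by (rule add_mono[rotated])
  also have "\<dots> = (?X + 2) * (?K * \<beta>)" unfolding distrib_right by linarith
  finally have "?T1 + T \<le> (?X + 2) * (?K * \<beta>)" .
  moreover have "exec (cap_com g) s \<omega> (?T1 + T) s' \<omega>"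
    unfolding cap_com_def by (rule exec.Seq[OF exec.Seq[OF 1 2] T(1)])
  ultimately show ?thesis using T(2) unfolding R_def by blast
qed

definition move_com :: com where
  "move_com = Seq (Assign (Cell ctr_exp) (Cell (var_exp out_arr (Cell ctr_exp))))
     (Assign ctr_exp (Add (Cell ctr_exp) (Lit 1)))"

text \<open>Cells \<open>0\<close> and \<open>1\<close> hold the dimensions, which are needed for addressing, so they are
  overwritten last, and the value for cell \<open>0\<close> is parked in cell \<open>n\<close>.\<close>

definition out_com :: com where
  "out_com = Seq (Seq (Seq (Assign (Cell (Lit 0)) (Cell (var_exp out_arr (Lit 0)))) (Assign ctr_exp (Lit 2)))
     (While (Sub (Cell (Lit 0)) (Cell ctr_exp)) move_com))
     (Seq (Assign (Lit 1) (Cell (var_exp out_arr (Lit 1)))) (Assign (Lit 0) (Cell (Cell (Lit 0)))))"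

definition out_cost :: nat where
  "out_cost = 5 + acsize (Cell (Lit 0)) + acsize (Cell (var_exp out_arr (Lit 0))) + acsize ctr_exp + acsize (Lit 2)
    + acsize (Sub (Cell (Lit 0)) (Cell ctr_exp)) + acsize (Cell ctr_exp) + acsize (Cell (var_exp out_arr (Cell ctr_exp)))
    + acsize ctr_exp + acsize (Add (Cell ctr_exp) (Lit 1)) + acsize (Lit 1) + acsize (Cell (var_exp out_arr (Lit 1)))
    + acsize (Lit 0) + acsize (Cell (Cell (Lit 0)))"

lemma out_com:
  assumes w: "2 \<le> w 0" and s0: "s 0 = w 0" "s (Suc 0) = w (Suc 0)" and bd: "bounded_mem \<beta> s"
    and \<beta>: "dims w < 2 ^ \<beta>"
  shows "\<exists>T s'. exec out_com s \<omega> T s' \<omega> \<and> (\<forall>i<w 0. s' i = s (var_addr w out_arr i))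
    \<and> T \<le> (w 0 + 2) * (out_cost * \<beta>)"
proof -
  let ?n = "w 0" and ?c = "var_addr w 0 0" and ?o = "\<lambda>i. s (var_addr w out_arr i)"
  have \<beta>1: "1 \<le> \<beta>" using \<beta> dims_ge[of w] by (cases \<beta>) auto
  have n\<beta>: "y < 2 ^ \<beta>" if "y \<le> ?n + 2" for y using that \<beta> by (simp add: dims_def)
  have big: "?n < var_addr w v i" for v i by (simp add: var_addr_def base_def)
  have co: "var_addr w out_arr i \<noteq> ?c" for i
    using var_addr_inj[of 0 out_arr w 0 i] by (auto simp: max_vars_def)
  have ob: "?o i < 2 ^ \<beta>" for i using bd by (simp add: bounded_mem_def)
  define R where "R j s' \<longleftrightarrow> s' 0 = w 0 \<and> s' (Suc 0) = w (Suc 0) \<and> s' ?n = ?o 0 \<and> s' ?c = j + 2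
    \<and> (\<forall>i<j + 2. 2 \<le> i \<longrightarrow> s' i = ?o i) \<and> (\<forall>i. s' (var_addr w out_arr i) = ?o i) \<and> bounded_mem \<beta> s'" for j s'
  let ?s1 = "s(?n := ?o 0)" and ?s2 = "s(?n := ?o 0, ?c := 2)"
  have b1: "bounded_mem \<beta> ?s1" using bd ob by (intro bounded_mem_upd) auto
  have 1: "exec (Assign (Cell (Lit 0)) (Cell (var_exp out_arr (Lit 0)))) s \<omega>
      (1 + acost (Cell (Lit 0)) s + acost (Cell (var_exp out_arr (Lit 0))) s) ?s1 \<omega>"
    using s0 by (intro exec_Assign) (simp_all add: aval_var_sizes)
  have 2: "exec (Assign ctr_exp (Lit 2)) ?s1 \<omega> (1 + acost ctr_exp ?s1 + acost (Lit 2) ?s1) ?s2 \<omega>"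
    using s0 w by (intro exec_Assign) (simp_all add: aval_var_sizes)
  have R0: "R 0 ?s2"
  proof -
    have ne: "var_addr w v i \<noteq> ?n" "var_addr w v i \<noteq> 0" "var_addr w v i \<noteq> Suc 0" for v i
      using big[of v i] w by linarith+
    have "bounded_mem \<beta> ?s2" using n\<beta>[of 2] by (intro bounded_mem_upd[OF b1]) auto
    then show ?thesis unfolding R_def using s0 w ne ne[symmetric] co by (auto simp del: neq0_conv)
  qed
  let ?e = "Sub (Cell (Lit 0)) (Cell ctr_exp)"
  let ?\<tau> = "(1 + acsize (Cell ctr_exp) * \<beta> + acsize (Cell (var_exp out_arr (Cell ctr_exp))) * \<beta>)
    + (1 + acsize ctr_exp * \<beta> + acsize (Add (Cell ctr_exp) (Lit 1)) * \<beta>)"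
  have "\<exists>T s'. exec (While ?e move_com) ?s2 \<omega> T s' \<omega> \<and> R (?n - 2) s'
      \<and> T \<le> (?n - 2 - 0 + 1) * (1 + acsize ?e * \<beta> + ?\<tau>)"
  proof (rule exec_loop[where R = R and b = "?n - 2" and j = 0])
    fix s' assume "R (?n - 2) s'"
    then show "aval ?e s' = 0 \<and> acost ?e s' \<le> acsize ?e * \<beta>"
      using acost_bound[OF _ \<beta>1, of s' ?e] aval_var_sizes[of s' w] w by (simp add: R_def)
  next
    fix j s' assume j: "j < ?n - 2" and "R j s'"
    then have r: "s' 0 = w 0" "s' (Suc 0) = w (Suc 0)" "s' ?n = ?o 0" "s' ?c = j + 2"
      "\<And>i. i < j + 2 \<Longrightarrow> 2 \<le> i \<Longrightarrow> s' i = ?o i" "\<And>i. s' (var_addr w out_arr i) = ?o i" "bounded_mem \<beta> s'"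
      by (auto simp: R_def)
    let ?t1 = "s'(j + 2 := ?o (j + 2))" and ?t2 = "s'(j + 2 := ?o (j + 2), ?c := Suc j + 2)"
    have jn: "j + 2 < ?n" using j by simp
    have ne: "var_addr w v i \<noteq> j + 2" for v i using big[of v i] jn by linarith
    have t1: "bounded_mem \<beta> ?t1" using r(7) ob by (intro bounded_mem_upd) auto
    have 1: "exec (Assign (Cell ctr_exp) (Cell (var_exp out_arr (Cell ctr_exp)))) s' \<omega>
        (1 + acost (Cell ctr_exp) s' + acost (Cell (var_exp out_arr (Cell ctr_exp))) s') ?t1 \<omega>"
      by (intro exec_Assign) (simp_all only: aval.simps aval_var_sizes[OF r(1,2)] r(4,6))
    have z: "?t1 0 = w 0" "?t1 (Suc 0) = w (Suc 0)" "?t1 ?c = j + 2" using r ne by auto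
    have 2: "exec (Assign ctr_exp (Add (Cell ctr_exp) (Lit 1))) ?t1 \<omega>
        (1 + acost ctr_exp ?t1 + acost (Add (Cell ctr_exp) (Lit 1)) ?t1) ?t2 \<omega>"
      by (intro exec_Assign) (simp_all only: aval.simps aval_var_sizes[OF z(1,2)] z(3))
    have "bounded_mem \<beta> ?t2" using n\<beta>[of "Suc j + 2"] jn by (intro bounded_mem_upd[OF t1]) auto
    then have "R (Suc j) ?t2"
      unfolding R_def using r(3,5,6) z ne co big[of 0 0] jn by (auto simp: less_Suc_eq)
    moreover have "(1 + acost (Cell ctr_exp) s' + acost (Cell (var_exp out_arr (Cell ctr_exp))) s')
        + (1 + acost ctr_exp ?t1 + acost (Add (Cell ctr_exp) (Lit 1)) ?t1) \<le> ?\<tau>"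
      by (intro add_mono order_refl acost_bound[OF r(7) \<beta>1] acost_bound[OF t1 \<beta>1])
    ultimately have "\<exists>T s''. exec move_com s' \<omega> T s'' \<omega> \<and> R (Suc j) s'' \<and> T \<le> ?\<tau>"
      using exec.Seq[OF 1 2] unfolding move_com_def by blast
    moreover have "aval ?e s' \<noteq> 0" using jn r(1,4) by (simp add: aval_var_sizes[OF r(1,2)])
    moreover have "acost ?e s' \<le> acsize ?e * \<beta>" by (rule acost_bound[OF r(7) \<beta>1])
    ultimately show "aval ?e s' \<noteq> 0 \<and> acost ?e s' \<le> acsize ?e * \<beta>
        \<and> (\<exists>T s''. exec move_com s' \<omega> T s'' \<omega> \<and> R (Suc j) s'' \<and> T \<le> ?\<tau>)" by blast
  qed (use R0 in auto)
  then obtain T s3 where T: "exec (While ?e move_com) ?s2 \<omega> T s3 \<omega>" "R (?n - 2) s3"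
    "T \<le> (?n - 2 + 1) * (1 + acsize ?e * \<beta> + ?\<tau>)" by auto
  from T(2) w have r: "s3 0 = w 0" "s3 (Suc 0) = w (Suc 0)" "s3 ?n = ?o 0"
    "\<And>i. i < ?n \<Longrightarrow> 2 \<le> i \<Longrightarrow> s3 i = ?o i" "\<And>i. s3 (var_addr w out_arr i) = ?o i" "bounded_mem \<beta> s3"
    by (auto simp: R_def)
  let ?s4 = "s3(Suc 0 := ?o (Suc 0))" and ?s5 = "s3(Suc 0 := ?o (Suc 0), 0 := ?o 0)"
  have b4: "bounded_mem \<beta> ?s4" using r(6) ob by (intro bounded_mem_upd) auto
  have 4: "exec (Assign (Lit 1) (Cell (var_exp out_arr (Lit 1)))) s3 \<omega>
      (1 + acost (Lit 1) s3 + acost (Cell (var_exp out_arr (Lit 1))) s3) ?s4 \<omega>"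
    by (intro exec_Assign) (simp_all add: aval_var_sizes[OF r(1,2)] r(5))
  have 5: "exec (Assign (Lit 0) (Cell (Cell (Lit 0)))) ?s4 \<omega>
      (1 + acost (Lit 0) ?s4 + acost (Cell (Cell (Lit 0))) ?s4) ?s5 \<omega>"
    using w r(1,3) by (intro exec_Assign) auto
  let ?T = "(1 + acost (Cell (Lit 0)) s + acost (Cell (var_exp out_arr (Lit 0))) s) + (1 + acost ctr_exp ?s1 + acost (Lit 2) ?s1) + T
    + ((1 + acost (Lit 1) s3 + acost (Cell (var_exp out_arr (Lit 1))) s3)
    + (1 + acost (Lit 0) ?s4 + acost (Cell (Cell (Lit 0))) ?s4))"
  have "exec out_com s \<omega> ?T ?s5 \<omega>"
    unfolding out_com_def by (rule exec.Seq[OF exec.Seq[OF exec.Seq[OF 1 2] T(1)] exec.Seq[OF 4 5]])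
  moreover have "\<forall>i<?n. ?s5 i = ?o i"
  proof (intro allI impI)
    fix i assume "i < ?n"
    then show "?s5 i = ?o i" using r(4)[of i] by (cases "i = 0"; cases "i = Suc 0") auto
  qed
  moreover have "?T \<le> (?n + 2) * (out_cost * \<beta>)"
  proof -
    have "1 + acsize ?e * \<beta> + ?\<tau> \<le> out_cost * \<beta>" using \<beta>1 unfolding out_cost_def distrib_right by linarith
    then have "(?n - 2 + 1) * (1 + acsize ?e * \<beta> + ?\<tau>) \<le> (?n + 1) * (out_cost * \<beta>)" by (intro mult_le_mono) auto
    then have "T \<le> (?n + 1) * (out_cost * \<beta>)" using T(3) by (rule order_trans[rotated])
    moreover have "?T - T \<le> out_cost * \<beta>"
      using acost_bound[OF bd \<beta>1, of "Cell (Lit 0)"] acost_bound[OF bd \<beta>1, of "Cell (var_exp out_arr (Lit 0))"]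
        acost_bound[OF b1 \<beta>1, of ctr_exp] acost_bound[OF b1 \<beta>1, of "Lit 2"]
        acost_bound[OF r(6) \<beta>1, of "Lit 1"] acost_bound[OF r(6) \<beta>1, of "Cell (var_exp out_arr (Lit 1))"]
        acost_bound[OF b4 \<beta>1, of "Lit 0"] acost_bound[OF b4 \<beta>1, of "Cell (Cell (Lit 0))"] \<beta>1
      unfolding out_cost_def distrib_right by linarith
    moreover have "(?n + 2) * (out_cost * \<beta>) = (?n + 1) * (out_cost * \<beta>) + out_cost * \<beta>"
      unfolding distrib_right by linarith
    ultimately show ?thesis by linarith
  qed
  ultimately show ?thesis by blast
qed

lemma program_run:
  obtains A H where "\<And>w \<omega>. 2 \<le> w 0 \<Longrightarrow> (\<And>x. w x \<le> dims w) \<Longrightarrow>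
    \<exists>T s' Q h. exec A w \<omega> T s' \<omega> \<and> T \<le> dims w ^ H \<and> value_cap (w 0) (w (Suc 0)) \<le> Q
      \<and> (\<forall>i<w 0. s' i = hsem w Q main_com h out_arr i)"
proof -
  obtain b where b: "\<And>w. value_cap (w 0) (w (Suc 0)) \<le> 2 ^ (dims w ^ b)"
    using bits_bounded_cap unfolding bits_bounded_def by blast
  obtain m where m: "simulates m (comp main_com) (\<lambda>w Q. hsem w Q main_com)"
    using comp_simulates[OF wf_main] by blast
  \<comment> \<open>\<open>b\<close> makes the cap large enough, \<open>m\<close> makes the word
    length large enough for the simulation, and the 1 ensures that the dimensions themselves
    fit.\<close>
  define g where "g = b + m + 1"
  define time where "time w = (dims w ^ g + 2) * (cap_cost g * (dims w ^ g + 1))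
    + (dims w ^ m * (dims w ^ g + 1) + (w 0 + 2) * (out_cost * (dims w ^ g + 1)))" for w
  have "poly_bounded time"
    unfolding time_def dims_def by (rule poly_bounded_intros poly_bounded_size(2)[folded One_nat_def])+
  then obtain H where H: "\<And>w. time w \<le> dims w ^ H" unfolding poly_bounded_def by blast
  show thesis
  proof (rule that)
    fix w \<omega>
    assume w: "2 \<le> w 0" and small: "\<And>x. w x \<le> dims w"
    define Q where "Q = (2::nat) ^ (dims w ^ g)"
    define \<beta> where "\<beta> = dims w ^ g + 1"
    have big: "x < 2 ^ \<beta>" if "x \<le> dims w ^ g" for x
      using that less_exp[of \<beta>] unfolding \<beta>_def by linarith
    have d1: "dims w \<le> dims w ^ g" using dims_power_mono[of 1 g w] by (simp add: g_def)
    have w1: "1 \<le> w 0" using w by simp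
    have bd: "bounded_mem \<beta> w"
      unfolding bounded_mem_def using small d1 big le_trans by blast
    obtain T1 s1 where 1: "exec (cap_com g) w \<omega> T1 s1 \<omega>" "frozen w s1" "s1 (cap_addr w) = 2 ^ (dims w ^ g)"
      "bounded_mem \<beta> s1" "T1 \<le> (dims w ^ g + 2) * (cap_cost g * \<beta>)"
      using cap_com[of w w \<beta> g \<omega>, OF w1 _ bd] by (auto simp: frozen_def \<beta>_def)
    \<comment> \<open>The arrays start with whatever the memory contains; \<open>main_com\<close> is
      correct for every initial state.\<close>
    define h where "h v i = s1 (var_addr w v i)" for v i
    have rep: "represents w Q s1 h" using 1(2,3) by (simp add: represents_def Q_def h_def)
    have "dims w ^ m < 2 ^ \<beta>" using dims_power_mono[of m g w] by (intro big) (simp add: g_def)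
    then obtain T2 s2 where 2: "exec (comp main_com) s1 \<omega> T2 s2 \<omega>" "represents w Q s2 (hsem w Q main_com h)"
      "bounded_mem \<beta> s2" "T2 \<le> dims w ^ m * \<beta>"
      using m[unfolded simulates_def, rule_format, OF w1 rep 1(4)] by blast
    have fr2: "frozen w s2" using 2(2) by (simp add: represents_def)
    obtain T3 s3 where 3: "exec out_com s2 \<omega> T3 s3 \<omega>" "\<forall>i<w 0. s3 i = s2 (var_addr w out_arr i)"
      "T3 \<le> (w 0 + 2) * (out_cost * \<beta>)"
      using out_com[OF w _ _ 2(3) big[OF d1], of \<omega>] frozen_dims[OF fr2] by auto
    have "exec (Seq (cap_com g) (Seq (comp main_com) out_com)) w \<omega> (T1 + (T2 + T3)) s3 \<omega>"
      by (rule exec.Seq[OF 1(1) exec.Seq[OF 2(1) 3(1)]])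
    moreover have "T1 + (T2 + T3) \<le> dims w ^ H"
      using add_mono[OF 1(5) add_mono[OF 2(4) 3(3)]] H[of w] unfolding time_def \<beta>_def by (rule order_trans)
    moreover have "value_cap (w 0) (w (Suc 0)) \<le> Q"
    proof -
      have "value_cap (w 0) (w (Suc 0)) \<le> 2 ^ (dims w ^ b)" by (rule b)
      also have "\<dots> \<le> Q" unfolding Q_def by (intro power_increasing dims_power_mono) (auto simp: g_def)
      finally show ?thesis .
    qed
    moreover have "\<forall>i<w 0. s3 i = hsem w Q main_com h out_arr i"
      using 3(2) 2(2) by (simp add: represents_def max_vars_def)
    ultimately show "\<exists>T s' Q h. exec (Seq (cap_com g) (Seq (comp main_com) out_com)) w \<omega> T s' \<omega> \<and> T \<le> dims w ^ H
        \<and> value_cap (w 0) (w (Suc 0)) \<le> Q \<and> (\<forall>i<w 0. s' i = hsem w Q main_com h out_arr i)" by blast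
  qed
qed

section \<open>The discrepancy bound\<close>

lemma expected_time_le:
  assumes "\<And>\<omega>. \<exists>T s' \<omega>'. exec A s \<omega> T s' \<omega>' \<and> T \<le> N"
  shows "expected_time A s \<le> of_nat N"
proof -
  interpret prob_space coin_space
    unfolding coin_space_def by (intro prob_space.prob_space_stream_space measure_pmf.prob_space_axioms)
  have "run_time A s \<omega> \<le> of_nat N" for \<omega>
  proof -
    obtain T s' \<omega>' where T: "exec A s \<omega> T s' \<omega>'" "T \<le> N" using assms by blast
    have "run_time A s \<omega> \<le> of_nat T"
      unfolding run_time_def by (rule INF_lower) (use T(1) in blast)
    also have "\<dots> \<le> of_nat N" using T(2) by simp
    finally show ?thesis .
  qed
  then have "expected_time A s \<le> (\<integral>\<^sup>+ \<omega>. of_nat N \<partial>coin_space)"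
    unfolding expected_time_def by (intro nn_integral_mono)
  also have "\<dots> = of_nat N" by (simp add: emeasure_space_1)
  finally show ?thesis .
qed

section \<open>From machine output to colorings\<close>

lemma nth_concat_rows:
  assumes "j < length Ss" "i < m" "\<And>S. length (g S) = m"
  shows "concat (map g Ss) ! (j * m + i) = g (Ss ! j) ! i"
  using assms(1)
proof (induction Ss arbitrary: j)
  case (Cons S Ss)
  then show ?case using assms(2,3) by (cases j) (simp_all add: nth_append)
qed simp

lemma input_memory_simps [simp]:
  "input_memory xs Ss 0 = length xs" "input_memory xs Ss (Suc 0) = length Ss"
  by (simp_all add: input_memory_def)

lemma input_memory_matrix:
  assumes "j < length Ss" "i < length xs"
  shows "input_memory xs Ss (2 + (j * length xs + i)) = of_bool (xs ! i \<in> Ss ! j)"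
proof -
  let ?c = "concat (map (\<lambda>S. map (\<lambda>x. of_bool (x \<in> S)) xs) Ss) :: nat list"
  have len: "length ?c = length Ss * length xs" by (induction Ss) simp_all
  have "j * length xs + i < Suc j * length xs" using assms(2) by simp
  also have "\<dots> \<le> length Ss * length xs" using assms(1) by (intro mult_le_mono1) simp
  finally have "input_memory xs Ss (2 + (j * length xs + i)) = ?c ! (j * length xs + i)"
    using len by (simp add: input_memory_def)
  then show ?thesis using nth_concat_rows[OF assms, of "\<lambda>S. map (\<lambda>x. of_bool (x \<in> S)) xs"] assms by simp
qed

lemma input_memory_le: "input_memory xs Ss x \<le> dims (input_memory xs Ss)"
proof -
  let ?w = "[length xs, length Ss] @ concat (map (\<lambda>S. map (\<lambda>x. of_bool (x \<in> S)) xs) Ss)"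
  have "y \<le> length xs + length Ss + 2" if "y \<in> set ?w" for y using that by auto
  then have "x < length ?w \<Longrightarrow> ?w ! x \<le> length xs + length Ss + 2" using nth_mem by blast
  then show ?thesis by (simp add: dims_def) (simp add: input_memory_def Let_def)
qed

definition incidence :: "'a list \<Rightarrow> 'a set list \<Rightarrow> nat \<Rightarrow> nat \<Rightarrow> nat" where
  "incidence xs Ss j i = of_bool (j < length Ss \<and> i < length xs \<and> xs ! i \<in> Ss ! j)"

text \<open>Nets on points are pulled back to positions along the enumeration, which is injective,
  so symmetric differences do not grow.\<close>

lemma near_net_incidence:
  assumes xs: "distinct xs" "set xs = X" and w: "walk n (length Ss) (incidence xs Ss) q" "n = length xs"
    and net: "\<And>Y. Y \<subseteq> X \<Longrightarrow> 4 \<le> card Y \<Longrightarrow> \<exists>N. N \<subseteq> Pow Y \<and> 4 * card N \<le> card Y \<and>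
      (\<forall>S\<in>set Ss. \<exists>P\<in>N. card (sym_diff (S \<inter> Y) P) \<le> q\<^sup>2)"
  shows "walk.near_net n (length Ss) (incidence xs Ss) q"
  unfolding walk.near_net_def[OF w(1)]
proof (intro allI impI)
  fix Y assume Y: "Y \<subseteq> {..<n}" "4 \<le> card Y"
  have inj: "inj_on ((!) xs) {..<n}" using xs(1) w(2) by (simp add: inj_on_nth)
  have finY: "finite Y" using Y(1) finite_subset by blast
  let ?Y = "(!) xs ` Y"
  have cY: "card ?Y = card Y" using inj_on_subset[OF inj Y(1)] by (rule card_image)
  have "?Y \<subseteq> X" using Y(1) xs(2) w(2) by auto
  from net[OF this] cY Y(2) obtain N where N: "N \<subseteq> Pow ?Y" "4 * card N \<le> card Y"
    "\<And>S. S \<in> set Ss \<Longrightarrow> \<exists>P\<in>N. card (sym_diff (S \<inter> ?Y) P) \<le> q\<^sup>2" by auto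
  have finN: "finite N" using N(1) finY finite_subset by blast
  let ?f = "\<lambda>T. {i \<in> Y. xs ! i \<in> T}"
  have "card (?f ` N) \<le> card N" using finN by (rule card_image_le)
  moreover have "\<exists>T\<in>?f ` N. card (sym_diff {i \<in> Y. incidence xs Ss j i = 1} T) \<le> q\<^sup>2" if j: "j < length Ss" for j
  proof -
    obtain P where P: "P \<in> N" "card (sym_diff (Ss ! j \<inter> ?Y) P) \<le> q\<^sup>2" using N(3) j by (meson nth_mem)
    let ?A = "sym_diff {i \<in> Y. incidence xs Ss j i = 1} (?f P)"
    have "?A \<subseteq> {..<n}" using Y(1) by auto
    then have "card ?A = card ((!) xs ` ?A)" by (intro card_image[symmetric] inj_on_subset[OF inj])
    also have "\<dots> \<le> card (sym_diff (Ss ! j \<inter> ?Y) P)"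
    proof (rule card_mono)
      show "finite (sym_diff (Ss ! j \<inter> ?Y) P)" using P(1) N(1) finY finite_subset by blast
      show "(!) xs ` ?A \<subseteq> sym_diff (Ss ! j \<inter> ?Y) P"
        using Y(1) j w(2) by (auto simp: incidence_def)
    qed
    finally show ?thesis using P by (intro bexI[of _ "?f P"]) auto
  qed
  ultimately show "\<exists>N. N \<subseteq> Pow Y \<and> 4 * card N \<le> card Y \<and>
      (\<forall>j<length Ss. \<exists>T\<in>N. card (sym_diff {i \<in> Y. incidence xs Ss j i = 1} T) \<le> q\<^sup>2)"
    using N(2) by (intro exI[of _ "?f ` N"]) auto
qed

text \<open>\<open>colorings\<close> consists of extensional functions, hence the restriction to
  \<open>set xs\<close>.\<close>

definition list_coloring :: "'a list \<Rightarrow> (nat \<Rightarrow> nat) \<Rightarrow> 'a \<Rightarrow> int" where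
  "list_coloring xs c = (\<lambda>x\<in>set xs. if c (the_inv_into {..<length xs} ((!) xs) x) = 0 then -1 else 1)"

lemma list_coloring_nth:
  assumes "distinct xs" "i < length xs"
  shows "list_coloring xs c (xs ! i) = (if c i = 0 then -1 else 1)"
proof -
  have "the_inv_into {..<length xs} ((!) xs) (xs ! i) = i"
    using assms by (intro the_inv_into_f_f) (auto simp: inj_on_nth)
  then show ?thesis using assms(2) by (simp add: list_coloring_def)
qed

lemma list_coloring_in: "list_coloring xs c \<in> colorings (set xs)"
  by (auto simp: list_coloring_def colorings_def)

lemma coloring_disc_le:
  assumes "0 \<le> B" "finite \<S>" "\<And>S. S \<in> \<S> \<Longrightarrow> \<bar>real_of_int (\<Sum>x\<in>S. f x)\<bar> \<le> B"
  shows "real_of_int (coloring_disc \<S> f) \<le> B"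
proof -
  have "coloring_disc \<S> f \<in> insert 0 ((\<lambda>S. \<bar>\<Sum>x\<in>S. f x\<bar>) ` \<S>)"
    unfolding coloring_disc_def using assms(2) by (intro Max_in) auto
  then show ?thesis using assms(1,3) by auto
qed

lemma list_coloring_disc:
  assumes xs: "distinct xs" and Ss: "\<And>S. S \<in> set Ss \<Longrightarrow> S \<subseteq> set xs"
    and c: "\<And>i. i < length xs \<Longrightarrow> c i \<le> 1"
  shows "coloring_disc (set Ss) (list_coloring xs c)
    \<le> real (max_disc (length xs) (length Ss) (incidence xs Ss) c)"
proof (rule coloring_disc_le)
  let ?n = "length xs" and ?f = "list_coloring xs c"
  fix S assume "S \<in> set Ss"
  then obtain j where j: "j < length Ss" "Ss ! j = S" by (auto simp: in_set_conv_nth)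
  have bij: "bij_betw ((!) xs) {..<?n} (set xs)" using xs by (rule bij_betw_nth) auto
  have "real_of_int (\<Sum>x\<in>S. ?f x) = (\<Sum>x\<in>set xs \<inter> S. real_of_int (?f x))"
    using Ss[OF \<open>S \<in> set Ss\<close>] by (simp add: Int_absorb1)
  also have "\<dots> = (\<Sum>x\<in>set xs. if x \<in> S then real_of_int (?f x) else 0)" by (rule sum.inter_restrict) simp
  also have "\<dots> = (\<Sum>i<?n. if xs ! i \<in> S then real_of_int (?f (xs ! i)) else 0)"
    using sum.reindex_bij_betw[OF bij] by (rule sym)
  also have "\<dots> = (\<Sum>i<?n. real (incidence xs Ss j i) * (2 * real (c i) - 1))"
  proof (rule sum.cong[OF refl])
    fix i assume "i \<in> {..<?n}"
    then have i: "i < ?n" by simp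
    have "c i = 0 \<or> c i = 1" using c[OF i] by linarith
    then show "(if xs ! i \<in> S then real_of_int (?f (xs ! i)) else 0) = real (incidence xs Ss j i) * (2 * real (c i) - 1)"
      using i j by (auto simp: incidence_def list_coloring_nth[OF xs i])
  qed
  finally show "\<bar>real_of_int (\<Sum>x\<in>S. ?f x)\<bar> \<le> real (max_disc ?n (length Ss) (incidence xs Ss) c)"
    using max_disc_ge[OF j(1)] by metis
qed auto

lemma disc_le_coloring_disc: "finite X \<Longrightarrow> f \<in> colorings X \<Longrightarrow> disc X \<S> \<le> coloring_disc \<S> f"
  unfolding disc_def by (intro Min_le) (auto simp: colorings_def finite_PiE)

text \<open>The whole system is its own trace on X, so the shatter function at n bounds its size;
  this is why the logarithm of the number of sets is O(ln n).\<close>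

lemma card_system_le:
  assumes "finite X" "1 \<le> card X" "\<S> \<subseteq> Pow X" "primal_shatter_dim X \<S> d C"
  shows "real (card \<S>) \<le> C * real (card X) powr d"
proof -
  have "(\<lambda>S. S \<inter> X) ` \<S> = (\<lambda>S. S) ` \<S>" using assms(3) by (intro image_cong) auto
  then have "restrict_sys \<S> X = \<S>" by (simp add: restrict_sys_def)
  then have "real (card \<S>) \<le> real (shatter_function X \<S> (card X))"
    using shatter_function_ge[OF assms(1) order_refl, of \<S>] by simp
  also have "\<dots> \<le> C * real (card X) powr d" using assms(2,4) unfolding primal_shatter_dim_def by auto
  finally show ?thesis .
qed

text \<open>For n \<ge> 2 one has 1 \<le> 2 ln n, which absorbs additive constants; in particular
  4096 (2 + l) \<le> 20480 l for l = ln n.\<close>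

lemma log_bound:
  fixes c d C \<theta> :: real
  assumes c: "1 \<le> c" and C: "1 \<le> C" and \<theta>: "1 \<le> \<theta>" and n: "2 \<le> n" and k: "0 < k" "real k \<le> C * real n powr d"
    and q: "real q \<le> 2 * (c * \<theta>)"
  shows "2 * real q * (ln (2 * real k) + 4096 * (2 + ln n)) + 8
    \<le> (4 * c * (2 * ln (2 * C) + d + 20480) + 16) * (\<theta> * ln n)"
proof -
  let ?l = "ln (real n)"
  have "1 / 2 \<le> ln (2::real)" using ln2_ge_two_thirds by linarith
  also have "ln 2 \<le> ?l" using n by simp
  finally have l: "1 \<le> 2 * ?l" by simp
  have "ln (2 * real k) \<le> ln (2 * C * real n powr d)" using k by (intro ln_mono) auto
  also have "\<dots> = ln (2 * C) + d * ?l" using C n by (simp add: ln_mult ln_powr)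
  also have "ln (2 * C) \<le> ln (2 * C) * (2 * ?l)"
    using C l mult_left_mono[OF l, of "ln (2 * C)"] by simp
  finally have "ln (2 * real k) + 4096 * (2 + ?l) \<le> (2 * ln (2 * C) + d + 20480) * ?l"
    using l by (simp add: algebra_simps)
  moreover have nn: "0 \<le> ln (2 * real k) + 4096 * (2 + ?l)" using k l by (intro add_nonneg_nonneg) auto
  ultimately have "2 * real q * (ln (2 * real k) + 4096 * (2 + ?l))
      \<le> 2 * (2 * (c * \<theta>)) * ((2 * ln (2 * C) + d + 20480) * ?l)"
    using q by (intro mult_mono) auto
  moreover have "8 * 1 \<le> 16 * (\<theta> * ?l)"
    using mult_mono[OF \<theta> l] \<theta> by simp
  ultimately show ?thesis by (simp add: algebra_simps)
qed

lemma root_scale: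
  fixes c t d :: real
  assumes "1 \<le> c" "1 \<le> t" "1 \<le> d"
  shows "1 \<le> t powr (1/2 - 1/(2*d))" "(sqrt c * t powr (1/2 - 1/(2*d)))\<^sup>2 = c * t powr (1 - 1/d)"
proof -
  have "1/(2*d) \<le> 1/2" using assms(3) by (simp add: field_simps)
  then show "1 \<le> t powr (1/2 - 1/(2*d))" using assms(2) by (intro ge_one_powr_ge_zero) auto
  have "2 * (1/2 - 1/(2*d)) = 1 - 1/d" using assms(3) by (simp add: field_simps)
  then have "(t powr (1/2 - 1/(2*d)))\<^sup>2 = t powr (1 - 1/d)"
    by (simp add: power2_eq_square powr_add[symmetric])
  then show "(sqrt c * t powr (1/2 - 1/(2*d)))\<^sup>2 = c * t powr (1 - 1/d)"
    using assms(1) by (simp add: power_mult_distrib)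
qed

text \<open>q is the square root of the net distance, rounded up and capped at n, the last value
  that the program tries. At the cap, q^2 is at least the size of any symmetric difference inside X,
  so the given nets still qualify.\<close>

lemma run_disc:
  fixes d C c :: real and X :: "'a set"
  assumes d: "1 \<le> d" and c: "1 \<le> c" and t: "1 \<le> t"
    and net: "\<And>Y. Y \<subseteq> X \<Longrightarrow> 4 \<le> card Y \<Longrightarrow> \<exists>N. N \<subseteq> Pow Y \<and> 4 * card N \<le> card Y \<and>
        (\<forall>S\<in>\<S>. \<exists>P\<in>N. card (sym_diff (S \<inter> Y) P) \<le> c * real t powr (1 - 1 / d))"
    and X: "finite X" "2 \<le> card X" "\<S> \<subseteq> Pow X" "primal_shatter_dim X \<S> d C"
    and xs: "distinct xs" "set xs = X" and Ss: "distinct Ss" "set Ss = \<S>" "Ss \<noteq> []"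
    and Q: "value_cap (length xs) (length Ss) \<le> Q"
    and s': "\<And>i. i < length xs \<Longrightarrow> s' i = hsem (input_memory xs Ss) Q main_com h out_arr i"
  shows "real_of_int (coloring_disc \<S> (list_coloring xs s'))
    \<le> (4 * sqrt c * (2 * ln (2 * max C 1) + d + 20480) + 16) * (real t powr (1/2 - 1/(2*d)) * ln (real (card X)))"
proof -
  let ?n = "length xs" and ?k = "length Ss" and ?a = "incidence xs Ss"
  define \<theta> where "\<theta> = real t powr (1/2 - 1/(2*d))"
  define e where "e = sqrt c * \<theta>"
  have \<theta>1: "1 \<le> \<theta>" and e2: "e\<^sup>2 = c * real t powr (1 - 1/d)"
    using root_scale[OF c _ d, of t] t by (simp_all add: \<theta>_def e_def)
  have sc: "1 \<le> sqrt c" using c by simp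
  have e1: "1 \<le> e" using mult_mono[OF sc \<theta>1] sc by (simp add: e_def)
  have n: "?n = card X" "?k = card \<S>" using distinct_card[OF xs(1)] xs(2) distinct_card[OF Ss(1)] Ss(2) by auto
  have k0: "0 < ?k" using Ss(3) by simp
  define q where "q = min ?n (nat \<lceil>e\<rceil>)"
  have q: "0 < q" "q \<le> ?n" "real q \<le> 2 * e"
    unfolding q_def using e1 X(2) n(1) by (auto simp: min_def) linarith+
  have wk: "walk ?n ?k ?a q" using q X(2) n(1) k0 by unfold_locales (auto simp: incidence_def)
  have near: "walk.near_net ?n ?k ?a q"
  proof (rule near_net_incidence[OF xs wk refl])
    fix Y assume Y: "Y \<subseteq> X" "4 \<le> card Y"
    have finY: "finite Y" using X(1) Y(1) finite_subset by blast
    obtain N where N: "N \<subseteq> Pow Y" "4 * card N \<le> card Y"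
      "\<And>S. S \<in> \<S> \<Longrightarrow> \<exists>P\<in>N. card (sym_diff (S \<inter> Y) P) \<le> c * real t powr (1 - 1 / d)" using net[OF Y] by blast
    have "card (sym_diff (S \<inter> Y) P) \<le> q\<^sup>2"
      if "P \<in> N" and P: "card (sym_diff (S \<inter> Y) P) \<le> c * real t powr (1 - 1 / d)" for S P
    proof (cases "q = ?n")
      case True
      have "card (sym_diff (S \<inter> Y) P) \<le> card Y" using \<open>P \<in> N\<close> N(1) finY by (intro card_mono) auto
      also have "\<dots> \<le> q" using True n(1) card_mono[OF X(1) Y(1)] by simp
      also have "\<dots> \<le> q\<^sup>2" by (simp add: power2_nat_le_imp_le power2_eq_square)
      finally show ?thesis .
    next
      case False
      then have "e \<le> real q" unfolding q_def by (auto simp: min_def split: if_splits) linarith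
      then have "e\<^sup>2 \<le> (real q)\<^sup>2" using e1 by (intro power_mono) auto
      then have "real (card (sym_diff (S \<inter> Y) P)) \<le> (real q)\<^sup>2" using P e2 by linarith
      then show ?thesis by (simp only: of_nat_power[symmetric] of_nat_le_iff)
    qed
    then show "\<exists>N. N \<subseteq> Pow Y \<and> 4 * card N \<le> card Y \<and> (\<forall>S\<in>set Ss. \<exists>P\<in>N. card (sym_diff (S \<inter> Y) P) \<le> q\<^sup>2)"
      using N Ss(2) by meson
  qed
  have big: "prog_big ?n ?k ?a p (input_memory xs Ss) Q" if "0 < p" "p \<le> ?n" for p
    using that Q k0 by (intro prog_big_cap) (auto simp: incidence_def input_memory_matrix[simplified])
  have n0: "0 < ?n" using X(2) n(1) by simp
  note main = main_com[OF big n0 q(1,2) near, where h = h]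
  have out: "max_disc ?n ?k ?a s' = max_disc ?n ?k ?a (hsem (input_memory xs Ss) Q main_com h out_arr)"
    using s' by (rule max_disc_cong)
  have "real_of_int (coloring_disc \<S> (list_coloring xs s')) \<le> real (max_disc ?n ?k ?a s')"
    using list_coloring_disc[OF xs(1), of Ss s'] X(3) xs(2) Ss(2) main(1) s' by auto
  also have "\<dots> \<le> 2 * real q * (ln (2 * real ?k) + 4096 * (2 + ln ?n)) + 8" unfolding out by (rule main(2))
  also have "\<dots> \<le> (4 * sqrt c * (2 * ln (2 * max C 1) + d + 20480) + 16) * (\<theta> * ln ?n)"
  proof (rule log_bound)
    have "real ?k \<le> C * real ?n powr d" using card_system_le[OF X(1) _ X(3,4)] X(2) n by simp
    also have "\<dots> \<le> max C 1 * real ?n powr d" by (intro mult_right_mono) auto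
    finally show "real ?k \<le> max C 1 * real ?n powr d" .
  qed (use \<theta>1 sc q n X(2) k0 in \<open>auto simp: e_def\<close>)
  finally show ?thesis by (simp add: \<theta>_def n)
qed

theorem theorem7:
  fixes d C :: real
  assumes "1 \<le> d"
  shows "\<exists>(K :: real) (A :: com) (p :: nat poly).
    \<forall>(X :: 'a set) (\<S> :: 'a set set) (n :: nat) (t :: nat).
      finite X \<and> card X = n \<and> 2 \<le> n \<and> 3 \<le> t \<and> \<S> \<subseteq> Pow X
      \<and> primal_shatter_dim X \<S> d C
      \<and> size_sensitive_shattering X \<S> 1 (d - 1) C
      \<and> (\<forall>x\<in>X. card {S \<in> \<S>. x \<in> S} \<le> t)
      \<longrightarrow>
      (let B = K * (real t powr (1/2 - 1/(2 * d)) * sqrt (ln (ln (real t))) * ln (real n)) in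
        real_of_int (disc X \<S>) \<le> B
        \<and> (\<forall>(xs :: 'a list) (Ss :: 'a set list).
              distinct xs \<and> set xs = X \<and> distinct Ss \<and> set Ss = \<S> \<longrightarrow>
              expected_time A (input_memory xs Ss) \<le> of_nat (poly p (length xs + length Ss))
              \<and> (\<forall>\<omega> T s' \<omega>'. exec A (input_memory xs Ss) \<omega> T s' \<omega>' \<longrightarrow>
                    (\<exists>f\<in>colorings X. stores_coloring xs s' f
                       \<and> real_of_int (coloring_disc \<S> f) \<le> B))))"
proof -
  obtain c :: real where c: "1 \<le> c"
    "\<And>(X :: 'a set) \<S> t Y. finite X \<Longrightarrow> primal_shatter_dim X \<S> d C \<Longrightarrow>
      size_sensitive_shattering X \<S> 1 (d - 1) C \<Longrightarrow> \<S> \<subseteq> Pow X \<Longrightarrow> 1 \<le> t \<Longrightarrow>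
      (\<And>x. x \<in> X \<Longrightarrow> card {S \<in> \<S>. x \<in> S} \<le> t) \<Longrightarrow> Y \<subseteq> X \<Longrightarrow> 4 \<le> card Y \<Longrightarrow>
      \<exists>N. N \<subseteq> Pow Y \<and> 4 * card N \<le> card Y \<and>
        (\<forall>S\<in>\<S>. \<exists>P\<in>N. card (sym_diff (S \<inter> Y) P) \<le> c * real t powr (1 - 1 / d))"
    using shallow_net[OF assms, where ?'a = 'a and C = C] by blast
  obtain A H where A: "\<And>w \<omega>. 2 \<le> w 0 \<Longrightarrow> (\<And>x. w x \<le> dims w) \<Longrightarrow>
    \<exists>T s' Q h. exec A w \<omega> T s' \<omega> \<and> T \<le> dims w ^ H \<and> value_cap (w 0) (w (Suc 0)) \<le> Q
      \<and> (\<forall>i<w 0. s' i = hsem w Q main_com h out_arr i)"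
    using program_run by blast
  define K0 where "K0 = 4 * sqrt c * (2 * ln (2 * max C 1) + d + 20480) + 16"
  \<comment> \<open>The least value of the additional factor for t \<ge> 3, positive because ln 3 >
    1; \<open>K0\<close> is divided by it.\<close>
  define lo where "lo = sqrt (ln (ln (3::real)))"
  have "1 < ln (3::real)" using ln3_gt_1 by simp
  then have lo: "0 < lo" by (simp add: lo_def)
  have K0: "0 \<le> K0"
    unfolding K0_def using c(1) assms by (intro add_nonneg_nonneg mult_nonneg_nonneg) auto
  \<comment> \<open>\<open>[:2, 1:]\<close> is x + 2, the value of \<open>dims\<close> on an input
    with x = \<open>length xs + length Ss\<close>.\<close>
  define p :: "nat poly" where "p = [:2, 1:] ^ H"
  show ?thesis
  proof (intro exI[of _ "K0 / lo"] exI[of _ A] exI[of _ p] allI impI, elim conjE)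
    fix X :: "'a set" and \<S> n t
    assume X: "finite X" "card X = n" "2 \<le> n" "3 \<le> t" "\<S> \<subseteq> Pow X" "primal_shatter_dim X \<S> d C"
      "size_sensitive_shattering X \<S> 1 (d - 1) C" "\<forall>x\<in>X. card {S \<in> \<S>. x \<in> S} \<le> t"
    define B where "B = K0 / lo * (real t powr (1/2 - 1/(2 * d)) * sqrt (ln (ln (real t))) * ln (real n))"
    have KB: "K0 * (real t powr (1/2 - 1/(2*d)) * ln (real n)) \<le> B"
    proof -
      have "ln (ln 3) \<le> ln (ln (real t))" by (subst ln_le_cancel_iff) (use X(4) in auto)
      then have "lo \<le> sqrt (ln (ln (real t)))" unfolding lo_def by (rule real_sqrt_le_mono)
      then have "1 \<le> sqrt (ln (ln (real t))) / lo" using lo by simp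
      then have "K0 * (real t powr (1/2 - 1/(2*d)) * ln (real n)) * 1
          \<le> K0 * (real t powr (1/2 - 1/(2*d)) * ln (real n)) * (sqrt (ln (ln (real t))) / lo)"
        using K0 X(3) by (intro mult_left_mono mult_nonneg_nonneg) auto
      then show ?thesis by (simp add: B_def mult_ac)
    qed
    have B0: "0 \<le> B"
    proof -
      have "0 \<le> K0 * (real t powr (1/2 - 1/(2*d)) * ln (real n))" using K0 X(3) by (intro mult_nonneg_nonneg) auto
      then show ?thesis using KB by linarith
    qed
    have fin: "finite \<S>" using X(1,5) finite_subset by blast
    have net: "\<exists>N. N \<subseteq> Pow Y \<and> 4 * card N \<le> card Y \<and>
        (\<forall>S\<in>\<S>. \<exists>P\<in>N. card (sym_diff (S \<inter> Y) P) \<le> c * real t powr (1 - 1 / d))"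
      if "Y \<subseteq> X" "4 \<le> card Y" for Y
      using X that by (intro c(2)[of X]) auto
    have run: "\<exists>T s'. exec A (input_memory xs Ss) \<omega> T s' \<omega> \<and> T \<le> poly p (length xs + length Ss)
        \<and> real_of_int (coloring_disc \<S> (list_coloring xs s')) \<le> B"
      if xs: "distinct xs" "set xs = X" and Ss: "distinct Ss" "set Ss = \<S>" for xs Ss \<omega>
    proof -
      have len: "length xs = n" using distinct_card[OF xs(1)] xs(2) X(2) by simp
      obtain T s' Q h where T: "exec A (input_memory xs Ss) \<omega> T s' \<omega>" "T \<le> dims (input_memory xs Ss) ^ H"
        "value_cap (length xs) (length Ss) \<le> Q"
        "\<forall>i<length xs. s' i = hsem (input_memory xs Ss) Q main_com h out_arr i"
        using A[of "input_memory xs Ss" \<omega>] input_memory_le[of xs Ss] len X(3) by auto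
      have "dims (input_memory xs Ss) ^ H = poly p (length xs + length Ss)"
        by (simp add: p_def dims_def poly_power add_ac)
      moreover have "real_of_int (coloring_disc \<S> (list_coloring xs s')) \<le> B"
      proof (cases "Ss = []")
        \<comment> \<open>Without sets the analysis, which needs k > 0, does not apply, but the
          discrepancy is 0 and the program still halts.\<close>
        case True
        then show ?thesis using Ss(2) B0 by (simp add: coloring_disc_def)
      next
        case False
        have "real_of_int (coloring_disc \<S> (list_coloring xs s'))
            \<le> K0 * (real t powr (1/2 - 1/(2*d)) * ln (real (card X)))"
          unfolding K0_def
          by (rule run_disc[OF assms c(1) _ net X(1) _ X(5,6) xs Ss False T(3)]) (use X T(4) in auto)
        then show ?thesis using KB X(2) by simp
      qed
      ultimately show ?thesis using T(1,2) by auto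
    qed
    \<comment> \<open>The existence bound is read off from the output of the program on an arbitrary
      enumeration.\<close>
    have "real_of_int (disc X \<S>) \<le> B"
    proof -
      obtain xs Ss where e: "distinct xs" "set xs = X" "distinct Ss" "set Ss = \<S>"
        using finite_distinct_list[OF X(1)] finite_distinct_list[OF fin] by metis
      obtain s' where "real_of_int (coloring_disc \<S> (list_coloring xs s')) \<le> B" using run[OF e] by blast
      moreover have "disc X \<S> \<le> coloring_disc \<S> (list_coloring xs s')"
        using disc_le_coloring_disc[OF X(1)] list_coloring_in[of xs s'] e(2) by simp
      ultimately show ?thesis by linarith
    qed
    moreover have "expected_time A (input_memory xs Ss) \<le> of_nat (poly p (length xs + length Ss))"
      if "distinct xs \<and> set xs = X \<and> distinct Ss \<and> set Ss = \<S>" for xs Ss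
      using run[of xs Ss] that by (intro expected_time_le) blast
    moreover have "\<exists>f\<in>colorings X. stores_coloring xs s' f \<and> real_of_int (coloring_disc \<S> f) \<le> B"
      if e: "distinct xs \<and> set xs = X \<and> distinct Ss \<and> set Ss = \<S>" and ex: "exec A (input_memory xs Ss) \<omega> T s' \<omega>'"
      for xs Ss \<omega> T s' \<omega>'
    proof -
      obtain U r where r: "exec A (input_memory xs Ss) \<omega> U r \<omega>" "real_of_int (coloring_disc \<S> (list_coloring xs r)) \<le> B"
        using run[of xs Ss \<omega>] e by blast
      \<comment> \<open>Determinism identifies an arbitrary halting run with the one constructed
        above.\<close>
      have "s' = r" using exec_deterministic[OF ex r(1)] by simp
      then show ?thesis
        using r(2) e list_coloring_in[of xs r] list_coloring_nth[of xs]
        by (intro bexI[of _ "list_coloring xs r"]) (auto simp: stores_coloring_def)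
    qed
    ultimately show "let B = K0 / lo * (real t powr (1/2 - 1/(2 * d)) * sqrt (ln (ln (real t))) * ln (real n)) in
        real_of_int (disc X \<S>) \<le> B
        \<and> (\<forall>(xs :: 'a list) (Ss :: 'a set list).
              distinct xs \<and> set xs = X \<and> distinct Ss \<and> set Ss = \<S> \<longrightarrow>
              expected_time A (input_memory xs Ss) \<le> of_nat (poly p (length xs + length Ss))
              \<and> (\<forall>\<omega> T s' \<omega>'. exec A (input_memory xs Ss) \<omega> T s' \<omega>' \<longrightarrow>
                    (\<exists>f\<in>colorings X. stores_coloring xs s' f
                       \<and> real_of_int (coloring_disc \<S> f) \<le> B)))"
      unfolding B_def[symmetric] Let_def by blast
  qed
qed

end
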